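(* Let $(\mathbb{X},\mathcal{X})$ and $(\mathbb{Y},\mathcal{Y})$ be locally compact second countable Hausdorff spaces with their Borel $\sigma$-algebras and let $k\in\mathbb{N}$. Let $g:\mathbb{X}^k\times\mathbf{N}_{\mathbb{X}}\to\{0,1\}$ and $f:\mathbb{X}^k\times\mathbf{N}_{\mathbb{X}}\to\mathbb{Y}$ be measurable functions, symmetric in the $\mathbb{X}^k$-coordinates, and let $\mathcal{S}:\mathbb{X}^k\times\mathbf{N}_{\mathbb{X}}\to\mathcal{F}$ be a measurable function that is a stopping set and to which $f$ and $g$ are localized (both notions as defined in the context). Let $\eta$ be a Poisson process on $\mathbb{X}$ with a $\sigma$-finite intensity measure $\mathbf{K}$, let $$\xi:=\xi[\eta]:=\frac1{k!}\sum_{\mathbf{x}\in\eta^k_{\neq}}g(\mathbf{x},\eta)\,\delta_{f(\mathbf{x},\eta)},$$ and let $\mathbf{L}$ be the intensity measure of $\xi$, assumed to satisfy $\mathbf{L}(\mathbb{Y})<\infty$. Let $\zeta$ be a Poisson process on $\mathbb{Y}$ with a finite intensity measure $\mathbf{M}$. Suppose that we are given a measurable mapping $\mathbf{x}\mapsto S_{\mathbf{x}}$ from $\mathbb{X}^k$ to $\mathcal{F}$ satisfying $\mathbf{x}\subset S_{\mathbf{x}}$. Define $$\tilde g(\mathbf{x},\omega):=g(\mathbf{x},\omega)\,\mathbf{1}\{\mathcal{S}(\mathbf{x},\omega)\subset S_{\mathbf{x}}\},\quad \omega\in\mathbf{N}_{\mathbb{X}},\qquad \xi_{\mathrm{tr}}:=\frac1{k!}\sum_{\mathbf{x}\in\eta^k_{\neq}}\tilde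 g(\mathbf{x},\eta)\,\delta_{f(\mathbf{x},\eta)}.$$ Then $$\begin{aligned}\mathbf{d_{KR}}(\xi,\zeta)&\le d_{TV}(\mathbf{L},\mathbf{M})+2\big(\mathrm{Var}(\xi_{\mathrm{tr}}(\mathbb{Y}))-\mathbb{E}\{\xi_{\mathrm{tr}}(\mathbb{Y})\}\big)+E_1+2E_2\\&=d_{TV}(\mathbf{L},\mathbf{M})+E_1+E_2+E_3+E_4\end{aligned}$$ with $$E_1:=\frac{2}{k!}\int_{\mathbb{X}^k}\mathbb{E}\big\{g(\mathbf{x},\eta+\delta_{\mathbf{x}})\,\mathbf{1}\{\mathcal{S}(\mathbf{x},\eta+\delta_{\mathbf{x}})\not\subset S_{\mathbf{x}}\}\big\}\,\mathbf{K}^k(\mathrm{d}\mathbf{x}),$$ $$E_2:=\frac{2}{(k!)^2}\int_{\mathbb{X}^k}\int_{\mathbb{X}^k}\mathbf{1}\{S_{\mathbf{x}}\cap S_{\mathbf{z}}\neq\emptyset\}\,\mathbb{E}\{\tilde g(\mathbf{x},\eta+\delta_{\mathbf{x}})\}\,\mathbb{E}\{\tilde g(\mathbf{z},\eta+\delta_{\mathbf{z}})\}\,\mathbf{K}^k(\mathrm{d}\mathbf{z})\,\mathbf{K}^k(\mathrm{d}\mathbf{x}),$$ $$E_3:=\frac{2}{(k!)^2}\int_{\mathbb{X}^k}\int_{\mathbb{X}^k}\mathbf{1}\{S_{\mathbf{x}}\cap S_{\mathbf{z}}\neq\emptyset\}\,\mathbb{E}\{\tilde g(\mathbf{x},\eta+\delta_{\mathbf{x}}+\delta_{\mathbf{z}})\,\tilde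 g(\mathbf{z},\eta+\delta_{\mathbf{x}}+\delta_{\mathbf{z}})\}\,\mathbf{K}^k(\mathrm{d}\mathbf{z})\,\mathbf{K}^k(\mathrm{d}\mathbf{x}),$$ $$E_4:=\frac{2}{k!}\sum_{\emptyset\subsetneq I\subsetneq\{1,\ldots,k\}}\frac{1}{(k-|I|)!}\int_{\mathbb{X}^k}\int_{\mathbb{X}^{k-|I|}}\mathbb{E}\{\tilde g(\mathbf{x},\eta+\delta_{\mathbf{x}}+\delta_{\mathbf{z}})\,\tilde g((\mathbf{x}_I,\mathbf{z}),\eta+\delta_{\mathbf{x}}+\delta_{\mathbf{z}})\}\,\mathbf{K}^{k-|I|}(\mathrm{d}\mathbf{z})\,\mathbf{K}^k(\mathrm{d}\mathbf{x}),$$ where for $I=\{i_1,\ldots,i_m\}$ we set $\mathbf{x}_I=(x_{i_1},\ldots,x_{i_m})$ and $(\mathbf{x}_I,\mathbf{z})=(x_{i_1},\ldots,x_{i_m},z_1,\ldots,z_{k-m})$.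
   Context: $\mathbf{N}_{\mathbb{X}}$ (resp. $\widehat{\mathbf{N}}_{\mathbb{X}}$) is the space of $\sigma$-finite (resp. finite) counting measures on $\mathbb{X}$, with the $\sigma$-algebra generated by the maps $\omega\mapsto\omega(B)$, $B\in\mathcal{X}$; similarly for $\mathbb{Y}$. Counting measures $\omega=\sum_{i\in I}\delta_{x_i}$ are identified with multisets; $\omega^k_{\neq}:=\{(x_{i_1},\ldots,x_{i_k}): i_1,\ldots,i_k\in I\text{ pairwise distinct}\}$, and sums over $\omega^k_{\neq}$ run over all $k$-tuples of pairwise distinct indices. $\omega\cap S$ is the restriction of $\omega$ to $S\in\mathcal{X}$ (as a multiset). For $\mathbf{x}=(x_1,\ldots,x_k)$, $\delta_{\mathbf{x}}:=\sum_{i}\delta_{x_i}$, and $\mathbf{x}\subset A$ means $\{x_1,\ldots,x_k\}\subset A$. $\mathcal{F}=\mathcal{F}(\mathbb{X})$ is the space of all closed subsets of $\mathbb{X}$, with the smallest $\sigma$-algebra containing $\{F\in\mathcal{F}:F\cap K\neq\emptyset\}$ for all compact $K\subset\mathbb{X}$. Localized: $f,g$ are localized to $\mathcal{S}$ if for all $\omega\in\mathbf{N}_{\mathbb{X}}$, all $\mathbf{x}\in\omega^k_{\neq}$ and all (measurable) $S\supset\mathcal{S}(\mathbf{x},\omega)$ we have $g(\mathbf{x},\omega)=g(\mathbf{x},\omega\cap S)$ and, if $g(\mathbf{x},\omega)=1$, $f(\mathbf{x},\omega)=f(\mathbf{x},\omega\cap S)$. Stopping set: for every $\mathbf{x}$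 and every compact $S\subset\mathbb{X}$, $\{\omega\in\mathbf{N}_{\mathbb{X}}:\mathcal{S}(\mathbf{x},\omega)\subset S\}=\{\omega\in\mathbf{N}_{\mathbb{X}}:\mathcal{S}(\mathbf{x},\omega\cap S)\subset S\}$. The intensity measure of $\xi$ is $\mathbf{L}(A)=\mathbb{E}\{\xi(A)\}$, $A\in\mathcal{Y}$. For measures $\mu_1,\mu_2$, $d_{TV}(\mu_1,\mu_2):=\sup\{|\mu_1(A)-\mu_2(A)|\}$ over measurable $A$ with $\mu_1(A),\mu_2(A)<\infty$. The Kantorovich–Rubinstein distance between (a.s.) finite point processes on $\mathbb{Y}$ is $\mathbf{d_{KR}}(\xi,\zeta):=\sup_{h}|\mathbb{E}\{h(\xi)\}-\mathbb{E}\{h(\zeta)\}|$, the supremum being over all measurable $h:\widehat{\mathbf{N}}_{\mathbb{Y}}\to\mathbb{R}$ with $|h(\omega_1)-h(\omega_2)|\le d_{TV}(\omega_1,\omega_2)$ for all $\omega_1,\omega_2$.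
   Formalization: Two hypotheses are added, without which the claim fails: g̃ is symmetric in the X^k-coordinates, and the stopping-set identity also holds with S = S_x for every x (automatic if S_x is compact or if 𝒮 takes compact values). *)

theory Defs
  imports "HOL-Probability.Probability"
begin

text \<open>
  Spaces are types of class \<open>{second_countable_topology, t2_space}\<close> with their Borel sigma-algebra;
  local compactness is a separate hypothesis.  A tuple in the \<open>k\<close>-th power of the space is an
  extensional function on the index set \<open>{..<k}\<close>, so indices run from \<open>0\<close>.
\<close>

definition counting_measures :: "'a::topological_space measure set" where
  "counting_measures = {\<omega>. sets \<omega> = sets borel \<and> sigma_finite_measure \<omega> \<and>
     (\<forall>B\<in>sets borel. emeasure \<omega> B = \<infinity> \<or> (\<exists>n::nat. emeasure \<omega> B = of_nat n))}"

definition finite_counting_measures :: "'a::topological_space measure set" where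
  "finite_counting_measures = {\<omega> \<in> counting_measures. emeasure \<omega> UNIV < \<infinity>}"

definition eval_sigma :: "'a::topological_space measure set \<Rightarrow> 'a measure measure" where
  "eval_sigma \<Omega> =
     sigma \<Omega> {{\<omega> \<in> \<Omega>. emeasure \<omega> B \<in> A} | A B. A \<in> sets borel \<and> B \<in> sets borel}"

definition N_space :: "'a::topological_space measure measure" where
  "N_space = eval_sigma counting_measures"

definition finite_N_space :: "'a::topological_space measure measure" where
  "finite_N_space = eval_sigma finite_counting_measures"

definition restr :: "'a measure \<Rightarrow> 'a set \<Rightarrow> 'a measure" where
  "restr \<omega> S = density \<omega> (indicator S)"

definition add_measure :: "'a measure \<Rightarrow> 'a measure \<Rightarrow> 'a measure" where
  "add_measure \<mu> \<nu> = measure_of (space \<mu>) (sets \<mu>) (\<lambda>A. emeasure \<mu> A + emeasure \<nu> A)"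

definition dirac_sum :: "nat \<Rightarrow> (nat \<Rightarrow> 'a::topological_space) \<Rightarrow> 'a measure" where
  "dirac_sum m x = distr (count_space {..<m}) borel x"

text \<open>
  A canonical index set \<open>I\<close> for the representation of \<open>\<omega>\<close> as a sum of Dirac measures: a point \<open>x\<close>
  of multiplicity \<open>m\<close> contributes the indices \<open>(x, 0), \<dots>, (x, m - 1)\<close>, and the index \<open>(x, j)\<close>
  stands for the point \<open>x\<close>.  See \<open>counting_measure_eq_dirac_sum\<close> below.
\<close>

definition point_indices :: "'a measure \<Rightarrow> ('a \<times> nat) set" where
  "point_indices \<omega> = {(x, j). of_nat j < emeasure \<omega> {x}}"

definition distinct_indices :: "nat \<Rightarrow> 'a measure \<Rightarrow> (nat \<Rightarrow> 'a \<times> nat) set" where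
  "distinct_indices k \<omega> = {i \<in> {..<k} \<rightarrow>\<^sub>E point_indices \<omega>. inj_on i {..<k}}"

definition pts :: "nat \<Rightarrow> (nat \<Rightarrow> 'a \<times> nat) \<Rightarrow> (nat \<Rightarrow> 'a)" where
  "pts k i = (\<lambda>l\<in>{..<k}. fst (i l))"

text \<open>The tuples in \<open>\<omega>\<^sup>k\<^sub>\<noteq>\<close>, without their multiplicities.\<close>

definition distinct_tuples :: "nat \<Rightarrow> 'a measure \<Rightarrow> (nat \<Rightarrow> 'a) set" where
  "distinct_tuples k \<omega> = pts k ` distinct_indices k \<omega>"

definition tuple_space :: "nat \<Rightarrow> (nat \<Rightarrow> 'a::topological_space) measure" where
  "tuple_space k = PiM {..<k} (\<lambda>_. borel)"

definition measure_power :: "nat \<Rightarrow> 'a measure \<Rightarrow> (nat \<Rightarrow> 'a) measure" where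
  "measure_power k K = PiM {..<k} (\<lambda>_. K)"

definition symmetric_in_tuple ::
    "nat \<Rightarrow> ((nat \<Rightarrow> 'a::topological_space) \<Rightarrow> 'a measure \<Rightarrow> 'b) \<Rightarrow> bool" where
  "symmetric_in_tuple k F \<longleftrightarrow>
     (\<forall>\<pi> x \<omega>. \<pi> permutes {..<k} \<longrightarrow> x \<in> space (tuple_space k) \<longrightarrow> \<omega> \<in> counting_measures \<longrightarrow>
        F (\<lambda>i. x (\<pi> i)) \<omega> = F x \<omega>)"

definition closed_set_space :: "'a::topological_space set measure" where
  "closed_set_space = sigma {F. closed F} {{F. closed F \<and> F \<inter> K \<noteq> {}} | K. compact K}"

definition localized ::
    "nat \<Rightarrow> ((nat \<Rightarrow> 'a::topological_space) \<Rightarrow> 'a measure \<Rightarrow> real) \<Rightarrow>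
     ((nat \<Rightarrow> 'a) \<Rightarrow> 'a measure \<Rightarrow> 'b) \<Rightarrow> ((nat \<Rightarrow> 'a) \<Rightarrow> 'a measure \<Rightarrow> 'a set) \<Rightarrow> bool" where
  "localized k g f \<S> \<longleftrightarrow>
     (\<forall>\<omega>\<in>counting_measures. \<forall>x\<in>distinct_tuples k \<omega>. \<forall>S\<in>sets borel. \<S> x \<omega> \<subseteq> S \<longrightarrow>
        g x \<omega> = g x (restr \<omega> S) \<and> (g x \<omega> = 1 \<longrightarrow> f x \<omega> = f x (restr \<omega> S)))"

definition stops_at ::
    "((nat \<Rightarrow> 'a::topological_space) \<Rightarrow> 'a measure \<Rightarrow> 'a set) \<Rightarrow> (nat \<Rightarrow> 'a) \<Rightarrow> 'a set \<Rightarrow> bool" where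
  "stops_at \<S> x S \<longleftrightarrow>
     {\<omega>\<in>counting_measures. \<S> x \<omega> \<subseteq> S} = {\<omega>\<in>counting_measures. \<S> x (restr \<omega> S) \<subseteq> S}"

text \<open>
  The defining condition quantifies over compact \<open>S\<close>.  It therefore says nothing about a
  non-compact closed \<open>S\<close> if \<open>\<S> x \<omega>\<close> itself is not compact; where such an \<open>S\<close> is used,
  \<open>stops_at \<S> x S\<close> has to be asked for separately.
\<close>

definition stopping_set ::
    "nat \<Rightarrow> ((nat \<Rightarrow> 'a::topological_space) \<Rightarrow> 'a measure \<Rightarrow> 'a set) \<Rightarrow> bool" where
  "stopping_set k \<S> \<longleftrightarrow> (\<forall>x\<in>space (tuple_space k). \<forall>S. compact S \<longrightarrow> stops_at \<S> x S)"

text \<open>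
  The convention for an infinite mean is that the count is almost surely infinite.  The library's
  \<open>poisson_pmf\<close> is specified for positive rates only, hence the explicit weights (with \<open>0 ^ 0 = 1\<close>).
\<close>

definition poisson_process ::
    "'p measure \<Rightarrow> ('p \<Rightarrow> 'a::topological_space measure) \<Rightarrow> 'a measure \<Rightarrow> bool" where
  "poisson_process P \<eta> K \<longleftrightarrow>
     \<eta> \<in> P \<rightarrow>\<^sub>M N_space \<and>
     (\<forall>B\<in>sets borel. \<forall>n::nat. measure P {p\<in>space P. emeasure (\<eta> p) B = of_nat n} =
        (if emeasure K B = \<infinity> then 0 else exp (- measure K B) * measure K B ^ n / fact n)) \<and>
     (\<forall>(m::nat) B. (\<forall>i<m. B i \<in> sets borel) \<and> disjoint_family_on B {..<m} \<longrightarrow>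
        prob_space.indep_vars P (\<lambda>_. borel) (\<lambda>i p. emeasure (\<eta> p) (B i)) {..<m})"

text \<open>The measure \<open>(1 / k!) \<Sum>\<^bsub>x \<in> \<omega>\<^sup>k\<^sub>\<noteq>\<^esub> g(x, \<omega>) \<delta>\<^bsub>f(x, \<omega>)\<^esub>\<close>.\<close>

definition tuple_measure ::
    "nat \<Rightarrow> ((nat \<Rightarrow> 'a) \<Rightarrow> 'a measure \<Rightarrow> real) \<Rightarrow>
     ((nat \<Rightarrow> 'a) \<Rightarrow> 'a measure \<Rightarrow> 'b::topological_space) \<Rightarrow> 'a measure \<Rightarrow> 'b measure" where
  "tuple_measure k g f \<omega> = scale_measure (ennreal (1 / fact k))
     (distr (density (count_space (distinct_indices k \<omega>)) (\<lambda>i. ennreal (g (pts k i) \<omega>)))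
        borel (\<lambda>i. f (pts k i) \<omega>))"

definition intensity_measure ::
    "'p measure \<Rightarrow> ('p \<Rightarrow> 'a::topological_space measure) \<Rightarrow> 'a measure" where
  "intensity_measure P \<xi> =
     measure_of UNIV (sets borel) (\<lambda>A. \<integral>\<^sup>+ p. emeasure (\<xi> p) A \<partial>P)"

text \<open>
  The variance of a nonnegative, almost surely finite random variable with finite mean; unlike the
  library's \<open>variance\<close>, it takes the value \<open>\<infinity>\<close> (and not \<open>0\<close>) if the second moment is infinite.
\<close>

definition ext_variance :: "'p measure \<Rightarrow> ('p \<Rightarrow> ennreal) \<Rightarrow> ennreal" where
  "ext_variance P X =
     (\<integral>\<^sup>+ p. ennreal ((enn2real (X p) - enn2real (\<integral>\<^sup>+ q. X q \<partial>P))\<^sup>2) \<partial>P)"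

definition d_TV :: "'a::topological_space measure \<Rightarrow> 'a measure \<Rightarrow> ennreal" where
  "d_TV \<mu> \<nu> = (SUP A\<in>{A\<in>sets borel. emeasure \<mu> A < \<infinity> \<and> emeasure \<nu> A < \<infinity>}.
     ennreal \<bar>measure \<mu> A - measure \<nu> A\<bar>)"

definition KR_test_functions :: "('a::topological_space measure \<Rightarrow> real) set" where
  "KR_test_functions = {h \<in> borel_measurable finite_N_space.
     \<forall>\<omega>1\<in>finite_counting_measures. \<forall>\<omega>2\<in>finite_counting_measures.
       ennreal \<bar>h \<omega>1 - h \<omega>2\<bar> \<le> d_TV \<omega>1 \<omega>2}"

text \<open>
  Test functions live on finite counting measures and the processes take such values almost surely,
  so the expectation is restricted to this event.  It is taken with respect to the completed
  probability measure because \<open>\<omega> \<mapsto> tuple_measure k g f \<omega>\<close> need not be measurable on the whole of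
  \<open>N_space\<close>: on general sigma-finite counting measures the evaluation maps do not even make the set
  of simple ones measurable.  For a Poisson process with sigma-finite intensity \<open>\<xi>\<close> agrees with a
  measurable map off a null set, but the Bochner integral of a non-measurable function is \<open>0\<close>.
  The nonnegative integrals used elsewhere do not depend on null sets.
\<close>

definition KR_expectation ::
    "'p measure \<Rightarrow> ('p \<Rightarrow> 'a::topological_space measure) \<Rightarrow> ('a measure \<Rightarrow> real) \<Rightarrow> real" where
  "KR_expectation P \<xi> h =
     (\<integral>p. (if \<xi> p \<in> finite_counting_measures then h (\<xi> p) else 0) \<partial>completion P)"

text \<open>The two processes may live on different probability spaces; only their laws matter.\<close>

definition d_KR ::
    "'p measure \<Rightarrow> ('p \<Rightarrow> 'a::topological_space measure) \<Rightarrow>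
     'q measure \<Rightarrow> ('q \<Rightarrow> 'a measure) \<Rightarrow> ennreal" where
  "d_KR P \<xi> Q \<zeta> =
     (SUP h\<in>KR_test_functions. ennreal \<bar>KR_expectation P \<xi> h - KR_expectation Q \<zeta> h\<bar>)"

text \<open>The \<open>k\<close>-tuple \<open>(x\<^sub>I, z)\<close> for \<open>I \<subseteq> {..<k}\<close> and a \<open>(k - |I|)\<close>-tuple \<open>z\<close>.\<close>

definition combine_tuple ::
    "nat \<Rightarrow> nat set \<Rightarrow> (nat \<Rightarrow> 'a) \<Rightarrow> (nat \<Rightarrow> 'a) \<Rightarrow> (nat \<Rightarrow> 'a)" where
  "combine_tuple k I x z =
     (\<lambda>j\<in>{..<k}. if j < card I then x (sorted_list_of_set I ! j) else z (j - card I))"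

lemma counting_measure_null_if_no_atoms:
  fixes \<omega> :: "'a::{second_countable_topology, t1_space} measure"
  assumes \<omega>: "\<omega> \<in> counting_measures" and B: "B \<in> sets borel" "emeasure \<omega> B < \<infinity>"
    and na: "\<And>x. x \<in> B \<Longrightarrow> emeasure \<omega> {x} = 0"
  shows "emeasure \<omega> B = 0"
proof -
  have sets[measurable_cong, simp]: "sets \<omega> = sets borel"
    using \<omega> by (simp add: counting_measures_def)
  obtain \<B> :: "'a set set" where \<B>: "countable \<B>" "topological_basis \<B>"
    using ex_countable_basis by blast
  have "\<exists>U\<in>\<B>. x \<in> U \<and> emeasure \<omega> (U \<inter> B) = 0" if x: "x \<in> B" for x
  proof -
    obtain A :: "nat \<Rightarrow> 'a set" where A: "\<And>i. open (A i)" "\<And>i. x \<in> A i"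
      "\<And>S. open S \<Longrightarrow> x \<in> S \<Longrightarrow> eventually (\<lambda>i. A i \<subseteq> S) sequentially"
      by (rule first_countable_topology_class.countable_basis_at_decseq[of x]) (rule that)
    define D where "D n = (\<Inter>i\<le>n. A i) \<inter> B" for n
    have Dm: "D n \<in> sets \<omega>" for n
      unfolding D_def using A(1) B by auto
    have D: "decseq D" unfolding D_def decseq_def by force
    have "(\<Inter>n. D n) = {x}"
    proof -
      have "y = x" if y: "y \<in> (\<Inter>n. D n)" for y
      proof (rule ccontr)
        assume "y \<noteq> x"
        then have "eventually (\<lambda>i. A i \<subseteq> - {y}) sequentially" by (intro A(3)) auto
        then obtain i where "A i \<subseteq> - {y}" by (auto simp: eventually_sequentially)
        then show False using y by (auto simp: D_def)
      qed
      then show ?thesis using A(2) x by (auto simp: D_def)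
    qed
    moreover have "emeasure \<omega> (D n) < \<infinity>" for n
      using B(2) emeasure_mono[of "D n" B \<omega>] B(1) by (auto simp: D_def intro: le_less_trans)
    ultimately have lim: "(\<lambda>n. emeasure \<omega> (D n)) \<longlonglongrightarrow> 0"
      using Lim_emeasure_decseq[of D \<omega>] D Dm na[OF x] by (auto simp: image_subset_iff less_top)
    then have "eventually (\<lambda>n. emeasure \<omega> (D n) < 1) sequentially"
      by (intro order_tendstoD) auto
    then obtain n where n: "emeasure \<omega> (D n) < 1" by (auto simp: eventually_sequentially)
    have "emeasure \<omega> (D n) = \<infinity> \<or> (\<exists>m::nat. emeasure \<omega> (D n) = of_nat m)"
      using \<omega> Dm by (auto simp: counting_measures_def)
    then have z: "emeasure \<omega> (D n) = 0"
    proof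
      assume "\<exists>m::nat. emeasure \<omega> (D n) = of_nat m"
      then obtain m :: nat where m: "emeasure \<omega> (D n) = of_nat m" by blast
      then have "(of_nat m :: ennreal) < of_nat 1" using n by simp
      then have "m < 1" by (simp only: of_nat_less_iff)
      then show ?thesis using m by simp
    qed (use n in auto)
    have "open (\<Inter>i\<le>n. A i)" using A(1) by auto
    then obtain U where U: "U \<in> \<B>" "x \<in> U" "U \<subseteq> (\<Inter>i\<le>n. A i)"
      using A(2) topological_basisE[OF \<B>(2)] by (metis INT_I)
    have "emeasure \<omega> (U \<inter> B) \<le> emeasure \<omega> (D n)"
      using U Dm by (intro emeasure_mono) (auto simp: D_def)
    then show ?thesis using U z by auto
  qed
  then have sub: "B \<subseteq> (\<Union>U\<in>{U\<in>\<B>. emeasure \<omega> (U \<inter> B) = 0}. U \<inter> B)" by blast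
  have "(\<Union>U\<in>{U\<in>\<B>. emeasure \<omega> (U \<inter> B) = 0}. U \<inter> B) \<in> null_sets \<omega>"
    using \<B> B(1) by (intro null_sets_UN') (auto simp: null_sets_def dest: topological_basis_open)
  with sub show ?thesis using null_sets_subset B(1) by (metis null_setsD1 sets)
qed

lemma counting_measure_eq_dirac_sum:
  fixes \<omega> :: "'a::{second_countable_topology, t1_space} measure"
  assumes \<omega>: "\<omega> \<in> counting_measures"
  shows "\<omega> = distr (count_space (point_indices \<omega>)) borel fst"
proof (rule measure_eqI)
  have sets[measurable_cong, simp]: "sets \<omega> = sets borel"
    using \<omega> by (simp add: counting_measures_def)
  then show "sets \<omega> = sets (distr (count_space (point_indices \<omega>)) borel fst)" by simp
  interpret sigma_finite_measure \<omega> using \<omega> by (simp add: counting_measures_def)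
  fix B assume "B \<in> sets \<omega>"
  then have B: "B \<in> sets borel" by simp
  obtain C :: "nat \<Rightarrow> 'a set" where C: "range C \<subseteq> sets \<omega>" "(\<Union>i. C i) = space \<omega>"
    "\<And>i. emeasure \<omega> (C i) \<noteq> \<infinity>"
    using sigma_finite by blast
  have [simp]: "space \<omega> = UNIV" using sets_eq_imp_space_eq[OF sets] by simp
  define A where "A = {x. emeasure \<omega> {x} \<noteq> 0}"
  have nat: "\<exists>n::nat. emeasure \<omega> {x} = of_nat n" for x
  proof -
    obtain i where "x \<in> C i" using C(2) by auto
    then have "emeasure \<omega> {x} \<le> emeasure \<omega> (C i)" using C(1) by (intro emeasure_mono) auto
    then have "emeasure \<omega> {x} \<noteq> \<infinity>" using C(3)[of i] by (auto simp: top_unique)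
    then show ?thesis using \<omega> by (auto simp: counting_measures_def)
  qed
  have one: "1 \<le> emeasure \<omega> {x}" if "x \<in> A" for x
  proof -
    obtain n :: nat where n: "emeasure \<omega> {x} = of_nat n" using nat by blast
    with that have "1 \<le> n" by (cases n) (auto simp: A_def)
    then have "of_nat 1 \<le> (of_nat n :: ennreal)" by (simp only: of_nat_le_iff)
    then show ?thesis by (simp add: n)
  qed
  have fin: "finite (A \<inter> C i)" for i
  proof (rule ccontr)
    assume inf: "infinite (A \<inter> C i)"
    have "C i \<in> sets borel" using C(1) by auto
    then have "emeasure \<omega> (C i) = \<infinity> \<or> (\<exists>n::nat. emeasure \<omega> (C i) = of_nat n)"
      using \<omega> unfolding counting_measures_def by blast
    then obtain n :: nat where n: "emeasure \<omega> (C i) = of_nat n"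
      using C(3)[of i] by blast
    obtain F where F: "F \<subseteq> A \<inter> C i" "finite F" "card F = Suc n"
      using infinite_arbitrarily_large[OF inf] by blast
    have "of_nat (Suc n) = (\<Sum>x\<in>F. 1 :: ennreal)" using F by simp
    also have "\<dots> \<le> (\<Sum>x\<in>F. emeasure \<omega> {x})" using F one by (intro sum_mono) auto
    also have "\<dots> = emeasure \<omega> F" using F by (intro emeasure_eq_sum_singleton[symmetric]) auto
    also have "\<dots> \<le> emeasure \<omega> (C i)" using F C(1) by (intro emeasure_mono) auto
    finally have "Suc n \<le> n" unfolding n by (simp only: of_nat_le_iff)
    then show False by simp
  qed
  have "A = (\<Union>i. A \<inter> C i)" using C(2) by auto
  then have cA: "countable A" by (metis countable_UN[of UNIV] fin countable_finite countableI_type)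
  have Am: "A \<in> sets borel" by (rule sets.countable[OF _ cA]) auto
  have "emeasure \<omega> (C i - A) = 0" for i
  proof (rule counting_measure_null_if_no_atoms[OF \<omega>])
    show "C i - A \<in> sets borel" using C(1) Am by auto
    show "emeasure \<omega> (C i - A) < \<infinity>"
      using emeasure_mono[of "C i - A" "C i" \<omega>] C(1) C(3)[of i] by (auto simp: less_top top_unique)
  qed (auto simp: A_def)
  then have "(\<Union>i. C i - A) \<in> null_sets \<omega>"
    using C(1) Am by (intro null_sets_UN) auto
  then have "B - A \<in> null_sets \<omega>"
    by (rule null_sets_subset) (use C(2) B Am in auto)
  then have "emeasure \<omega> B = emeasure \<omega> (B \<inter> A)"
    using B Am by (intro emeasure_eq_AE) (auto intro: AE_I' )
  also have "\<dots> = (\<integral>\<^sup>+ x. emeasure \<omega> {x} \<partial>count_space (B \<inter> A))"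
    using cA by (intro emeasure_countable_singleton) auto
  also have "\<dots> = (\<integral>\<^sup>+ x. emeasure \<omega> {x} * indicator B x \<partial>count_space UNIV)"
    by (subst nn_integral_count_space_indicator)
       (auto intro!: nn_integral_cong simp: A_def indicator_def split: if_splits)
  also have "\<dots> = (\<integral>\<^sup>+ x. \<integral>\<^sup>+ j. indicator (point_indices \<omega> \<inter> fst -` B) (x, j)
      \<partial>count_space UNIV \<partial>count_space UNIV)"
  proof (intro nn_integral_cong)
    fix x
    obtain n :: nat where n: "emeasure \<omega> {x} = of_nat n" using nat by blast
    have "(\<integral>\<^sup>+ j. indicator (point_indices \<omega> \<inter> fst -` B) (x, j) \<partial>count_space UNIV)
      = (\<integral>\<^sup>+ j. indicator {..<n} j * indicator B x \<partial>count_space UNIV)"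
      by (intro nn_integral_cong) (auto simp: point_indices_def n indicator_def)
    also have "\<dots> = of_nat n * indicator B x" by (simp add: nn_integral_multc)
    finally show "emeasure \<omega> {x} * indicator B x =
      (\<integral>\<^sup>+ j. indicator (point_indices \<omega> \<inter> fst -` B) (x, j) \<partial>count_space UNIV)" by (simp add: n)
  qed
  also have "\<dots> = emeasure (count_space UNIV) (point_indices \<omega> \<inter> fst -` B)"
    by (subst nn_integral_fst_count_space) simp
  also have "\<dots> = emeasure (distr (count_space (point_indices \<omega>)) borel fst) B"
    using B by (simp add: emeasure_distr emeasure_count_space Int_commute)
  finally show "emeasure \<omega> B = emeasure (distr (count_space (point_indices \<omega>)) borel fst) B" .
qed

end

theory Submission
  imports Defs
begin

text \<open>
  The proof is Stein's method for Poisson process approximation, combined with the Mecke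
  formula.

  Keep each point of a finite counting measure \<open>\<omega>\<close> with probability \<open>t\<close>, add a Poisson process
  with intensity \<open>1 - t\<close> times \<open>M\<close>, take the expected increment of the test function \<open>h\<close> at a
  point \<open>y\<close> and integrate over \<open>t\<close> in the unit interval; call the result \<open>U y \<omega>\<close>. Then \<open>h \<omega>\<close>
  minus the expectation of \<open>h\<close> at the Poisson process \<open>\<zeta>\<close> is the integral of \<open>U y (\<omega> - \<delta>\<^sub>y)\<close>
  with respect to \<open>\<omega>\<close> minus the integral of \<open>U y \<omega>\<close> with respect to \<open>M\<close> (\<open>stein_equation\<close>).
  The mixture over \<open>t\<close> has explicit weights, and the identity is a recursion for them
  (\<open>wgt_rec\<close>). Replacing \<open>h\<close> by its sum with a constant and the number of points makes all
  terms nonnegative; it turns the bound \<open>1\<close> on the increments into values of \<open>U\<close> between \<open>0\<close>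
  and \<open>2\<close>, with oscillation at most \<open>1\<close> in \<open>y\<close>.

  The equation is applied to the truncated statistic. By the Mecke formula
  (\<open>multivariate_mecke\<close>) the integral with respect to it is an integral over tuples \<open>x\<close> that
  are added to \<open>\<eta>\<close>. Whether \<open>x\<close> counts, and where its point lies, depends only on the part of
  \<open>\<eta>\<close> in \<open>Sx x\<close>; the tuples \<open>z\<close> whose region \<open>Sx z\<close> is disjoint from \<open>Sx x\<close> depend only on the
  part of \<open>\<eta>\<close> outside. The two parts are independent. Leaving out the remaining tuples, before
  and after the independence is used, costs at most twice their expected number, since \<open>U\<close> is
  bounded by \<open>2\<close>. This yields \<open>E3\<close> and \<open>E4\<close> when \<open>x\<close> is added and \<open>E2\<close> when it is not
  (\<open>palm_comparison\<close>). What is left is the difference between the integrals of \<open>U\<close> with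
  respect to the intensity measure and with respect to \<open>M\<close>, which the oscillation bound
  controls by the total variation distance (\<open>nn_integral_diff_le_d_TV\<close>). The truncation
  removes half of \<open>E1\<close> points on average, and this enters twice: through the statistic and
  through its intensity measure.

  The second form of the bound holds because the second moment of the truncated count can be
  computed by the Mecke formula. Pairs of tuples with disjoint regions contribute the same
  amount to it as to the square of the mean, and cancel from the variance; what is left are
  the terms \<open>E2\<close>, \<open>E3\<close> and \<open>E4\<close> (\<open>variance_identity\<close>).

  The sums over tuples need not be measurable functions of a general sigma-finite counting
  measure. The process \<open>\<eta>\<close> is therefore modified on a null set such that it is always finite
  on each set of an exhaustion \<open>C\<close> with finite intensities (\<open>poisson_modification\<close>), and all
  functionals are considered on \<open>locally_finite C\<close>.
\<close>

section \<open>Counting measures and their evaluation sigma-algebra\<close>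

lemma sets_counting: "\<omega> \<in> counting_measures \<Longrightarrow> sets \<omega> = sets borel"
  by (simp add: counting_measures_def)

lemma space_counting: "\<omega> \<in> counting_measures \<Longrightarrow> space \<omega> = UNIV"
  using sets_eq_imp_space_eq[OF sets_counting] by auto

lemma counting_values:
  "\<omega> \<in> counting_measures \<Longrightarrow> emeasure \<omega> B = \<infinity> \<or> (\<exists>n::nat. emeasure \<omega> B = of_nat n)"
proof (cases "B \<in> sets borel")
  case False
  assume "\<omega> \<in> counting_measures"
  then have "emeasure \<omega> B = 0" using False by (intro emeasure_notin_sets) (simp add: sets_counting)
  then show ?thesis by (metis of_nat_0)
qed (simp add: counting_measures_def)

lemma counting_singleton:
  assumes "\<omega> \<in> counting_measures"
  shows "\<exists>n::nat. emeasure \<omega> {x::'a::{second_countable_topology, t2_space}} = of_nat n"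
proof -
  interpret sigma_finite_measure \<omega> using assms by (simp add: counting_measures_def)
  obtain C :: "nat \<Rightarrow> 'a set" where C: "range C \<subseteq> sets \<omega>" "(\<Union>i. C i) = space \<omega>"
    "\<And>i. emeasure \<omega> (C i) \<noteq> \<infinity>" using sigma_finite by blast
  obtain i where "x \<in> C i" using C(2) space_counting[OF assms] by auto
  then have "emeasure \<omega> {x} \<le> emeasure \<omega> (C i)" using C(1) by (intro emeasure_mono) auto
  then have "emeasure \<omega> {x} \<noteq> \<infinity>" using C(3)[of i] by (auto simp: top_unique)
  then show ?thesis using counting_values[OF assms, of "{x}"] by blast
qed

lemma counting_measuresI:
  assumes "sets \<omega> = sets borel"
    and "\<And>B. B \<in> sets borel \<Longrightarrow> emeasure \<omega> B = \<infinity> \<or> (\<exists>n::nat. emeasure \<omega> B = of_nat n)"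
    and "\<And>i. C i \<in> sets borel" "(\<Union>i::nat. C i) = UNIV" "\<And>i. emeasure \<omega> (C i) \<noteq> \<infinity>"
  shows "\<omega> \<in> counting_measures"
proof -
  have "sigma_finite_measure \<omega>"
    by (rule sigma_finite_measure.intro, rule exI[of _ "range C"])
       (use assms sets_eq_imp_space_eq[OF assms(1)] in auto)
  then show ?thesis using assms unfolding counting_measures_def by auto
qed

text \<open>The exhausting sets of the larger measure serve for the smaller one.\<close>

lemma counting_dominated:
  fixes \<omega> :: "'a::{second_countable_topology, t2_space} measure"
  assumes "\<omega> \<in> counting_measures" "sets \<mu> = sets borel"
    and "\<And>B. B \<in> sets borel \<Longrightarrow> emeasure \<mu> B = \<infinity> \<or> (\<exists>n::nat. emeasure \<mu> B = of_nat n)"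
    and "\<And>B. B \<in> sets borel \<Longrightarrow> emeasure \<mu> B \<le> emeasure \<omega> B"
  shows "\<mu> \<in> counting_measures"
proof -
  interpret sigma_finite_measure \<omega> using assms by (simp add: counting_measures_def)
  obtain C :: "nat \<Rightarrow> 'a set" where C: "range C \<subseteq> sets \<omega>" "(\<Union>i. C i) = space \<omega>"
    "\<And>i. emeasure \<omega> (C i) \<noteq> \<infinity>" using sigma_finite by blast
  have Cb: "C i \<in> sets borel" for i using C(1) sets_counting[OF assms(1)] by auto
  show ?thesis
  proof (rule counting_measuresI[OF assms(2,3), of C])
    show "emeasure \<mu> (C i) \<noteq> \<infinity>" for i
      using assms(4)[OF Cb[of i]] C(3)[of i] by (auto simp: top_unique)
  qed (use Cb C(2) space_counting[OF assms(1)] in auto)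
qed

lemma sets_add_measure[simp]: "sets (add_measure \<mu> \<nu>) = sets \<mu>"
  by (simp add: add_measure_def)

lemma emeasure_add_measure:
  assumes "sets \<nu> = sets \<mu>"
  shows "emeasure (add_measure \<mu> \<nu>) A = emeasure \<mu> A + emeasure \<nu> A"
proof (cases "A \<in> sets \<mu>")
  case True
  show ?thesis
  proof (rule emeasure_measure_of[OF add_measure_def])
    show "countably_additive (sets (add_measure \<mu> \<nu>)) (\<lambda>A. emeasure \<mu> A + emeasure \<nu> A)"
      unfolding countably_additive_def
      by (auto simp: suminf_add[symmetric] suminf_emeasure assms)
  qed (use True in \<open>auto simp: positive_def sets.space_closed dest: sets.sets_into_space\<close>)
qed (simp add: emeasure_notin_sets assms)

lemma counting_add:
  fixes \<omega> :: "'a::{second_countable_topology, t2_space} measure"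
  assumes w: "\<omega> \<in> counting_measures" and v: "\<nu> \<in> counting_measures"
    and fin: "emeasure \<nu> UNIV < \<infinity>"
  shows "add_measure \<omega> \<nu> \<in> counting_measures"
proof -
  interpret sigma_finite_measure \<omega> using assms by (simp add: counting_measures_def)
  obtain C :: "nat \<Rightarrow> 'a set" where C: "range C \<subseteq> sets \<omega>" "(\<Union>i. C i) = space \<omega>"
    "\<And>i. emeasure \<omega> (C i) \<noteq> \<infinity>" using sigma_finite by blast
  have Cb: "C i \<in> sets borel" for i using C(1) sets_counting[OF w] by auto
  have e: "emeasure (add_measure \<omega> \<nu>) B = emeasure \<omega> B + emeasure \<nu> B" for B
    by (intro emeasure_add_measure) (simp add: sets_counting w v)
  show ?thesis
  proof (rule counting_measuresI[of _ C])
    show "emeasure (add_measure \<omega> \<nu>) B = \<infinity> \<or> (\<exists>n::nat. emeasure (add_measure \<omega> \<nu>) B = of_nat n)" for B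
      using counting_values[OF w, of B] counting_values[OF v, of B] unfolding e
      by (auto simp flip: of_nat_add)
    have "emeasure \<nu> (C i) \<le> emeasure \<nu> UNIV" for i
      using Cb by (intro emeasure_mono) (auto simp: sets_counting v)
    then have "emeasure \<nu> (C i) < top" for i using fin le_less_trans by (metis infinity_ennreal_def)
    then show "emeasure (add_measure \<omega> \<nu>) (C i) \<noteq> \<infinity>" for i
      using C(3)[of i] unfolding e by (simp add: less_top)
  qed (use Cb C(2) space_counting[OF w] in \<open>auto simp: sets_counting w\<close>)
qed

lemma emeasure_dirac_sum:
  "B \<in> sets borel \<Longrightarrow> emeasure (dirac_sum m x) B = (\<Sum>i<m. indicator B (x i))"
  unfolding dirac_sum_def
  by (simp add: nn_integral_distr nn_integral_count_space_finite flip: nn_integral_indicator)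

lemma sets_dirac_sum[simp]: "sets (dirac_sum m x) = sets borel"
  by (simp add: dirac_sum_def)

lemma emeasure_dirac_sum_UNIV: "emeasure (dirac_sum m x) UNIV = of_nat m"
  by (simp add: emeasure_dirac_sum)

lemma dirac_sum_nat: "B \<in> sets borel \<Longrightarrow> \<exists>n::nat. emeasure (dirac_sum m x) B = of_nat n"
  by (auto simp: dirac_sum_def emeasure_distr)

lemma counting_dirac_sum: "dirac_sum m x \<in> counting_measures"
  by (rule counting_measuresI[of _ "\<lambda>_. UNIV"]) (auto simp: emeasure_dirac_sum_UNIV dirac_sum_nat)

lemma counting_add_dirac:
  fixes \<omega> :: "'a::{second_countable_topology, t2_space} measure"
  shows "\<omega> \<in> counting_measures \<Longrightarrow> add_measure \<omega> (dirac_sum m x) \<in> counting_measures"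
  by (intro counting_add counting_dirac_sum) (auto simp: emeasure_dirac_sum_UNIV of_nat_less_top)

lemma sets_restr[simp]: "sets (restr \<omega> S) = sets \<omega>"
  by (simp add: restr_def)

lemma emeasure_restr: "S \<in> sets \<omega> \<Longrightarrow> B \<in> sets \<omega> \<Longrightarrow> emeasure (restr \<omega> S) B = emeasure \<omega> (S \<inter> B)"
  unfolding restr_def
  by (subst emeasure_density) (auto simp: nn_integral_indicator[symmetric] simp del: nn_integral_indicator
      intro!: nn_integral_cong split: split_indicator)

lemma counting_restr:
  fixes \<omega> :: "'a::{second_countable_topology, t2_space} measure"
  assumes "\<omega> \<in> counting_measures" "S \<in> sets borel"
  shows "restr \<omega> S \<in> counting_measures"
  by (rule counting_dominated[OF assms(1)])
     (use assms counting_values[OF assms(1)] in \<open>auto simp: sets_counting emeasure_restr intro!: emeasure_mono\<close>)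

lemma measure_eq_borelI:
  assumes "sets \<mu> = sets borel" "sets \<nu> = sets borel"
    and "\<And>B. B \<in> sets borel \<Longrightarrow> emeasure \<mu> B = emeasure \<nu> B"
  shows "\<mu> = \<nu>"
  by (rule measure_eqI) (use assms in auto)

lemma add_dirac_commute:
  assumes "sets \<omega> = sets borel"
  shows "add_measure (add_measure \<omega> (dirac_sum m x)) (dirac_sum n y)
    = add_measure (add_measure \<omega> (dirac_sum n y)) (dirac_sum m x)"
  by (rule measure_eq_borelI) (auto simp: assms emeasure_add_measure add_ac)

lemma restr_restr:
  assumes "sets \<omega> = sets borel" "S \<in> sets borel" "T \<in> sets borel"
  shows "restr (restr \<omega> S) T = restr \<omega> (S \<inter> T)"
  by (rule measure_eq_borelI) (use assms in \<open>auto simp: emeasure_restr Int_assoc\<close>)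

lemma restr_add:
  assumes "sets \<omega> = sets borel" "sets \<nu> = sets borel" "S \<in> sets borel"
  shows "restr (add_measure \<omega> \<nu>) S = add_measure (restr \<omega> S) (restr \<nu> S)"
  by (rule measure_eq_borelI) (use assms in \<open>auto simp: emeasure_restr emeasure_add_measure\<close>)

lemma restr_dirac_sum:
  fixes x :: "nat \<Rightarrow> 'a::topological_space"
  assumes "x ` {..<m} \<subseteq> S" "S \<in> sets borel"
  shows "restr (dirac_sum m x) S = dirac_sum m x"
  by (rule measure_eq_borelI)
     (use assms in \<open>auto simp: emeasure_restr emeasure_dirac_sum sets.Int intro!: sum.cong split: split_indicator\<close>)

lemma restr_add_dirac_disjoint:
  fixes x :: "nat \<Rightarrow> 'a::topological_space"
  assumes "sets \<omega> = sets borel" "S \<in> sets borel" "x ` {..<m} \<inter> S = {}"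
  shows "restr (add_measure \<omega> (dirac_sum m x)) S = restr \<omega> S"
proof (rule measure_eq_borelI)
  fix B :: "'a set" assume B: "B \<in> sets borel"
  have "(\<Sum>i<m. indicator (S \<inter> B) (x i)) = (0::ennreal)"
    using assms(3) by (intro sum.neutral) (auto split: split_indicator)
  then show "emeasure (restr (add_measure \<omega> (dirac_sum m x)) S) B = emeasure (restr \<omega> S) B"
    using assms B by (simp add: emeasure_restr emeasure_add_measure emeasure_dirac_sum sets.Int)
qed (use assms in auto)

lemma restr_add_dirac_subset:
  fixes x :: "nat \<Rightarrow> 'a::topological_space"
  assumes "sets \<omega> = sets borel" "S \<in> sets borel" "x ` {..<m} \<subseteq> S"
  shows "restr (add_measure \<omega> (dirac_sum m x)) S = add_measure (restr \<omega> S) (dirac_sum m x)"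
  using assms by (simp add: restr_add restr_dirac_sum)

text \<open>
  With \<open>C\<close> constant and equal to the whole space these are the finite counting measures, so
  that \<open>\<eta>\<close> and \<open>\<zeta>\<close> are treated alike.
\<close>

definition locally_finite :: "(nat \<Rightarrow> 'a::topological_space set) \<Rightarrow> 'a measure set" where
  "locally_finite C = {\<omega> \<in> counting_measures. \<forall>i. emeasure \<omega> (C i) < \<infinity>}"

lemma locally_finite_UNIV: "locally_finite (\<lambda>_. UNIV) = finite_counting_measures"
  by (auto simp: locally_finite_def finite_counting_measures_def)

lemma space_eval_sigma[simp]: "space (eval_sigma \<Omega>) = \<Omega>"
  unfolding eval_sigma_def by (rule space_measure_of) auto

lemma sets_eval_sigma: "sets (eval_sigma \<Omega>) = sigma_sets \<Omega>
    {{\<omega> \<in> \<Omega>. emeasure \<omega> B \<in> A} | A B. A \<in> sets borel \<and> B \<in> sets borel}"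
  unfolding eval_sigma_def by (rule sets_measure_of) auto

lemma measurable_emeasure_eval[measurable (raw)]:
  assumes "X \<in> T \<rightarrow>\<^sub>M eval_sigma \<Omega>" "B \<in> sets borel"
  shows "(\<lambda>t. emeasure (X t) B) \<in> borel_measurable T"
proof -
  have "(\<lambda>\<omega>. emeasure \<omega> B) \<in> borel_measurable (eval_sigma \<Omega>)"
  proof (rule measurableI)
    fix A :: "ennreal set" assume "A \<in> sets borel"
    then show "(\<lambda>\<omega>. emeasure \<omega> B) -` A \<inter> space (eval_sigma \<Omega>) \<in> sets (eval_sigma \<Omega>)"
      unfolding sets_eval_sigma using assms(2)
      by (intro sigma_sets.Basic) (auto simp: vimage_def Int_def conj_commute)
  qed auto
  then show ?thesis using assms(1) by simp
qed

lemma measurable_eval_sigmaI: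
  assumes "\<And>t. t \<in> space T \<Longrightarrow> X t \<in> \<Omega>"
    and "\<And>B. B \<in> sets borel \<Longrightarrow> (\<lambda>t. emeasure (X t) B) \<in> borel_measurable T"
  shows "X \<in> T \<rightarrow>\<^sub>M eval_sigma \<Omega>"
  unfolding eval_sigma_def
proof (rule measurable_measure_of)
  fix y assume "y \<in> {{\<omega> \<in> \<Omega>. emeasure \<omega> B \<in> A} |A B. A \<in> sets borel \<and> B \<in> sets borel}"
  then obtain A B where y: "y = {\<omega> \<in> \<Omega>. emeasure \<omega> B \<in> A}" "A \<in> sets borel" "B \<in> sets borel" by auto
  have "X -` y \<inter> space T = (\<lambda>t. emeasure (X t) B) -` A \<inter> space T" using assms(1) y by auto
  then show "X -` y \<inter> space T \<in> sets T" using measurable_sets[OF assms(2)[OF y(3)] y(2)] by simp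
qed (use assms in auto)

lemma measurable_eval_sigma_iff:
  "X \<in> T \<rightarrow>\<^sub>M eval_sigma \<Omega> \<longleftrightarrow> (\<forall>t\<in>space T. X t \<in> \<Omega>) \<and>
     (\<forall>B\<in>sets borel. (\<lambda>t. emeasure (X t) B) \<in> borel_measurable T)"
  using measurable_eval_sigmaI[of T X \<Omega>] measurable_emeasure_eval[of X T \<Omega>] measurable_space[of X T "eval_sigma \<Omega>"]
  by (metis space_eval_sigma)

lemma measurable_eval_sigma_change:
  "X \<in> T \<rightarrow>\<^sub>M eval_sigma \<Omega> \<Longrightarrow> (\<And>t. t \<in> space T \<Longrightarrow> X t \<in> \<Omega>') \<Longrightarrow> X \<in> T \<rightarrow>\<^sub>M eval_sigma \<Omega>'"
  by (simp add: measurable_eval_sigma_iff)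

lemma inverse_one_plus_ennreal:
  assumes "a < (\<infinity>::ennreal)"
  shows "(1 + a) * inverse (1 + a) = 1" and "inverse (1 + a) * a \<le> 1"
proof -
  obtain r where r: "a = ennreal r" "0 \<le> r" using assms by (cases a rule: ennreal_cases) auto
  have a1: "1 + a = ennreal (1 + r)" using r by (simp flip: ennreal_1 ennreal_plus)
  have i: "inverse (1 + a) = ennreal (inverse (1 + r))"
    unfolding a1 using r(2) by (intro inverse_ennreal) simp
  have "(1 + a) * inverse (1 + a) = ennreal (1 + r) * ennreal (inverse (1 + r))"
    by (subst i, subst a1) (rule refl)
  also have "\<dots> = ennreal ((1 + r) * inverse (1 + r))" using r(2) by (intro ennreal_mult[symmetric]) auto
  finally have "(1 + a) * inverse (1 + a) = ennreal ((1 + r) * inverse (1 + r))" .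
  then show "(1 + a) * inverse (1 + a) = 1" using r(2) by simp
  show "inverse (1 + a) * a \<le> 1"
  proof -
    have "inverse (1 + a) * a = ennreal (inverse (1 + r)) * ennreal r"
      by (subst i, subst r(1)) (rule refl)
    also have "\<dots> = ennreal (inverse (1 + r) * r)" using r(2) by (intro ennreal_mult[symmetric]) auto
    also have "\<dots> \<le> 1" using r(2) by (simp add: ennreal_le_1 field_simps)
    finally show ?thesis .
  qed
qed

lemma measurable_tuple_component:
  assumes "x \<in> T \<rightarrow>\<^sub>M tuple_space m" "i < m"
  shows "(\<lambda>t. x t i) \<in> T \<rightarrow>\<^sub>M borel"
  by (rule measurable_compose[OF assms(1)[unfolded tuple_space_def] measurable_component_singleton])
     (use assms(2) in simp)

lemma measurable_tupleI:
  assumes "\<And>i. i < m \<Longrightarrow> (\<lambda>t. x t i) \<in> T \<rightarrow>\<^sub>M borel"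
    and "\<And>t. t \<in> space T \<Longrightarrow> x t \<in> extensional {..<m}"
  shows "x \<in> T \<rightarrow>\<^sub>M tuple_space m"
  unfolding tuple_space_def
  by (rule measurable_PiM_single')
     (use assms in \<open>auto simp: PiE_iff\<close>)

locale exhaustion =
  fixes C :: "nat \<Rightarrow> 'a::{second_countable_topology, t2_space} set"
  assumes C_sets[measurable, simp]: "\<And>i. C i \<in> sets borel"
    and C_inc: "incseq C" and C_UN: "(\<Union>i. C i) = UNIV"
begin

abbreviation "\<Omega> \<equiv> locally_finite C"
abbreviation "N \<equiv> eval_sigma \<Omega>"

lemma counting_of_lf: "\<omega> \<in> \<Omega> \<Longrightarrow> \<omega> \<in> counting_measures"
  by (simp add: locally_finite_def)

lemma sets_lf: "\<omega> \<in> \<Omega> \<Longrightarrow> sets \<omega> = sets borel"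
  by (simp add: counting_of_lf sets_counting)

lemma space_lf: "\<omega> \<in> \<Omega> \<Longrightarrow> space \<omega> = UNIV"
  by (simp add: counting_of_lf space_counting)

lemma lfI:
  assumes "sets \<omega> = sets borel"
    and "\<And>B. B \<in> sets borel \<Longrightarrow> emeasure \<omega> B = \<infinity> \<or> (\<exists>n::nat. emeasure \<omega> B = of_nat n)"
    and "\<And>i. emeasure \<omega> (C i) < \<infinity>"
  shows "\<omega> \<in> \<Omega>"
  unfolding locally_finite_def using counting_measuresI[OF assms(1,2) C_sets C_UN] assms(3)
  by (auto simp: less_top)

lemma lf_dominated:
  assumes "\<omega> \<in> \<Omega>" "sets \<mu> = sets borel"
    and "\<And>B. B \<in> sets borel \<Longrightarrow> emeasure \<mu> B = \<infinity> \<or> (\<exists>n::nat. emeasure \<mu> B = of_nat n)"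
    and "\<And>B. B \<in> sets borel \<Longrightarrow> emeasure \<mu> B \<le> emeasure \<omega> B"
  shows "\<mu> \<in> \<Omega>"
  using assms le_less_trans[OF assms(4)[OF C_sets]] by (intro lfI) (auto simp: locally_finite_def)

lemma lf_add: "\<omega> \<in> \<Omega> \<Longrightarrow> \<nu> \<in> finite_counting_measures \<Longrightarrow> add_measure \<omega> \<nu> \<in> \<Omega>"
proof -
  assume w: "\<omega> \<in> \<Omega>" and v: "\<nu> \<in> finite_counting_measures"
  have vc: "\<nu> \<in> counting_measures" "emeasure \<nu> UNIV < \<infinity>" using v by (auto simp: finite_counting_measures_def)
  have "emeasure \<nu> (C i) \<le> emeasure \<nu> UNIV" for i
    by (intro emeasure_mono) (auto simp: sets_counting vc)
  then have "emeasure \<nu> (C i) < \<infinity>" for i using vc(2) le_less_trans by blast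
  then show ?thesis
    using w counting_add[OF counting_of_lf[OF w] vc]
    by (auto simp: locally_finite_def emeasure_add_measure sets_lf w sets_counting vc)
qed

lemma finite_dirac_sum: "dirac_sum m x \<in> finite_counting_measures"
  by (simp add: finite_counting_measures_def counting_dirac_sum emeasure_dirac_sum_UNIV of_nat_less_top)

lemma lf_add_dirac: "\<omega> \<in> \<Omega> \<Longrightarrow> add_measure \<omega> (dirac_sum m x) \<in> \<Omega>"
  by (intro lf_add finite_dirac_sum)

lemma lf_restr: "\<omega> \<in> \<Omega> \<Longrightarrow> S \<in> sets borel \<Longrightarrow> restr \<omega> S \<in> \<Omega>"
  by (rule lf_dominated[of \<omega>])
     (use counting_values[OF counting_of_lf] in \<open>auto simp: sets_lf emeasure_restr intro!: emeasure_mono\<close>)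

lemma lf_null: "null_measure borel \<in> \<Omega>"
  by (rule lfI) (auto simp: intro: exI[of _ 0])

lemma measurable_add_dirac[measurable (raw)]:
  assumes [measurable]: "X \<in> T \<rightarrow>\<^sub>M N" "\<And>i. i < m \<Longrightarrow> (\<lambda>t. x t i) \<in> T \<rightarrow>\<^sub>M borel"
  shows "(\<lambda>t. add_measure (X t) (dirac_sum m (x t))) \<in> T \<rightarrow>\<^sub>M N"
proof (rule measurable_eval_sigmaI)
  have X: "X t \<in> \<Omega>" if "t \<in> space T" for t using measurable_space[OF assms(1) that] by simp
  then show "add_measure (X t) (dirac_sum m (x t)) \<in> \<Omega>" if "t \<in> space T" for t
    using that by (intro lf_add_dirac) auto
  fix B :: "'a set" assume [measurable]: "B \<in> sets borel"
  have "(\<lambda>t. emeasure (X t) B + (\<Sum>i<m. indicator B (x t i))) \<in> borel_measurable T"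
    by measurable
  then show "(\<lambda>t. emeasure (add_measure (X t) (dirac_sum m (x t))) B) \<in> borel_measurable T"
    by (rule measurable_cong[THEN iffD2, rotated])
       (simp add: emeasure_add_measure sets_lf X emeasure_dirac_sum)
qed

lemma measurable_restr[measurable (raw)]:
  assumes [measurable]: "X \<in> T \<rightarrow>\<^sub>M N" and S[measurable]: "S \<in> sets borel"
  shows "(\<lambda>t. restr (X t) S) \<in> T \<rightarrow>\<^sub>M N"
proof (rule measurable_eval_sigmaI)
  have X: "X t \<in> \<Omega>" if "t \<in> space T" for t using measurable_space[OF assms(1) that] by simp
  then show "restr (X t) S \<in> \<Omega>" if "t \<in> space T" for t
    using that S by (intro lf_restr) auto
  fix B :: "'a set" assume [measurable]: "B \<in> sets borel"
  have "(\<lambda>t. emeasure (X t) (S \<inter> B)) \<in> borel_measurable T" by measurable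
  then show "(\<lambda>t. emeasure (restr (X t) S) B) \<in> borel_measurable T"
    by (rule measurable_cong[THEN iffD2, rotated]) (simp add: emeasure_restr sets_lf X)
qed

text \<open>
  The restriction of a random locally finite measure to \<open>C i\<close>, divided by one plus its mass,
  is a subprobability kernel, for which measurability is known; the integral is the supremum
  over \<open>i\<close> of the rescaled integrals.
\<close>

lemma kernel_nn_integral_measurable:
  assumes \<phi>[measurable]: "(\<lambda>(t, y). \<phi> t y) \<in> borel_measurable (T \<Otimes>\<^sub>M borel)"
    and X[measurable]: "X \<in> T \<rightarrow>\<^sub>M N"
  shows "(\<lambda>t. \<integral>\<^sup>+ y. \<phi> t y \<partial>X t) \<in> borel_measurable T"
proof -
  define c where "c i t = inverse (1 + emeasure (X t) (C i))" for i t
  define L where "L i t = scale_measure (c i t) (restr (X t) (C i))" for i t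
  have Xt: "X t \<in> \<Omega>" if "t \<in> space T" for t using measurable_space[OF X that] by simp
  have fin: "emeasure (X t) (C i) < \<infinity>" if "t \<in> space T" for t i
    using Xt[OF that] by (simp add: locally_finite_def)
  have eL: "emeasure (L i t) B = c i t * emeasure (X t) (C i \<inter> B)"
    if "t \<in> space T" "B \<in> sets borel" for i t B
    using that by (simp add: L_def emeasure_restr sets_lf Xt)
  have L[measurable]: "L i \<in> T \<rightarrow>\<^sub>M subprob_algebra borel" for i
  proof (rule measurable_subprob_algebra)
    fix t assume t: "t \<in> space T"
    show s: "sets (L i t) = sets borel" by (simp add: L_def sets_lf Xt t)
    have sp: "space (L i t) = UNIV" using sets_eq_imp_space_eq[OF s] by simp
    have "emeasure (L i t) UNIV \<le> 1"
      using inverse_one_plus_ennreal(2)[of "emeasure (X t) (C i)"] fin[OF t, of i]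
      by (simp add: eL t c_def)
    then show "subprob_space (L i t)" by (intro subprob_spaceI) (auto simp: sp)
  next
    fix B :: "'a set" assume B[measurable]: "B \<in> sets borel"
    have "(\<lambda>t. c i t * emeasure (X t) (C i \<inter> B)) \<in> borel_measurable T" unfolding c_def by measurable
    then show "(\<lambda>t. emeasure (L i t) B) \<in> borel_measurable T"
      by (rule measurable_cong[THEN iffD2, rotated]) (simp add: eL)
  qed
  have "(\<lambda>t. SUP i. (1 + emeasure (X t) (C i)) * (\<integral>\<^sup>+ y. \<phi> t y \<partial>L i t)) \<in> borel_measurable T"
    using nn_integral_measurable_subprob_algebra2[OF \<phi> L] by measurable
  then show ?thesis
  proof (rule measurable_cong[THEN iffD2, rotated])
    fix t assume t: "t \<in> space T"
    have [measurable_cong]: "sets (X t) = sets borel" using sets_lf Xt t by auto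
    have [measurable]: "(\<lambda>y. \<phi> t y) \<in> borel_measurable borel" using t by measurable
    have "(1 + emeasure (X t) (C i)) * (\<integral>\<^sup>+ y. \<phi> t y \<partial>L i t) = (\<integral>\<^sup>+ y. \<phi> t y * indicator (C i) y \<partial>X t)" for i
    proof -
      have "(1 + emeasure (X t) (C i)) * c i t = 1"
        unfolding c_def using fin[OF t, of i] by (intro inverse_one_plus_ennreal(1)) simp
      then show ?thesis
        unfolding L_def restr_def
        by (simp add: nn_integral_scale_measure nn_integral_density mult.assoc[symmetric] mult.commute[of "indicator _ _"])
    qed
    then have "(SUP i. (1 + emeasure (X t) (C i)) * (\<integral>\<^sup>+ y. \<phi> t y \<partial>L i t))
      = (SUP i. \<integral>\<^sup>+ y. \<phi> t y * indicator (C i) y \<partial>X t)" by simp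
    also have "\<dots> = (\<integral>\<^sup>+ y. (SUP i. \<phi> t y * indicator (C i) y) \<partial>X t)"
      by (intro nn_integral_monotone_convergence_SUP[symmetric])
         (use C_inc in \<open>auto simp: incseq_def le_fun_def split: split_indicator\<close>)
    also have "\<dots> = (\<integral>\<^sup>+ y. \<phi> t y \<partial>X t)"
    proof (intro nn_integral_cong antisym SUP_least)
      fix y obtain i where "y \<in> C i" using C_UN by auto
      then show "\<phi> t y \<le> (SUP i. \<phi> t y * indicator (C i) y)"
        by (intro SUP_upper2[of i]) auto
    qed (auto split: split_indicator)
    finally show "(\<integral>\<^sup>+ y. \<phi> t y \<partial>X t) = (SUP i. (1 + emeasure (X t) (C i)) * (\<integral>\<^sup>+ y. \<phi> t y \<partial>L i t))" ..
  qed
qed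

end

section \<open>Sums over tuples of distinct indices\<close>

definition inj_tuples :: "nat \<Rightarrow> 'b set \<Rightarrow> (nat \<Rightarrow> 'b) set" where
  "inj_tuples k J = {i \<in> {..<k} \<rightarrow>\<^sub>E J. inj_on i {..<k}}"

definition tuple_cons :: "nat \<Rightarrow> 'b \<Rightarrow> (nat \<Rightarrow> 'b) \<Rightarrow> nat \<Rightarrow> 'b" where
  "tuple_cons k y w = (\<lambda>j\<in>{..<Suc k}. case j of 0 \<Rightarrow> y | Suc j' \<Rightarrow> w j')"

text \<open>
  The sums in the statement run over tuples of distinct indices, so a point of multiplicity
  \<open>n\<close> counts as \<open>n\<close> different points.
\<close>

definition tsum :: "nat \<Rightarrow> 'a measure \<Rightarrow> ((nat \<Rightarrow> 'a) \<Rightarrow> ennreal) \<Rightarrow> ennreal" where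
  "tsum k \<omega> \<phi> = (\<integral>\<^sup>+ i. \<phi> (pts k i) \<partial>count_space (distinct_indices k \<omega>))"

definition tuple_sym :: "nat \<Rightarrow> ((nat \<Rightarrow> 'a) \<Rightarrow> 'b) \<Rightarrow> bool" where
  "tuple_sym k \<phi> \<longleftrightarrow> (\<forall>\<pi> x. \<pi> permutes {..<k} \<longrightarrow> x \<in> extensional {..<k} \<longrightarrow> \<phi> (\<lambda>i. x (\<pi> i)) = \<phi> x)"

text \<open>
  Where \<open>y\<close> is not a point of \<open>\<omega>\<close> the subtraction would not be a measure, and \<open>\<omega>\<close> is left as
  it is.
\<close>

definition remove_point :: "'a::topological_space \<Rightarrow> 'a measure \<Rightarrow> 'a measure" where
  "remove_point y \<omega> = (if 1 \<le> emeasure \<omega> {y}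
     then measure_of UNIV (sets borel) (\<lambda>B. emeasure \<omega> B - indicator B y) else \<omega>)"

abbreviation dirac :: "'a::topological_space \<Rightarrow> 'a measure" where
  "dirac y \<equiv> dirac_sum (Suc 0) (\<lambda>_. y)"

lemma space_tuple_space: "space (tuple_space k) = extensional {..<k}"
  by (auto simp: tuple_space_def space_PiM PiE_def)

lemma distinct_indices_eq: "distinct_indices k \<omega> = inj_tuples k (point_indices \<omega>)"
  by (simp add: distinct_indices_def inj_tuples_def)

lemma pts_extensional: "pts k i \<in> extensional {..<k}"
  by (simp add: pts_def)

lemma tuple_cons_simps[simp]:
  "tuple_cons k y w 0 = y"
  "j < k \<Longrightarrow> tuple_cons k y w (Suc j) = w j"
  by (auto simp: tuple_cons_def)

lemma tuple_cons_extensional[simp]: "tuple_cons k y w \<in> extensional {..<Suc k}"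
  by (simp add: tuple_cons_def)

lemma pts_tuple_cons: "pts (Suc k) (tuple_cons k a i) = tuple_cons k (fst a) (pts k i)"
  by (auto simp: fun_eq_iff pts_def tuple_cons_def split: nat.split)

lemma nn_integral_Sigma_count_space:
  "(\<integral>\<^sup>+ z. f z \<partial>count_space (Sigma A B)) = (\<integral>\<^sup>+ a. \<integral>\<^sup>+ b. f (a, b) \<partial>count_space (B a) \<partial>count_space A)"
proof -
  have "(\<integral>\<^sup>+ z. f z \<partial>count_space (Sigma A B)) = (\<integral>\<^sup>+ z. f z * indicator (Sigma A B) z \<partial>count_space UNIV)"
    by (simp add: nn_integral_count_space_indicator)
  also have "\<dots> = (\<integral>\<^sup>+ a. \<integral>\<^sup>+ b. f (a, b) * indicator (Sigma A B) (a, b) \<partial>count_space UNIV \<partial>count_space UNIV)"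
    by (rule nn_integral_fst_count_space[symmetric])
  also have "\<dots> = (\<integral>\<^sup>+ a. (\<integral>\<^sup>+ b. f (a, b) * indicator (B a) b \<partial>count_space UNIV) * indicator A a \<partial>count_space UNIV)"
    by (intro nn_integral_cong) (auto split: split_indicator intro!: nn_integral_cong)
  finally show ?thesis by (simp add: nn_integral_count_space_indicator)
qed

lemma nn_integral_count_space_union:
  assumes "A \<inter> B = {}"
  shows "(\<integral>\<^sup>+ x. f x \<partial>count_space (A \<union> B)) = (\<integral>\<^sup>+ x. f x \<partial>count_space A) + (\<integral>\<^sup>+ x. f x \<partial>count_space B)"
  using nn_integral_disjoint_pair_countspace[OF assms, of f] by (simp add: nn_integral_count_space_indicator)

text \<open>
  Choosing an injective tuple amounts to choosing its first entry and then an injective tuple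
  that avoids it; all recursions in the length of a tuple rest on this.
\<close>

lemma tuple_cons_bij:
  "bij_betw (\<lambda>(a, i). tuple_cons k a i) (SIGMA a:J. inj_tuples k (J - {a})) (inj_tuples (Suc k) J)"
proof (rule bij_betw_byWitness[where f' = "\<lambda>i. (i 0, \<lambda>j\<in>{..<k}. i (Suc j))"])
  show "\<forall>z\<in>SIGMA a:J. inj_tuples k (J - {a}). (\<lambda>i. (i 0, \<lambda>j\<in>{..<k}. i (Suc j))) ((\<lambda>(a, i). tuple_cons k a i) z) = z"
    by (auto simp: inj_tuples_def PiE_iff extensional_def fun_eq_iff)
  show "\<forall>i\<in>inj_tuples (Suc k) J. (\<lambda>(a, i). tuple_cons k a i) ((\<lambda>i. (i 0, \<lambda>j\<in>{..<k}. i (Suc j))) i) = i"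
    by (auto simp: inj_tuples_def PiE_iff extensional_def fun_eq_iff tuple_cons_def split: nat.split)
  show "(\<lambda>(a, i). tuple_cons k a i) ` (SIGMA a:J. inj_tuples k (J - {a})) \<subseteq> inj_tuples (Suc k) J"
  proof safe
    fix a i assume a: "a \<in> J" and i: "i \<in> inj_tuples k (J - {a})"
    have i': "i j \<in> J" "i j \<noteq> a" if "j < k" for j using i that by (auto simp: inj_tuples_def PiE_iff)
    have "tuple_cons k a i j \<in> J" if "j < Suc k" for j
      using that i' a by (cases j) auto
    moreover have "inj_on (tuple_cons k a i) {..<Suc k}"
    proof (rule inj_onI)
      fix j l assume *: "j \<in> {..<Suc k}" "l \<in> {..<Suc k}" "tuple_cons k a i j = tuple_cons k a i l"
      show "j = l"
        using * i i'  by (cases j; cases l) (auto simp: inj_tuples_def dest: inj_onD)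
    qed
    ultimately show "tuple_cons k a i \<in> inj_tuples (Suc k) J" by (auto simp: inj_tuples_def PiE_iff)
  qed
  show "(\<lambda>i. (i 0, \<lambda>j\<in>{..<k}. i (Suc j))) ` inj_tuples (Suc k) J \<subseteq> (SIGMA a:J. inj_tuples k (J - {a}))"
  proof (rule image_subsetI)
    fix i assume i: "i \<in> inj_tuples (Suc k) J"
    then have inj: "inj_on i {..<Suc k}" and J: "\<And>j. j < Suc k \<Longrightarrow> i j \<in> J"
      by (auto simp: inj_tuples_def PiE_iff)
    have "i (Suc j) \<noteq> i 0" if "j < k" for j using inj_onD[OF inj, of "Suc j" 0] that by auto
    moreover have "inj_on (\<lambda>j\<in>{..<k}. i (Suc j)) {..<k}"
      by (rule inj_onI) (use inj_onD[OF inj] in fastforce)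
    ultimately show "(i 0, \<lambda>j\<in>{..<k}. i (Suc j)) \<in> (SIGMA a:J. inj_tuples k (J - {a}))"
      using J by (auto simp: inj_tuples_def)
  qed
qed

lemma inj_tuples_map_bij:
  assumes "bij_betw \<tau> J J'"
  shows "bij_betw (\<lambda>i. \<lambda>l\<in>{..<k}. \<tau> (i l)) (inj_tuples k J) (inj_tuples k J')"
proof (rule bij_betw_byWitness[where f' = "\<lambda>i. \<lambda>l\<in>{..<k}. inv_into J \<tau> (i l)"])
  have inv: "inv_into J \<tau> (\<tau> a) = a" if "a \<in> J" for a
    using assms that by (simp add: bij_betw_inv_into_left)
  have inv': "\<tau> (inv_into J \<tau> a) = a" "inv_into J \<tau> a \<in> J" if "a \<in> J'" for a
    using assms that by (auto simp: bij_betw_inv_into_right bij_betw_imp_surj_on intro: inv_into_into)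
  show "\<forall>i\<in>inj_tuples k J. (\<lambda>l\<in>{..<k}. inv_into J \<tau> ((\<lambda>l\<in>{..<k}. \<tau> (i l)) l)) = i"
    by (auto simp: inj_tuples_def PiE_iff fun_eq_iff inv extensional_def)
  show "\<forall>i\<in>inj_tuples k J'. (\<lambda>l\<in>{..<k}. \<tau> ((\<lambda>l\<in>{..<k}. inv_into J \<tau> (i l)) l)) = i"
    by (auto simp: inj_tuples_def PiE_iff fun_eq_iff inv' extensional_def)
  show "(\<lambda>i. \<lambda>l\<in>{..<k}. \<tau> (i l)) ` inj_tuples k J \<subseteq> inj_tuples k J'"
    using assms by (auto simp: inj_tuples_def PiE_iff bij_betw_def inj_on_def)
  show "(\<lambda>i. \<lambda>l\<in>{..<k}. inv_into J \<tau> (i l)) ` inj_tuples k J' \<subseteq> inj_tuples k J"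
    by (auto simp: inj_tuples_def PiE_iff inv' inj_on_def) (metis inv'(1) lessThan_iff)
qed

lemma inj_tuples_permute_bij:
  assumes \<pi>: "\<pi> permutes {..<k}"
  shows "bij_betw (\<lambda>i l. i (\<pi> l)) (inj_tuples k J) (inj_tuples k J)"
proof (rule bij_betw_byWitness[where f' = "\<lambda>i l. i (inv \<pi> l)"])
  have *: "(\<lambda>l. i (\<rho> l)) \<in> inj_tuples k J" if "\<rho> permutes {..<k}" "i \<in> inj_tuples k J" for \<rho> i
  proof -
    have "inj_on (i \<circ> \<rho>) {..<k}"
      using that by (intro comp_inj_on) (auto simp: inj_tuples_def permutes_image permutes_inj_on)
    then show ?thesis
      using that permutes_in_image[OF that(1)] permutes_not_in[OF that(1)]
      by (auto simp: inj_tuples_def PiE_iff extensional_def o_def)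
  qed
  show "(\<lambda>i l. i (\<pi> l)) ` inj_tuples k J \<subseteq> inj_tuples k J" using *[OF \<pi>] by auto
  show "(\<lambda>i l. i (inv \<pi> l)) ` inj_tuples k J \<subseteq> inj_tuples k J" using *[OF permutes_inv[OF \<pi>]] by auto
qed (auto simp: fun_eq_iff permutes_inverses[OF \<pi>])

lemma pts_permute: "\<pi> permutes {..<k} \<Longrightarrow> pts k (\<lambda>l. i (\<pi> l)) = (\<lambda>l. pts k i (\<pi> l))"
  using permutes_in_image[of \<pi> "{..<k}"] permutes_not_in[of \<pi> "{..<k}"]
  by (auto simp: pts_def fun_eq_iff)

lemma counting_singletonE:
  fixes \<omega> :: "'a::{second_countable_topology, t2_space} measure"
  assumes "\<omega> \<in> counting_measures"
  obtains n :: nat where "emeasure \<omega> {x} = of_nat n"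
  using counting_singleton[OF assms] by blast

lemma nn_integral_counting:
  fixes \<omega> :: "'a::{second_countable_topology, t2_space} measure"
  assumes "\<omega> \<in> counting_measures" "f \<in> borel_measurable borel"
  shows "(\<integral>\<^sup>+ y. f y \<partial>\<omega>) = (\<integral>\<^sup>+ a. f (fst a) \<partial>count_space (point_indices \<omega>))"
  by (subst counting_measure_eq_dirac_sum[OF assms(1)]) (use assms(2) in \<open>auto simp: nn_integral_distr\<close>)

lemma emeasure_counting:
  fixes \<omega> :: "'a::{second_countable_topology, t2_space} measure"
  assumes "\<omega> \<in> counting_measures" "B \<in> sets borel"
  shows "emeasure \<omega> B = (\<integral>\<^sup>+ a. indicator B (fst a) \<partial>count_space (point_indices \<omega>))"
  using nn_integral_counting[OF assms(1), of "indicator B"] assms by (simp add: sets_counting)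

text \<open>In the representation of \<open>\<omega>\<close> as a sum of Dirac measures, leave out one index of \<open>y\<close>.\<close>

lemma counting_decompose:
  fixes \<omega> :: "'a::{second_countable_topology, t2_space} measure"
  assumes w: "\<omega> \<in> counting_measures" and y: "1 \<le> emeasure \<omega> {y}"
  obtains \<nu> where "\<nu> \<in> counting_measures" "\<omega> = add_measure \<nu> (dirac y)"
proof -
  let ?J = "point_indices \<omega>"
  define \<nu> where "\<nu> = distr (count_space (?J - {(y, 0)})) borel fst"
  have y0: "(y, 0) \<in> ?J"
    using less_le_trans[of 0 1 "emeasure \<omega> {y}"] y by (simp add: point_indices_def)
  have e\<nu>: "emeasure \<nu> B = (\<integral>\<^sup>+ a. indicator B (fst a) \<partial>count_space (?J - {(y, 0)}))" if "B \<in> sets borel" for B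
    using that unfolding \<nu>_def by (simp add: nn_integral_distr flip: nn_integral_indicator)
  have sum: "emeasure \<omega> B = emeasure \<nu> B + indicator B y" if B: "B \<in> sets borel" for B
  proof -
    have "emeasure \<omega> B = (\<integral>\<^sup>+ a. indicator B (fst a) \<partial>count_space ((?J - {(y, 0)}) \<union> {(y, 0)}))"
      using y0 by (subst emeasure_counting[OF w B]) (simp add: insert_absorb)
    also have "\<dots> = emeasure \<nu> B + indicator B y"
      by (subst nn_integral_count_space_union) (auto simp: e\<nu> B nn_integral_count_space_finite)
    finally show ?thesis .
  qed
  have "\<nu> \<in> counting_measures"
  proof (rule counting_dominated[OF w])
    show "emeasure \<nu> B = \<infinity> \<or> (\<exists>n::nat. emeasure \<nu> B = of_nat n)" if "B \<in> sets borel" for B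
      using that unfolding \<nu>_def by (auto simp: emeasure_distr emeasure_count_space)
  qed (auto simp: sum \<nu>_def)
  moreover have "\<omega> = add_measure \<nu> (dirac y)"
    by (rule measure_eq_borelI)
       (auto simp: sets_counting w \<nu>_def emeasure_add_measure sum emeasure_dirac_sum)
  ultimately show thesis by (rule that)
qed

lemma remove_point_add_dirac:
  fixes \<nu> :: "'a::{second_countable_topology, t2_space} measure"
  assumes "\<nu> \<in> counting_measures"
  shows "remove_point y (add_measure \<nu> (dirac y)) = \<nu>"
proof -
  have s: "sets \<nu> = sets borel" "space \<nu> = UNIV" by (auto simp: sets_counting space_counting assms)
  have e: "emeasure (add_measure \<nu> (dirac y)) B = emeasure \<nu> B + indicator B y" if "B \<in> sets borel" for B
    using that by (simp add: emeasure_add_measure s emeasure_dirac_sum)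
  have "measure_of UNIV (sets borel) (\<lambda>B. emeasure (add_measure \<nu> (dirac y)) B - indicator B y)
    = measure_of UNIV (sets borel) (emeasure \<nu>)"
    by (rule measure_of_eq) (auto simp: e sets.sigma_sets_eq[of borel, simplified] split: split_indicator)
  also have "\<dots> = \<nu>" using measure_of_of_measure[of \<nu>] by (simp add: s)
  finally show ?thesis by (simp add: remove_point_def e)
qed

text \<open>
  The additional copy of \<open>y\<close> takes the first free index, which is the old multiplicity.
\<close>

lemma point_indices_add_dirac:
  fixes \<nu> :: "'a::{second_countable_topology, t2_space} measure"
  assumes "\<nu> \<in> counting_measures" "emeasure \<nu> {y} = of_nat n"
  shows "point_indices (add_measure \<nu> (dirac y)) = insert (y, n) (point_indices \<nu>)"
    and "(y, n) \<notin> point_indices \<nu>"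
proof -
  have e: "emeasure (add_measure \<nu> (dirac y)) {x} = emeasure \<nu> {x} + indicator {x} y" for x
    by (simp add: emeasure_add_measure sets_counting assms emeasure_dirac_sum)
  have "((of_nat j::ennreal) < of_nat n + 1) \<longleftrightarrow> j = n \<or> (of_nat j::ennreal) < of_nat n" for j :: nat
    by (metis Suc_eq_plus1 less_Suc_eq of_nat_1 of_nat_add of_nat_less_iff)
  then show "point_indices (add_measure \<nu> (dirac y)) = insert (y, n) (point_indices \<nu>)"
    by (auto simp: point_indices_def e assms(2) split: split_indicator split_indicator_asm)
  show "(y, n) \<notin> point_indices \<nu>" by (simp add: point_indices_def assms(2))
qed

lemma nn_integral_tuple_transport:
  assumes "bij_betw \<tau> J J'" "\<And>a. a \<in> J \<Longrightarrow> fst (\<tau> a) = fst a"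
  shows "(\<integral>\<^sup>+ i. \<phi> (pts k i) \<partial>count_space (inj_tuples k J)) = (\<integral>\<^sup>+ i. \<phi> (pts k i) \<partial>count_space (inj_tuples k J'))"
proof -
  have "(\<integral>\<^sup>+ i. \<phi> (pts k i) \<partial>count_space (inj_tuples k J'))
    = (\<integral>\<^sup>+ i. \<phi> (pts k (\<lambda>l\<in>{..<k}. \<tau> (i l))) \<partial>count_space (inj_tuples k J))"
    by (rule nn_integral_bij_count_space[OF inj_tuples_map_bij[OF assms(1)], symmetric])
  also have "\<dots> = (\<integral>\<^sup>+ i. \<phi> (pts k i) \<partial>count_space (inj_tuples k J))"
  proof (rule nn_integral_cong, rule arg_cong[of _ _ \<phi>])
    fix i assume "i \<in> space (count_space (inj_tuples k J))"
    then show "pts k (\<lambda>l\<in>{..<k}. \<tau> (i l)) = pts k i"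
      using assms(2) by (auto simp: pts_def fun_eq_iff inj_tuples_def PiE_iff)
  qed
  finally show ?thesis ..
qed

text \<open>
  Removing a point frees its last index rather than the given index \<open>a\<close>; the two belong to the
  same point, so exchanging them does not change the sum.
\<close>

lemma tsum_remove_point:
  fixes \<omega> :: "'a::{second_countable_topology, t2_space} measure"
  assumes w: "\<omega> \<in> counting_measures" and a: "a \<in> point_indices \<omega>"
  shows "tsum k (remove_point (fst a) \<omega>) \<phi>
    = (\<integral>\<^sup>+ i. \<phi> (pts k i) \<partial>count_space (inj_tuples k (point_indices \<omega> - {a})))"
proof -
  obtain y j where aj: "a = (y, j)" by (cases a)
  obtain n :: nat where n: "emeasure \<omega> {y} = of_nat n" by (rule counting_singletonE[OF w])
  have jn: "j < n" using a by (simp add: aj point_indices_def n)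
  then have "of_nat 1 \<le> (of_nat n :: ennreal)" by (subst of_nat_le_iff) auto
  then obtain \<nu> where \<nu>: "\<nu> \<in> counting_measures" "\<omega> = add_measure \<nu> (dirac y)"
    using counting_decompose[OF w, of y] n by auto
  obtain m :: nat where m: "emeasure \<nu> {y} = of_nat m" by (rule counting_singletonE[OF \<nu>(1)])
  have pi: "point_indices \<omega> = insert (y, m) (point_indices \<nu>)" "(y, m) \<notin> point_indices \<nu>"
    using point_indices_add_dirac[OF \<nu>(1) m] by (simp_all add: \<nu>(2))
  then have J\<nu>: "point_indices \<nu> = point_indices \<omega> - {(y, m)}" by auto
  let ?\<tau> = "Transposition.transpose a (y, m)"
  have "bij_betw ?\<tau> (point_indices \<omega> - {a}) (?\<tau> ` (point_indices \<omega> - {a}))"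
    by (intro inj_on_imp_bij_betw inj_on_subset[OF inj_swap]) (auto intro: inj_transpose)
  moreover have "?\<tau> ` (point_indices \<omega> - {a}) = point_indices \<omega> - {(y, m)}"
  proof -
    have "?\<tau> ` point_indices \<omega> = point_indices \<omega>" using a pi by (intro transpose_image_eq) auto
    then show ?thesis by (subst image_set_diff) auto
  qed
  ultimately have bij: "bij_betw ?\<tau> (point_indices \<omega> - {a}) (point_indices \<nu>)" by (simp add: J\<nu>)
  have fst\<tau>: "fst (?\<tau> b) = fst b" for b by (cases "b = a"; cases "b = (y, m)") (auto simp: aj)
  have "remove_point (fst a) \<omega> = \<nu>" using remove_point_add_dirac[OF \<nu>(1)] by (simp add: \<nu>(2) aj)
  then show ?thesis
    unfolding tsum_def distinct_indices_eq
    using nn_integral_tuple_transport[OF bij fst\<tau>, of k \<phi>] by simp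
qed

lemma tsum_Suc_indices:
  fixes \<omega> :: "'a::{second_countable_topology, t2_space} measure"
  assumes w: "\<omega> \<in> counting_measures"
  shows "tsum (Suc k) \<omega> \<phi> =
    (\<integral>\<^sup>+ a. tsum k (remove_point (fst a) \<omega>) (\<lambda>w. \<phi> (tuple_cons k (fst a) w)) \<partial>count_space (point_indices \<omega>))"
proof -
  let ?J = "point_indices \<omega>"
  have "tsum (Suc k) \<omega> \<phi> = (\<integral>\<^sup>+ z. \<phi> (pts (Suc k) ((\<lambda>(a, i). tuple_cons k a i) z))
      \<partial>count_space (SIGMA a:?J. inj_tuples k (?J - {a})))"
    unfolding tsum_def distinct_indices_eq by (rule nn_integral_bij_count_space[OF tuple_cons_bij, symmetric])
  also have "\<dots> = (\<integral>\<^sup>+ a. \<integral>\<^sup>+ i. \<phi> (tuple_cons k (fst a) (pts k i)) \<partial>count_space (inj_tuples k (?J - {a})) \<partial>count_space ?J)"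
    by (subst nn_integral_Sigma_count_space) (simp add: pts_tuple_cons)
  also have "\<dots> = (\<integral>\<^sup>+ a. tsum k (remove_point (fst a) \<omega>) (\<lambda>w. \<phi> (tuple_cons k (fst a) w)) \<partial>count_space ?J)"
    by (intro nn_integral_cong) (simp add: tsum_remove_point[OF w])
  finally show ?thesis .
qed

lemma tsum_add: "tsum k \<omega> (\<lambda>x. \<phi> x + \<psi> x) = tsum k \<omega> \<phi> + tsum k \<omega> \<psi>"
  unfolding tsum_def by (rule nn_integral_add) auto

lemma tsum_cmult: "tsum k \<omega> (\<lambda>x. c * \<phi> x) = c * tsum k \<omega> \<phi>"
  unfolding tsum_def by (rule nn_integral_cmult) auto

lemma tsum_mono: "(\<And>x. x \<in> distinct_tuples k \<omega> \<Longrightarrow> \<phi> x \<le> \<psi> x) \<Longrightarrow> tsum k \<omega> \<phi> \<le> tsum k \<omega> \<psi>"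
  unfolding tsum_def by (intro nn_integral_mono) (auto simp: distinct_tuples_def)

lemma tsum_cong: "(\<And>x. x \<in> distinct_tuples k \<omega> \<Longrightarrow> \<phi> x = \<psi> x) \<Longrightarrow> tsum k \<omega> \<phi> = tsum k \<omega> \<psi>"
  unfolding tsum_def by (intro nn_integral_cong) (auto simp: distinct_tuples_def)

lemma distinct_tuples_extensional: "x \<in> distinct_tuples k \<omega> \<Longrightarrow> x \<in> extensional {..<k}"
  by (auto simp: distinct_tuples_def pts_extensional)

lemma tsum_zero[simp]: "tsum 0 \<omega> \<phi> = \<phi> (\<lambda>_. undefined)"
  unfolding tsum_def distinct_indices_eq
  by (simp add: inj_tuples_def pts_def nn_integral_count_space_finite)

text \<open>
  A tuple with distinct indices uses the new index at most once, at one of \<open>Suc k\<close> places, and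
  by symmetry every place contributes as much as the first one.
\<close>

lemma tsum_add_dirac:
  fixes \<omega> :: "'a::{second_countable_topology, t2_space} measure"
  assumes w: "\<omega> \<in> counting_measures" and sym: "tuple_sym (Suc k) \<phi>"
  shows "tsum (Suc k) (add_measure \<omega> (dirac y)) \<phi>
    = tsum (Suc k) \<omega> \<phi> + of_nat (Suc k) * tsum k \<omega> (\<lambda>w. \<phi> (tuple_cons k y w))"
proof -
  obtain n :: nat where n: "emeasure \<omega> {y} = of_nat n" by (rule counting_singletonE[OF w])
  define J where "J = point_indices \<omega>"
  define a where "a = (y, n)"
  have J': "point_indices (add_measure \<omega> (dirac y)) = insert a J" and aJ: "a \<notin> J"
    using point_indices_add_dirac[OF w n] by (auto simp: J_def a_def)
  define D where "D = inj_tuples (Suc k) (insert a J)"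
  define E where "E l = {i \<in> D. i l = a}" for l
  let ?\<psi> = "\<lambda>i. \<phi> (pts (Suc k) i)"
  have DJ: "inj_tuples (Suc k) J \<subseteq> D" by (auto simp: D_def inj_tuples_def PiE_iff)
  have split: "indicator D i = (indicator (inj_tuples (Suc k) J) i + (\<Sum>l<Suc k. indicator (E l) i) :: ennreal)" for i
  proof (cases "i \<in> D")
    case False
    then have "indicator (E l) i = (0::ennreal)" for l by (simp add: E_def)
    then show ?thesis using False DJ by (auto simp: indicator_def)
  next
    case True
    show ?thesis
    proof (cases "\<exists>l<Suc k. i l = a")
      case False
      then have "i \<in> inj_tuples (Suc k) J" using True by (auto simp: D_def inj_tuples_def PiE_iff)
      moreover have "(\<Sum>l<Suc k. indicator (E l) i) = (0::ennreal)"
        using False by (intro sum.neutral) (auto simp: E_def)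
      ultimately show ?thesis using True by simp
    next
      case ex: True
      then obtain l where l: "l < Suc k" "i l = a" by blast
      then have "i \<notin> inj_tuples (Suc k) J" using aJ by (auto simp: inj_tuples_def PiE_iff)
      moreover have "indicator (E j) i = (if j = l then 1 else 0::ennreal)" if "j < Suc k" for j
        using True l that by (auto simp: E_def D_def inj_tuples_def indicator_def dest: inj_onD)
      then have "(\<Sum>j<Suc k. indicator (E j) i) = (\<Sum>j<Suc k. if j = l then 1 else 0::ennreal)"
        by (intro sum.cong) auto
      ultimately show ?thesis using True l by simp
    qed
  qed
  have E0: "(\<integral>\<^sup>+ i. ?\<psi> i \<partial>count_space (E 0)) = tsum k \<omega> (\<lambda>w. \<phi> (tuple_cons k y w))"
  proof -
    have "bij_betw (\<lambda>(a, i). tuple_cons k a i) ({a} \<times> inj_tuples k J) (E 0)"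
    proof -
      let ?S = "SIGMA b:insert a J. inj_tuples k (insert a J - {b})"
      let ?f = "\<lambda>(a, i). tuple_cons k a i"
      have sub: "{a} \<times> inj_tuples k J \<subseteq> ?S" using aJ by auto
      have im: "?f ` ?S = D" using tuple_cons_bij[of k "insert a J"] by (simp add: bij_betw_def D_def)
      have "?f ` ({a} \<times> inj_tuples k J) = E 0"
      proof
        show "?f ` ({a} \<times> inj_tuples k J) \<subseteq> E 0" using im sub by (fastforce simp: E_def)
        show "E 0 \<subseteq> ?f ` ({a} \<times> inj_tuples k J)"
        proof
          fix i assume i: "i \<in> E 0"
          then have "i \<in> ?f ` ?S" by (simp add: im E_def)
          then obtain b w where bw: "i = tuple_cons k b w" "w \<in> inj_tuples k (insert a J - {b})" by auto
          then have "b = a" using i by (simp add: E_def)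
          then show "i \<in> ?f ` ({a} \<times> inj_tuples k J)" using bw aJ by auto
        qed
      qed
      then show ?thesis using bij_betw_subset[OF tuple_cons_bij sub] by simp
    qed
    from nn_integral_bij_count_space[OF this, of ?\<psi>, symmetric]
    show ?thesis
      by (simp add: nn_integral_Sigma_count_space nn_integral_count_space_finite pts_tuple_cons
         tsum_def distinct_indices_eq J_def a_def)
  qed
  have El: "(\<integral>\<^sup>+ i. ?\<psi> i \<partial>count_space (E l)) = (\<integral>\<^sup>+ i. ?\<psi> i \<partial>count_space (E 0))" if l: "l < Suc k" for l
  proof -
    let ?\<pi> = "Transposition.transpose 0 l"
    have \<pi>: "?\<pi> permutes {..<Suc k}" using l by (intro permutes_swap_id) auto
    let ?r = "\<lambda>i j. i (?\<pi> j)"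
    have b: "bij_betw ?r D D" unfolding D_def by (rule inj_tuples_permute_bij[OF \<pi>])
    have rD: "?r i \<in> D" if "i \<in> D" for i using bij_betwE[OF b] that by blast
    have rE: "?r i \<in> E l" if "i \<in> E 0" for i using rD[of i] that by (simp add: E_def)
    have rE': "?r i \<in> E 0" if "i \<in> E l" for i using rD[of i] that by (simp add: E_def)
    have "?r ` E 0 = E l"
    proof
      show "?r ` E 0 \<subseteq> E l" using rE by blast
      show "E l \<subseteq> ?r ` E 0"
      proof
        fix i assume i: "i \<in> E l"
        show "i \<in> ?r ` E 0" by (rule image_eqI[of _ _ "?r i"]) (use rE'[OF i] in simp_all)
      qed
    qed
    then have bE: "bij_betw ?r (E 0) (E l)"
      using b inj_on_subset[of ?r D "E 0"] by (simp add: bij_betw_def E_def)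
    have "?\<psi> (?r i) = ?\<psi> i" for i
      using sym \<pi> pts_extensional[of "Suc k" i] unfolding tuple_sym_def by (simp add: pts_permute)
    then show ?thesis
      using nn_integral_bij_count_space[OF bE, of ?\<psi>] by simp
  qed
  have "tsum (Suc k) (add_measure \<omega> (dirac y)) \<phi> = (\<integral>\<^sup>+ i. ?\<psi> i * indicator D i \<partial>count_space UNIV)"
    by (simp add: tsum_def distinct_indices_eq J' D_def nn_integral_count_space_indicator)
  also have "\<dots> = (\<integral>\<^sup>+ i. ?\<psi> i * indicator (inj_tuples (Suc k) J) i \<partial>count_space UNIV)
     + (\<Sum>l<Suc k. \<integral>\<^sup>+ i. ?\<psi> i * indicator (E l) i \<partial>count_space UNIV)"
  proof -
    have "(\<integral>\<^sup>+ i. ?\<psi> i * indicator D i \<partial>count_space UNIV)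
      = (\<integral>\<^sup>+ i. ?\<psi> i * indicator (inj_tuples (Suc k) J) i + (\<Sum>l<Suc k. ?\<psi> i * indicator (E l) i) \<partial>count_space UNIV)"
      by (simp only: split distrib_left sum_distrib_left)
    also have "\<dots> = (\<integral>\<^sup>+ i. ?\<psi> i * indicator (inj_tuples (Suc k) J) i \<partial>count_space UNIV)
      + (\<integral>\<^sup>+ i. (\<Sum>l<Suc k. ?\<psi> i * indicator (E l) i) \<partial>count_space UNIV)"
      by (rule nn_integral_add) auto
    also have "(\<integral>\<^sup>+ i. (\<Sum>l<Suc k. ?\<psi> i * indicator (E l) i) \<partial>count_space UNIV)
      = (\<Sum>l<Suc k. \<integral>\<^sup>+ i. ?\<psi> i * indicator (E l) i \<partial>count_space UNIV)"
      by (rule nn_integral_sum) auto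
    finally show ?thesis .
  qed
  also have "(\<integral>\<^sup>+ i. ?\<psi> i * indicator (inj_tuples (Suc k) J) i \<partial>count_space UNIV) = tsum (Suc k) \<omega> \<phi>"
    by (simp add: tsum_def distinct_indices_eq J_def nn_integral_count_space_indicator)
  also have "(\<Sum>l<Suc k. \<integral>\<^sup>+ i. ?\<psi> i * indicator (E l) i \<partial>count_space UNIV)
    = (\<Sum>l<Suc k. tsum k \<omega> (\<lambda>w. \<phi> (tuple_cons k y w)))"
  proof (rule sum.cong)
    fix l assume "l \<in> {..<Suc k}"
    then show "(\<integral>\<^sup>+ i. ?\<psi> i * indicator (E l) i \<partial>count_space UNIV) = tsum k \<omega> (\<lambda>w. \<phi> (tuple_cons k y w))"
      using El[of l] E0 by (simp add: nn_integral_count_space_indicator)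
  qed simp
  finally show ?thesis by simp
qed

lemma tuple_symD: "tuple_sym k \<phi> \<Longrightarrow> \<pi> permutes {..<k} \<Longrightarrow> x \<in> extensional {..<k} \<Longrightarrow> \<phi> (\<lambda>i. x (\<pi> i)) = \<phi> x"
  by (simp add: tuple_sym_def)

lemma combine_tuple_extensional[simp]: "combine_tuple k I x w \<in> extensional {..<k}"
  by (simp add: combine_tuple_def)

lemma tuple_sym_combine:
  assumes sym: "tuple_sym k \<phi>" and I: "card I \<le> k"
  shows "tuple_sym (k - card I) (\<lambda>w. \<phi> (combine_tuple k I x w))"
  unfolding tuple_sym_def
proof (intro allI impI)
  fix \<pi> :: "nat \<Rightarrow> nat" and w :: "nat \<Rightarrow> 'a"
  assume \<pi>: "\<pi> permutes {..<k - card I}" and w: "w \<in> extensional {..<k - card I}"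
  let ?c = "card I"
  define \<sigma> where "\<sigma> \<rho> j = (if j < ?c then j else if j < k then ?c + \<rho> (j - ?c) else j)" for \<rho> :: "nat \<Rightarrow> nat" and j
  have in_range: "\<rho> (j - ?c) < k - ?c" if "\<rho> permutes {..<k - ?c}" "?c \<le> j" "j < k" for \<rho> j
    using permutes_in_image[OF that(1), of "j - ?c"] that by auto
  have \<sigma>in: "\<sigma> \<rho> j < k" if "\<rho> permutes {..<k - ?c}" "j < k" for \<rho> j
    using in_range[OF that(1), of j] that I unfolding \<sigma>_def by auto
  have \<sigma>inv: "\<sigma> \<rho> (\<sigma> \<rho>' j) = j" if "\<rho> permutes {..<k - ?c}" "\<rho>' permutes {..<k - ?c}" "j < k"
    "\<And>i. \<rho> (\<rho>' i) = i" for \<rho> \<rho>' j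
    using in_range[OF that(2), of j] that unfolding \<sigma>_def by auto
  have "bij_betw (\<sigma> \<pi>) {..<k} {..<k}"
    using \<sigma>in[OF \<pi>] \<sigma>in[OF permutes_inv[OF \<pi>]] \<sigma>inv[OF \<pi> permutes_inv[OF \<pi>]] \<sigma>inv[OF permutes_inv[OF \<pi>] \<pi>]
      permutes_inverses[OF \<pi>]
    by (intro bij_betw_byWitness[where f' = "\<sigma> (inv \<pi>)"]) auto
  then have perm: "\<sigma> \<pi> permutes {..<k}" by (rule bij_imp_permutes) (simp add: \<sigma>_def)
  have "combine_tuple k I x (\<lambda>i. w (\<pi> i)) = (\<lambda>i. combine_tuple k I x w (\<sigma> \<pi> i))"
    using \<sigma>in[OF \<pi>] by (auto simp: fun_eq_iff combine_tuple_def \<sigma>_def)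
  then show "\<phi> (combine_tuple k I x (\<lambda>i. w (\<pi> i))) = \<phi> (combine_tuple k I x w)"
    using tuple_symD[OF sym perm, of "combine_tuple k I x w"] by simp
qed

lemma sorted_list_of_set_snoc:
  assumes "I \<subseteq> {..<m::nat}"
  shows "sorted_list_of_set (insert m I) = sorted_list_of_set I @ [m]"
proof -
  have fin: "finite I" using assms finite_subset by blast
  have "sorted (sorted_list_of_set I @ [m])"
    using fin assms by (auto simp: sorted_append less_imp_le)
  moreover have "distinct (sorted_list_of_set I @ [m])" using fin assms by auto
  moreover have "set (sorted_list_of_set I @ [m]) = insert m I" using fin by auto
  ultimately show ?thesis
    by (metis sorted_list_of_set.idem_if_sorted_distinct)
qed

text \<open>
  If the new index \<open>m\<close> exceeds all indices in \<open>I\<close>, its point is the last one taken from \<open>x\<close>.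
\<close>

lemma combine_tuple_insert:
  assumes I: "I \<subseteq> {..<m}" and c: "Suc (card I) \<le> k"
  shows "combine_tuple k (insert m I) x w = combine_tuple k I x (tuple_cons (k - Suc (card I)) (x m) w)"
proof -
  have fin: "finite I" using I finite_subset by blast
  have mI: "m \<notin> I" using I by auto
  have len: "length (sorted_list_of_set I) = card I" by simp
  show ?thesis
    unfolding fun_eq_iff
  proof
    fix j show "combine_tuple k (insert m I) x w j = combine_tuple k I x (tuple_cons (k - Suc (card I)) (x m) w) j"
    proof (cases "j < card I \<or> j = card I \<or> k \<le> j")
      case True
      then show ?thesis
        using fin mI c by (auto simp: combine_tuple_def sorted_list_of_set_snoc[OF I] nth_append)
    next
      case False
      then obtain i where i: "j - card I = Suc i" by (metis Suc_diff_Suc linorder_neqE_nat)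
      then have "j - Suc (card I) = i" "i < k - Suc (card I)" using False by auto
      then show ?thesis using False fin mI i by (auto simp: combine_tuple_def)
    qed
  qed
qed

text \<open>
  A tuple in the enlarged configuration is determined up to order by the set \<open>I\<close> of added
  points that it uses and by its remaining points. The factorials count the orders, which
  makes all terms have coefficient one and allows an induction that adds one point at a time
  by \<open>tsum_add_dirac\<close>.
\<close>

lemma tsum_add_dirac_sum:
  fixes \<omega> :: "'a::{second_countable_topology, t2_space} measure"
  assumes w: "\<omega> \<in> counting_measures" and sym: "tuple_sym k \<phi>"
  shows "ennreal (1 / fact k) * tsum k (add_measure \<omega> (dirac_sum m x)) \<phi>
    = (\<Sum>I\<in>Pow {..<m}. if card I \<le> k
        then ennreal (1 / fact (k - card I)) * tsum (k - card I) \<omega> (\<lambda>w. \<phi> (combine_tuple k I x w)) else 0)"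
  using w
proof (induction m arbitrary: \<omega>)
  case 0
  have *: "add_measure \<omega> (dirac_sum 0 x) = \<omega>"
    by (rule measure_eq_borelI) (auto simp: sets_counting[OF 0] emeasure_add_measure emeasure_dirac_sum)
  have "tsum k \<omega> \<phi> = tsum k \<omega> (\<lambda>w. \<phi> (combine_tuple k {} x w))"
  proof (rule tsum_cong, rule arg_cong[of _ _ \<phi>])
    fix w assume "w \<in> distinct_tuples k \<omega>"
    from distinct_tuples_extensional[OF this]
    show "w = combine_tuple k {} x w" by (auto simp: combine_tuple_def fun_eq_iff extensional_def)
  qed
  then show ?case by (simp add: *)
next
  case (Suc m)
  let ?\<omega>' = "add_measure \<omega> (dirac (x m))"
  define c where "c j = ennreal (1 / fact j)" for j
  define F where "F I \<omega> = (if card I \<le> k then c (k - card I) * tsum (k - card I) \<omega> (\<lambda>w. \<phi> (combine_tuple k I x w)) else 0)"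
    for I and \<omega> :: "'a measure"
  have "add_measure \<omega> (dirac_sum (Suc m) x) = add_measure ?\<omega>' (dirac_sum m x)"
    by (rule measure_eq_borelI)
       (auto simp: sets_counting[OF Suc.prems] emeasure_add_measure emeasure_dirac_sum add_ac)
  then have "c k * tsum k (add_measure \<omega> (dirac_sum (Suc m) x)) \<phi> = (\<Sum>I\<in>Pow {..<m}. F I ?\<omega>')"
    using Suc.IH[OF counting_add_dirac[OF Suc.prems]] unfolding c_def F_def by simp
  also have "\<dots> = (\<Sum>I\<in>Pow {..<m}. F I \<omega> + F (insert m I) \<omega>)"
  proof (rule sum.cong)
    fix I assume "I \<in> Pow {..<m}"
    then have I: "I \<subseteq> {..<m}" by simp
    then have ci: "card (insert m I) = Suc (card I)"
      using finite_subset[OF I] by (subst card_insert_disjoint) auto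
    show "F I ?\<omega>' = F I \<omega> + F (insert m I) \<omega>"
    proof (cases "Suc (card I) \<le> k")
      case False
      then have "F (insert m I) \<omega> = 0" by (simp add: F_def ci)
      moreover have "F I ?\<omega>' = F I \<omega>" using False by (cases "card I = k") (auto simp: F_def)
      ultimately show ?thesis by simp
    next
      case True
      define j where "j = k - Suc (card I)"
      have kj: "k - card I = Suc j" using True by (simp add: j_def)
      have cc: "c (Suc j) * of_nat (Suc j) = c j"
        unfolding c_def by (subst ennreal_of_nat_eq_real_of_nat, subst ennreal_mult[symmetric])
          (auto simp: field_simps simp del: of_nat_Suc)
      have sym': "tuple_sym (Suc j) (\<lambda>w. \<phi> (combine_tuple k I x w))"
        using tuple_sym_combine[OF sym, of I x] True by (simp add: kj)
      have "F I ?\<omega>' = c (Suc j) * tsum (Suc j) \<omega> (\<lambda>w. \<phi> (combine_tuple k I x w))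
          + c (Suc j) * (of_nat (Suc j) * tsum j \<omega> (\<lambda>w. \<phi> (combine_tuple k I x (tuple_cons j (x m) w))))"
        using True by (simp add: F_def kj tsum_add_dirac[OF Suc.prems sym'] distrib_left del: of_nat_Suc)
      also have "\<dots> = F I \<omega> + F (insert m I) \<omega>"
        using True by (simp add: F_def kj ci cc mult.assoc[symmetric] combine_tuple_insert[OF I True] flip: j_def del: of_nat_Suc)
      finally show ?thesis .
    qed
  qed simp
  also have "\<dots> = (\<Sum>I\<in>Pow {..<m}. F I \<omega>) + (\<Sum>I\<in>insert m ` Pow {..<m}. F I \<omega>)"
    unfolding sum.distrib by (subst sum.reindex) (auto simp: inj_on_def)
  also have "\<dots> = (\<Sum>I\<in>Pow {..<Suc m}. F I \<omega>)"
    unfolding lessThan_Suc Pow_insert by (subst sum.union_disjoint) auto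
  finally show ?case unfolding c_def F_def .
qed

text \<open>
  The permutations act freely on injective tuples, so the orbits have \<open>fact k\<close> elements.
\<close>

lemma permutations_divide_symmetric_sets:
  assumes inj: "\<And>i. i \<in> E \<Longrightarrow> inj_on i {..<k}"
    and perm: "\<And>i \<pi>. i \<in> E \<Longrightarrow> \<pi> permutes {..<k} \<Longrightarrow> (\<lambda>l. i (\<pi> l)) \<in> E"
    and fin: "finite (E :: (nat \<Rightarrow> 'b) set)"
  shows "fact k dvd card E"
proof -
  let ?P = "{\<pi>. \<pi> permutes {..<k}}"
  define cl where "cl i = (\<lambda>\<pi> l. i (\<pi> l)) ` ?P" for i :: "nat \<Rightarrow> 'b"
  have mem: "i \<in> cl i" for i unfolding cl_def
    by (rule image_eqI[of _ _ id]) (auto simp: permutes_id)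
  have U: "\<Union>(cl ` E) = E" using mem perm by (auto simp: cl_def)
  have sub: "cl i' \<subseteq> cl i" if i': "i' \<in> cl i" for i i'
  proof
    fix j assume "j \<in> cl i'"
    then obtain \<rho> where \<rho>: "\<rho> permutes {..<k}" "j = (\<lambda>l. i' (\<rho> l))" by (auto simp: cl_def)
    obtain \<pi> where \<pi>: "\<pi> permutes {..<k}" "i' = (\<lambda>l. i (\<pi> l))" using i' unfolding cl_def by blast
    show "j \<in> cl i" unfolding cl_def
      by (rule image_eqI[of _ _ "\<pi> \<circ> \<rho>"]) (auto simp: \<rho> \<pi> permutes_compose)
  qed
  have symm: "i \<in> cl i'" if i': "i' \<in> cl i" for i i'
  proof -
    obtain \<pi> where \<pi>: "\<pi> permutes {..<k}" "i' = (\<lambda>l. i (\<pi> l))" using i' unfolding cl_def by blast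
    show ?thesis unfolding cl_def
      by (rule image_eqI[of _ _ "inv \<pi>"]) (auto simp: \<pi> permutes_inv permutes_inverses[OF \<pi>(1)])
  qed
  have eq: "cl i = cl i'" if "i' \<in> cl i" for i i'
    using sub[OF that] sub[OF symm[OF that]] by auto
  have "card (cl i) = fact k" if i: "i \<in> E" for i
  proof -
    have "inj_on (\<lambda>\<pi> l. i (\<pi> l)) ?P"
    proof (rule inj_onI)
      fix \<pi> \<rho> assume *: "\<pi> \<in> ?P" "\<rho> \<in> ?P" "(\<lambda>l. i (\<pi> l)) = (\<lambda>l. i (\<rho> l))"
      show "\<pi> = \<rho>"
      proof
        fix l show "\<pi> l = \<rho> l"
        proof (cases "l < k")
          case True
          then have "\<pi> l \<in> {..<k}" "\<rho> l \<in> {..<k}" using * permutes_in_image by fastforce+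
          moreover have "i (\<pi> l) = i (\<rho> l)" using *(3) by meson
          ultimately show ?thesis using inj_onD[OF inj[OF i]] by blast
        next
          case False
          then show ?thesis using * by (auto simp: permutes_not_in)
        qed
      qed
    qed
    then show ?thesis by (simp add: cl_def card_image card_permutations)
  qed
  moreover have disj: "cl a \<inter> cl b = {}" if ne: "cl a \<noteq> cl b" for a b
  proof (rule ccontr)
    assume "cl a \<inter> cl b \<noteq> {}"
    then obtain x where "x \<in> cl a" "x \<in> cl b" by auto
    from eq[OF this(1)] eq[OF this(2)] show False using ne by simp
  qed
  ultimately have "fact k dvd card (\<Union>(cl ` E))"
    using disj by (intro dvd_partition) (use fin U in auto)
  then show ?thesis by (simp add: U)
qed

text \<open>
  By symmetry the tuples where \<open>\<phi>\<close> equals one come in full orbits of the permutations; hence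
  the division by \<open>fact k\<close> leaves an integer, and the statistics are counting measures.
\<close>

lemma tsum_symmetric_count:
  assumes sym: "tuple_sym k \<phi>" and val: "\<And>x. x \<in> distinct_tuples k \<omega> \<Longrightarrow> \<phi> x \<in> {0, 1}"
  shows "ennreal (1 / fact k) * tsum k \<omega> \<phi> = \<infinity> \<or> (\<exists>n::nat. ennreal (1 / fact k) * tsum k \<omega> \<phi> = of_nat n)"
proof -
  define E where "E = {i \<in> inj_tuples k (point_indices \<omega>). \<phi> (pts k i) = 1}"
  have E: "E \<subseteq> inj_tuples k (point_indices \<omega>)" by (auto simp: E_def)
  have "tsum k \<omega> \<phi> = (\<integral>\<^sup>+ i. indicator E i \<partial>count_space (inj_tuples k (point_indices \<omega>)))"
    unfolding tsum_def distinct_indices_eq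
    using val by (intro nn_integral_cong)
      (auto simp: E_def distinct_tuples_def distinct_indices_eq split: split_indicator)
  also have "\<dots> = emeasure (count_space (inj_tuples k (point_indices \<omega>))) E"
    using E by (intro nn_integral_indicator) auto
  finally have T: "tsum k \<omega> \<phi> = (if finite E then of_nat (card E) else \<infinity>)"
    using E by (simp add: emeasure_count_space)
  show ?thesis
  proof (cases "finite E")
    case False
    then show ?thesis by (simp add: T ennreal_mult_top)
  next
    case True
    have "fact k dvd card E"
    proof (rule permutations_divide_symmetric_sets[OF _ _ True])
      show "inj_on i {..<k}" if "i \<in> E" for i using that by (auto simp: E_def inj_tuples_def)
      fix i \<pi> assume i: "i \<in> E" and \<pi>: "\<pi> permutes {..<k}"
      have "(\<lambda>l. i (\<pi> l)) \<in> inj_tuples k (point_indices \<omega>)"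
        using bij_betwE[OF inj_tuples_permute_bij[OF \<pi>]] i by (auto simp: E_def)
      moreover have "\<phi> (pts k (\<lambda>l. i (\<pi> l))) = \<phi> (pts k i)"
        using tuple_symD[OF sym \<pi> pts_extensional] by (simp add: pts_permute[OF \<pi>])
      ultimately show "(\<lambda>l. i (\<pi> l)) \<in> E" using i by (simp add: E_def)
    qed
    then obtain n where n: "card E = fact k * n" by (auto simp: dvd_def)
    have "ennreal (1 / fact k) * tsum k \<omega> \<phi> = ennreal (1 / fact k * real (card E))"
      using True by (simp add: T ennreal_of_nat_eq_real_of_nat ennreal_mult[symmetric])
    also have "\<dots> = of_nat n" by (simp add: n ennreal_of_nat_eq_real_of_nat)
    finally show ?thesis by blast
  qed
qed

lemma distinct_tuplesI:
  fixes \<omega> :: "'a::{second_countable_topology, t2_space} measure"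
  assumes x: "x \<in> extensional {..<k}" and le: "\<And>y. emeasure (dirac_sum k x) {y} \<le> emeasure \<omega> {y}"
  shows "x \<in> distinct_tuples k \<omega>"
proof -
  \<comment> \<open>The repetitions of a point within \<open>x\<close> are numbered in their order of occurrence.\<close>
  define i where "i = (\<lambda>l\<in>{..<k}. (x l, card {l'. l' < l \<and> x l' = x l}))"
  have e: "emeasure (dirac_sum k x) {y} = of_nat (card {l. l < k \<and> x l = y})" for y
    by (simp add: emeasure_dirac_sum indicator_def sum.If_cases Int_def)
  have less: "card {l'. l' < l \<and> x l' = x l} < card {l'. l' < m \<and> x l' = x l}" if "l < m" for l m
    using that by (intro psubset_card_mono) auto
  have "i l \<in> point_indices \<omega>" if "l < k" for l
  proof -
    have "(of_nat (card {l'. l' < l \<and> x l' = x l}) :: ennreal) < of_nat (card {l'. l' < k \<and> x l' = x l})"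
      using less[OF that] by simp
    also have "\<dots> \<le> emeasure \<omega> {x l}" using le[of "x l"] by (simp add: e)
    finally show ?thesis using that by (simp add: i_def point_indices_def)
  qed
  moreover have "inj_on i {..<k}"
  proof (rule inj_onI)
    fix l m assume "l \<in> {..<k}" "m \<in> {..<k}" "i l = i m"
    then show "l = m" using less[of l m] less[of m l] by (cases l m rule: linorder_cases) (auto simp: i_def)
  qed
  ultimately have "i \<in> distinct_indices k \<omega>" by (auto simp: distinct_indices_def i_def)
  moreover have "pts k i = x" using x by (auto simp: pts_def i_def fun_eq_iff extensional_def)
  ultimately show ?thesis unfolding distinct_tuples_def by force
qed

lemma distinct_tuples_add_dirac:
  fixes \<omega> :: "'a::{second_countable_topology, t2_space} measure"
  assumes "\<omega> \<in> counting_measures" "x \<in> extensional {..<k}"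
  shows "x \<in> distinct_tuples k (add_measure \<omega> (dirac_sum k x))"
  by (rule distinct_tuplesI) (auto simp: assms emeasure_add_measure sets_counting)

lemma distinct_tuples_mono_add:
  fixes \<omega> :: "'a::{second_countable_topology, t2_space} measure"
  assumes "\<omega> \<in> counting_measures" "x \<in> distinct_tuples k \<omega>"
  shows "x \<in> distinct_tuples k (add_measure \<omega> (dirac_sum m z))"
proof -
  have "point_indices \<omega> \<subseteq> point_indices (add_measure \<omega> (dirac_sum m z))"
    by (auto simp: point_indices_def emeasure_add_measure sets_counting assms intro: less_le_trans)
  then show ?thesis
    using assms(2) by (fastforce simp: distinct_tuples_def distinct_indices_def PiE_iff)
qed

lemma point_indices_restr:
  fixes \<omega> :: "'a::{second_countable_topology, t2_space} measure"
  assumes "\<omega> \<in> counting_measures" "A \<in> sets borel"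
  shows "point_indices (restr \<omega> A) = {a \<in> point_indices \<omega>. fst a \<in> A}"
proof -
  have "emeasure (restr \<omega> A) {x} = (if x \<in> A then emeasure \<omega> {x} else 0)" for x
    using assms by (auto simp: emeasure_restr sets_counting Int_insert_right)
  then show ?thesis by (auto simp: point_indices_def split: if_splits)
qed

lemma distinct_tuples_restr:
  fixes \<omega> :: "'a::{second_countable_topology, t2_space} measure"
  assumes "\<omega> \<in> counting_measures" "A \<in> sets borel" "x \<in> distinct_tuples k \<omega>" "x ` {..<k} \<subseteq> A"
  shows "x \<in> distinct_tuples k (restr \<omega> A)"
  using assms(3,4) unfolding distinct_tuples_def distinct_indices_def point_indices_restr[OF assms(1,2)]
  by (fastforce simp: pts_def PiE_iff)

lemma tsum_restr:
  fixes \<omega> :: "'a::{second_countable_topology, t2_space} measure"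
  assumes "\<omega> \<in> counting_measures" "A \<in> sets borel"
  shows "tsum k (restr \<omega> A) \<phi> = tsum k \<omega> (\<lambda>x. \<phi> x * (if x ` {..<k} \<subseteq> A then 1 else 0))"
proof -
  have "inj_tuples k {a \<in> point_indices \<omega>. fst a \<in> A} = {i \<in> inj_tuples k (point_indices \<omega>). pts k i ` {..<k} \<subseteq> A}"
    by (auto simp: inj_tuples_def pts_def PiE_iff)
  then show ?thesis
    unfolding tsum_def distinct_indices_eq point_indices_restr[OF assms]
    by (auto simp: nn_integral_count_space_indicator intro!: nn_integral_cong split: split_indicator)
qed

section \<open>The measure attached to a sum over tuples\<close>

lemma sets_tuple_measure[simp]: "sets (tuple_measure k g f \<omega>) = sets borel"
  by (simp add: tuple_measure_def)

lemma nn_integral_tuple_measure: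
  assumes [measurable]: "\<phi> \<in> borel_measurable borel"
  shows "(\<integral>\<^sup>+ y. \<phi> y \<partial>tuple_measure k g f \<omega>)
    = ennreal (1 / fact k) * tsum k \<omega> (\<lambda>x. ennreal (g x \<omega>) * \<phi> (f x \<omega>))"
  unfolding tuple_measure_def tsum_def
  by (simp add: nn_integral_scale_measure nn_integral_distr nn_integral_density)

lemma emeasure_tuple_measure:
  assumes "B \<in> sets borel"
  shows "emeasure (tuple_measure k g f \<omega>) B
    = ennreal (1 / fact k) * tsum k \<omega> (\<lambda>x. ennreal (g x \<omega>) * indicator B (f x \<omega>))"
  using nn_integral_tuple_measure[of "indicator B" k g f \<omega>] assms by simp

lemma tuple_sym_component:
  assumes "symmetric_in_tuple k g" "\<omega> \<in> counting_measures"
  shows "tuple_sym k (\<lambda>x. g x \<omega>)"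
  using assms unfolding tuple_sym_def symmetric_in_tuple_def by (auto simp: space_tuple_space)

lemma tuple_sym_comp: "tuple_sym k g \<Longrightarrow> tuple_sym k f \<Longrightarrow> tuple_sym k (\<lambda>x. H (g x) (f x))"
  by (simp add: tuple_sym_def)

lemma tuple_measure_values:
  assumes "tuple_sym k (\<lambda>x. g x \<omega>)" "tuple_sym k (\<lambda>x. f x \<omega>)"
    and "\<And>x. x \<in> extensional {..<k} \<Longrightarrow> g x \<omega> \<in> {0, 1::real}" and B: "B \<in> sets borel"
  shows "emeasure (tuple_measure k g f \<omega>) B = \<infinity> \<or> (\<exists>n::nat. emeasure (tuple_measure k g f \<omega>) B = of_nat n)"
  unfolding emeasure_tuple_measure[OF B]
proof (rule tsum_symmetric_count)
  show "tuple_sym k (\<lambda>x. ennreal (g x \<omega>) * indicator B (f x \<omega>))"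
    using assms(1,2) by (rule tuple_sym_comp)
  fix x assume "x \<in> distinct_tuples k \<omega>"
  from assms(3)[OF distinct_tuples_extensional[OF this]]
  show "ennreal (g x \<omega>) * indicator B (f x \<omega>) \<in> {0, 1}" by (auto split: split_indicator)
qed

lemma tuple_measure_finite_counting_iff:
  assumes "tuple_sym k (\<lambda>x. g x \<omega>)" "tuple_sym k (\<lambda>x. f x \<omega>)"
    and "\<And>x. x \<in> extensional {..<k} \<Longrightarrow> g x \<omega> \<in> {0, 1::real}"
  shows "tuple_measure k g f \<omega> \<in> finite_counting_measures \<longleftrightarrow> emeasure (tuple_measure k g f \<omega>) UNIV < \<infinity>"
proof -
  have "emeasure (tuple_measure k g f \<omega>) B = \<infinity> \<or> (\<exists>n::nat. emeasure (tuple_measure k g f \<omega>) B = of_nat n)"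
    if "B \<in> sets borel" for B by (rule tuple_measure_values) (use assms that in auto)
  from counting_measuresI[OF sets_tuple_measure this, of "\<lambda>_. UNIV"]
  show ?thesis by (auto simp: finite_counting_measures_def less_top)
qed

section \<open>Measurability of sums over tuples\<close>

lemma measurable_tuple_cons[measurable (raw)]:
  assumes "y \<in> T \<rightarrow>\<^sub>M borel" "w \<in> T \<rightarrow>\<^sub>M tuple_space k"
  shows "(\<lambda>t. tuple_cons k (y t) (w t)) \<in> T \<rightarrow>\<^sub>M tuple_space (Suc k)"
proof (rule measurable_tupleI)
  fix i assume i: "i < Suc k"
  show "(\<lambda>t. tuple_cons k (y t) (w t) i) \<in> T \<rightarrow>\<^sub>M borel"
  proof (cases i)
    case (Suc j)
    then show ?thesis using i measurable_tuple_component[OF assms(2), of j] by simp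
  qed (use assms in simp)
qed simp

context exhaustion
begin

lemma emeasure_remove_point:
  assumes "(\<omega> :: 'a measure) \<in> counting_measures" "B \<in> sets borel"
  shows "emeasure (remove_point y \<omega>) B = (if 1 \<le> emeasure \<omega> {y} then emeasure \<omega> B - indicator B y else emeasure \<omega> B)"
proof (cases "1 \<le> emeasure \<omega> {y}")
  case True
  obtain \<nu> where \<nu>: "\<nu> \<in> counting_measures" "\<omega> = add_measure \<nu> (dirac y)"
    using counting_decompose[OF assms(1) True] .
  have "emeasure \<omega> B = emeasure \<nu> B + indicator B y"
    using \<nu> assms(2) by (simp add: emeasure_add_measure sets_counting emeasure_dirac_sum)
  then show ?thesis using True remove_point_add_dirac[OF \<nu>(1), of y]
    by (auto simp: \<nu>(2) split: split_indicator)
qed (simp add: remove_point_def)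

lemma lf_remove_point: "\<omega> \<in> \<Omega> \<Longrightarrow> remove_point y \<omega> \<in> \<Omega>"
proof (cases "1 \<le> emeasure \<omega> {y}")
  case True
  assume w: "\<omega> \<in> \<Omega>"
  obtain \<nu> where \<nu>: "\<nu> \<in> counting_measures" "\<omega> = add_measure \<nu> (dirac y)"
    using counting_decompose[OF counting_of_lf[OF w] True] .
  have "\<nu> \<in> \<Omega>" by (rule lf_dominated[OF w])
    (use \<nu> counting_values[OF \<nu>(1)] in \<open>auto simp: emeasure_add_measure sets_counting\<close>)
  then show ?thesis using remove_point_add_dirac[OF \<nu>(1)] by (simp add: \<nu>(2))
qed (simp add: remove_point_def)

lemma measurable_atom[measurable (raw)]:
  assumes [measurable]: "X \<in> T \<rightarrow>\<^sub>M N" "y \<in> T \<rightarrow>\<^sub>M borel"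
  shows "(\<lambda>t. emeasure (X t) {y t}) \<in> borel_measurable T"
proof -
  have "(\<lambda>t. \<integral>\<^sup>+ z. (if z = y t then 1 else 0) \<partial>X t) \<in> borel_measurable T"
    by (rule kernel_nn_integral_measurable) measurable
  then show ?thesis
  proof (rule measurable_cong[THEN iffD2, rotated])
    fix t assume "t \<in> space T"
    then have "X t \<in> \<Omega>" using measurable_space[OF assms(1)] by auto
    then have "emeasure (X t) {y t} = (\<integral>\<^sup>+ z. indicator {y t} z \<partial>X t)" by (simp add: sets_lf)
    also have "\<dots> = (\<integral>\<^sup>+ z. (if z = y t then 1 else 0) \<partial>X t)" by (intro nn_integral_cong) auto
    finally show "emeasure (X t) {y t} = (\<integral>\<^sup>+ z. (if z = y t then 1 else 0) \<partial>X t)" .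
  qed
qed

lemma measurable_remove_point[measurable (raw)]:
  assumes [measurable]: "X \<in> T \<rightarrow>\<^sub>M N" "y \<in> T \<rightarrow>\<^sub>M borel"
  shows "(\<lambda>t. remove_point (y t) (X t)) \<in> T \<rightarrow>\<^sub>M N"
proof (rule measurable_eval_sigmaI)
  have X: "X t \<in> \<Omega>" if "t \<in> space T" for t using measurable_space[OF assms(1) that] by simp
  then show "remove_point (y t) (X t) \<in> \<Omega>" if "t \<in> space T" for t using that by (intro lf_remove_point) auto
  fix B :: "'a set" assume B[measurable]: "B \<in> sets borel"
  have "(\<lambda>t. if 1 \<le> emeasure (X t) {y t} then emeasure (X t) B - indicator B (y t) else emeasure (X t) B)
    \<in> borel_measurable T"
    by measurable
  then show "(\<lambda>t. emeasure (remove_point (y t) (X t)) B) \<in> borel_measurable T"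
    by (rule measurable_cong[THEN iffD2, rotated]) (simp add: emeasure_remove_point counting_of_lf X)
qed

text \<open>
  The parameter is a pair with a tuple in its second component, so that the induction on \<open>k\<close>
  can move the points that have been chosen already into the parameter.
\<close>

lemma measurable_tsum_aux:
  fixes X :: "'t \<times> (nat \<Rightarrow> 'a) \<Rightarrow> 'a measure" and \<phi> :: "'t \<times> (nat \<Rightarrow> 'a) \<Rightarrow> (nat \<Rightarrow> 'a) \<Rightarrow> ennreal"
  shows "X \<in> T \<Otimes>\<^sub>M tuple_space n \<rightarrow>\<^sub>M N \<Longrightarrow>
   (\<lambda>(z, w). \<phi> z w) \<in> borel_measurable ((T \<Otimes>\<^sub>M tuple_space n) \<Otimes>\<^sub>M tuple_space k) \<Longrightarrow>
   (\<lambda>z. tsum k (X z) (\<phi> z)) \<in> borel_measurable (T \<Otimes>\<^sub>M tuple_space n)"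
proof (induction k arbitrary: n X \<phi>)
  case 0
  note [measurable] = 0(2)
  have [measurable]: "(\<lambda>_. \<lambda>_. undefined) \<in> T \<Otimes>\<^sub>M tuple_space n \<rightarrow>\<^sub>M (tuple_space 0 :: (nat \<Rightarrow> 'a) measure)"
    by (intro measurable_const) (simp add: space_tuple_space)
  show ?case unfolding tsum_zero by measurable
next
  case (Suc k)
  note [measurable] = Suc.prems
  let ?r = "\<lambda>z. (fst z, restrict (snd z) {..<n})"
  have comp: "(\<lambda>z. snd z i) \<in> T \<Otimes>\<^sub>M tuple_space (Suc n) \<rightarrow>\<^sub>M (borel :: 'a measure)" if "i < Suc n" for i
    by (rule measurable_tuple_component[OF measurable_snd that])
  have [measurable]: "(\<lambda>z. restrict (snd z) {..<n}) \<in> T \<Otimes>\<^sub>M tuple_space (Suc n) \<rightarrow>\<^sub>M (tuple_space n :: (nat \<Rightarrow> 'a) measure)"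
    by (rule measurable_tupleI) (use comp in auto)
  have [measurable]: "(\<lambda>z. snd z n) \<in> T \<Otimes>\<^sub>M tuple_space (Suc n) \<rightarrow>\<^sub>M (borel :: 'a measure)" using comp by simp
  define G where "G z = tsum k (remove_point (snd z n) (X (?r z))) (\<lambda>w. \<phi> (?r z) (tuple_cons k (snd z n) w))" for z
  have [measurable]: "G \<in> borel_measurable (T \<Otimes>\<^sub>M tuple_space (Suc n))"
    unfolding G_def by (rule Suc.IH) measurable
  have upd[measurable]: "(\<lambda>(z, y). (snd z)(n := y)) \<in> (T \<Otimes>\<^sub>M tuple_space n) \<Otimes>\<^sub>M borel \<rightarrow>\<^sub>M (tuple_space (Suc n) :: (nat \<Rightarrow> 'a) measure)"
  proof (rule measurable_tupleI)
    fix i assume i: "i < Suc n"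
    have "(\<lambda>p. snd (fst p) i) \<in> (T \<Otimes>\<^sub>M tuple_space n) \<Otimes>\<^sub>M borel \<rightarrow>\<^sub>M (borel :: 'a measure)" if "i < n"
      by (rule measurable_tuple_component[OF _ that]) measurable
    then show "(\<lambda>t. (case t of (z, y) \<Rightarrow> (snd z)(n := y)) i) \<in> (T \<Otimes>\<^sub>M tuple_space n) \<Otimes>\<^sub>M borel \<rightarrow>\<^sub>M (borel :: 'a measure)"
      using i by (cases "i = n") (auto simp: case_prod_unfold)
  qed (auto simp: space_pair_measure space_tuple_space extensional_def)
  define g where "g z y = G (fst z, (snd z)(n := y))" for z y
  have g[measurable]: "(\<lambda>(z, y). g z y) \<in> borel_measurable ((T \<Otimes>\<^sub>M tuple_space n) \<Otimes>\<^sub>M borel)"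
    unfolding g_def by measurable
  have g_eq: "g z y = tsum k (remove_point y (X z)) (\<lambda>w. \<phi> z (tuple_cons k y w))"
    if z: "z \<in> space (T \<Otimes>\<^sub>M (tuple_space n :: (nat \<Rightarrow> 'a) measure))" for z y
  proof -
    have "restrict ((snd z)(n := y)) {..<n} = snd z"
      using z by (auto simp: space_pair_measure space_tuple_space extensional_def fun_eq_iff)
    then show ?thesis by (simp add: g_def G_def)
  qed
  have "(\<lambda>z. \<integral>\<^sup>+ y. g z y \<partial>X z) \<in> borel_measurable (T \<Otimes>\<^sub>M tuple_space n)"
    by (rule kernel_nn_integral_measurable) measurable
  then show ?case
  proof (rule measurable_cong[THEN iffD2, rotated])
    fix z assume z: "z \<in> space (T \<Otimes>\<^sub>M (tuple_space n :: (nat \<Rightarrow> 'a) measure))"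
    then have "X z \<in> counting_measures" using measurable_space[OF Suc.prems(1)] counting_of_lf by auto
    moreover have "g z \<in> borel_measurable borel" using measurable_compose_Pair1[OF z g] by simp
    ultimately show "tsum (Suc k) (X z) (\<phi> z) = (\<integral>\<^sup>+ y. g z y \<partial>X z)"
      by (simp add: tsum_Suc_indices nn_integral_counting flip: g_eq[OF z])
  qed
qed

lemma measurable_tsum[measurable (raw)]:
  fixes X :: "'t \<Rightarrow> 'a measure"
  assumes [measurable]: "X \<in> T \<rightarrow>\<^sub>M N" "(\<lambda>(t, w). \<phi> t w) \<in> borel_measurable (T \<Otimes>\<^sub>M tuple_space k)"
  shows "(\<lambda>t. tsum k (X t) (\<phi> t)) \<in> borel_measurable T"
proof -
  have [measurable]: "(\<lambda>_. \<lambda>_. undefined) \<in> T \<rightarrow>\<^sub>M (tuple_space 0 :: (nat \<Rightarrow> 'a) measure)"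
    by (intro measurable_const) (simp add: space_tuple_space)
  have aux: "(\<lambda>z. tsum k (X (fst z)) (\<phi> (fst z))) \<in> borel_measurable (T \<Otimes>\<^sub>M (tuple_space 0 :: (nat \<Rightarrow> 'a) measure))"
    by (rule measurable_tsum_aux) measurable
  have "(\<lambda>t. (t, \<lambda>_. undefined :: 'a)) \<in> T \<rightarrow>\<^sub>M T \<Otimes>\<^sub>M (tuple_space 0 :: (nat \<Rightarrow> 'a) measure)"
    by measurable
  from measurable_compose[OF this aux] show ?thesis by simp
qed

lemma tsum_Suc:
  assumes w: "\<omega> \<in> \<Omega>" and [measurable]: "\<phi> \<in> borel_measurable (tuple_space (Suc k))"
  shows "tsum (Suc k) \<omega> \<phi> = (\<integral>\<^sup>+ y. tsum k (remove_point y \<omega>) (\<lambda>w. \<phi> (tuple_cons k y w)) \<partial>\<omega>)"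
proof -
  have [measurable]: "(\<lambda>_. \<omega>) \<in> borel \<rightarrow>\<^sub>M N" by (intro measurable_const) (simp add: w)
  have "(\<lambda>y. tsum k (remove_point y \<omega>) (\<lambda>w. \<phi> (tuple_cons k y w))) \<in> borel_measurable borel"
    by measurable
  then show ?thesis
    using w by (simp add: tsum_Suc_indices nn_integral_counting counting_of_lf)
qed

end

section \<open>Independent restrictions and the Mecke formula\<close>

lemma (in prob_space) indep_sets_reindex:
  assumes bij: "bij_betw h I' I" and ind: "indep_sets (\<lambda>n. F (h n)) I'"
  shows "indep_sets F I"
proof (rule indep_setsI)
  fix i assume "i \<in> I"
  then obtain n where "n \<in> I'" "i = h n" using bij by (auto simp: bij_betw_def)
  then show "F i \<subseteq> events" using ind by (auto simp: indep_sets_def)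
next
  fix A J assume J: "J \<noteq> {}" "J \<subseteq> I" "finite J" and A: "\<forall>j\<in>J. A j \<in> F j"
  define J' where "J' = {n \<in> I'. h n \<in> J}"
  have im: "h ` J' = J" using bij J(2) by (auto simp: J'_def bij_betw_def)
  have inj: "inj_on h J'" using bij by (auto simp: J'_def bij_betw_def intro: inj_on_subset)
  have J': "J' \<subseteq> I'" "J' \<noteq> {}" "finite J'"
    using im J finite_imageD[OF _ inj] by (auto simp: J'_def)
  have "prob (\<Inter>n\<in>J'. A (h n)) = (\<Prod>n\<in>J'. prob (A (h n)))"
    by (rule indep_setsD[OF ind J']) (use A im in auto)
  also have "(\<Inter>n\<in>J'. A (h n)) = (\<Inter>j\<in>J. A j)" using im by auto
  also have "(\<Prod>n\<in>J'. prob (A (h n))) = (\<Prod>j\<in>J. prob (A j))"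
    by (subst im[symmetric], subst prod.reindex[OF inj]) simp
  finally show "prob (\<Inter>j\<in>J. A j) = (\<Prod>j\<in>J. prob (A j))" .
qed

text \<open>An intersection stable generator: the events in terms of finitely many counts.\<close>

definition cylinders :: "'a::topological_space measure set \<Rightarrow> 'a measure set set" where
  "cylinders \<Omega> = {{\<omega> \<in> \<Omega>. \<forall>i<m. emeasure \<omega> (B i) \<in> A i} | (m::nat) B A.
     (\<forall>i<m. B i \<in> sets borel) \<and> (\<forall>i<m. A i \<in> sets borel)}"

lemma cylindersD:
  assumes "Z \<in> cylinders \<Omega>"
  shows "\<exists>(m::nat) B A. Z = {\<omega> \<in> \<Omega>. \<forall>i<m. emeasure \<omega> (B i) \<in> A i} \<and>
    (\<forall>i<m. B i \<in> sets borel) \<and> (\<forall>i<m. A i \<in> sets borel)"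
  using assms by (simp add: cylinders_def)

lemma Int_stable_cylinders: "Int_stable (cylinders \<Omega>)"
proof (rule Int_stableI)
  fix Y Z assume Yc: "Y \<in> cylinders \<Omega>" and Zc: "Z \<in> cylinders \<Omega>"
  obtain m :: nat and B A where Y: "Y = {\<omega> \<in> \<Omega>. \<forall>i<m. emeasure \<omega> (B i) \<in> A i}"
      "\<forall>i<m. B i \<in> sets borel" "\<forall>i<m. A i \<in> sets borel"
    using cylindersD[OF Yc] by (elim exE conjE) (rule that)
  obtain m' :: nat and B' A' where Z: "Z = {\<omega> \<in> \<Omega>. \<forall>i<m'. emeasure \<omega> (B' i) \<in> A' i}"
      "\<forall>i<m'. B' i \<in> sets borel" "\<forall>i<m'. A' i \<in> sets borel"
    using cylindersD[OF Zc] by (elim exE conjE) (rule that)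
  let ?B = "\<lambda>i. if i < m then B i else B' (i - m)" and ?A = "\<lambda>i. if i < m then A i else A' (i - m)"
  have all: "(\<forall>i<m + m'. Q i) \<longleftrightarrow> (\<forall>i<m. Q i) \<and> (\<forall>i<m'. Q (m + i))" for Q
  proof (intro iffI allI impI)
    fix i assume *: "(\<forall>i<m. Q i) \<and> (\<forall>i<m'. Q (m + i))" and i: "i < m + m'"
    show "Q i"
    proof (cases "i < m")
      case False
      then have "Q (m + (i - m))" using * i by (intro conjunct2[OF *, rule_format]) auto
      then show ?thesis using False by simp
    qed (use * in blast)
  qed auto
  have split: "(\<forall>i<m + m'. emeasure \<omega> (?B i) \<in> ?A i) \<longleftrightarrow>
    (\<forall>i<m. emeasure \<omega> (B i) \<in> A i) \<and> (\<forall>i<m'. emeasure \<omega> (B' i) \<in> A' i)" for \<omega>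
    unfolding all by simp
  have "Y \<inter> Z = {\<omega> \<in> \<Omega>. \<forall>i<m + m'. emeasure \<omega> (?B i) \<in> ?A i}"
    unfolding split by (simp only: Y(1) Z(1)) blast
  moreover have "\<forall>i<m + m'. ?B i \<in> sets borel" "\<forall>i<m + m'. ?A i \<in> sets borel"
    using Y(2,3) Z(2,3) by simp_all
  ultimately have "Y \<inter> Z = {\<omega> \<in> \<Omega>. \<forall>i<m + m'. emeasure \<omega> (?B i) \<in> ?A i} \<and>
    (\<forall>i<m + m'. ?B i \<in> sets borel) \<and> (\<forall>i<m + m'. ?A i \<in> sets borel)" by (intro conjI)
  then show "Y \<inter> Z \<in> cylinders \<Omega>" unfolding cylinders_def mem_Collect_eq by (intro exI)
qed

lemma cylinders_sets:
  assumes Zc: "Z \<in> cylinders \<Omega>"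
  shows "Z \<in> sets (eval_sigma \<Omega>)"
proof -
  obtain m :: nat and B A where Z: "Z = {\<omega> \<in> \<Omega>. \<forall>i<m. emeasure \<omega> (B i) \<in> A i}"
    and BA: "\<forall>i<m. B i \<in> sets borel" "\<forall>i<m. A i \<in> sets borel"
    using cylindersD[OF Zc] by (elim exE conjE) (rule that)
  have "{\<omega> \<in> space (eval_sigma \<Omega>). \<forall>i\<in>{..<m}. emeasure \<omega> (B i) \<in> A i} \<in> sets (eval_sigma \<Omega>)"
  proof (rule sets.sets_Collect_finite_All)
    fix i assume "i \<in> {..<m}"
    then show "{\<omega> \<in> space (eval_sigma \<Omega>). emeasure \<omega> (B i) \<in> A i} \<in> sets (eval_sigma \<Omega>)"
      using BA by (auto simp: sets_eval_sigma intro!: sigma_sets.Basic)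
  qed simp
  then show "Z \<in> sets (eval_sigma \<Omega>)" by (simp only: Z Ball_def lessThan_iff space_eval_sigma)
qed

lemma sets_eval_sigma_cylinders: "sets (eval_sigma \<Omega>) = sigma_sets \<Omega> (cylinders \<Omega>)"
proof
  show "sigma_sets \<Omega> (cylinders \<Omega>) \<subseteq> sets (eval_sigma \<Omega>)"
    using sets.sigma_sets_subset[of "cylinders \<Omega>" "eval_sigma \<Omega>"] cylinders_sets by auto
  show "sets (eval_sigma \<Omega>) \<subseteq> sigma_sets \<Omega> (cylinders \<Omega>)"
    unfolding sets_eval_sigma
  proof (rule sigma_sets_mono', safe)
    fix A :: "ennreal set" and B :: "'a set" assume "A \<in> sets borel" "B \<in> sets borel"
    then show "{\<omega> \<in> \<Omega>. emeasure \<omega> B \<in> A} \<in> cylinders \<Omega>"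
      unfolding cylinders_def
      by (intro CollectI exI[of _ "1::nat"] exI[of _ "\<lambda>_. B"] exI[of _ "\<lambda>_. A"]) auto
  qed
qed

text \<open>
  The atoms of the algebra generated by \<open>B 0\<close>, \<open>\<dots>\<close>, \<open>B (m - 1)\<close>, indexed by the sets \<open>J\<close> of
  those \<open>i\<close> with the atom contained in \<open>B i\<close>.
\<close>

definition atom :: "nat \<Rightarrow> (nat \<Rightarrow> 'a set) \<Rightarrow> nat set \<Rightarrow> 'a set" where
  "atom m B J = {x. {i. i < m \<and> x \<in> B i} = J}"

lemma atom_sets:
  assumes "\<And>i. i < m \<Longrightarrow> B i \<in> sets borel" shows "atom m B J \<in> sets borel"
proof -
  have inter: "(\<Inter>i\<in>{..<m}. if i \<in> J then B i else - B i) \<in> sets borel"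
  proof (cases "m = 0")
    case False
    show ?thesis by (rule sets.finite_INT) (use False assms in auto)
  qed simp
  have "atom m B J = (if J \<subseteq> {..<m} then (\<Inter>i\<in>{..<m}. if i \<in> J then B i else - B i) else {})"
    by (auto simp: atom_def split: if_splits)
  then show ?thesis using inter by (simp del: INT_simps)
qed

lemma emeasure_atoms:
  assumes [simp]: "sets \<mu> = sets borel" and B: "\<And>i. i < m \<Longrightarrow> B i \<in> sets borel" and D: "D \<in> sets borel" and i: "i < m"
  shows "emeasure \<mu> (D \<inter> B i) = (\<Sum>J\<in>{J \<in> Pow {..<m}. i \<in> J}. emeasure \<mu> (D \<inter> atom m B J))"
proof -
  have "D \<inter> B i = (\<Union>J\<in>{J \<in> Pow {..<m}. i \<in> J}. D \<inter> atom m B J)"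
    using i by (auto simp: atom_def)
  also have "emeasure \<mu> \<dots> = (\<Sum>J\<in>{J \<in> Pow {..<m}. i \<in> J}. emeasure \<mu> (D \<inter> atom m B J))"
    using atom_sets[OF B] D
    by (intro sum_emeasure[symmetric]) (auto simp: disjoint_family_on_def atom_def)
  finally show ?thesis .
qed

text \<open>
  A Poisson process with values in \<open>locally_finite C\<close>; by \<open>poisson_modification\<close> below this
  can be assumed for every sigma-finite intensity.
\<close>

locale poisson = exhaustion C + prob_space P for C :: "nat \<Rightarrow> 'a::{second_countable_topology, t2_space} set" and P :: "'p measure" +
  fixes \<eta> :: "'p \<Rightarrow> 'a measure" and K :: "'a measure"
  assumes poisson: "poisson_process P \<eta> K"
    and K_sets[simp, measurable_cong]: "sets K = sets borel"
    and K_fin: "\<And>i. emeasure K (C i) < \<infinity>"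
    and \<eta>_N[measurable]: "\<eta> \<in> P \<rightarrow>\<^sub>M N"
begin

lemma K_sigma_finite: "sigma_finite_measure K"
  by (rule sigma_finite_measure.intro, rule exI[of _ "range C"])
     (use K_fin C_UN sets_eq_imp_space_eq[OF K_sets] in \<open>auto simp: less_top\<close>)

sublocale K: sigma_finite_measure K by (rule K_sigma_finite)

sublocale PK: pair_sigma_finite P K by standard

lemma eta_lf: "p \<in> space P \<Longrightarrow> \<eta> p \<in> \<Omega>"
  using measurable_space[OF \<eta>_N] by simp

lemma indep_counts:
  assumes "finite I" "disjoint_family_on E I" "\<And>i. i \<in> I \<Longrightarrow> E i \<in> sets borel"
  shows "indep_vars (\<lambda>_. borel) (\<lambda>i p. emeasure (\<eta> p) (E i)) I"
proof -
  obtain h where h: "bij_betw h {..<card I} I"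
    using ex_bij_betw_nat_finite[OF assms(1)] by (auto simp: lessThan_atLeast0)
  have "disjoint_family_on (\<lambda>n. E (h n)) {..<card I}"
    using assms(2) h unfolding disjoint_family_on_def bij_betw_def inj_on_def by blast
  moreover have "\<forall>n<card I. E (h n) \<in> sets borel" using assms(3) h by (auto simp: bij_betw_def)
  ultimately have "indep_vars (\<lambda>_. borel) (\<lambda>n p. emeasure (\<eta> p) (E (h n))) {..<card I}"
    using poisson by (auto simp: poisson_process_def)
  then have "indep_sets (\<lambda>n. (\<lambda>i. {(\<lambda>p. emeasure (\<eta> p) (E i)) -` A \<inter> space P |A. A \<in> sets borel}) (h n)) {..<card I}"
    by (simp add: indep_vars_def2)
  from indep_sets_reindex[OF h this] show ?thesis
    using assms(3) by (simp add: indep_vars_def2)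
qed

text \<open>
  The sets \<open>B i\<close> may overlap, and independence is only given for disjoint sets. But the counts
  in the sets \<open>D \<inter> B i\<close> are functions of the counts in the atoms within \<open>D\<close>, the other counts
  are functions of the counts in the atoms within the complement, and all these atoms together
  are disjoint.
\<close>

lemma indep_restr_cylinders:
  assumes D[measurable]: "D \<in> sets borel"
    and B: "\<And>i. i < (m::nat) \<Longrightarrow> B i \<in> sets borel" and A: "\<And>i. i < m \<Longrightarrow> A i \<in> sets borel"
    and B': "\<And>i. i < (m'::nat) \<Longrightarrow> B' i \<in> sets borel" and A': "\<And>i. i < m' \<Longrightarrow> A' i \<in> sets borel"
  shows "prob ({p \<in> space P. \<forall>i<m. emeasure (\<eta> p) (D \<inter> B i) \<in> A i} \<inter> {p \<in> space P. \<forall>i<m'. emeasure (\<eta> p) (-D \<inter> B' i) \<in> A' i})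
    = prob {p \<in> space P. \<forall>i<m. emeasure (\<eta> p) (D \<inter> B i) \<in> A i} * prob {p \<in> space P. \<forall>i<m'. emeasure (\<eta> p) (-D \<inter> B' i) \<in> A' i}"
proof -
  define I1 :: "(nat set + nat set) set" where "I1 = Inl ` Pow {..<m}"
  define I2 :: "(nat set + nat set) set" where "I2 = Inr ` Pow {..<m'}"
  define E where "E = case_sum (\<lambda>J. D \<inter> atom m B J) (\<lambda>J. -D \<inter> atom m' B' J)"
  have "indep_vars (\<lambda>_. borel) (\<lambda>i p. emeasure (\<eta> p) (E i)) (I1 \<union> I2)"
  proof (rule indep_counts)
    show "disjoint_family_on E (I1 \<union> I2)"
      unfolding disjoint_family_on_def by (auto simp: I1_def I2_def E_def atom_def)
  qed (use atom_sets[OF B] atom_sets[OF B'] D in \<open>auto simp: I1_def I2_def E_def\<close>)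
  then have ind: "indep_var (PiM I1 (\<lambda>_. borel)) (\<lambda>p. restrict (\<lambda>i. emeasure (\<eta> p) (E i)) I1)
      (PiM I2 (\<lambda>_. borel)) (\<lambda>p. restrict (\<lambda>i. emeasure (\<eta> p) (E i)) I2)"
    by (rule indep_var_restrict) (auto simp: I1_def I2_def)
  define Y1 :: "(nat set + nat set \<Rightarrow> ennreal) set"
    where "Y1 = {u \<in> space (PiM I1 (\<lambda>_. borel)). \<forall>i\<in>{..<m}. (\<Sum>J\<in>{J \<in> Pow {..<m}. i \<in> J}. u (Inl J)) \<in> A i}"
  define Y2 :: "(nat set + nat set \<Rightarrow> ennreal) set"
    where "Y2 = {u \<in> space (PiM I2 (\<lambda>_. borel)). \<forall>i\<in>{..<m'}. (\<Sum>J\<in>{J \<in> Pow {..<m'}. i \<in> J}. u (Inr J)) \<in> A' i}"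
  have Y1: "Y1 \<in> sets (PiM I1 (\<lambda>_. borel))"
    unfolding Y1_def
  proof (rule sets.sets_Collect_finite_All)
    fix i assume i: "i \<in> {..<m}"
    have "(\<lambda>u. \<Sum>J\<in>{J \<in> Pow {..<m}. i \<in> J}. u (Inl J)) \<in> borel_measurable (PiM I1 (\<lambda>_. borel :: ennreal measure))"
      by (rule borel_measurable_sum, rule measurable_component_singleton) (auto simp: I1_def)
    from measurable_sets_Collect[OF this, of "\<lambda>z. z \<in> A i"]
    show "{u \<in> space (PiM I1 (\<lambda>_. borel)). (\<Sum>J\<in>{J \<in> Pow {..<m}. i \<in> J}. u (Inl J)) \<in> A i} \<in> sets (PiM I1 (\<lambda>_. borel))"
      using A i by simp
  qed simp
  have Y2: "Y2 \<in> sets (PiM I2 (\<lambda>_. borel))"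
    unfolding Y2_def
  proof (rule sets.sets_Collect_finite_All)
    fix i assume i: "i \<in> {..<m'}"
    have "(\<lambda>u. \<Sum>J\<in>{J \<in> Pow {..<m'}. i \<in> J}. u (Inr J)) \<in> borel_measurable (PiM I2 (\<lambda>_. borel :: ennreal measure))"
      by (rule borel_measurable_sum, rule measurable_component_singleton) (auto simp: I2_def)
    from measurable_sets_Collect[OF this, of "\<lambda>z. z \<in> A' i"]
    show "{u \<in> space (PiM I2 (\<lambda>_. borel)). (\<Sum>J\<in>{J \<in> Pow {..<m'}. i \<in> J}. u (Inr J)) \<in> A' i} \<in> sets (PiM I2 (\<lambda>_. borel))"
      using A' i by simp
  qed simp
  have e1: "(\<lambda>p. restrict (\<lambda>i. emeasure (\<eta> p) (E i)) I1) -` Y1 \<inter> space P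
      = {p \<in> space P. \<forall>i<m. emeasure (\<eta> p) (D \<inter> B i) \<in> A i}"
  proof -
    have "(\<Sum>J\<in>{J \<in> Pow {..<m}. i \<in> J}. restrict (\<lambda>i. emeasure (\<eta> p) (E i)) I1 (Inl J)) = emeasure (\<eta> p) (D \<inter> B i)"
      if "i < m" "p \<in> space P" for i p
    proof -
      have "emeasure (\<eta> p) (D \<inter> B i) = (\<Sum>J\<in>{J \<in> Pow {..<m}. i \<in> J}. emeasure (\<eta> p) (D \<inter> atom m B J))"
        by (rule emeasure_atoms) (use that B D in \<open>auto simp: sets_lf eta_lf\<close>)
      also have "\<dots> = (\<Sum>J\<in>{J \<in> Pow {..<m}. i \<in> J}. restrict (\<lambda>i. emeasure (\<eta> p) (E i)) I1 (Inl J))"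
        by (rule sum.cong) (auto simp: I1_def E_def)
      finally show ?thesis ..
    qed
    then show ?thesis by (auto simp: Y1_def space_PiM)
  qed
  have e2: "(\<lambda>p. restrict (\<lambda>i. emeasure (\<eta> p) (E i)) I2) -` Y2 \<inter> space P
      = {p \<in> space P. \<forall>i<m'. emeasure (\<eta> p) (-D \<inter> B' i) \<in> A' i}"
  proof -
    have "(\<Sum>J\<in>{J \<in> Pow {..<m'}. i \<in> J}. restrict (\<lambda>i. emeasure (\<eta> p) (E i)) I2 (Inr J)) = emeasure (\<eta> p) (-D \<inter> B' i)"
      if "i < m'" "p \<in> space P" for i p
    proof -
      have "emeasure (\<eta> p) (-D \<inter> B' i) = (\<Sum>J\<in>{J \<in> Pow {..<m'}. i \<in> J}. emeasure (\<eta> p) (-D \<inter> atom m' B' J))"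
        by (rule emeasure_atoms) (use that B' borel_comp[OF D] in \<open>auto simp: sets_lf eta_lf\<close>)
      also have "\<dots> = (\<Sum>J\<in>{J \<in> Pow {..<m'}. i \<in> J}. restrict (\<lambda>i. emeasure (\<eta> p) (E i)) I2 (Inr J))"
        by (rule sum.cong) (auto simp: I2_def E_def)
      finally show ?thesis ..
    qed
    then show ?thesis by (auto simp: Y2_def space_PiM)
  qed
  have "(\<lambda>p. (restrict (\<lambda>i. emeasure (\<eta> p) (E i)) I1, restrict (\<lambda>i. emeasure (\<eta> p) (E i)) I2)) -` (Y1 \<times> Y2) \<inter> space P
     = {p \<in> space P. \<forall>i<m. emeasure (\<eta> p) (D \<inter> B i) \<in> A i} \<inter> {p \<in> space P. \<forall>i<m'. emeasure (\<eta> p) (-D \<inter> B' i) \<in> A' i}"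
    unfolding e1[symmetric] e2[symmetric] by auto
  with indep_varD[OF ind Y1 Y2] show ?thesis by (simp only: e1 e2)
qed

lemma indep_restr:
  assumes D[measurable]: "D \<in> sets borel"
  shows "indep_var N (\<lambda>p. restr (\<eta> p) D) N (\<lambda>p. restr (\<eta> p) (-D))"
proof -
  let ?G = "\<lambda>S. {(\<lambda>p. restr (\<eta> p) S) -` Z \<inter> space P | Z. Z \<in> cylinders \<Omega>}"
  have vim: "(\<lambda>p. restr (\<eta> p) S) -` {\<omega> \<in> \<Omega>. \<forall>i<m. emeasure \<omega> (B i) \<in> A i} \<inter> space P
    = {p \<in> space P. \<forall>i<m. emeasure (\<eta> p) (S \<inter> B i) \<in> A i}"
    if "S \<in> sets borel" "\<And>i. i < m \<Longrightarrow> B i \<in> sets borel" for S and m :: nat and B A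
    using that eta_lf by (auto simp: emeasure_restr sets_lf intro: lf_restr)
  have ev: "?G S \<subseteq> events" if S[measurable]: "S \<in> sets borel" for S
  proof safe
    fix Z assume "Z \<in> cylinders \<Omega>"
    then have "Z \<in> sets N" by (rule cylinders_sets)
    then show "(\<lambda>p. restr (\<eta> p) S) -` Z \<inter> space P \<in> events" by (intro measurable_sets[of _ P N]) measurable
  qed
  have "indep_set (?G D) (?G (-D))"
  proof (rule indep_setI)
    fix a b assume "a \<in> ?G D" "b \<in> ?G (-D)"
    then obtain Y Z where a: "a = (\<lambda>p. restr (\<eta> p) D) -` Y \<inter> space P" "Y \<in> cylinders \<Omega>"
      and b: "b = (\<lambda>p. restr (\<eta> p) (-D)) -` Z \<inter> space P" "Z \<in> cylinders \<Omega>" by auto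
    obtain m :: nat and B A where Y: "Y = {\<omega> \<in> \<Omega>. \<forall>i<m. emeasure \<omega> (B i) \<in> A i}"
      "\<forall>i<m. B i \<in> sets borel" "\<forall>i<m. A i \<in> sets borel" using cylindersD[OF a(2)] by (elim exE conjE) (rule that)
    obtain m' :: nat and B' A' where Z: "Z = {\<omega> \<in> \<Omega>. \<forall>i<m'. emeasure \<omega> (B' i) \<in> A' i}"
      "\<forall>i<m'. B' i \<in> sets borel" "\<forall>i<m'. A' i \<in> sets borel" using cylindersD[OF b(2)] by (elim exE conjE) (rule that)
    have av: "a = {p \<in> space P. \<forall>i<m. emeasure (\<eta> p) (D \<inter> B i) \<in> A i}"
      unfolding a(1) Y(1) by (rule vim) (use Y in auto)
    have bv: "b = {p \<in> space P. \<forall>i<m'. emeasure (\<eta> p) (-D \<inter> B' i) \<in> A' i}"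
      unfolding b(1) Z(1) by (rule vim) (use Z in auto)
    show "prob (a \<inter> b) = prob a * prob b"
      unfolding av bv by (rule indep_restr_cylinders) (use Y Z in auto)
  qed (use ev[of D] ev[of "-D"] in auto)
  note ind0 = this
  have stable: "Int_stable (?G S)" for S
  proof (rule Int_stableI)
    fix a b assume "a \<in> ?G S" "b \<in> ?G S"
    then obtain Y Z where "a = (\<lambda>p. restr (\<eta> p) S) -` Y \<inter> space P" "Y \<in> cylinders \<Omega>"
      "b = (\<lambda>p. restr (\<eta> p) S) -` Z \<inter> space P" "Z \<in> cylinders \<Omega>" by auto
    moreover from this have "a \<inter> b = (\<lambda>p. restr (\<eta> p) S) -` (Y \<inter> Z) \<inter> space P" by auto
    ultimately show "a \<inter> b \<in> ?G S" using Int_stableD[OF Int_stable_cylinders, of Y \<Omega> Z] by blast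
  qed
  have ind: "indep_set (sigma_sets (space P) (?G D)) (sigma_sets (space P) (?G (-D)))"
    by (rule indep_set_sigma_sets[OF ind0 stable stable])
  have eq: "sigma_sets (space P) {(\<lambda>p. restr (\<eta> p) S) -` A \<inter> space P |A. A \<in> sets N} = sigma_sets (space P) (?G S)"
    if "S \<in> sets borel" for S
  proof -
    have "{(\<lambda>p. restr (\<eta> p) S) -` A \<inter> space P |A. A \<in> sets N} = sigma_sets (space P) (?G S)"
      unfolding sets_eval_sigma_cylinders
      by (rule sigma_sets_vimage_commute) (use that eta_lf lf_restr in auto)
    moreover have "?G S \<subseteq> Pow (space P)" by auto
    ultimately show ?thesis by (simp only: sigma_sets_sigma_sets_eq)
  qed
  show ?thesis unfolding indep_var_eq eq[OF D] eq[OF borel_comp[OF D]] using ind by simp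
qed

lemma nn_integral_restr_indep:
  assumes [measurable]: "D \<in> sets borel" "(\<lambda>(\<omega>, \<omega>'). \<Phi> \<omega> \<omega>') \<in> borel_measurable (N \<Otimes>\<^sub>M N)"
  shows "(\<integral>\<^sup>+ p. \<Phi> (restr (\<eta> p) D) (restr (\<eta> p) (-D)) \<partial>P)
    = (\<integral>\<^sup>+ q. \<integral>\<^sup>+ p. \<Phi> (restr (\<eta> p) D) (restr (\<eta> q) (-D)) \<partial>P \<partial>P)"
proof -
  let ?X = "\<lambda>p. restr (\<eta> p) D" and ?Y = "\<lambda>p. restr (\<eta> p) (-D)"
  have eq: "distr P N ?X \<Otimes>\<^sub>M distr P N ?Y = distr P (N \<Otimes>\<^sub>M N) (\<lambda>p. (?X p, ?Y p))"
    using indep_restr[OF assms(1)] unfolding indep_var_distribution_eq by blast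
  interpret X: prob_space "distr P N ?X" by (rule prob_space_distr) measurable
  interpret Y: prob_space "distr P N ?Y" by (rule prob_space_distr) measurable
  interpret XY: pair_sigma_finite "distr P N ?X" "distr P N ?Y" ..
  have "(\<integral>\<^sup>+ p. \<Phi> (?X p) (?Y p) \<partial>P) = (\<integral>\<^sup>+ z. (\<lambda>(\<omega>, \<omega>'). \<Phi> \<omega> \<omega>') z \<partial>distr P (N \<Otimes>\<^sub>M N) (\<lambda>p. (?X p, ?Y p)))"
    by (subst nn_integral_distr) auto
  also have "\<dots> = (\<integral>\<^sup>+ \<omega>'. \<integral>\<^sup>+ \<omega>. \<Phi> \<omega> \<omega>' \<partial>distr P N ?X \<partial>distr P N ?Y)"
    unfolding eq[symmetric] by (subst XY.nn_integral_snd[symmetric]) auto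
  also have "\<dots> = (\<integral>\<^sup>+ q. (\<integral>\<^sup>+ \<omega>. \<Phi> \<omega> (?Y q) \<partial>distr P N ?X) \<partial>P)"
    by (rule nn_integral_distr) measurable
  also have "\<dots> = (\<integral>\<^sup>+ q. \<integral>\<^sup>+ p. \<Phi> (?X p) (?Y q) \<partial>P \<partial>P)"
  proof (rule nn_integral_cong, rule nn_integral_distr)
    fix q assume "q \<in> space P"
    then have "?Y q \<in> space N" using measurable_space[of ?Y P N q] by simp
    then show "(\<lambda>\<omega>. \<Phi> \<omega> (?Y q)) \<in> borel_measurable (distr P N ?X)" by measurable
  qed measurable
  finally show ?thesis .
qed

lemma prob_count:
  assumes "B \<in> sets borel" "emeasure K B < \<infinity>"
  shows "emeasure P {p \<in> space P. emeasure (\<eta> p) B = of_nat n} = ennreal (exp (- measure K B) * measure K B ^ n / fact n)"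
  using poisson assms unfolding poisson_process_def emeasure_eq_measure by auto

lemma AE_count_finite:
  assumes B[measurable]: "B \<in> sets borel" and fin: "emeasure K B < \<infinity>"
  shows "AE p in P. \<exists>n::nat. emeasure (\<eta> p) B = of_nat n"
proof -
  let ?S = "\<lambda>n. {p \<in> space P. emeasure (\<eta> p) B = of_nat n}"
  have d: "disjoint_family ?S" by (auto simp: disjoint_family_on_def)
  have [measurable]: "?S n \<in> events" for n by measurable
  let ?l = "measure K B"
  have "(\<lambda>n. ?l ^ n / fact n) sums exp ?l"
    using exp_converges[of ?l] by (simp add: divide_inverse mult.commute)
  from sums_mult[OF this, of "exp (- ?l)"]
  have s: "(\<lambda>n. exp (- ?l) * ?l ^ n / fact n) sums 1"
    by (simp add: exp_minus)
  have "emeasure P (\<Union>n. ?S n) = (\<Sum>n. emeasure P (?S n))"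
    using d by (intro suminf_emeasure[symmetric]) auto
  also have "\<dots> = (\<Sum>n. ennreal (exp (- measure K B) * measure K B ^ n / fact n))"
    by (simp only: prob_count[OF B fin])
  also have "\<dots> = ennreal 1"
    using s by (intro suminf_ennreal_eq) auto
  finally have "prob (\<Union>n. ?S n) = 1" by (simp add: emeasure_eq_measure)
  from AE_prob_1[OF this] show ?thesis by (rule AE_mp) (intro AE_I2, auto)
qed

end

lemma suminf_ennreal_Suc: "(\<Sum>n. f n) = (f 0 :: ennreal) + (\<Sum>n. f (Suc n))"
proof -
  have "(\<lambda>n. f (Suc n)) sums (\<Sum>n. f (Suc n))" by (rule summable_sums[OF summableI])
  from sums_unique[OF sums_Suc[OF this]] show ?thesis by (simp add: add.commute)
qed

lemma cylindersI:
  assumes "\<forall>i<(m::nat). B i \<in> sets borel" "\<forall>i<m. A i \<in> sets borel"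
  shows "{\<omega> \<in> \<Omega>. \<forall>i<m. emeasure \<omega> (B i) \<in> A i} \<in> cylinders \<Omega>"
  unfolding cylinders_def mem_Collect_eq
  by (intro exI[of _ m] exI[of _ B] exI[of _ A] conjI refl assms)

locale borel_sigma_finite = sigma_finite_measure K for K :: "'a::{second_countable_topology, t2_space} measure" +
  assumes K_sets[simp, measurable_cong]: "sets K = sets borel"
begin

sublocale KP: product_sigma_finite "\<lambda>_::nat. K" by standard

lemma nn_integral_measure_power_Suc:
  assumes [measurable]: "\<phi> \<in> borel_measurable (tuple_space (Suc k))"
  shows "(\<integral>\<^sup>+ x. \<phi> x \<partial>measure_power (Suc k) K) = (\<integral>\<^sup>+ y. \<integral>\<^sup>+ w. \<phi> (tuple_cons k y w) \<partial>measure_power k K \<partial>K)"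
proof -
  have st: "sets (measure_power j K) = sets (tuple_space j)" for j
    unfolding measure_power_def tuple_space_def by (intro sets_PiM_cong) auto
  interpret Kk: sigma_finite_measure "measure_power k K"
    unfolding measure_power_def by (rule KP.sigma_finite) simp
  interpret KKk: pair_sigma_finite K "measure_power k K" ..
  note st[measurable_cong]
  have m[measurable]: "(\<lambda>(y, w). tuple_cons k y w) \<in> K \<Otimes>\<^sub>M measure_power k K \<rightarrow>\<^sub>M tuple_space (Suc k)"
    by measurable
  let ?D = "distr (K \<Otimes>\<^sub>M measure_power k K) (tuple_space (Suc k)) (\<lambda>(y, w). tuple_cons k y w)"
  have "?D = PiM {..<Suc k} (\<lambda>_. K)"
  proof (rule KP.PiM_eqI)
    show "sets ?D = sets (PiM {..<Suc k} (\<lambda>_. K))" using st[of "Suc k"] by (simp add: measure_power_def)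
    fix A assume A: "\<And>i. i \<in> {..<Suc k} \<Longrightarrow> A i \<in> sets K"
    have PA: "Pi\<^sub>E {..<Suc k} A \<in> sets (tuple_space (Suc k))"
      unfolding tuple_space_def by (rule sets_PiM_I_finite) (use A in auto)
    have pre: "(\<lambda>(y, w). tuple_cons k y w) -` Pi\<^sub>E {..<Suc k} A \<inter> space (K \<Otimes>\<^sub>M measure_power k K)
      = A 0 \<times> Pi\<^sub>E {..<k} (\<lambda>i. A (Suc i))"
    proof -
      have sK: "space K = UNIV" using sets_eq_imp_space_eq[OF K_sets] by simp
      have all: "(\<forall>i<Suc k. tuple_cons k y w i \<in> A i) \<longleftrightarrow> y \<in> A 0 \<and> (\<forall>i<k. w i \<in> A (Suc i))" for y w
        by (auto simp: less_Suc_eq_0_disj)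
      have "tuple_cons k y w \<in> Pi\<^sub>E {..<Suc k} A \<longleftrightarrow> y \<in> A 0 \<and> (\<forall>i<k. w i \<in> A (Suc i))" for y w
        using all[of y w] by (auto simp: PiE_iff)
      then show ?thesis
        unfolding space_pair_measure sets_eq_imp_space_eq[OF st] space_tuple_space sK
        by (auto simp: PiE_iff extensional_def)
    qed
    have P2: "Pi\<^sub>E {..<k} (\<lambda>i. A (Suc i)) \<in> sets (measure_power k K)"
      unfolding measure_power_def by (rule sets_PiM_I_finite) (use A in auto)
    have "emeasure ?D (Pi\<^sub>E {..<Suc k} A) = emeasure (K \<Otimes>\<^sub>M measure_power k K) (A 0 \<times> Pi\<^sub>E {..<k} (\<lambda>i. A (Suc i)))"
      by (subst emeasure_distr[OF m PA]) (simp only: pre)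
    also have "\<dots> = emeasure K (A 0) * emeasure (measure_power k K) (Pi\<^sub>E {..<k} (\<lambda>i. A (Suc i)))"
      by (rule Kk.emeasure_pair_measure_Times) (use A P2 in auto)
    also have "emeasure (measure_power k K) (Pi\<^sub>E {..<k} (\<lambda>i. A (Suc i))) = (\<Prod>i<k. emeasure K (A (Suc i)))"
      unfolding measure_power_def by (rule KP.emeasure_PiM) (use A in auto)
    also have "emeasure K (A 0) * (\<Prod>i<k. emeasure K (A (Suc i))) = (\<Prod>i<Suc k. emeasure K (A i))"
      by (rule prod.lessThan_Suc_shift[symmetric])
    finally show "emeasure ?D (Pi\<^sub>E {..<Suc k} A) = (\<Prod>i<Suc k. emeasure K (A i))" .
  qed simp
  then have "(\<integral>\<^sup>+ x. \<phi> x \<partial>measure_power (Suc k) K) = (\<integral>\<^sup>+ x. \<phi> x \<partial>?D)" by (simp add: measure_power_def)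
  also have "\<dots> = (\<integral>\<^sup>+ z. \<phi> ((\<lambda>(y, w). tuple_cons k y w) z) \<partial>(K \<Otimes>\<^sub>M measure_power k K))"
    by (rule nn_integral_distr) measurable
  also have "\<dots> = (\<integral>\<^sup>+ y. \<integral>\<^sup>+ w. \<phi> (tuple_cons k y w) \<partial>measure_power k K \<partial>K)"
    by (subst Kk.nn_integral_fst[symmetric]) auto
  finally show ?thesis .
qed

lemma sets_measure_power[simp, measurable_cong]: "sets (measure_power j K) = sets (tuple_space j)"
  unfolding measure_power_def tuple_space_def by (intro sets_PiM_cong) auto

lemma space_measure_power: "space (measure_power j K) = extensional {..<j}"
  using sets_eq_imp_space_eq[OF sets_measure_power] by (simp add: space_tuple_space)

lemma sigma_finite_measure_power: "sigma_finite_measure (measure_power k K)"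
  unfolding measure_power_def by (rule KP.sigma_finite) simp

lemma nn_integral_measure_power_0: "(\<integral>\<^sup>+ x. \<phi> x \<partial>measure_power 0 K) = \<phi> (\<lambda>_. undefined)"
  by (simp add: measure_power_def PiM_empty nn_integral_count_space_finite)

end

context poisson
begin

sublocale PW: borel_sigma_finite K by standard simp

lemma eta_split:
  assumes p: "p \<in> space P" and [measurable]: "B \<in> sets borel" "D \<in> sets borel"
  shows "emeasure (\<eta> p) B = emeasure (\<eta> p) (B \<inter> D) + emeasure (\<eta> p) (B - D)"
proof -
  have "emeasure (\<eta> p) (B \<inter> D) + emeasure (\<eta> p) (B - D) = emeasure (\<eta> p) (B \<inter> D \<union> (B - D))"
    by (rule plus_emeasure) (auto simp: sets_lf[OF eta_lf[OF p]])
  moreover have "B \<inter> D \<union> (B - D) = B" by auto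
  ultimately show ?thesis by simp
qed

text \<open>
  The Mecke formula rests on the recursion \<open>(n + 1) * p (n + 1) = \<lambda> * p n\<close> for the weights \<open>p\<close>
  of the Poisson distribution with parameter \<open>\<lambda>\<close>. If every set of the cylinder contains \<open>D\<close> or
  misses it, then the cylinder sees the points in \<open>D\<close> only through their number, and this
  number is independent of the configuration outside \<open>D\<close>; adding a point of \<open>D\<close> increases it
  by one.
\<close>

lemma mecke_good_rectangle:
  assumes D[measurable]: "D \<in> sets borel" and fin: "emeasure K D < \<infinity>"
    and B[measurable]: "\<And>i. i < (m::nat) \<Longrightarrow> B i \<in> sets borel" and A: "\<And>i. i < m \<Longrightarrow> A i \<in> sets borel"
    and good: "\<And>i. i < m \<Longrightarrow> D \<subseteq> B i \<or> D \<inter> B i = {}"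
    and Z: "Z = {\<omega> \<in> \<Omega>. \<forall>i<m. emeasure \<omega> (B i) \<in> A i}"
  shows "(\<integral>\<^sup>+ p. emeasure (\<eta> p) D * indicator Z (\<eta> p) \<partial>P)
    = (\<integral>\<^sup>+ y. indicator D y * emeasure P {p \<in> space P. add_measure (\<eta> p) (dirac y) \<in> Z} \<partial>K)"
proof -
  define R where "R p = restr (\<eta> p) (-D)" for p
  define Q where "Q n = {\<omega> \<in> \<Omega>. \<forall>i\<in>{..<m}. (if D \<subseteq> B i then of_nat n else 0) + emeasure \<omega> (B i) \<in> A i}" for n :: nat
  define S where "S n = {p \<in> space P. emeasure (\<eta> p) D = of_nat n}" for n :: nat
  define T where "T n = {p \<in> space P. R p \<in> Q n}" for n :: nat
  define l where "l = measure K D"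
  have l: "0 \<le> l" "emeasure K D = ennreal l"
    using fin by (auto simp: l_def emeasure_eq_ennreal_measure less_top)
  have Q[measurable]: "Q n \<in> sets N" for n
  proof -
    have "{\<omega> \<in> space N. \<forall>i\<in>{..<m}. (if D \<subseteq> B i then of_nat n else 0) + emeasure \<omega> (B i) \<in> A i} \<in> sets N"
    proof (rule sets.sets_Collect_finite_All)
      fix i assume i: "i \<in> {..<m}"
      have "(\<lambda>\<omega>. (if D \<subseteq> B i then of_nat n else 0) + emeasure \<omega> (B i)) \<in> borel_measurable N"
        using i by (intro borel_measurable_add measurable_emeasure_eval[OF measurable_ident]) auto
      from measurable_sets[OF this, of "A i"]
      show "{\<omega> \<in> space N. (if D \<subseteq> B i then of_nat n else 0) + emeasure \<omega> (B i) \<in> A i} \<in> sets N"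
        using A i by (simp add: vimage_def Int_def conj_commute)
    qed simp
    then show ?thesis by (simp add: Q_def)
  qed
  have [measurable]: "R \<in> P \<rightarrow>\<^sub>M N" unfolding R_def by measurable
  have [measurable]: "S n \<in> events" for n unfolding S_def by measurable
  have [measurable]: "T n \<in> events" for n unfolding T_def by measurable
  have disj: "disjoint_family S" by (auto simp: S_def disjoint_family_on_def)
  have ind: "emeasure P (S n \<inter> T j) = emeasure P (S n) * emeasure P (T j)" for n j
  proof -
    let ?W = "{\<omega> \<in> space N. emeasure \<omega> D = of_nat n}"
    have W: "?W \<in> sets N"
      using measurable_sets[OF measurable_emeasure_eval[OF measurable_ident D], of "{of_nat n}" \<Omega>]
      by (simp add: vimage_def Int_def conj_commute)
    have "prob ((\<lambda>p. (restr (\<eta> p) D, restr (\<eta> p) (-D))) -` (?W \<times> Q j) \<inter> space P)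
      = prob ((\<lambda>p. restr (\<eta> p) D) -` ?W \<inter> space P) * prob ((\<lambda>p. restr (\<eta> p) (-D)) -` Q j \<inter> space P)"
      by (rule indep_varD[OF indep_restr[OF D] W Q])
    moreover have "(\<lambda>p. restr (\<eta> p) D) -` ?W \<inter> space P = S n"
      using eta_lf lf_restr[OF _ D] by (auto simp: S_def emeasure_restr sets_lf)
    moreover have "(\<lambda>p. restr (\<eta> p) (-D)) -` Q j \<inter> space P = T j"
      by (auto simp: T_def R_def)
    moreover have "(\<lambda>p. (restr (\<eta> p) D, restr (\<eta> p) (-D))) -` (?W \<times> Q j) \<inter> space P
      = ((\<lambda>p. restr (\<eta> p) D) -` ?W \<inter> space P) \<inter> ((\<lambda>p. restr (\<eta> p) (-D)) -` Q j \<inter> space P)" by auto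
    ultimately show ?thesis by (simp add: emeasure_eq_measure ennreal_mult[symmetric])
  qed
  have R_eval: "emeasure (R p) (B i) = emeasure (\<eta> p) (B i - D)" if "p \<in> space P" "i < m" for p i
    using that by (simp add: R_def emeasure_restr sets_lf eta_lf Diff_eq Int_commute)
  have eta_B: "emeasure (\<eta> p) (B i) = (if D \<subseteq> B i then emeasure (\<eta> p) D else 0) + emeasure (R p) (B i)"
    if "p \<in> space P" "i < m" for p i
  proof (cases "D \<subseteq> B i")
    case True
    then have "B i \<inter> D = D" by auto
    then show ?thesis using True eta_split[OF that(1) B[OF that(2)] D] R_eval[OF that] by simp
  next
    case False
    then have "B i \<inter> D = {}" using good[OF that(2)] by auto
    then show ?thesis using False eta_split[OF that(1) B[OF that(2)] D] R_eval[OF that] by simp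
  qed
  have memZ: "\<eta> p \<in> Z \<longleftrightarrow> p \<in> T n" if "p \<in> S n" for p n
    using that eta_lf measurable_space[of R P N p] by (auto simp: Z S_def T_def Q_def eta_B)
  have memZ': "add_measure (\<eta> p) (dirac y) \<in> Z \<longleftrightarrow> p \<in> T (Suc n)" if "p \<in> S n" "y \<in> D" for p n y
  proof -
    have p: "p \<in> space P" "emeasure (\<eta> p) D = of_nat n" using that by (auto simp: S_def)
    have "emeasure (add_measure (\<eta> p) (dirac y)) (B i) = (if D \<subseteq> B i then of_nat (Suc n) else 0) + emeasure (R p) (B i)"
      if i: "i < m" for i
      using good[OF i] \<open>y \<in> D\<close> p i
      by (auto simp: emeasure_add_measure sets_lf eta_lf emeasure_dirac_sum eta_B add_ac split: split_indicator)
    then show ?thesis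
      using p eta_lf measurable_space[of R P N p] by (auto simp: Z T_def Q_def lf_add_dirac)
  qed
  have AE_S: "AE p in P. \<exists>n. p \<in> S n"
    using AE_count_finite[OF D fin] by (auto simp: S_def)
  have sum_S: "(\<Sum>n. f n * indicator (S n) p) = f n" if "p \<in> S n" for f :: "nat \<Rightarrow> ennreal" and p n
    using suminf_cmult_indicator[OF disj that, of f] by simp
  have "(\<integral>\<^sup>+ p. emeasure (\<eta> p) D * indicator Z (\<eta> p) \<partial>P)
    = (\<integral>\<^sup>+ p. (\<Sum>n. (of_nat n * indicator (T n) p) * indicator (S n) p) \<partial>P)"
  proof (rule nn_integral_cong_AE, use AE_S in eventually_elim)
    case (elim p)
    then obtain n where n: "p \<in> S n" by blast
    then have "emeasure (\<eta> p) D = of_nat n" by (simp add: S_def)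
    then show ?case
      using memZ[OF n] sum_S[OF n] by (simp split: split_indicator)
  qed
  also have "\<dots> = (\<Sum>n. \<integral>\<^sup>+ p. of_nat n * indicator (S n \<inter> T n) p \<partial>P)"
    by (subst nn_integral_suminf) (auto intro!: suminf_cong nn_integral_cong split: split_indicator)
  also have "\<dots> = (\<Sum>n. of_nat n * (emeasure P (S n) * emeasure P (T n)))"
    by (intro suminf_cong) (simp add: nn_integral_cmult ind)
  also have "\<dots> = (\<Sum>n. of_nat (Suc n) * (emeasure P (S (Suc n)) * emeasure P (T (Suc n))))"
    by (subst suminf_ennreal_Suc) simp
  \<comment> \<open>The Poisson recursion; the event \<open>T (Suc n)\<close> already describes the configuration with one more point.\<close>
  also have "\<dots> = (\<Sum>n. emeasure K D * (emeasure P (S n) * emeasure P (T (Suc n))))"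
  proof (rule suminf_cong)
    fix n
    have pS: "emeasure P (S j) = ennreal (exp (- l) * l ^ j / fact j)" for j
      unfolding S_def prob_count[OF D fin] l_def ..
    have "of_nat (Suc n) * emeasure P (S (Suc n)) = ennreal (real (Suc n) * (exp (- l) * l ^ Suc n / fact (Suc n)))"
      unfolding pS ennreal_of_nat_eq_real_of_nat by (rule ennreal_mult[symmetric]) (use l(1) in auto)
    also have "\<dots> = ennreal (l * (exp (- l) * l ^ n / fact n))"
      by (simp add: field_simps del: of_nat_Suc)
    also have "\<dots> = emeasure K D * emeasure P (S n)"
      unfolding pS l(2) by (rule ennreal_mult) (use l(1) in auto)
    finally show "of_nat (Suc n) * (emeasure P (S (Suc n)) * emeasure P (T (Suc n)))
      = emeasure K D * (emeasure P (S n) * emeasure P (T (Suc n)))"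
      by (simp add: mult.assoc[symmetric] del: of_nat_Suc)
  qed
  also have "\<dots> = emeasure K D * (\<Sum>n. emeasure P (S n) * emeasure P (T (Suc n)))"
    by simp
  also have "\<dots> = (\<integral>\<^sup>+ y. indicator D y * (\<Sum>n. emeasure P (S n) * emeasure P (T (Suc n))) \<partial>K)"
    by (simp add: nn_integral_multc)
  also have "\<dots> = (\<integral>\<^sup>+ y. indicator D y * emeasure P {p \<in> space P. add_measure (\<eta> p) (dirac y) \<in> Z} \<partial>K)"
  proof (rule nn_integral_cong)
    fix y
    show "indicator D y * (\<Sum>n. emeasure P (S n) * emeasure P (T (Suc n)))
      = indicator D y * emeasure P {p \<in> space P. add_measure (\<eta> p) (dirac y) \<in> Z}"
    proof (cases "y \<in> D")
      case y: True
      have ZN[measurable]: "Z \<in> sets N"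
        unfolding Z by (rule cylinders_sets, rule cylindersI) (use A B in auto)
      have ev: "{p \<in> space P. add_measure (\<eta> p) (dirac y) \<in> Z} \<in> events" by measurable
      have "emeasure P {p \<in> space P. add_measure (\<eta> p) (dirac y) \<in> Z}
        = (\<integral>\<^sup>+ p. indicator {p \<in> space P. add_measure (\<eta> p) (dirac y) \<in> Z} p \<partial>P)"
        using ev by simp
      also have "\<dots> = (\<integral>\<^sup>+ p. (\<Sum>n. indicator (T (Suc n)) p * indicator (S n) p) \<partial>P)"
      proof (rule nn_integral_cong_AE, use AE_S in eventually_elim)
        case (elim p)
        then obtain n where n: "p \<in> S n" by blast
        then have "p \<in> space P" by (simp add: S_def)
        then show ?case
          using memZ'[OF n y] sum_S[OF n] by (simp split: split_indicator)
      qed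
      also have "\<dots> = (\<Sum>n. \<integral>\<^sup>+ p. indicator (S n \<inter> T (Suc n)) p \<partial>P)"
        unfolding indicator_inter_arith by (subst nn_integral_suminf) (simp_all add: mult.commute)
      also have "\<dots> = (\<Sum>n. emeasure P (S n) * emeasure P (T (Suc n)))"
      proof (rule suminf_cong)
        fix n
        have "(\<integral>\<^sup>+ p. indicator (S n \<inter> T (Suc n)) p \<partial>P) = emeasure P (S n \<inter> T (Suc n))"
          by (rule nn_integral_indicator) measurable
        then show "(\<integral>\<^sup>+ p. indicator (S n \<inter> T (Suc n)) p \<partial>P) = emeasure P (S n) * emeasure P (T (Suc n))"
          by (simp only: ind)
      qed
      finally show ?thesis by simp
    qed simp
  qed
  finally show ?thesis .
qed

text \<open>
  Cut \<open>D\<close> along the sets of the cylinder, one at a time; both sides are additive in \<open>D\<close>.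
\<close>

lemma mecke_rectangle:
  assumes D: "D \<in> sets borel" and fin: "emeasure K D < \<infinity>" and Z: "Z \<in> cylinders \<Omega>"
  shows "(\<integral>\<^sup>+ p. emeasure (\<eta> p) D * indicator Z (\<eta> p) \<partial>P)
    = (\<integral>\<^sup>+ y. indicator D y * emeasure P {p \<in> space P. add_measure (\<eta> p) (dirac y) \<in> Z} \<partial>K)"
proof -
  obtain m :: nat and B A where Zeq: "Z = {\<omega> \<in> \<Omega>. \<forall>i<m. emeasure \<omega> (B i) \<in> A i}"
    and B: "\<forall>i<m. B i \<in> sets borel" and A: "\<forall>i<m. A i \<in> sets borel"
    using cylindersD[OF Z] by (elim exE conjE) (rule that)
  have [measurable]: "Z \<in> sets N" by (rule cylinders_sets[OF Z])
  let ?F = "\<lambda>D. (\<integral>\<^sup>+ p. emeasure (\<eta> p) D * indicator Z (\<eta> p) \<partial>P)"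
  let ?G = "\<lambda>D. (\<integral>\<^sup>+ y. indicator D y * emeasure P {p \<in> space P. add_measure (\<eta> p) (dirac y) \<in> Z} \<partial>K)"
  have "D \<in> sets borel \<longrightarrow> emeasure K D < \<infinity> \<longrightarrow> (\<forall>i<m. j \<le> i \<longrightarrow> D \<subseteq> B i \<or> D \<inter> B i = {}) \<longrightarrow> ?F D = ?G D" for j D
  proof (induction j arbitrary: D)
    case 0
    show ?case
    proof (intro impI)
      assume "D \<in> sets borel" "emeasure K D < \<infinity>" "\<forall>i<m. 0 \<le> i \<longrightarrow> D \<subseteq> B i \<or> D \<inter> B i = {}"
      then show "?F D = ?G D" using A B by (intro mecke_good_rectangle[OF _ _ _ _ _ Zeq]) auto
    qed
  next
    case (Suc j)
    show ?case
    proof (intro impI)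
      assume D[measurable]: "D \<in> sets borel" and fin: "emeasure K D < \<infinity>"
        and good: "\<forall>i<m. Suc j \<le> i \<longrightarrow> D \<subseteq> B i \<or> D \<inter> B i = {}"
      show "?F D = ?G D"
      proof (cases "j < m")
        case False
        then show ?thesis using Suc.IH[of D] D fin by auto
      next
        case j: True
        have Bj[measurable]: "B j \<in> sets borel" using B j by auto
        have ge: "j \<le> i \<longleftrightarrow> i = j \<or> Suc j \<le> i" for i by auto
        have fin': "emeasure K (D \<inter> B j) < \<infinity>" "emeasure K (D - B j) < \<infinity>"
          by (rule le_less_trans[OF emeasure_mono fin]; auto)+
        have good': "D' \<subseteq> B i \<or> D' \<inter> B i = {}" if D': "D' = D \<inter> B j \<or> D' = D - B j" and i: "i < m" "j \<le> i" for i D'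
        proof (cases "i = j")
          case False
          then have "D \<subseteq> B i \<or> D \<inter> B i = {}" using good i by simp
          then show ?thesis using D' by blast
        qed (use D' in blast)
        have 1: "?F (D \<inter> B j) = ?G (D \<inter> B j)"
          by (rule Suc.IH[rule_format]) (simp_all only: fin', use good' in auto)
        have 2: "?F (D - B j) = ?G (D - B j)"
          by (rule Suc.IH[rule_format]) (simp_all only: fin', use good' in auto)
        have "?F D = (\<integral>\<^sup>+ p. emeasure (\<eta> p) (D \<inter> B j) * indicator Z (\<eta> p) + emeasure (\<eta> p) (D - B j) * indicator Z (\<eta> p) \<partial>P)"
          by (intro nn_integral_cong) (simp add: eta_split[OF _ D Bj] distrib_right)
        also have "\<dots> = ?F (D \<inter> B j) + ?F (D - B j)" by (rule nn_integral_add) measurable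
        also have "\<dots> = ?G (D \<inter> B j) + ?G (D - B j)" by (simp only: 1 2)
        also have "\<dots> = (\<integral>\<^sup>+ y. indicator (D \<inter> B j) y * emeasure P {p \<in> space P. add_measure (\<eta> p) (dirac y) \<in> Z}
           + indicator (D - B j) y * emeasure P {p \<in> space P. add_measure (\<eta> p) (dirac y) \<in> Z} \<partial>K)"
          by (rule nn_integral_add[symmetric]) measurable
        also have "\<dots> = ?G D" by (intro nn_integral_cong) (auto split: split_indicator)
        finally show ?thesis .
      qed
    qed
  qed
  from this[of D m] show ?thesis using D fin by simp
qed

text \<open>
  Both sides are measures in \<open>W\<close>. They agree on an intersection stable generator, the products
  of a set within some \<open>C i\<close> and a cylinder, and they are finite on the products of \<open>C i\<close> with
  the whole space.
\<close>

lemma mecke_set: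
  assumes W: "W \<in> sets (borel \<Otimes>\<^sub>M N)"
  shows "(\<integral>\<^sup>+ p. \<integral>\<^sup>+ y. indicator W (y, \<eta> p) \<partial>\<eta> p \<partial>P)
    = (\<integral>\<^sup>+ y. \<integral>\<^sup>+ p. indicator W (y, add_measure (\<eta> p) (dirac y)) \<partial>P \<partial>K)"
proof -
  define F where "F W = (\<integral>\<^sup>+ p. \<integral>\<^sup>+ y. indicator W (y, \<eta> p) \<partial>\<eta> p \<partial>P)" for W
  define \<mu>1 where "\<mu>1 = measure_of (UNIV \<times> \<Omega>) (sets (borel \<Otimes>\<^sub>M N)) F"
  define \<mu>2 where "\<mu>2 = distr (K \<Otimes>\<^sub>M P) (borel \<Otimes>\<^sub>M N) (\<lambda>(y, p). (y, add_measure (\<eta> p) (dirac y)))"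
  have sp: "space ((borel :: 'a measure) \<Otimes>\<^sub>M N) = UNIV \<times> \<Omega>" by (simp add: space_pair_measure)
  have sets1: "sets \<mu>1 = sets (borel \<Otimes>\<^sub>M N)"
    unfolding \<mu>1_def sp[symmetric] by (rule sets.sets_measure_of_eq)
  have sets2: "sets \<mu>2 = sets (borel \<Otimes>\<^sub>M N)" by (simp add: \<mu>2_def)
  have sb: "sets (\<eta> p) = sets borel" if "p \<in> space P" for p by (simp add: sets_lf eta_lf that)
  have meas: "(\<lambda>y. indicator W (y, \<eta> p) :: ennreal) \<in> borel_measurable (\<eta> p)"
    if "p \<in> space P" "W \<in> sets (borel \<Otimes>\<^sub>M N)" for p W
  proof -
    have [measurable]: "W \<in> sets (borel \<Otimes>\<^sub>M N)" "\<eta> p \<in> space N" using that eta_lf by auto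
    have "(\<lambda>y. indicator W (y, \<eta> p) :: ennreal) \<in> borel_measurable borel" by measurable
    then show ?thesis by (simp add: measurable_cong_sets[OF sb[OF that(1)] refl])
  qed
  have meas2: "(\<lambda>p. \<integral>\<^sup>+ y. indicator W (y, \<eta> p) \<partial>\<eta> p) \<in> borel_measurable P" if [measurable]: "W \<in> sets (borel \<Otimes>\<^sub>M N)" for W
    by (rule kernel_nn_integral_measurable) measurable
  have e1: "emeasure \<mu>1 W = F W" if "W \<in> sets (borel \<Otimes>\<^sub>M N)" for W
  proof (rule emeasure_measure_of[OF \<mu>1_def])
    show "sets ((borel :: 'a measure) \<Otimes>\<^sub>M N) \<subseteq> Pow (UNIV \<times> \<Omega>)" using sets.space_closed[of "(borel :: 'a measure) \<Otimes>\<^sub>M N"] sp by simp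
    show "countably_additive (sets \<mu>1) F"
      unfolding countably_additive_def sets1
    proof (intro allI impI)
      fix A :: "nat \<Rightarrow> ('a \<times> 'a measure) set" assume A: "range A \<subseteq> sets (borel \<Otimes>\<^sub>M N)" "disjoint_family A"
      have Ai: "A i \<in> sets (borel \<Otimes>\<^sub>M N)" for i using A by auto
      have "(\<Sum>i. F (A i)) = (\<integral>\<^sup>+ p. (\<Sum>i. \<integral>\<^sup>+ y. indicator (A i) (y, \<eta> p) \<partial>\<eta> p) \<partial>P)"
        unfolding F_def by (rule nn_integral_suminf[symmetric]) (rule meas2[OF Ai])
      also have "\<dots> = (\<integral>\<^sup>+ p. \<integral>\<^sup>+ y. (\<Sum>i. indicator (A i) (y, \<eta> p)) \<partial>\<eta> p \<partial>P)"
        by (intro nn_integral_cong nn_integral_suminf[symmetric] meas Ai)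
      also have "\<dots> = F (\<Union>i. A i)"
        unfolding F_def by (intro nn_integral_cong suminf_indicator A(2))
      finally show "(\<Sum>i. F (A i)) = F (\<Union>i. A i)" .
    qed
  qed (use that in \<open>auto simp: positive_def F_def sets1\<close>)
  have e2: "emeasure \<mu>2 W = (\<integral>\<^sup>+ y. \<integral>\<^sup>+ p. indicator W (y, add_measure (\<eta> p) (dirac y)) \<partial>P \<partial>K)"
    if [measurable]: "W \<in> sets (borel \<Otimes>\<^sub>M N)" for W
  proof -
    have "emeasure \<mu>2 W = (\<integral>\<^sup>+ z. indicator W z \<partial>\<mu>2)" by (simp add: sets2)
    also have "\<dots> = (\<integral>\<^sup>+ z. indicator W ((\<lambda>(y, p). (y, add_measure (\<eta> p) (dirac y))) z) \<partial>(K \<Otimes>\<^sub>M P))"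
      unfolding \<mu>2_def by (rule nn_integral_distr) measurable
    also have "\<dots> = (\<integral>\<^sup>+ y. \<integral>\<^sup>+ p. indicator W (y, add_measure (\<eta> p) (dirac y)) \<partial>P \<partial>K)"
      by (subst nn_integral_fst[symmetric]) auto
    finally show ?thesis .
  qed
  define Ea where "Ea = {D \<in> sets borel. \<exists>i. D \<subseteq> C i}"
  define E where "E = {D \<times> Z | D Z. D \<in> Ea \<and> Z \<in> cylinders \<Omega>}"
  have \<Omega>cyl: "\<Omega> \<in> cylinders \<Omega>"
    unfolding cylinders_def by (intro CollectI exI[of _ "0::nat"]) auto
  have sets_Ea: "sets borel = sigma_sets UNIV Ea"
  proof
    show "sigma_sets UNIV Ea \<subseteq> sets borel"
      using sets.sigma_sets_subset[of Ea borel] by (auto simp: Ea_def)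
    show "sets borel \<subseteq> sigma_sets UNIV Ea"
    proof
      fix D :: "'a set" assume D: "D \<in> sets borel"
      have "D = (\<Union>i. D \<inter> C i)" using C_UN by auto
      moreover have "(\<Union>i. D \<inter> C i) \<in> sigma_sets UNIV Ea"
        by (rule sigma_sets.Union, rule sigma_sets.Basic) (use D in \<open>auto simp: Ea_def\<close>)
      ultimately show "D \<in> sigma_sets UNIV Ea" by simp
    qed
  qed
  have setsE: "sets (borel \<Otimes>\<^sub>M N) = sigma_sets (UNIV \<times> \<Omega>) E"
  proof -
    have cu: "countable (range C)" by simp
    have "sets (borel \<Otimes>\<^sub>M N) = sets (sigma (space borel \<times> space N) {a \<times> b | a b. a \<in> Ea \<and> b \<in> cylinders \<Omega>})"
      by (rule sets_pair_eq[where Ca = "range C" and Cb = "{\<Omega>}"])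
         (use sets_Ea \<Omega>cyl C_UN in \<open>auto simp: sets_eval_sigma_cylinders Ea_def cylinders_def\<close>)
    also have "\<dots> = sigma_sets (UNIV \<times> \<Omega>) E"
      unfolding E_def by (subst sets_measure_of) (auto simp: cylinders_def)
    finally show ?thesis .
  qed
  have "\<mu>1 = \<mu>2"
  proof (rule measure_eqI_generator_eq[of E "UNIV \<times> \<Omega>" _ _ "\<lambda>i. C i \<times> \<Omega>"])
    show "Int_stable E"
    proof (rule Int_stableI)
      fix a b assume "a \<in> E" "b \<in> E"
      then obtain D Z D' Z' where ab: "a = D \<times> Z" "b = D' \<times> Z'" "D \<in> Ea" "D' \<in> Ea" "Z \<in> cylinders \<Omega>" "Z' \<in> cylinders \<Omega>"
        unfolding E_def by blast
      have "D \<inter> D' \<in> Ea" using ab(3,4) unfolding Ea_def by blast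
      moreover have "Z \<inter> Z' \<in> cylinders \<Omega>" using ab Int_stableD[OF Int_stable_cylinders] by blast
      moreover have "a \<inter> b = (D \<inter> D') \<times> (Z \<inter> Z')" using ab by blast
      ultimately show "a \<inter> b \<in> E" unfolding E_def by blast
    qed
    show "E \<subseteq> Pow (UNIV \<times> \<Omega>)" by (auto simp: E_def cylinders_def)
    show "sets \<mu>1 = sigma_sets (UNIV \<times> \<Omega>) E" "sets \<mu>2 = sigma_sets (UNIV \<times> \<Omega>) E"
      by (simp_all only: sets1 sets2 setsE)
    have "C i \<in> Ea" for i by (auto simp: Ea_def)
    then show "range (\<lambda>i. C i \<times> \<Omega>) \<subseteq> E" unfolding E_def using \<Omega>cyl by blast
    show "(\<Union>i. C i \<times> \<Omega>) = UNIV \<times> \<Omega>" using C_UN by auto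
    have rect: "emeasure \<mu>1 (D \<times> Z) = (\<integral>\<^sup>+ y. indicator D y * emeasure P {p \<in> space P. add_measure (\<eta> p) (dirac y) \<in> Z} \<partial>K)"
      "emeasure \<mu>2 (D \<times> Z) = (\<integral>\<^sup>+ y. indicator D y * emeasure P {p \<in> space P. add_measure (\<eta> p) (dirac y) \<in> Z} \<partial>K)"
      if DE: "D \<in> Ea" and ZC: "Z \<in> cylinders \<Omega>" for D Z
    proof -
      have D[measurable]: "D \<in> sets borel" using DE by (simp add: Ea_def)
      have [measurable]: "Z \<in> sets N" by (rule cylinders_sets[OF ZC])
      have DZ: "D \<times> Z \<in> sets (borel \<Otimes>\<^sub>M N)" by (intro pair_measureI) auto
      obtain i where "D \<subseteq> C i" using DE by (auto simp: Ea_def)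
      then have "emeasure K D \<le> emeasure K (C i)" by (intro emeasure_mono) auto
      then have fin: "emeasure K D < \<infinity>" using K_fin[of i] by (rule le_less_trans)
      have "F (D \<times> Z) = (\<integral>\<^sup>+ p. emeasure (\<eta> p) D * indicator Z (\<eta> p) \<partial>P)"
        unfolding F_def
      proof (rule nn_integral_cong)
        fix p assume p: "p \<in> space P"
        have "(\<integral>\<^sup>+ y. indicator (D \<times> Z) (y, \<eta> p) \<partial>\<eta> p) = (\<integral>\<^sup>+ y. indicator D y * indicator Z (\<eta> p) \<partial>\<eta> p)"
          by (intro nn_integral_cong) (auto split: split_indicator)
        also have "\<dots> = (\<integral>\<^sup>+ y. indicator D y \<partial>\<eta> p) * indicator Z (\<eta> p)"
          by (rule nn_integral_multc, rule borel_measurable_indicator) (simp add: sb[OF p])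
        also have "(\<integral>\<^sup>+ y. indicator D y \<partial>\<eta> p) = emeasure (\<eta> p) D"
          by (rule nn_integral_indicator) (simp add: sb[OF p])
        finally show "(\<integral>\<^sup>+ y. indicator (D \<times> Z) (y, \<eta> p) \<partial>\<eta> p) = emeasure (\<eta> p) D * indicator Z (\<eta> p)" .
      qed
      then show "emeasure \<mu>1 (D \<times> Z) = (\<integral>\<^sup>+ y. indicator D y * emeasure P {p \<in> space P. add_measure (\<eta> p) (dirac y) \<in> Z} \<partial>K)"
        by (simp add: e1[OF DZ] mecke_rectangle[OF D fin ZC])
      show "emeasure \<mu>2 (D \<times> Z) = (\<integral>\<^sup>+ y. indicator D y * emeasure P {p \<in> space P. add_measure (\<eta> p) (dirac y) \<in> Z} \<partial>K)"
        unfolding e2[OF DZ]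
      proof (rule nn_integral_cong)
        fix y
        have "(\<integral>\<^sup>+ p. indicator (D \<times> Z) (y, add_measure (\<eta> p) (dirac y)) \<partial>P)
          = (\<integral>\<^sup>+ p. indicator D y * indicator {p \<in> space P. add_measure (\<eta> p) (dirac y) \<in> Z} p \<partial>P)"
          by (intro nn_integral_cong) (auto split: split_indicator)
        also have "\<dots> = indicator D y * (\<integral>\<^sup>+ p. indicator {p \<in> space P. add_measure (\<eta> p) (dirac y) \<in> Z} p \<partial>P)"
          by (rule nn_integral_cmult) measurable
        also have "(\<integral>\<^sup>+ p. indicator {p \<in> space P. add_measure (\<eta> p) (dirac y) \<in> Z} p \<partial>P)
          = emeasure P {p \<in> space P. add_measure (\<eta> p) (dirac y) \<in> Z}"
          by (rule nn_integral_indicator) measurable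
        finally show "(\<integral>\<^sup>+ p. indicator (D \<times> Z) (y, add_measure (\<eta> p) (dirac y)) \<partial>P)
          = indicator D y * emeasure P {p \<in> space P. add_measure (\<eta> p) (dirac y) \<in> Z}" .
      qed
    qed
    show "emeasure \<mu>1 X = emeasure \<mu>2 X" if "X \<in> E" for X
      using that rect unfolding E_def by auto
    fix i
    have "emeasure \<mu>1 (C i \<times> \<Omega>) = (\<integral>\<^sup>+ y. indicator (C i) y * emeasure P {p \<in> space P. add_measure (\<eta> p) (dirac y) \<in> \<Omega>} \<partial>K)"
      by (rule rect(1)) (auto simp: Ea_def \<Omega>cyl)
    also have "\<dots> \<le> (\<integral>\<^sup>+ y. indicator (C i) y * 1 \<partial>K)"
      by (intro nn_integral_mono mult_left_mono emeasure_le_1) auto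
    also have "\<dots> = emeasure K (C i)" by simp
    finally show "emeasure \<mu>1 (C i \<times> \<Omega>) \<noteq> \<infinity>" using K_fin[of i] by (auto simp: top_unique)
  qed
  then show ?thesis using e1[OF W] e2[OF W] by (simp add: F_def)
qed

lemma mecke:
  assumes "(\<lambda>(y, \<omega>). \<phi> y \<omega>) \<in> borel_measurable (borel \<Otimes>\<^sub>M N)"
  shows "(\<integral>\<^sup>+ p. \<integral>\<^sup>+ y. \<phi> y (\<eta> p) \<partial>\<eta> p \<partial>P) = (\<integral>\<^sup>+ y. \<integral>\<^sup>+ p. \<phi> y (add_measure (\<eta> p) (dirac y)) \<partial>P \<partial>K)"
proof -
  have sb: "sets (\<eta> p) = sets borel" if "p \<in> space P" for p by (simp add: sets_lf eta_lf that)
  have m1: "(\<lambda>y. u (y, \<eta> p)) \<in> borel_measurable (\<eta> p)"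
    if "p \<in> space P" "u \<in> borel_measurable (borel \<Otimes>\<^sub>M N)" for p and u :: "_ \<Rightarrow> ennreal"
  proof -
    have [measurable]: "u \<in> borel_measurable (borel \<Otimes>\<^sub>M N)" "\<eta> p \<in> space N" using that eta_lf by auto
    have "(\<lambda>y. u (y, \<eta> p)) \<in> borel_measurable borel" by measurable
    then show ?thesis by (simp add: measurable_cong_sets[OF sb[OF that(1)] refl])
  qed
  have m2: "(\<lambda>p. \<integral>\<^sup>+ y. u (y, \<eta> p) \<partial>\<eta> p) \<in> borel_measurable P"
    if [measurable]: "u \<in> borel_measurable (borel \<Otimes>\<^sub>M N)" for u :: "_ \<Rightarrow> ennreal"
    by (rule kernel_nn_integral_measurable) measurable
  have "(\<integral>\<^sup>+ p. \<integral>\<^sup>+ y. u (y, \<eta> p) \<partial>\<eta> p \<partial>P) = (\<integral>\<^sup>+ y. \<integral>\<^sup>+ p. u (y, add_measure (\<eta> p) (dirac y)) \<partial>P \<partial>K)"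
    if "u \<in> borel_measurable (borel \<Otimes>\<^sub>M N)" for u :: "_ \<Rightarrow> ennreal"
    using that
  proof (induction rule: borel_measurable_induct)
    case (cong u v)
    have 1: "u (y, \<eta> p) = v (y, \<eta> p)" if "p \<in> space P" for y p
      using cong(3) eta_lf[OF that] by (simp add: space_pair_measure)
    have 2: "u (y, add_measure (\<eta> p) (dirac y)) = v (y, add_measure (\<eta> p) (dirac y))" if "p \<in> space P" for y p
      using cong(3) lf_add_dirac[OF eta_lf[OF that]] by (simp add: space_pair_measure)
    show ?case using cong(4) by (simp add: 1 2 cong: nn_integral_cong)
  next
    case (set W)
    then show ?case by (rule mecke_set)
  next
    case (mult u c)
    note [measurable] = mult(2)
    have "(\<integral>\<^sup>+ p. \<integral>\<^sup>+ y. c * u (y, \<eta> p) \<partial>\<eta> p \<partial>P) = c * (\<integral>\<^sup>+ p. \<integral>\<^sup>+ y. u (y, \<eta> p) \<partial>\<eta> p \<partial>P)"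
      by (simp add: nn_integral_cmult[OF m1[OF _ mult(2)]] nn_integral_cmult[OF m2[OF mult(2)]] cong: nn_integral_cong)
    also have "\<dots> = (\<integral>\<^sup>+ y. \<integral>\<^sup>+ p. c * u (y, add_measure (\<eta> p) (dirac y)) \<partial>P \<partial>K)"
      by (simp add: mult(4) nn_integral_cmult)
    finally show ?case .
  next
    case (add u v)
    note [measurable] = add.hyps(1,3)
    have "(\<integral>\<^sup>+ p. \<integral>\<^sup>+ y. v (y, \<eta> p) + u (y, \<eta> p) \<partial>\<eta> p \<partial>P)
      = (\<integral>\<^sup>+ p. \<integral>\<^sup>+ y. v (y, \<eta> p) \<partial>\<eta> p \<partial>P) + (\<integral>\<^sup>+ p. \<integral>\<^sup>+ y. u (y, \<eta> p) \<partial>\<eta> p \<partial>P)"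
      by (simp add: nn_integral_add[OF m1[OF _ add.hyps(3)] m1[OF _ add.hyps(1)]] nn_integral_add[OF m2[OF add.hyps(3)] m2[OF add.hyps(1)]] cong: nn_integral_cong)
    also have "\<dots> = (\<integral>\<^sup>+ y. \<integral>\<^sup>+ p. v (y, add_measure (\<eta> p) (dirac y)) + u (y, add_measure (\<eta> p) (dirac y)) \<partial>P \<partial>K)"
      by (simp add: add.IH nn_integral_add)
    finally show ?case .
  next
    case (seq U)
    note [measurable] = seq(1)
    have inc: "incseq (\<lambda>i y. U i (y, \<omega> y))" for \<omega> using seq.hyps(3) by (auto simp: incseq_def le_fun_def)
    have inc2: "incseq (\<lambda>i p. \<integral>\<^sup>+ y. U i (y, \<eta> p) \<partial>\<eta> p)"
      using seq.hyps(3) by (auto simp: incseq_def le_fun_def intro!: nn_integral_mono)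
    have inc3: "incseq (\<lambda>i p. U i (y, add_measure (\<eta> p) (dirac y)))" for y
      using seq.hyps(3) by (auto simp: incseq_def le_fun_def)
    have inc4: "incseq (\<lambda>i y. \<integral>\<^sup>+ p. U i (y, add_measure (\<eta> p) (dirac y)) \<partial>P)"
      using seq.hyps(3) by (auto simp: incseq_def le_fun_def intro!: nn_integral_mono)
    have "(\<integral>\<^sup>+ p. \<integral>\<^sup>+ y. (SUP i. U i (y, \<eta> p)) \<partial>\<eta> p \<partial>P) = (\<integral>\<^sup>+ p. (SUP i. \<integral>\<^sup>+ y. U i (y, \<eta> p) \<partial>\<eta> p) \<partial>P)"
      by (intro nn_integral_cong nn_integral_monotone_convergence_SUP inc m1 seq.hyps)
    also have "\<dots> = (SUP i. \<integral>\<^sup>+ p. \<integral>\<^sup>+ y. U i (y, \<eta> p) \<partial>\<eta> p \<partial>P)"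
      by (intro nn_integral_monotone_convergence_SUP inc2 m2 seq.hyps)
    also have "\<dots> = (SUP i. \<integral>\<^sup>+ y. \<integral>\<^sup>+ p. U i (y, add_measure (\<eta> p) (dirac y)) \<partial>P \<partial>K)"
      by (simp add: seq.IH)
    also have "\<dots> = (\<integral>\<^sup>+ y. (SUP i. \<integral>\<^sup>+ p. U i (y, add_measure (\<eta> p) (dirac y)) \<partial>P) \<partial>K)"
      by (intro nn_integral_monotone_convergence_SUP[symmetric] inc4) measurable
    also have "\<dots> = (\<integral>\<^sup>+ y. \<integral>\<^sup>+ p. (SUP i. U i (y, add_measure (\<eta> p) (dirac y))) \<partial>P \<partial>K)"
      by (intro nn_integral_cong nn_integral_monotone_convergence_SUP[symmetric] inc3) measurable
    finally show ?case by (simp add: SUP_apply image_comp)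
  qed
  from this[OF assms] show ?thesis by simp
qed

text \<open>
  Sum over the first point of the tuple and apply the formula for one point, where the point
  is removed from the configuration on one side and added on the other.
\<close>

lemma multivariate_mecke:
  assumes "(\<lambda>(x, \<omega>). \<phi> x \<omega>) \<in> borel_measurable (tuple_space k \<Otimes>\<^sub>M N)"
  shows "(\<integral>\<^sup>+ p. tsum k (\<eta> p) (\<lambda>x. \<phi> x (\<eta> p)) \<partial>P)
    = (\<integral>\<^sup>+ x. \<integral>\<^sup>+ p. \<phi> x (add_measure (\<eta> p) (dirac_sum k x)) \<partial>P \<partial>measure_power k K)"
  using assms
proof (induction k arbitrary: \<phi>)
  case 0
  have "add_measure (\<eta> p) (dirac_sum 0 x) = \<eta> p" if "p \<in> space P" for p x
    by (rule measure_eq_borelI) (auto simp: sets_lf eta_lf that emeasure_add_measure emeasure_dirac_sum)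
  then show ?case by (simp add: PW.nn_integral_measure_power_0 cong: nn_integral_cong)
next
  case (Suc k)
  note [measurable] = Suc.prems
  have idN[measurable]: "(\<lambda>z. snd z) \<in> borel \<Otimes>\<^sub>M N \<rightarrow>\<^sub>M N" by measurable
  define \<psi> where "\<psi> y \<omega> = tsum k (remove_point y \<omega>) (\<lambda>w. \<phi> (tuple_cons k y w) \<omega>)" for y \<omega>
  have "(\<integral>\<^sup>+ p. tsum (Suc k) (\<eta> p) (\<lambda>x. \<phi> x (\<eta> p)) \<partial>P) = (\<integral>\<^sup>+ p. \<integral>\<^sup>+ y. \<psi> y (\<eta> p) \<partial>\<eta> p \<partial>P)"
  proof (rule nn_integral_cong)
    fix p assume p: "p \<in> space P"
    then have [measurable]: "\<eta> p \<in> space N" using eta_lf by simp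
    have "(\<lambda>x. \<phi> x (\<eta> p)) \<in> borel_measurable (tuple_space (Suc k))" by measurable
    then show "tsum (Suc k) (\<eta> p) (\<lambda>x. \<phi> x (\<eta> p)) = (\<integral>\<^sup>+ y. \<psi> y (\<eta> p) \<partial>\<eta> p)"
      unfolding \<psi>_def by (rule tsum_Suc[OF eta_lf[OF p]])
  qed
  also have "\<dots> = (\<integral>\<^sup>+ y. \<integral>\<^sup>+ p. \<psi> y (add_measure (\<eta> p) (dirac y)) \<partial>P \<partial>K)"
    by (rule mecke) (unfold \<psi>_def, measurable)
  also have "\<dots> = (\<integral>\<^sup>+ y. \<integral>\<^sup>+ p. tsum k (\<eta> p) (\<lambda>w. \<phi> (tuple_cons k y w) (add_measure (\<eta> p) (dirac y))) \<partial>P \<partial>K)"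
    unfolding \<psi>_def
    by (intro nn_integral_cong) (simp add: remove_point_add_dirac counting_of_lf[OF eta_lf])
  also have "\<dots> = (\<integral>\<^sup>+ y. \<integral>\<^sup>+ w. \<integral>\<^sup>+ p. \<phi> (tuple_cons k y w) (add_measure (add_measure (\<eta> p) (dirac_sum k w)) (dirac y)) \<partial>P \<partial>measure_power k K \<partial>K)"
  proof (rule nn_integral_cong)
    fix y
    show "(\<integral>\<^sup>+ p. tsum k (\<eta> p) (\<lambda>w. \<phi> (tuple_cons k y w) (add_measure (\<eta> p) (dirac y))) \<partial>P)
      = (\<integral>\<^sup>+ w. \<integral>\<^sup>+ p. \<phi> (tuple_cons k y w) (add_measure (add_measure (\<eta> p) (dirac_sum k w)) (dirac y)) \<partial>P \<partial>measure_power k K)"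
      by (rule Suc.IH) measurable
  qed
  also have "\<dots> = (\<integral>\<^sup>+ y. \<integral>\<^sup>+ w. \<integral>\<^sup>+ p. \<phi> (tuple_cons k y w) (add_measure (\<eta> p) (dirac_sum (Suc k) (tuple_cons k y w))) \<partial>P \<partial>measure_power k K \<partial>K)"
  proof (intro nn_integral_cong)
    fix y w p assume p: "p \<in> space P"
    have "add_measure (add_measure (\<eta> p) (dirac_sum k w)) (dirac y) = add_measure (\<eta> p) (dirac_sum (Suc k) (tuple_cons k y w))"
      by (rule measure_eq_borelI)
         (auto simp: sets_lf eta_lf p emeasure_add_measure emeasure_dirac_sum add_ac sum.lessThan_Suc_shift simp del: sum.lessThan_Suc)
    then show "\<phi> (tuple_cons k y w) (add_measure (add_measure (\<eta> p) (dirac_sum k w)) (dirac y))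
      = \<phi> (tuple_cons k y w) (add_measure (\<eta> p) (dirac_sum (Suc k) (tuple_cons k y w)))" by simp
  qed
  also have "\<dots> = (\<integral>\<^sup>+ x. \<integral>\<^sup>+ p. \<phi> x (add_measure (\<eta> p) (dirac_sum (Suc k) x)) \<partial>P \<partial>measure_power (Suc k) K)"
  proof (rule PW.nn_integral_measure_power_Suc[symmetric])
    have [measurable]: "(\<lambda>z. fst z i) \<in> tuple_space (Suc k) \<Otimes>\<^sub>M P \<rightarrow>\<^sub>M (borel :: 'a measure)" if "i < Suc k" for i
      by (rule measurable_tuple_component[OF measurable_fst that])
    show "(\<lambda>x. \<integral>\<^sup>+ p. \<phi> x (add_measure (\<eta> p) (dirac_sum (Suc k) x)) \<partial>P) \<in> borel_measurable (tuple_space (Suc k))"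
      by measurable
  qed
  finally show ?case .
qed

end

section \<open>Measurability of set relations in the Fell topology\<close>

lemma compact_closure_basis:
  assumes "locally_compact_space (euclidean :: 'a::{second_countable_topology, t2_space} topology)"
  obtains \<C> :: "'a::{second_countable_topology, t2_space} set set" where "countable \<C>" "\<And>U. U \<in> \<C> \<Longrightarrow> open U" "\<And>U. U \<in> \<C> \<Longrightarrow> compact (closure U)"
    "\<And>W x. open W \<Longrightarrow> x \<in> W \<Longrightarrow> \<exists>U\<in>\<C>. x \<in> U \<and> closure U \<subseteq> W"
proof -
  obtain \<B> :: "'a set set" where \<B>: "countable \<B>" "topological_basis \<B>"
    using ex_countable_basis by blast
  define \<C> where "\<C> = {U \<in> \<B>. compact (closure U)}"
  have "Hausdorff_space (euclidean :: 'a topology)"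
    unfolding Hausdorff_space_def disjnt_def using hausdorff by (simp, blast)
  then have "regular_space (euclidean :: 'a topology)"
    using locally_compact_Hausdorff_imp_regular_space assms by blast
  then have nb: "neighbourhood_base_of (\<lambda>C. compactin euclidean C \<and> closedin euclidean C) (euclidean :: 'a topology)"
    using locally_compact_regular_space_neighbourhood_base assms by blast
  have "\<exists>U\<in>\<C>. x \<in> U \<and> closure U \<subseteq> W" if W: "open W" "x \<in> W" for W and x :: 'a
  proof -
    obtain V D where V: "open V" "compact D" "closed D" "x \<in> V" "V \<subseteq> D" "D \<subseteq> W"
      using nb[unfolded neighbourhood_base_of, rule_format, of W x] W by auto
    obtain U where U: "U \<in> \<B>" "x \<in> U" "U \<subseteq> V"
      using topological_basisE[OF \<B>(2) V(1,4)] by metis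
    have "closure U \<subseteq> D" using U V by (intro closure_minimal) auto
    moreover from this have "compact (closure U)"
      using compact_Int_closed[OF V(2) closed_closure, of U] by (simp add: Int_absorb1)
    ultimately show ?thesis using U V unfolding \<C>_def by blast
  qed
  moreover have "countable \<C>" using \<B>(1) unfolding \<C>_def by (rule countable_subset[rotated]) auto
  moreover have "open U" "compact (closure U)" if "U \<in> \<C>" for U
    using that topological_basis_open[OF \<B>(2)] by (auto simp: \<C>_def)
  ultimately show thesis using that by blast
qed

lemma space_closed_set_space[simp]: "space closed_set_space = {F. closed F}"
  unfolding closed_set_space_def by (rule space_measure_of) auto

lemma closed_of_measurable: "X \<in> T \<rightarrow>\<^sub>M closed_set_space \<Longrightarrow> t \<in> space T \<Longrightarrow> closed (X t)"
  using measurable_space[of X T closed_set_space t] by simp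

lemma hit_compact: "compact D \<Longrightarrow> {F. closed F \<and> F \<inter> D \<noteq> {}} \<in> sets closed_set_space"
  unfolding closed_set_space_def by (subst sets_measure_of) (auto intro!: sigma_sets.Basic)

lemma pred_hit_compact:
  assumes "X \<in> T \<rightarrow>\<^sub>M closed_set_space" "compact D"
  shows "Measurable.pred T (\<lambda>t. X t \<inter> D \<noteq> {})"
proof -
  have "{t \<in> space T. X t \<inter> D \<noteq> {}} = X -` {F. closed F \<and> F \<inter> D \<noteq> {}} \<inter> space T"
    using closed_of_measurable[OF assms(1)] by auto
  then show ?thesis using measurable_sets[OF assms(1) hit_compact[OF assms(2)]] by (simp add: pred_def)
qed

lemma pred_hit_open:
  fixes X :: "'t \<Rightarrow> 'a::{second_countable_topology, t2_space} set"
  assumes lc: "locally_compact_space (euclidean :: 'a topology)"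
    and X: "X \<in> T \<rightarrow>\<^sub>M closed_set_space" and W: "open W"
  shows "Measurable.pred T (\<lambda>t. X t \<inter> W \<noteq> {})"
proof -
  obtain \<C> :: "'a set set" where \<C>: "countable \<C>" "\<And>U. U \<in> \<C> \<Longrightarrow> open U" "\<And>U. U \<in> \<C> \<Longrightarrow> compact (closure U)"
    "\<And>W x. open W \<Longrightarrow> x \<in> W \<Longrightarrow> \<exists>U\<in>\<C>. x \<in> U \<and> closure U \<subseteq> W" by (rule compact_closure_basis[OF lc]) (rule that)
  have "X t \<inter> W \<noteq> {} \<longleftrightarrow> (\<exists>U\<in>{U \<in> \<C>. closure U \<subseteq> W}. X t \<inter> closure U \<noteq> {})" for t
  proof
    assume "X t \<inter> W \<noteq> {}"
    then obtain x where x: "x \<in> X t" "x \<in> W" by auto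
    obtain U where "U \<in> \<C>" "x \<in> U" "closure U \<subseteq> W" using \<C>(4)[OF W x(2)] by auto
    then show "\<exists>U\<in>{U \<in> \<C>. closure U \<subseteq> W}. X t \<inter> closure U \<noteq> {}" using x closure_subset[of U] by blast
  qed blast
  moreover have "Measurable.pred T (\<lambda>t. \<exists>U\<in>{U \<in> \<C>. closure U \<subseteq> W}. X t \<inter> closure U \<noteq> {})"
    using \<C>(1) by (intro measurable_pred_countable(2) pred_hit_compact[OF X] \<C>(3)) auto
  ultimately show ?thesis by simp
qed

text \<open>
  If a point of \<open>X t\<close> is not in \<open>Y t\<close>, a basis set around it has its compact closure outside
  \<open>Y t\<close>. So the inclusion is a countable condition on which open sets \<open>X t\<close> meets and which
  compact sets \<open>Y t\<close> meets.
\<close>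

lemma pred_closed_subset:
  fixes X Y :: "'t \<Rightarrow> 'a::{second_countable_topology, t2_space} set"
  assumes lc: "locally_compact_space (euclidean :: 'a topology)"
    and X: "X \<in> T \<rightarrow>\<^sub>M closed_set_space" and Y: "Y \<in> T \<rightarrow>\<^sub>M closed_set_space"
  shows "Measurable.pred T (\<lambda>t. X t \<subseteq> Y t)"
proof -
  obtain \<C> :: "'a set set" where \<C>: "countable \<C>" "\<And>U. U \<in> \<C> \<Longrightarrow> open U" "\<And>U. U \<in> \<C> \<Longrightarrow> compact (closure U)"
    "\<And>W x. open W \<Longrightarrow> x \<in> W \<Longrightarrow> \<exists>U\<in>\<C>. x \<in> U \<and> closure U \<subseteq> W" by (rule compact_closure_basis[OF lc]) (rule that)
  have eq: "X t \<subseteq> Y t \<longleftrightarrow> \<not> (\<exists>U\<in>\<C>. X t \<inter> U \<noteq> {} \<and> \<not> (Y t \<inter> closure U \<noteq> {}))" if t: "t \<in> space T" for t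
  proof
    assume *: "\<not> (\<exists>U\<in>\<C>. X t \<inter> U \<noteq> {} \<and> \<not> (Y t \<inter> closure U \<noteq> {}))"
    show "X t \<subseteq> Y t"
    proof (rule subsetI, rule ccontr)
      fix x assume x: "x \<in> X t" "x \<notin> Y t"
      have "open (- Y t)" using closed_of_measurable[OF Y t] by (simp add: open_Compl)
      then obtain U where "U \<in> \<C>" "x \<in> U" "closure U \<subseteq> - Y t" using \<C>(4)[of "- Y t" x] x by auto
      then show False using * x by blast
    qed
  qed (use closure_subset in blast)
  have "Measurable.pred T (\<lambda>t. \<not> (\<exists>U\<in>\<C>. X t \<inter> U \<noteq> {} \<and> \<not> (Y t \<inter> closure U \<noteq> {})))"
    using \<C>(1)
    by (intro pred_intros_logic measurable_pred_countable(2) pred_hit_compact[OF Y] pred_hit_open[OF lc X] \<C>(2,3)) auto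
  then show ?thesis by (rule measurable_cong[THEN iffD2, rotated]) (rule eq)
qed

text \<open>
  Within a compact set disjoint closed sets are separated by a finite union \<open>A\<close> of basis sets
  that covers the part of \<open>X t\<close> and whose closures miss \<open>Y t\<close>; there are only countably many
  such unions.
\<close>

lemma pred_closed_disjoint:
  fixes X Y :: "'t \<Rightarrow> 'a::{second_countable_topology, t2_space} set"
  assumes lc: "locally_compact_space (euclidean :: 'a topology)"
    and X: "X \<in> T \<rightarrow>\<^sub>M closed_set_space" and Y: "Y \<in> T \<rightarrow>\<^sub>M closed_set_space"
  shows "Measurable.pred T (\<lambda>t. X t \<inter> Y t = {})"
proof -
  obtain \<C> :: "'a set set" where \<C>: "countable \<C>" "\<And>U. U \<in> \<C> \<Longrightarrow> open U" "\<And>U. U \<in> \<C> \<Longrightarrow> compact (closure U)"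
    "\<And>W x. open W \<Longrightarrow> x \<in> W \<Longrightarrow> \<exists>U\<in>\<C>. x \<in> U \<and> closure U \<subseteq> W" by (rule compact_closure_basis[OF lc]) (rule that)
  define \<F> where "\<F> = {A. finite A \<and> A \<subseteq> \<C>}"
  have c\<F>: "countable \<F>" using countable_Collect_finite_subset[OF \<C>(1)] by (simp add: \<F>_def)
  have fin: "compact (\<Union>(closure ` A))" "open (\<Union>A)" if "A \<in> \<F>" for A
    using that \<C>(2,3) by (auto simp: \<F>_def intro!: compact_UN)
  define Q where "Q t V A \<longleftrightarrow> \<not> (Y t \<inter> \<Union>(closure ` A) \<noteq> {}) \<and> \<not> (X t \<inter> (closure V - \<Union>A) \<noteq> {})" for t V A
  have eq: "X t \<inter> Y t = {} \<longleftrightarrow> (\<forall>V\<in>\<C>. \<exists>A\<in>\<F>. Q t V A)" if t: "t \<in> space T" for t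
  proof
    assume disj: "X t \<inter> Y t = {}"
    show "\<forall>V\<in>\<C>. \<exists>A\<in>\<F>. Q t V A"
    proof
      fix V assume V: "V \<in> \<C>"
      have "compact (closure V \<inter> X t)"
        using \<C>(3)[OF V] closed_of_measurable[OF X t] by (rule compact_Int_closed)
      moreover have "\<exists>U\<in>\<C>. x \<in> U \<and> closure U \<subseteq> - Y t" if "x \<in> closure V \<inter> X t" for x
        using that disj closed_of_measurable[OF Y t] by (intro \<C>(4)) (auto simp: open_Compl)
      then have "closure V \<inter> X t \<subseteq> \<Union>{U \<in> \<C>. closure U \<subseteq> - Y t}" by blast
      ultimately obtain A where A: "A \<subseteq> {U \<in> \<C>. closure U \<subseteq> - Y t}" "finite A" "closure V \<inter> X t \<subseteq> \<Union>A"
        using compactE[of "closure V \<inter> X t" "{U \<in> \<C>. closure U \<subseteq> - Y t}"] \<C>(2) by auto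
      then have "A \<in> \<F>" by (auto simp: \<F>_def)
      moreover have "Q t V A" unfolding Q_def using A by blast
      ultimately show "\<exists>A\<in>\<F>. Q t V A" ..
    qed
  next
    assume *: "\<forall>V\<in>\<C>. \<exists>A\<in>\<F>. Q t V A"
    show "X t \<inter> Y t = {}"
    proof (rule ccontr)
      assume "X t \<inter> Y t \<noteq> {}"
      then obtain x where x: "x \<in> X t" "x \<in> Y t" by auto
      obtain V where V: "V \<in> \<C>" "x \<in> V" using \<C>(4)[of UNIV x] by auto
      obtain A where A: "Q t V A" using * V by auto
      have "x \<in> closure V" using V closure_subset by auto
      then have "x \<in> \<Union>A" using A x by (auto simp: Q_def)
      then have "x \<in> \<Union>(closure ` A)" using closure_subset by blast
      then show False using A x by (auto simp: Q_def)
    qed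
  qed
  have mQ: "Measurable.pred T (\<lambda>t. Q t V A)" if "V \<in> \<C>" "A \<in> \<F>" for V A
    unfolding Q_def
    using that \<C>(3) fin
    by (intro pred_intros_logic pred_hit_compact[OF Y] pred_hit_compact[OF X])
       (auto intro!: compact_diff)
  have "Measurable.pred T (\<lambda>t. \<forall>V\<in>\<C>. \<exists>A\<in>\<F>. Q t V A)"
    by (intro measurable_pred_countable mQ \<C>(1) c\<F>)
  then show ?thesis by (rule measurable_cong[THEN iffD2, rotated]) (rule eq)
qed

section \<open>Counting points of finite counting measures\<close>

lemma (in exhaustion) measurable_dirac_sum[measurable (raw)]:
  assumes "\<And>i. i < m \<Longrightarrow> (\<lambda>t. x t i) \<in> T \<rightarrow>\<^sub>M borel"
  shows "(\<lambda>t. dirac_sum m (x t)) \<in> T \<rightarrow>\<^sub>M N"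
proof -
  have [measurable]: "(\<lambda>_. null_measure borel) \<in> T \<rightarrow>\<^sub>M N"
    by (intro measurable_const) (simp add: lf_null)
  have "add_measure (null_measure borel) (dirac_sum m z) = dirac_sum m z" for z :: "nat \<Rightarrow> 'a"
    by (rule measure_eq_borelI) (auto simp: emeasure_add_measure)
  moreover have "(\<lambda>t. add_measure (null_measure borel) (dirac_sum m (x t))) \<in> T \<rightarrow>\<^sub>M N"
    using assms by measurable
  ultimately show ?thesis by simp
qed

lemma nn_integral_counting_cong:
  fixes \<omega> :: "'a::{second_countable_topology, t2_space} measure"
  assumes w: "\<omega> \<in> counting_measures" and f: "f \<in> borel_measurable borel" "g \<in> borel_measurable borel"
    and eq: "\<And>y. 1 \<le> emeasure \<omega> {y} \<Longrightarrow> f y = g y"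
  shows "(\<integral>\<^sup>+ y. f y \<partial>\<omega>) = (\<integral>\<^sup>+ y. g y \<partial>\<omega>)"
  unfolding nn_integral_counting[OF w f(1)] nn_integral_counting[OF w f(2)]
proof (rule nn_integral_cong)
  fix a assume "a \<in> space (count_space (point_indices \<omega>))"
  then have a: "of_nat (snd a) < emeasure \<omega> {fst a}" by (auto simp: point_indices_def)
  obtain n :: nat where n: "emeasure \<omega> {fst a} = of_nat n" by (rule counting_singletonE[OF w])
  have "snd a < n" using a by (simp add: n)
  then have "of_nat 1 \<le> (of_nat n :: ennreal)" by (subst of_nat_le_iff) auto
  then show "f (fst a) = g (fst a)" by (intro eq) (simp add: n)
qed

text \<open>
  The parameter \<open>dummy\<close> only fixes the type of the points; the locale is the case of a
  constant exhaustion.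
\<close>

locale finite_counting =
  fixes dummy :: "'a::{second_countable_topology, t2_space} itself"
begin

sublocale exhaustion "\<lambda>_. UNIV :: 'a set"
  by standard (auto simp: incseq_def)

lemma fin_iff: "\<omega> \<in> \<Omega> \<longleftrightarrow> \<omega> \<in> finite_counting_measures"
  by (simp add: locally_finite_UNIV)

lemma N_eq: "finite_N_space = N"
  by (simp add: finite_N_space_def locally_finite_UNIV)

definition npts :: "'a measure \<Rightarrow> nat" where
  "npts \<omega> = nat \<lfloor>enn2real (emeasure \<omega> UNIV)\<rfloor>"

lemma npts: "\<omega> \<in> \<Omega> \<Longrightarrow> emeasure \<omega> UNIV = of_nat (npts \<omega>)"
proof -
  assume w: "\<omega> \<in> \<Omega>"
  then obtain n :: nat where "emeasure \<omega> UNIV = of_nat n"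
    using counting_values[OF counting_of_lf[OF w], of UNIV] by (auto simp: locally_finite_def)
  then show ?thesis by (simp add: npts_def)
qed

lemma measurable_npts[measurable]: "npts \<in> N \<rightarrow>\<^sub>M count_space UNIV"
  unfolding npts_def by measurable

lemma remove_point_decompose:
  assumes "\<omega> \<in> \<Omega>" "1 \<le> emeasure \<omega> {y}"
  shows "remove_point y \<omega> \<in> \<Omega>" "\<omega> = add_measure (remove_point y \<omega>) (dirac y)" "npts \<omega> = Suc (npts (remove_point y \<omega>))"
proof -
  obtain \<nu> where \<nu>: "\<nu> \<in> counting_measures" "\<omega> = add_measure \<nu> (dirac y)"
    using counting_decompose[OF counting_of_lf[OF assms(1)] assms(2)] .
  have r: "remove_point y \<omega> = \<nu>" unfolding \<nu>(2) by (rule remove_point_add_dirac[OF \<nu>(1)])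
  show 1: "remove_point y \<omega> \<in> \<Omega>" by (rule lf_remove_point[OF assms(1)])
  show 2: "\<omega> = add_measure (remove_point y \<omega>) (dirac y)" unfolding r by (rule \<nu>(2))
  have "emeasure \<omega> UNIV = emeasure (remove_point y \<omega>) UNIV + 1"
    by (subst 2) (simp add: emeasure_add_measure sets_lf[OF 1] emeasure_dirac_sum)
  then have "(of_nat (npts \<omega>) :: ennreal) = of_nat (Suc (npts (remove_point y \<omega>)))"
    by (simp add: npts[OF 1] npts[OF assms(1)] add.commute)
  then show "npts \<omega> = Suc (npts (remove_point y \<omega>))" by (simp only: of_nat_eq_iff)
qed

lemma nn_integral_const_lf: "\<omega> \<in> \<Omega> \<Longrightarrow> (\<integral>\<^sup>+ y. c \<partial>\<omega>) = of_nat (npts \<omega>) * c"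
  by (simp add: space_lf npts mult.commute)

text \<open>The number of injective tuples, chosen one point at a time.\<close>

lemma tsum_one: "\<omega> \<in> \<Omega> \<Longrightarrow> j \<le> npts \<omega> \<Longrightarrow> tsum j \<omega> (\<lambda>_. 1) = ennreal (fact (npts \<omega>) / fact (npts \<omega> - j))"
proof (induction j arbitrary: \<omega>)
  case (Suc j)
  note w = Suc.prems(1)
  obtain n where n: "npts \<omega> = Suc n" using Suc.prems by (cases "npts \<omega>") auto
  have [measurable]: "(\<lambda>_. \<omega>) \<in> borel \<rightarrow>\<^sub>M N" by (intro measurable_const) (simp add: w)
  have "tsum (Suc j) \<omega> (\<lambda>_. 1) = (\<integral>\<^sup>+ y. tsum j (remove_point y \<omega>) (\<lambda>_. 1) \<partial>\<omega>)"
    by (rule tsum_Suc[OF w]) simp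
  also have "\<dots> = (\<integral>\<^sup>+ y. ennreal (fact n / fact (n - j)) \<partial>\<omega>)"
  proof (rule nn_integral_counting_cong[OF counting_of_lf[OF w]])
    show "(\<lambda>y. tsum j (remove_point y \<omega>) (\<lambda>_. 1)) \<in> borel_measurable borel" by measurable
    fix y assume y: "1 \<le> emeasure \<omega> {y}"
    note r = remove_point_decompose[OF w y]
    then have "npts (remove_point y \<omega>) = n" by (simp add: n)
    then show "tsum j (remove_point y \<omega>) (\<lambda>_. 1) = ennreal (fact n / fact (n - j))"
      using Suc.IH[OF r(1)] Suc.prems n by simp
  qed simp
  also have "\<dots> = ennreal (real (Suc n) * (fact n / fact (n - j)))"
    by (simp only: nn_integral_const_lf[OF w] n ennreal_of_nat_eq_real_of_nat) (rule ennreal_mult[symmetric], auto)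
  also have "real (Suc n) * (fact n / fact (n - j)) = fact (Suc n) / fact (Suc n - Suc j)"
    by simp
  finally show ?case by (simp add: n)
qed simp

text \<open>
  A tuple of maximal length uses every point of \<open>\<omega>\<close>, so it reproduces \<open>\<omega>\<close>, in \<open>fact n\<close> orders.
\<close>

lemma tsum_dirac_sum_all:
  assumes "\<omega> \<in> \<Omega>" "npts \<omega> = n" "\<Phi> \<in> borel_measurable N"
  shows "tsum n \<omega> (\<lambda>x. \<Phi> (dirac_sum n x)) = ennreal (fact n) * \<Phi> \<omega>"
  using assms
proof (induction n arbitrary: \<omega> \<Phi>)
  case 0
  have "emeasure \<omega> UNIV = 0" using npts[OF 0(1)] 0 by simp
  have "emeasure \<omega> B = 0" if B: "B \<in> sets borel" for B
  proof -
    have "emeasure \<omega> B \<le> emeasure \<omega> UNIV" by (rule emeasure_mono) (auto simp: sets_lf 0)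
    then show ?thesis using \<open>emeasure \<omega> UNIV = 0\<close> by simp
  qed
  then have "dirac_sum 0 (\<lambda>_. undefined) = \<omega>"
    by (intro measure_eq_borelI) (auto simp: emeasure_dirac_sum sets_lf 0)
  then show ?case by simp
next
  case (Suc n)
  note w = Suc.prems(1) and \<Phi>[measurable] = Suc.prems(3)
  have [measurable]: "(\<lambda>_. \<omega>) \<in> borel \<rightarrow>\<^sub>M N" by (intro measurable_const) (simp add: w)
  have comp: "(\<lambda>x. x i) \<in> tuple_space m \<rightarrow>\<^sub>M (borel :: 'a measure)" if "i < m" for i m
    by (rule measurable_tuple_component[where x = "\<lambda>x. x", OF _ that]) simp
  have [measurable]: "(\<lambda>x. dirac_sum m x) \<in> tuple_space m \<rightarrow>\<^sub>M N" for m
    by (rule measurable_dirac_sum) (rule comp)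
  have ds: "dirac_sum (Suc n) (tuple_cons n y w) = add_measure (dirac_sum n w) (dirac y)" for y :: 'a and w
    by (rule measure_eq_borelI)
       (auto simp: emeasure_add_measure emeasure_dirac_sum add_ac sum.lessThan_Suc_shift simp del: sum.lessThan_Suc)
  have "tsum (Suc n) \<omega> (\<lambda>x. \<Phi> (dirac_sum (Suc n) x))
    = (\<integral>\<^sup>+ y. tsum n (remove_point y \<omega>) (\<lambda>w. \<Phi> (dirac_sum (Suc n) (tuple_cons n y w))) \<partial>\<omega>)"
    by (rule tsum_Suc[OF w]) measurable
  also have "\<dots> = (\<integral>\<^sup>+ y. ennreal (fact n) * \<Phi> \<omega> \<partial>\<omega>)"
  proof (rule nn_integral_counting_cong[OF counting_of_lf[OF w]])
    show "(\<lambda>y. tsum n (remove_point y \<omega>) (\<lambda>w. \<Phi> (dirac_sum (Suc n) (tuple_cons n y w)))) \<in> borel_measurable borel"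
      by measurable
    fix y assume y: "1 \<le> emeasure \<omega> {y}"
    note r = remove_point_decompose[OF w y]
    have "(\<lambda>\<mu>. \<Phi> (add_measure \<mu> (dirac y))) \<in> borel_measurable N" by measurable
    then show "tsum n (remove_point y \<omega>) (\<lambda>w. \<Phi> (dirac_sum (Suc n) (tuple_cons n y w))) = ennreal (fact n) * \<Phi> \<omega>"
      unfolding ds using Suc.IH[OF r(1), of "\<lambda>\<mu>. \<Phi> (add_measure \<mu> (dirac y))"] r(2,3) Suc.prems(2) by simp
  qed simp
  also have "\<dots> = (ennreal (real (Suc n)) * ennreal (fact n)) * \<Phi> \<omega>"
    by (simp only: nn_integral_const_lf[OF w] Suc.prems(2) ennreal_of_nat_eq_real_of_nat mult.assoc)
  also have "ennreal (real (Suc n)) * ennreal (fact n) = ennreal (fact (Suc n))"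
    by (subst ennreal_mult[symmetric]) auto
  finally show ?case .
qed

text \<open>
  A tuple of length \<open>j\<close> survives the removal of a point unless the point belongs to it, which
  leaves \<open>npts \<omega> - j\<close> choices.
\<close>

lemma nn_integral_tsum_remove_point:
  assumes w: "\<omega> \<in> \<Omega>" and \<Phi>[measurable]: "\<Phi> \<in> borel_measurable (tuple_space j)" and sym: "tuple_sym j \<Phi>"
    and fin: "tsum j \<omega> \<Phi> < \<infinity>" and j: "j \<le> npts \<omega>"
  shows "(\<integral>\<^sup>+ y. tsum j (remove_point y \<omega>) \<Phi> \<partial>\<omega>) = of_nat (npts \<omega> - j) * tsum j \<omega> \<Phi>"
proof -
  have [measurable]: "(\<lambda>_. \<omega>) \<in> borel \<rightarrow>\<^sub>M N" by (intro measurable_const) (simp add: w)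
  have m[measurable]: "(\<lambda>y. tsum j (remove_point y \<omega>) \<Phi>) \<in> borel_measurable borel" by measurable
  have [measurable_cong]: "sets \<omega> = sets borel" by (rule sets_lf[OF w])
  have "of_nat (npts \<omega> - j) * tsum j \<omega> \<Phi> + of_nat j * tsum j \<omega> \<Phi> = of_nat (npts \<omega>) * tsum j \<omega> \<Phi>"
    using j by (simp add: distrib_right[symmetric] flip: of_nat_add)
  also have "\<dots> = (\<integral>\<^sup>+ y. tsum j \<omega> \<Phi> \<partial>\<omega>)" by (simp only: nn_integral_const_lf[OF w])
  also have "\<dots> = (\<integral>\<^sup>+ y. tsum j (remove_point y \<omega>) \<Phi> \<partial>\<omega>) + of_nat j * tsum j \<omega> \<Phi>"
  proof (cases j)
    case (Suc i)
    have \<Phi>'[measurable]: "\<Phi> \<in> borel_measurable (tuple_space (Suc i))" using \<Phi> Suc by simp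
    have m2[measurable]: "(\<lambda>y. tsum i (remove_point y \<omega>) (\<lambda>w. \<Phi> (tuple_cons i y w))) \<in> borel_measurable borel"
      by measurable
    have "(\<integral>\<^sup>+ y. tsum j \<omega> \<Phi> \<partial>\<omega>) = (\<integral>\<^sup>+ y. tsum j (remove_point y \<omega>) \<Phi>
        + of_nat j * tsum i (remove_point y \<omega>) (\<lambda>w. \<Phi> (tuple_cons i y w)) \<partial>\<omega>)"
    proof (rule nn_integral_counting_cong[OF counting_of_lf[OF w]])
      fix y assume y: "1 \<le> emeasure \<omega> {y}"
      note r = remove_point_decompose[OF w y]
      show "tsum j \<omega> \<Phi> = tsum j (remove_point y \<omega>) \<Phi> + of_nat j * tsum i (remove_point y \<omega>) (\<lambda>w. \<Phi> (tuple_cons i y w))"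
        using tsum_add_dirac[OF counting_of_lf[OF r(1)], of i \<Phi> y] sym r(2) by (simp add: Suc)
    qed measurable
    also have "\<dots> = (\<integral>\<^sup>+ y. tsum j (remove_point y \<omega>) \<Phi> \<partial>\<omega>)
        + of_nat j * (\<integral>\<^sup>+ y. tsum i (remove_point y \<omega>) (\<lambda>w. \<Phi> (tuple_cons i y w)) \<partial>\<omega>)"
      by (subst nn_integral_add) (auto simp: nn_integral_cmult)
    also have "(\<integral>\<^sup>+ y. tsum i (remove_point y \<omega>) (\<lambda>w. \<Phi> (tuple_cons i y w)) \<partial>\<omega>) = tsum j \<omega> \<Phi>"
      using tsum_Suc[OF w \<Phi>'] by (simp add: Suc)
    finally show ?thesis .
  qed simp
  finally have eq: "of_nat j * tsum j \<omega> \<Phi> + of_nat (npts \<omega> - j) * tsum j \<omega> \<Phi>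
    = of_nat j * tsum j \<omega> \<Phi> + (\<integral>\<^sup>+ y. tsum j (remove_point y \<omega>) \<Phi> \<partial>\<omega>)" by (simp only: add.commute)
  have "of_nat j * tsum j \<omega> \<Phi> \<noteq> top" using fin by (simp add: ennreal_mult_eq_top_iff of_nat_less_top less_top)
  then show ?thesis using eq by (simp add: ennreal_add_left_cancel)
qed

end

section \<open>Weights of the Stein solution\<close>

text \<open>
  The kept, removed and new points of the interpolation with thinning probability \<open>t\<close>
  contribute powers of \<open>t\<close> and of \<open>1 - t\<close>; the exponential is the probability that a Poisson
  variable with parameter \<open>(1 - t) * m\<close> vanishes.
\<close>

definition wint :: "real \<Rightarrow> nat \<Rightarrow> nat \<Rightarrow> real" where
  "wint m a b = (LINT t:{0..1}|lborel. t ^ a * (1 - t) ^ b * exp (- ((1 - t) * m)))"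

text \<open>
  The weight of \<open>j\<close> kept points, \<open>i\<close> removed points and \<open>l\<close> new points. The factorials
  compensate for the order of the kept and of the new points.
\<close>

definition wgt :: "real \<Rightarrow> nat \<Rightarrow> nat \<Rightarrow> nat \<Rightarrow> real" where
  "wgt m j i l = wint m j (i + l) / (fact j * fact l)"

lemma wint_integrable:
  "set_integrable lborel {0..1::real} (\<lambda>t. t ^ a * (1 - t) ^ b * exp (- ((1 - t) * m)))"
  by (rule borel_integrable_atLeastAtMost') (intro continuous_intros)

lemma ennreal_wint:
  "ennreal (wint m a b) = (\<integral>\<^sup>+ t. ennreal (t ^ a * (1 - t) ^ b * exp (- ((1 - t) * m))) * indicator {0..1} t \<partial>lborel)"
proof -
  have "ennreal (wint m a b) = (\<integral>\<^sup>+ t. ennreal (indicator {0..1} t * (t ^ a * (1 - t) ^ b * exp (- ((1 - t) * m)))) \<partial>lborel)"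
    unfolding wint_def set_lebesgue_integral_def
    using wint_integrable[of a b m, unfolded set_integrable_def]
    by (subst nn_integral_eq_integral) (auto split: split_indicator)
  also have "\<dots> = (\<integral>\<^sup>+ t. ennreal (t ^ a * (1 - t) ^ b * exp (- ((1 - t) * m))) * indicator {0..1} t \<partial>lborel)"
    by (intro nn_integral_cong) (auto split: split_indicator)
  finally show ?thesis .
qed

lemma wint_nonneg: "0 \<le> wint m a b"
  unfolding wint_def set_lebesgue_integral_def
  by (intro integral_nonneg_AE) (auto split: split_indicator)

lemma wint_le_1: assumes "0 \<le> m" shows "wint m a b \<le> 1"
proof -
  have "ennreal (wint m a b) \<le> (\<integral>\<^sup>+ t. 1 * indicator {0..1} t \<partial>(lborel :: real measure))"
    unfolding ennreal_wint
  proof (rule nn_integral_mono)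
    fix t :: real
    have "t ^ a * (1 - t) ^ b * exp (- ((1 - t) * m)) \<le> 1 * 1 * 1" if "t \<in> {0..1}"
      using that assms by (intro mult_mono power_le_one) auto
    then show "ennreal (t ^ a * (1 - t) ^ b * exp (- ((1 - t) * m))) * indicator {0..1} t \<le> 1 * indicator {0..1} t"
      by (auto split: split_indicator)
  qed
  also have "\<dots> = ennreal 1" by simp
  finally show ?thesis by (subst (asm) ennreal_le_iff) auto
qed

text \<open>Integrate the derivative of the integrand; the special cases are the boundary terms.\<close>

lemma wint_rec:
  "real a * wint m (a - 1) b + m * wint m a b + (if a = 0 then exp (- m) else 0)
    = real b * wint m a (b - 1) + (if b = 0 then 1 else 0)"
proof -
  let ?e = "\<lambda>t. exp (- ((1 - t) * m))"
  let ?f = "\<lambda>t::real. real a * (t ^ (a - 1) * (1 - t) ^ b * ?e t) - real b * (t ^ a * (1 - t) ^ (b - 1) * ?e t)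
     + m * (t ^ a * (1 - t) ^ b * ?e t)"
  let ?F = "\<lambda>t::real. t ^ a * (1 - t) ^ b * ?e t"
  have "(LINT t:{0..1}|lborel. ?f t) = ?F 1 - ?F 0"
    unfolding set_lebesgue_integral_def
  proof (rule integral_FTC_Icc)
    fix t :: real
    have "(?F has_real_derivative ?f t) (at t within {0..1})"
      by (auto intro!: derivative_eq_intros simp: algebra_simps)
    then show "(?F has_vector_derivative ?f t) (at t within {0..1})"
      by (simp add: has_real_derivative_iff_has_vector_derivative)
  qed (auto intro!: continuous_intros)
  moreover have "(LINT t:{0..1}|lborel. ?f t) = real a * wint m (a - 1) b - real b * wint m a (b - 1) + m * wint m a b"
    unfolding wint_def
    by (simp add: set_integral_add(2) set_integral_diff(2) set_integral_mult_right wint_integrable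
        set_integral_diff(1) set_integrable_mult_right)
  moreover have "?F 1 - ?F 0 = (if b = 0 then 1 else 0) - (if a = 0 then exp (- m) else 0)"
    by (cases a; cases b) auto
  ultimately show ?thesis by simp
qed

lemma wgt_nonneg: "0 \<le> wgt m j i l"
  by (simp add: wgt_def wint_nonneg)

lemma wgt_le: "0 \<le> m \<Longrightarrow> wgt m j i l \<le> 1 / fact l"
proof -
  assume m: "0 \<le> m"
  have "wgt m j i l \<le> 1 / (fact j * fact l)"
    unfolding wgt_def by (intro divide_right_mono wint_le_1 m) auto
  also have "\<dots> \<le> 1 / (1 * fact l)"
    by (intro divide_left_mono mult_right_mono) auto
  finally show ?thesis by simp
qed

text \<open>This recursion is the Stein equation on the level of the weights.\<close>

lemma wgt_rec:
  "(case j of 0 \<Rightarrow> 0 | Suc j' \<Rightarrow> wgt m j' i l) + m * wgt m j i l + (if j = 0 then exp (- m) / fact l else 0)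
    = real i * wgt m j (i - 1) l + (case l of 0 \<Rightarrow> 0 | Suc l' \<Rightarrow> wgt m j i l') + (if i = 0 \<and> l = 0 then 1 / fact j else 0)"
proof -
  let ?d = "fact j * fact l :: real"
  have d: "?d \<noteq> 0" by simp
  have 1: "(case j of 0 \<Rightarrow> 0 | Suc j' \<Rightarrow> wgt m j' i l) = real j * wint m (j - 1) (i + l) / ?d"
    by (cases j) (simp_all add: wgt_def fact_Suc mult.assoc del: of_nat_Suc)
  have 2: "real i * wgt m j (i - 1) l + (case l of 0 \<Rightarrow> 0 | Suc l' \<Rightarrow> wgt m j i l') = real (i + l) * wint m j (i + l - 1) / ?d"
  proof -
    have "real i * wgt m j (i - 1) l = real i * wint m j (i + l - 1) / ?d"
      by (cases i) (auto simp: wgt_def)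
    moreover have "(case l of 0 \<Rightarrow> 0 | Suc l' \<Rightarrow> wgt m j i l') = real l * wint m j (i + l - 1) / ?d"
      by (cases l) (simp_all add: wgt_def fact_Suc mult.left_commute[of "fact j"] del: of_nat_Suc)
    ultimately show ?thesis by (simp add: add_divide_distrib[symmetric] distrib_right)
  qed
  have 3: "(if j = 0 then exp (- m) / fact l else 0) = (if j = 0 then exp (- m) else 0) / ?d" by simp
  have 4: "(if i = 0 \<and> l = 0 then 1 / fact j else 0) = (if i + l = 0 then 1 else 0) / ?d" by simp
  have 5: "m * wgt m j i l = m * wint m j (i + l) / ?d" by (simp add: wgt_def)
  show ?thesis
    unfolding 1 2 3 4 5 add_divide_distrib[symmetric] using wint_rec[of j m "i + l"] by simp
qed

text \<open>
  Under the integral over \<open>t\<close> these are the binomial weights for \<open>j\<close> and the Poisson weights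
  for \<open>l\<close>, and both sum up to one.
\<close>

lemma wgt_total:
  assumes m: "0 \<le> m"
  shows "(\<Sum>j\<le>n. \<Sum>l. ennreal (wgt m j (n - j) l) * (ennreal (fact n / fact (n - j)) * ennreal (m ^ l))) = 1"
proof -
  let ?A = "\<lambda>j t::real. real (n choose j) * t ^ j * (1 - t) ^ (n - j)"
  let ?B = "\<lambda>l t::real. ((1 - t) * m) ^ l / fact l * exp (- ((1 - t) * m))"
  have trm: "ennreal (wgt m j (n - j) l) * (ennreal (fact n / fact (n - j)) * ennreal (m ^ l))
    = (\<integral>\<^sup>+ t. ennreal (?A j t * ?B l t) * indicator {0..1} t \<partial>lborel)" if j: "j \<le> n" for j l
  proof -
    let ?c = "fact n / (fact j * fact (n - j)) * (m ^ l / fact l)"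
    have c: "0 \<le> ?c" using m by simp
    have "ennreal (wgt m j (n - j) l) * (ennreal (fact n / fact (n - j)) * ennreal (m ^ l))
      = ennreal (wgt m j (n - j) l * (fact n / fact (n - j) * m ^ l))"
      using m by (simp add: ennreal_mult[symmetric] wgt_nonneg)
    also have "wgt m j (n - j) l * (fact n / fact (n - j) * m ^ l) = ?c * wint m j (n - j + l)"
      by (simp add: wgt_def field_simps)
    also have "ennreal (?c * wint m j (n - j + l)) = ennreal ?c * ennreal (wint m j (n - j + l))"
      using c by (rule ennreal_mult) (rule wint_nonneg)
    also have "\<dots> = (\<integral>\<^sup>+ t. ennreal ?c * (ennreal (t ^ j * (1 - t) ^ (n - j + l) * exp (- ((1 - t) * m))) * indicator {0..1} t) \<partial>lborel)"
      unfolding ennreal_wint by (rule nn_integral_cmult[symmetric]) measurable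
    also have "\<dots> = (\<integral>\<^sup>+ t. ennreal (?A j t * ?B l t) * indicator {0..1} t \<partial>lborel)"
    proof (rule nn_integral_cong)
      fix t :: real
      have "ennreal ?c * ennreal (t ^ j * (1 - t) ^ (n - j + l) * exp (- ((1 - t) * m)))
        = ennreal (?c * (t ^ j * (1 - t) ^ (n - j + l) * exp (- ((1 - t) * m))))" if "t \<in> {0..1}"
        using c that by (intro ennreal_mult[symmetric]) auto
      moreover have "?c * (t ^ j * (1 - t) ^ (n - j + l) * exp (- ((1 - t) * m))) = ?A j t * ?B l t"
      proof -
        have "((1 - t) * m) ^ l = (1 - t) ^ l * m ^ l" by (rule power_mult_distrib)
        then show ?thesis
          by (simp only: binomial_fact[OF j, where 'a = real] power_add divide_inverse inverse_mult_distrib mult_ac)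
      qed
      ultimately show "ennreal ?c * (ennreal (t ^ j * (1 - t) ^ (n - j + l) * exp (- ((1 - t) * m))) * indicator {0..1} t)
        = ennreal (?A j t * ?B l t) * indicator {0..1} t"
        by (auto split: split_indicator)
    qed
    finally show ?thesis .
  qed
  have inner: "(\<Sum>l. ennreal (wgt m j (n - j) l) * (ennreal (fact n / fact (n - j)) * ennreal (m ^ l)))
    = (\<integral>\<^sup>+ t. ennreal (?A j t) * indicator {0..1} t \<partial>lborel)" if j: "j \<le> n" for j
  proof -
    have "(\<Sum>l. ennreal (wgt m j (n - j) l) * (ennreal (fact n / fact (n - j)) * ennreal (m ^ l)))
      = (\<integral>\<^sup>+ t. (\<Sum>l. ennreal (?A j t * ?B l t) * indicator {0..1} t) \<partial>lborel)"
      unfolding trm[OF j] by (rule nn_integral_suminf[symmetric]) measurable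
    also have "\<dots> = (\<integral>\<^sup>+ t. ennreal (?A j t) * indicator {0..1} t \<partial>lborel)"
    proof (rule nn_integral_cong)
      fix t :: real
      show "(\<Sum>l. ennreal (?A j t * ?B l t) * indicator {0..1} t) = ennreal (?A j t) * indicator {0..1} t"
      proof (cases "t \<in> {0..1}")
        case True
        let ?x = "(1 - t) * m"
        have "(\<lambda>l. ?x ^ l / fact l) sums exp ?x"
          using exp_converges[of ?x] by (simp add: divide_inverse mult.commute)
        from sums_mult[OF sums_mult2[OF this, of "exp (- ?x)"], of "?A j t"]
        have s: "(\<lambda>l. ?A j t * ?B l t) sums ?A j t" by (simp add: exp_minus)
        have "(\<Sum>l. ennreal (?A j t * ?B l t)) = ennreal (?A j t)"
          using True m by (intro suminf_ennreal_eq s mult_nonneg_nonneg) auto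
        then show ?thesis using True by simp
      qed simp
    qed
    finally show ?thesis .
  qed
  have "(\<Sum>j\<le>n. \<Sum>l. ennreal (wgt m j (n - j) l) * (ennreal (fact n / fact (n - j)) * ennreal (m ^ l)))
    = (\<Sum>j\<le>n. \<integral>\<^sup>+ t. ennreal (?A j t) * indicator {0..1} t \<partial>lborel)"
    by (intro sum.cong) (auto simp: inner)
  also have "\<dots> = (\<integral>\<^sup>+ t. (\<Sum>j\<le>n. ennreal (?A j t) * indicator {0..1} t) \<partial>lborel)"
    by (rule nn_integral_sum[symmetric]) measurable
  also have "\<dots> = (\<integral>\<^sup>+ t. indicator {0..1} t \<partial>(lborel :: real measure))"
  proof (rule nn_integral_cong)
    fix t :: real
    show "(\<Sum>j\<le>n. ennreal (?A j t) * indicator {0..1} t) = indicator {0..1} t"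
    proof (cases "t \<in> {0..1}")
      case True
      then have "(\<Sum>j\<le>n. ennreal (?A j t)) = ennreal (\<Sum>j\<le>n. ?A j t)"
        by (intro sum_ennreal) auto
      also have "(\<Sum>j\<le>n. ?A j t) = (t + (1 - t)) ^ n" by (rule binomial_ring[symmetric])
      finally show ?thesis using True by simp
    qed simp
  qed
  also have "\<dots> = 1" by simp
  finally show ?thesis .
qed

section \<open>Total variation and test functions\<close>

lemma d_TV_le:
  assumes "\<And>A. A \<in> sets borel \<Longrightarrow> emeasure \<mu> A < \<infinity> \<Longrightarrow> emeasure \<nu> A < \<infinity> \<Longrightarrow> \<bar>measure \<mu> A - measure \<nu> A\<bar> \<le> c"
  shows "d_TV \<mu> \<nu> \<le> ennreal c"
  unfolding d_TV_def using assms by (intro SUP_least ennreal_leI) auto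

lemma d_TV_ge:
  assumes "A \<in> sets borel" "emeasure \<mu> A < \<infinity>" "emeasure \<nu> A < \<infinity>"
  shows "ennreal \<bar>measure \<mu> A - measure \<nu> A\<bar> \<le> d_TV \<mu> \<nu>"
  unfolding d_TV_def using assms by (intro SUP_upper2[of A]) auto

lemma (in finite_counting) finite_lf:
  assumes "\<omega> \<in> \<Omega>" shows "emeasure \<omega> A < \<infinity>"
proof -
  have "emeasure \<omega> A \<le> emeasure \<omega> UNIV" using emeasure_space[of \<omega> A] by (simp add: space_lf assms)
  then show ?thesis using assms by (auto simp: locally_finite_def intro: le_less_trans)
qed

lemma (in finite_counting) measure_add_dirac:
  assumes w: "\<omega> \<in> \<Omega>" and A: "A \<in> sets borel"
  shows "measure (add_measure \<omega> (dirac y)) A = measure \<omega> A + indicator A y"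
proof -
  have "emeasure (add_measure \<omega> (dirac y)) A = emeasure \<omega> A + ennreal (indicator A y)"
    using A by (simp add: emeasure_add_measure sets_lf w emeasure_dirac_sum ennreal_indicator)
  then show ?thesis
    using finite_lf[OF w, of A] unfolding measure_def by (subst \<open>emeasure _ _ = _\<close>, subst enn2real_plus) (auto simp: less_top)
qed

locale stein = finite_counting dummy + M: finite_measure M
  for dummy :: "'a::{second_countable_topology, t2_space} itself" and M :: "'a measure" +
  fixes h :: "'a measure \<Rightarrow> real"
  assumes M_sets[simp, measurable_cong]: "sets M = sets borel"
    and h_test: "h \<in> KR_test_functions"
begin

sublocale PW: borel_sigma_finite M by standard simp

abbreviation "zero \<equiv> null_measure (borel :: 'a measure)"

lemma h_measurable[measurable]: "h \<in> borel_measurable N"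
  using h_test by (simp add: KR_test_functions_def N_eq)

lemma h_lipschitz: "\<omega> \<in> \<Omega> \<Longrightarrow> \<omega>' \<in> \<Omega> \<Longrightarrow> ennreal \<bar>h \<omega> - h \<omega>'\<bar> \<le> d_TV \<omega> \<omega>'"
  using h_test by (simp add: KR_test_functions_def fin_iff)

lemma h_bound:
  assumes "\<omega> \<in> \<Omega>" "\<omega>' \<in> \<Omega>" "0 \<le> c" "\<And>A. A \<in> sets borel \<Longrightarrow> \<bar>measure \<omega> A - measure \<omega>' A\<bar> \<le> c"
  shows "\<bar>h \<omega> - h \<omega>'\<bar> \<le> c"
proof -
  have "ennreal \<bar>h \<omega> - h \<omega>'\<bar> \<le> ennreal c"
    using h_lipschitz[OF assms(1,2)] d_TV_le[of \<omega> \<omega>' c] assms(4) by (auto intro: order_trans)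
  then show ?thesis using assms(3) by simp
qed

lemma h_add_dirac: "\<omega> \<in> \<Omega> \<Longrightarrow> \<bar>h (add_measure \<omega> (dirac y)) - h \<omega>\<bar> \<le> 1"
  by (rule h_bound) (auto simp: lf_add_dirac measure_add_dirac split: split_indicator)

lemma h_add_dirac_dirac: "\<omega> \<in> \<Omega> \<Longrightarrow> \<bar>h (add_measure \<omega> (dirac y)) - h (add_measure \<omega> (dirac y'))\<bar> \<le> 1"
  by (rule h_bound) (auto simp: lf_add_dirac measure_add_dirac split: split_indicator)

lemma h_size: assumes w: "\<omega> \<in> \<Omega>" shows "\<bar>h \<omega> - h zero\<bar> \<le> measure \<omega> UNIV"
proof (rule h_bound[OF w lf_null])
  fix A :: "'a set"
  have "emeasure \<omega> A \<le> emeasure \<omega> UNIV" using emeasure_space[of \<omega> A] by (simp add: space_lf w)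
  then have "measure \<omega> A \<le> measure \<omega> UNIV"
    unfolding measure_def using finite_lf[OF w, of UNIV] by (intro enn2real_mono) auto
  then show "\<bar>measure \<omega> A - measure zero A\<bar> \<le> measure \<omega> UNIV" by simp
qed simp

text \<open>
  The total mass is added since an additional point lowers \<open>h\<close> by at most one: this makes \<open>hp\<close>
  increasing, and adding a constant makes it nonnegative.
\<close>

definition hp :: "'a measure \<Rightarrow> real" where
  "hp \<omega> = h \<omega> + \<bar>h zero\<bar> + measure \<omega> UNIV"

definition Dh :: "'a \<Rightarrow> 'a measure \<Rightarrow> ennreal" where
  "Dh y \<omega> = ennreal (hp (add_measure \<omega> (dirac y)) - hp \<omega>)"

lemma hp_nonneg: "\<omega> \<in> \<Omega> \<Longrightarrow> 0 \<le> hp \<omega>"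
  using h_size[of \<omega>] unfolding hp_def by arith

lemma hp_upper: "\<omega> \<in> \<Omega> \<Longrightarrow> hp \<omega> \<le> 2 * \<bar>h zero\<bar> + 2 * measure \<omega> UNIV"
  using h_size[of \<omega>] unfolding hp_def by arith

lemma hp_measurable[measurable]: "hp \<in> borel_measurable N"
  unfolding hp_def measure_def by measurable

lemma hp_diff: "\<omega> \<in> \<Omega> \<Longrightarrow> hp (add_measure \<omega> (dirac y)) - hp \<omega> = h (add_measure \<omega> (dirac y)) - h \<omega> + 1"
  by (simp add: hp_def measure_add_dirac)

lemma Dh_le_2: "\<omega> \<in> \<Omega> \<Longrightarrow> Dh y \<omega> \<le> 2"
proof -
  assume w: "\<omega> \<in> \<Omega>"
  have "Dh y \<omega> \<le> ennreal 2" unfolding Dh_def using h_add_dirac[OF w, of y] by (intro ennreal_leI) (simp add: hp_diff w)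
  then show ?thesis by simp
qed

lemma Dh_osc: "\<omega> \<in> \<Omega> \<Longrightarrow> Dh y \<omega> \<le> Dh y' \<omega> + 1"
proof -
  assume w: "\<omega> \<in> \<Omega>"
  have "Dh y \<omega> \<le> ennreal ((hp (add_measure \<omega> (dirac y')) - hp \<omega>) + 1)"
    unfolding Dh_def using h_add_dirac_dirac[OF w, of y y'] by (intro ennreal_leI) (simp add: hp_diff w)
  also have "\<dots> = Dh y' \<omega> + 1"
    unfolding Dh_def using h_add_dirac[OF w, of y'] by (subst ennreal_plus) (auto simp: hp_diff w)
  finally show ?thesis .
qed

lemma Dh_add: "\<omega> \<in> \<Omega> \<Longrightarrow> Dh y \<omega> + ennreal (hp \<omega>) = ennreal (hp (add_measure \<omega> (dirac y)))"
proof -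
  assume w: "\<omega> \<in> \<Omega>"
  have "0 \<le> hp (add_measure \<omega> (dirac y)) - hp \<omega>" using h_add_dirac[OF w, of y] by (simp add: hp_diff w)
  from ennreal_plus[OF this hp_nonneg[OF w]] show ?thesis by (simp add: Dh_def)
qed

lemma Dh_measurable[measurable (raw)]:
  assumes [measurable]: "X \<in> T \<rightarrow>\<^sub>M N" "y \<in> T \<rightarrow>\<^sub>M borel"
  shows "(\<lambda>t. Dh (y t) (X t)) \<in> borel_measurable T"
  unfolding Dh_def by measurable

definition m :: real where "m = measure M UNIV"

lemma m_nonneg: "0 \<le> m" by (simp add: m_def)

lemma M_UNIV: "emeasure M UNIV = ennreal m"
  unfolding m_def by (rule M.emeasure_eq_measure)

abbreviation "Mp l \<equiv> measure_power l M"

lemma mass_Mp: "(\<integral>\<^sup>+ z. 1 \<partial>Mp l) = ennreal (m ^ l)"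
proof (induction l)
  case (Suc l)
  have "(\<integral>\<^sup>+ z. 1 \<partial>Mp (Suc l)) = (\<integral>\<^sup>+ y. \<integral>\<^sup>+ w. 1 \<partial>Mp l \<partial>M)"
    by (rule PW.nn_integral_measure_power_Suc) simp
  also have "\<dots> = (\<integral>\<^sup>+ y. ennreal (m ^ l) \<partial>M)" by (simp only: Suc.IH)
  also have "\<dots> = ennreal (m ^ l) * ennreal m"
    using M_UNIV sets_eq_imp_space_eq[OF M_sets] by simp
  also have "\<dots> = ennreal (m ^ Suc l)" using m_nonneg by (simp add: ennreal_mult[symmetric] mult.commute)
  finally show ?case .
next
  case 0
  show ?case by (subst PW.nn_integral_measure_power_0) simp
qed

text \<open>The result of the interpolation, with kept points \<open>x\<close> and new points \<open>z\<close>.\<close>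

definition join :: "nat \<Rightarrow> nat \<Rightarrow> (nat \<Rightarrow> 'a) \<Rightarrow> (nat \<Rightarrow> 'a) \<Rightarrow> 'a measure" where
  "join j l x z = add_measure (dirac_sum j x) (dirac_sum l z)"

lemma dirac_sum_lf: "dirac_sum j x \<in> \<Omega>"
  by (simp add: fin_iff finite_dirac_sum)

lemma join_lf: "join j l x z \<in> \<Omega>"
  unfolding join_def by (intro lf_add_dirac dirac_sum_lf)

lemma join_UNIV: "measure (join j l x z) UNIV = real j + real l"
  unfolding measure_def join_def
  by (simp add: emeasure_add_measure emeasure_dirac_sum_UNIV enn2real_plus of_nat_less_top)

lemma measurable_join[measurable (raw)]:
  assumes "x \<in> T \<rightarrow>\<^sub>M tuple_space j" "z \<in> T \<rightarrow>\<^sub>M tuple_space l"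
  shows "(\<lambda>t. join j l (x t) (z t)) \<in> T \<rightarrow>\<^sub>M N"
  unfolding join_def
  by (intro measurable_add_dirac measurable_dirac_sum measurable_tuple_component[OF assms(1)] measurable_tuple_component[OF assms(2)])

lemma join_eqI:
  "(\<And>B. B \<in> sets borel \<Longrightarrow> emeasure (join j l x z) B = emeasure \<nu> B) \<Longrightarrow> sets \<nu> = sets borel \<Longrightarrow> join j l x z = \<nu>"
  by (rule measure_eq_borelI) (auto simp: join_def)

lemma emeasure_join: "B \<in> sets borel \<Longrightarrow> emeasure (join j l x z) B = (\<Sum>i<j. indicator B (x i)) + (\<Sum>i<l. indicator B (z i))"
  by (simp add: join_def emeasure_add_measure emeasure_dirac_sum)

lemma join_cons_left: "join (Suc j) l (tuple_cons j y x) z = add_measure (join j l x z) (dirac y)"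
  by (rule join_eqI)
     (auto simp: join_def emeasure_add_measure emeasure_dirac_sum add_ac sum.lessThan_Suc_shift simp del: sum.lessThan_Suc)

lemma join_cons_right: "join j (Suc l) x (tuple_cons l y z) = add_measure (join j l x z) (dirac y)"
  by (rule join_eqI)
     (auto simp: join_def emeasure_add_measure emeasure_dirac_sum add_ac sum.lessThan_Suc_shift simp del: sum.lessThan_Suc)

lemma join_permute: "\<pi> permutes {..<j} \<Longrightarrow> join j l (\<lambda>i. x (\<pi> i)) z = join j l x z"
proof (rule join_eqI)
  fix B :: "'a set" assume \<pi>: "\<pi> permutes {..<j}" and B: "B \<in> sets borel"
  have "(\<Sum>i<j. indicator B (x (\<pi> i)) :: ennreal) = (\<Sum>i<j. indicator B (x i))"
    by (rule sum.permute[OF \<pi>, unfolded o_def, symmetric])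
  then show "emeasure (join j l (\<lambda>i. x (\<pi> i)) z) B = emeasure (join j l x z) B"
    by (simp add: emeasure_join B)
qed (simp add: join_def)

definition H :: "nat \<Rightarrow> nat \<Rightarrow> (nat \<Rightarrow> 'a) \<Rightarrow> ennreal" where
  "H j l x = (\<integral>\<^sup>+ z. ennreal (hp (join j l x z)) \<partial>Mp l)"

definition DH :: "nat \<Rightarrow> nat \<Rightarrow> 'a \<Rightarrow> (nat \<Rightarrow> 'a) \<Rightarrow> ennreal" where
  "DH j l y x = (\<integral>\<^sup>+ z. Dh y (join j l x z) \<partial>Mp l)"

definition F :: "'a measure \<Rightarrow> nat \<Rightarrow> nat \<Rightarrow> ennreal" where
  "F \<omega> j l = tsum j \<omega> (H j l)"

definition R :: "nat \<Rightarrow> nat \<Rightarrow> nat \<Rightarrow> ennreal" where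
  "R j i l = ennreal (wgt m j i l)"

text \<open>
  The difference operator of the solution of the Stein equation. The sums over \<open>j\<close> and \<open>l\<close>
  with the weights \<open>R\<close> are the expectation over the thinning of \<open>\<omega>\<close> and over the new points,
  mixed over \<open>t\<close>; the increment \<open>Dh\<close> of \<open>hp\<close> at \<open>y\<close> is taken at the resulting configuration.
\<close>

definition U :: "'a \<Rightarrow> 'a measure \<Rightarrow> ennreal" where
  "U y \<omega> = (\<Sum>j\<le>npts \<omega>. \<Sum>l. R j (npts \<omega> - j) l * tsum j \<omega> (DH j l y))"

lemma sigma_finite_Mp: "sigma_finite_measure (Mp l)"
  by (rule PW.sigma_finite_measure_power)

lemma H_measurable[measurable]: "H j l \<in> borel_measurable (tuple_space j)"
proof -
  interpret sigma_finite_measure "Mp l" by (rule sigma_finite_Mp)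
  show ?thesis unfolding H_def by measurable
qed

lemma DH_measurable[measurable]: "(\<lambda>(y, x). DH j l y x) \<in> borel_measurable (borel \<Otimes>\<^sub>M tuple_space j)"
proof -
  interpret sigma_finite_measure "Mp l" by (rule sigma_finite_Mp)
  show ?thesis unfolding DH_def by measurable
qed

lemma U_measurable: "(\<lambda>(y, \<omega>). U y \<omega>) \<in> borel_measurable (borel \<Otimes>\<^sub>M N)"
proof -
  have 1: "(\<lambda>z. \<Sum>j\<le>n. \<Sum>l. R j (n - j) l * tsum j (snd z) (DH j l (fst z))) \<in> borel_measurable (borel \<Otimes>\<^sub>M N)" for n
    by measurable
  have 2: "(\<lambda>z. npts (snd z)) \<in> borel \<Otimes>\<^sub>M N \<rightarrow>\<^sub>M count_space UNIV" by measurable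
  have "(\<lambda>z. (\<lambda>n z. \<Sum>j\<le>n. \<Sum>l. R j (n - j) l * tsum j (snd z) (DH j l (fst z))) (npts (snd z)) z) \<in> borel_measurable (borel \<Otimes>\<^sub>M N)"
    by (rule measurable_compose_countable[OF 1 2])
  then show ?thesis unfolding U_def by (simp add: case_prod_unfold)
qed

text \<open>
  The functional \<open>U\<close> averages \<open>Dh\<close> over a probability distribution, so it inherits the bounds
  on \<open>Dh\<close>.
\<close>

lemma total_weight:
  assumes "\<omega> \<in> \<Omega>"
  shows "(\<Sum>j\<le>npts \<omega>. \<Sum>l. R j (npts \<omega> - j) l * tsum j \<omega> (\<lambda>_. \<integral>\<^sup>+ z. 1 \<partial>Mp l)) = 1"
proof -
  have "tsum j \<omega> (\<lambda>_. \<integral>\<^sup>+ z. 1 \<partial>Mp l) = ennreal (fact (npts \<omega>) / fact (npts \<omega> - j)) * ennreal (m ^ l)"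
    if "j \<le> npts \<omega>" for j l
    unfolding mass_Mp using tsum_cmult[of j \<omega> "ennreal (m ^ l)" "\<lambda>_. 1"] tsum_one[OF assms that] by (simp add: mult.commute)
  then have "(\<Sum>j\<le>npts \<omega>. \<Sum>l. R j (npts \<omega> - j) l * tsum j \<omega> (\<lambda>_. \<integral>\<^sup>+ z. 1 \<partial>Mp l))
    = (\<Sum>j\<le>npts \<omega>. \<Sum>l. ennreal (wgt m j (npts \<omega> - j) l) * (ennreal (fact (npts \<omega>) / fact (npts \<omega> - j)) * ennreal (m ^ l)))"
    unfolding R_def by (intro sum.cong refl suminf_cong) auto
  also have "\<dots> = 1" by (rule wgt_total[OF m_nonneg])
  finally show ?thesis .
qed

lemma U_le_2: assumes w: "\<omega> \<in> \<Omega>" shows "U y \<omega> \<le> 2"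
proof -
  have "DH j l y x \<le> 2 * (\<integral>\<^sup>+ z. 1 \<partial>Mp l)" for j l x
  proof -
    have "DH j l y x \<le> (\<integral>\<^sup>+ z. 2 * 1 \<partial>Mp l)"
      unfolding DH_def by (intro nn_integral_mono) (simp add: Dh_le_2 join_lf)
    also have "\<dots> = 2 * (\<integral>\<^sup>+ z. 1 \<partial>Mp l)" by (rule nn_integral_cmult) simp
    finally show ?thesis .
  qed
  then have "U y \<omega> \<le> (\<Sum>j\<le>npts \<omega>. \<Sum>l. R j (npts \<omega> - j) l * tsum j \<omega> (\<lambda>_. 2 * (\<integral>\<^sup>+ z. 1 \<partial>Mp l)))"
    unfolding U_def by (intro sum_mono suminf_le mult_left_mono tsum_mono) auto
  also have "\<dots> = (\<Sum>j\<le>npts \<omega>. \<Sum>l. 2 * (R j (npts \<omega> - j) l * tsum j \<omega> (\<lambda>_. \<integral>\<^sup>+ z. 1 \<partial>Mp l)))"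
    unfolding tsum_cmult by (simp only: mult.left_commute)
  also have "\<dots> = 2 * (\<Sum>j\<le>npts \<omega>. \<Sum>l. R j (npts \<omega> - j) l * tsum j \<omega> (\<lambda>_. \<integral>\<^sup>+ z. 1 \<partial>Mp l))"
    unfolding ennreal_suminf_cmult sum_distrib_left ..
  also have "\<dots> = 2" by (simp only: total_weight[OF w] mult_1_right)
  finally show ?thesis .
qed

lemma U_osc: assumes w: "\<omega> \<in> \<Omega>" shows "U y \<omega> \<le> U y' \<omega> + 1"
proof -
  have DH: "DH j l y x \<le> DH j l y' x + (\<integral>\<^sup>+ z. 1 \<partial>Mp l)" if "x \<in> extensional {..<j}" for j l x
  proof -
    have [measurable]: "x \<in> space (tuple_space j)" using that by (simp add: space_tuple_space)
    have "DH j l y x \<le> (\<integral>\<^sup>+ z. Dh y' (join j l x z) + 1 \<partial>Mp l)"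
      unfolding DH_def by (intro nn_integral_mono Dh_osc join_lf)
    also have "\<dots> = DH j l y' x + (\<integral>\<^sup>+ z. 1 \<partial>Mp l)"
      unfolding DH_def by (rule nn_integral_add) measurable
    finally show ?thesis .
  qed
  have "U y \<omega> \<le> (\<Sum>j\<le>npts \<omega>. \<Sum>l. R j (npts \<omega> - j) l * tsum j \<omega> (\<lambda>x. DH j l y' x + (\<integral>\<^sup>+ z. 1 \<partial>Mp l)))"
    unfolding U_def by (intro sum_mono suminf_le mult_left_mono tsum_mono DH) (auto dest: distinct_tuples_extensional)
  also have "\<dots> = (\<Sum>j\<le>npts \<omega>. (\<Sum>l. R j (npts \<omega> - j) l * tsum j \<omega> (DH j l y'))
      + (\<Sum>l. R j (npts \<omega> - j) l * tsum j \<omega> (\<lambda>_. \<integral>\<^sup>+ z. 1 \<partial>Mp l)))"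
    unfolding tsum_add distrib_left by (intro sum.cong refl suminf_add[symmetric]) auto
  also have "\<dots> = U y' \<omega> + 1"
    unfolding sum.distrib total_weight[OF w] U_def ..
  finally show ?thesis .
qed

lemma H_bound: "H j l x \<le> ennreal ((2 * \<bar>h zero\<bar> + 2 * (real j + real l)) * m ^ l)"
proof -
  have "H j l x \<le> (\<integral>\<^sup>+ z. ennreal (2 * \<bar>h zero\<bar> + 2 * (real j + real l)) * 1 \<partial>Mp l)"
    unfolding H_def mult_1_right
    using hp_upper[OF join_lf] by (intro nn_integral_mono ennreal_leI) (simp only: join_UNIV)
  also have "\<dots> = ennreal (2 * \<bar>h zero\<bar> + 2 * (real j + real l)) * (\<integral>\<^sup>+ z. 1 \<partial>Mp l)"
    by (rule nn_integral_cmult) simp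
  also have "\<dots> = ennreal ((2 * \<bar>h zero\<bar> + 2 * (real j + real l)) * m ^ l)"
    unfolding mass_Mp using m_nonneg by (intro ennreal_mult[symmetric]) auto
  finally show ?thesis .
qed

lemma F_finite: assumes "\<omega> \<in> \<Omega>" "j \<le> npts \<omega>" shows "F \<omega> j l < \<infinity>"
proof -
  have "F \<omega> j l \<le> tsum j \<omega> (\<lambda>_. ennreal ((2 * \<bar>h zero\<bar> + 2 * (real j + real l)) * m ^ l) * 1)"
    unfolding F_def using H_bound by (intro tsum_mono) simp
  also have "\<dots> < \<infinity>" unfolding tsum_cmult tsum_one[OF assms] by (simp add: ennreal_mult_less_top)
  finally show ?thesis .
qed

text \<open>
  The masses of the powers of \<open>M\<close> grow geometrically, but the weights have a factorial in the
  denominator.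
\<close>

lemma weighted_F_finite:
  assumes w: "\<omega> \<in> \<Omega>" "j \<le> npts \<omega>" and c: "\<And>l. c l \<le> ennreal (1 / fact l)"
  shows "(\<Sum>l. c l * F \<omega> j l) < \<infinity>"
proof -
  let ?A = "2 * \<bar>h zero\<bar> + 2 * real j" and ?N = "fact (npts \<omega>) / fact (npts \<omega> - j) :: real"
  have le: "c l * F \<omega> j l \<le> ennreal (?N * ((?A + 2) * ((2 * m) ^ l / fact l)))" for l
  proof -
    have "F \<omega> j l \<le> tsum j \<omega> (\<lambda>_. ennreal ((2 * \<bar>h zero\<bar> + 2 * (real j + real l)) * m ^ l) * 1)"
      unfolding F_def using H_bound by (intro tsum_mono) simp
    also have "\<dots> = ennreal ((2 * \<bar>h zero\<bar> + 2 * (real j + real l)) * m ^ l * ?N)"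
      unfolding tsum_cmult tsum_one[OF w] using m_nonneg by (intro ennreal_mult[symmetric]) auto
    also have "\<dots> \<le> ennreal ((?A + 2) * 2 ^ l * m ^ l * ?N)"
    proof (intro ennreal_leI mult_right_mono)
      have l: "real l \<le> 2 ^ l" by (simp add: of_nat_less_two_power less_imp_le)
      have one: "(1::real) \<le> 2 ^ l" by simp
      have "2 * \<bar>h zero\<bar> + 2 * (real j + real l) = ?A * 1 + 2 * real l" by simp
      also have "\<dots> \<le> ?A * 2 ^ l + 2 * 2 ^ l"
        using l by (intro add_mono mult_left_mono one) auto
      also have "\<dots> = (?A + 2) * 2 ^ l" by (simp add: distrib_right)
      finally show "2 * \<bar>h zero\<bar> + 2 * (real j + real l) \<le> (?A + 2) * 2 ^ l" .
    qed (use m_nonneg in auto)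
    finally have "c l * F \<omega> j l \<le> ennreal (1 / fact l) * ennreal ((?A + 2) * 2 ^ l * m ^ l * ?N)"
      using c by (intro mult_mono) auto
    also have "\<dots> = ennreal (1 / fact l * ((?A + 2) * 2 ^ l * m ^ l * ?N))"
      using m_nonneg by (intro ennreal_mult[symmetric]) auto
    also have "1 / fact l * ((?A + 2) * 2 ^ l * m ^ l * ?N) = ?N * ((?A + 2) * ((2 * m) ^ l / fact l))"
      by (simp add: power_mult_distrib ac_simps)
    finally show ?thesis .
  qed
  have "(\<lambda>l. (2 * m) ^ l / fact l) sums exp (2 * m)"
    using exp_converges[of "2 * m"] by (simp add: divide_inverse mult.commute)
  then have s: "(\<lambda>l. ?N * ((?A + 2) * ((2 * m) ^ l / fact l))) sums (?N * ((?A + 2) * exp (2 * m)))"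
    by (intro sums_mult)
  have "(\<Sum>l. c l * F \<omega> j l) \<le> (\<Sum>l. ennreal (?N * ((?A + 2) * ((2 * m) ^ l / fact l))))"
    by (intro suminf_le le) auto
  also have "\<dots> = ennreal (?N * ((?A + 2) * exp (2 * m)))"
    using m_nonneg by (intro suminf_ennreal_eq s) auto
  finally show ?thesis by (auto intro: le_less_trans)
qed

lemma R_le: "R j i l \<le> ennreal (1 / fact l)"
  unfolding R_def by (intro ennreal_leI wgt_le m_nonneg)

lemma DH_add_H:
  assumes "x \<in> extensional {..<j}"
  shows "DH j l y x + H j l x = (\<integral>\<^sup>+ z. ennreal (hp (add_measure (join j l x z) (dirac y))) \<partial>Mp l)"
proof -
  have [measurable]: "x \<in> space (tuple_space j)" using assms by (simp add: space_tuple_space)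
  have "DH j l y x + H j l x = (\<integral>\<^sup>+ z. Dh y (join j l x z) + ennreal (hp (join j l x z)) \<partial>Mp l)"
    unfolding DH_def H_def by (rule nn_integral_add[symmetric]) measurable
  also have "\<dots> = (\<integral>\<^sup>+ z. ennreal (hp (add_measure (join j l x z) (dirac y))) \<partial>Mp l)"
    by (intro nn_integral_cong Dh_add join_lf)
  finally show ?thesis .
qed

text \<open>
  Adding the point \<open>y\<close> amounts to one more kept point; in \<open>H_Suc_right\<close> it amounts to one more
  new point.
\<close>

lemma H_Suc_left: "x \<in> extensional {..<j} \<Longrightarrow> H (Suc j) l (tuple_cons j y x) = DH j l y x + H j l x"
  by (subst DH_add_H) (simp_all add: H_def join_cons_left)

lemma H_Suc_right:
  assumes "x \<in> extensional {..<j}"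
  shows "H j (Suc l) x = (\<integral>\<^sup>+ y. DH j l y x \<partial>M) + ennreal m * H j l x"
proof -
  have [measurable]: "x \<in> space (tuple_space j)" using assms by (simp add: space_tuple_space)
  have "H j (Suc l) x = (\<integral>\<^sup>+ y. \<integral>\<^sup>+ w. ennreal (hp (join j (Suc l) x (tuple_cons l y w))) \<partial>Mp l \<partial>M)"
    unfolding H_def by (rule PW.nn_integral_measure_power_Suc) measurable
  also have "\<dots> = (\<integral>\<^sup>+ y. DH j l y x + H j l x \<partial>M)"
    unfolding join_cons_right DH_add_H[OF assms] ..
  also have "\<dots> = (\<integral>\<^sup>+ y. DH j l y x \<partial>M) + (\<integral>\<^sup>+ y. H j l x \<partial>M)"
    by (rule nn_integral_add) measurable
  also have "(\<integral>\<^sup>+ y. H j l x \<partial>M) = ennreal m * H j l x"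
    using M_UNIV sets_eq_imp_space_eq[OF M_sets] by (simp add: mult.commute)
  finally show ?thesis .
qed

lemma H_sym: "tuple_sym j (H j l)"
  unfolding tuple_sym_def H_def by (simp add: join_permute)

lemma U_remove_measurable:
  assumes "\<omega> \<in> \<Omega>" shows "(\<lambda>y. U y (remove_point y \<omega>)) \<in> borel_measurable borel"
proof -
  have [measurable]: "(\<lambda>_. \<omega>) \<in> borel \<rightarrow>\<^sub>M N" by (intro measurable_const) (simp add: assms)
  have "(\<lambda>y. (y, remove_point y \<omega>)) \<in> borel \<rightarrow>\<^sub>M borel \<Otimes>\<^sub>M N" by measurable
  from measurable_compose[OF this U_measurable] show ?thesis by simp
qed

lemma U_remove_identity:
  assumes w: "\<omega> \<in> \<Omega>" and n: "npts \<omega> = Suc n"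
  shows "(\<integral>\<^sup>+ y. U y (remove_point y \<omega>) \<partial>\<omega>) + (\<Sum>j\<le>n. \<Sum>l. R j (n - j) l * (of_nat (Suc n - j) * F \<omega> j l))
    = (\<Sum>j\<le>n. \<Sum>l. R j (n - j) l * F \<omega> (Suc j) l)"
proof -
  have [measurable]: "(\<lambda>_. \<omega>) \<in> borel \<rightarrow>\<^sub>M N" by (intro measurable_const) (simp add: w)
  have [measurable_cong]: "sets \<omega> = sets borel" by (rule sets_lf[OF w])
  let ?D = "\<lambda>j l y. tsum j (remove_point y \<omega>) (DH j l y)" and ?E = "\<lambda>j l y. tsum j (remove_point y \<omega>) (H j l)"
  have D[measurable]: "?D j l \<in> borel_measurable borel" for j l by measurable
  have E[measurable]: "?E j l \<in> borel_measurable borel" for j l by measurable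
  have DE: "(\<integral>\<^sup>+ y. ?D j l y \<partial>\<omega>) + of_nat (Suc n - j) * F \<omega> j l = F \<omega> (Suc j) l" if j: "j \<le> n" for j l
  proof -
    have "F \<omega> (Suc j) l = (\<integral>\<^sup>+ y. tsum j (remove_point y \<omega>) (\<lambda>x. H (Suc j) l (tuple_cons j y x)) \<partial>\<omega>)"
      unfolding F_def by (rule tsum_Suc[OF w H_measurable])
    also have "\<dots> = (\<integral>\<^sup>+ y. ?D j l y + ?E j l y \<partial>\<omega>)"
      unfolding tsum_add[symmetric]
      by (intro nn_integral_cong tsum_cong H_Suc_left distinct_tuples_extensional)
    also have "\<dots> = (\<integral>\<^sup>+ y. ?D j l y \<partial>\<omega>) + (\<integral>\<^sup>+ y. ?E j l y \<partial>\<omega>)" by (rule nn_integral_add) measurable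
    also have "(\<integral>\<^sup>+ y. ?E j l y \<partial>\<omega>) = of_nat (Suc n - j) * F \<omega> j l"
      unfolding F_def n[symmetric]
      by (rule nn_integral_tsum_remove_point[OF w H_measurable H_sym])
         (use F_finite[OF w, of j l] j n in \<open>auto simp: F_def\<close>)
    finally show ?thesis by simp
  qed
  have "(\<integral>\<^sup>+ y. U y (remove_point y \<omega>) \<partial>\<omega>) = (\<integral>\<^sup>+ y. (\<Sum>j\<le>n. \<Sum>l. R j (n - j) l * ?D j l y) \<partial>\<omega>)"
  proof (rule nn_integral_counting_cong[OF counting_of_lf[OF w]])
    show "(\<lambda>y. U y (remove_point y \<omega>)) \<in> borel_measurable borel" by (rule U_remove_measurable[OF w])
    fix y assume y: "1 \<le> emeasure \<omega> {y}"
    have "npts (remove_point y \<omega>) = n" using remove_point_decompose(3)[OF w y] n by simp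
    then show "U y (remove_point y \<omega>) = (\<Sum>j\<le>n. \<Sum>l. R j (n - j) l * ?D j l y)" by (simp add: U_def)
  qed measurable
  also have "\<dots> = (\<Sum>j\<le>n. \<Sum>l. R j (n - j) l * (\<integral>\<^sup>+ y. ?D j l y \<partial>\<omega>))"
    by (simp add: nn_integral_sum nn_integral_suminf nn_integral_cmult)
  finally have "(\<integral>\<^sup>+ y. U y (remove_point y \<omega>) \<partial>\<omega>) + (\<Sum>j\<le>n. \<Sum>l. R j (n - j) l * (of_nat (Suc n - j) * F \<omega> j l))
    = (\<Sum>j\<le>n. \<Sum>l. R j (n - j) l * ((\<integral>\<^sup>+ y. ?D j l y \<partial>\<omega>) + of_nat (Suc n - j) * F \<omega> j l))"
    by (simp add: sum.distrib[symmetric] suminf_add distrib_left)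
  also have "\<dots> = (\<Sum>j\<le>n. \<Sum>l. R j (n - j) l * F \<omega> (Suc j) l)"
    by (intro sum.cong refl suminf_cong) (simp add: DE)
  finally show ?thesis .
qed

lemma U_M_identity:
  assumes w: "\<omega> \<in> \<Omega>" and n: "npts \<omega> = n"
  shows "(\<integral>\<^sup>+ y. U y \<omega> \<partial>M) + (\<Sum>j\<le>n. \<Sum>l. R j (n - j) l * (ennreal m * F \<omega> j l))
    = (\<Sum>j\<le>n. \<Sum>l. R j (n - j) l * F \<omega> j (Suc l))"
proof -
  have [measurable]: "(\<lambda>_. \<omega>) \<in> borel \<rightarrow>\<^sub>M N" by (intro measurable_const) (simp add: w)
  let ?D = "\<lambda>j l y. tsum j \<omega> (DH j l y)"
  have D[measurable]: "?D j l \<in> borel_measurable borel" for j l by measurable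
  have fin: "finite (distinct_indices j \<omega>)" if "j \<le> n" for j
  proof -
    have "tsum j \<omega> (\<lambda>_. 1) < \<infinity>" unfolding tsum_one[OF w that[folded n]] by simp
    then have "emeasure (count_space (distinct_indices j \<omega>)) (distinct_indices j \<omega>) < \<infinity>" by (simp add: tsum_def)
    then show ?thesis by (simp add: emeasure_count_space split: if_splits)
  qed
  have DE: "(\<integral>\<^sup>+ y. ?D j l y \<partial>M) + ennreal m * F \<omega> j l = F \<omega> j (Suc l)" if j: "j \<le> n" for j l
  proof -
    have "(\<integral>\<^sup>+ y. ?D j l y \<partial>M) = tsum j \<omega> (\<lambda>x. \<integral>\<^sup>+ y. DH j l y x \<partial>M)"
    proof -
      have "(\<lambda>y. DH j l y (pts j i)) \<in> borel_measurable M" for i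
      proof -
        have [measurable]: "pts j i \<in> space (tuple_space j)" by (simp add: space_tuple_space pts_extensional)
        show ?thesis by measurable
      qed
      then show ?thesis
        unfolding tsum_def by (simp add: nn_integral_count_space_finite[OF fin[OF j]] nn_integral_sum)
    qed
    then have "(\<integral>\<^sup>+ y. ?D j l y \<partial>M) + ennreal m * F \<omega> j l = tsum j \<omega> (\<lambda>x. (\<integral>\<^sup>+ y. DH j l y x \<partial>M) + ennreal m * H j l x)"
      by (simp add: F_def tsum_add tsum_cmult)
    also have "\<dots> = F \<omega> j (Suc l)"
      unfolding F_def by (intro tsum_cong H_Suc_right[symmetric] distinct_tuples_extensional)
    finally show ?thesis .
  qed
  have "(\<integral>\<^sup>+ y. U y \<omega> \<partial>M) = (\<Sum>j\<le>n. \<Sum>l. R j (n - j) l * (\<integral>\<^sup>+ y. ?D j l y \<partial>M))"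
    unfolding U_def n by (simp add: nn_integral_sum nn_integral_suminf nn_integral_cmult)
  then have "(\<integral>\<^sup>+ y. U y \<omega> \<partial>M) + (\<Sum>j\<le>n. \<Sum>l. R j (n - j) l * (ennreal m * F \<omega> j l))
    = (\<Sum>j\<le>n. \<Sum>l. R j (n - j) l * ((\<integral>\<^sup>+ y. ?D j l y \<partial>M) + ennreal m * F \<omega> j l))"
    by (simp add: sum.distrib[symmetric] suminf_add distrib_left)
  also have "\<dots> = (\<Sum>j\<le>n. \<Sum>l. R j (n - j) l * F \<omega> j (Suc l))"
    by (intro sum.cong refl suminf_cong) (simp add: DE)
  finally show ?thesis .
qed

text \<open>
  The expectation of \<open>hp\<close> at a Poisson process with intensity \<open>M\<close>, written as a series over
  the number of points; \<open>poisson_hp\<close> below proves that it is this expectation.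
\<close>

definition steinc :: ennreal where
  "steinc = (\<Sum>l. ennreal (exp (- m) / fact l) * H 0 l (\<lambda>_. undefined))"

lemma F_zero: "F \<omega> 0 l = H 0 l (\<lambda>_. undefined)"
  by (simp add: F_def)

lemma F_all: assumes w: "\<omega> \<in> \<Omega>" shows "F \<omega> (npts \<omega>) 0 = ennreal (fact (npts \<omega>)) * ennreal (hp \<omega>)"
proof -
  have "join j 0 x (\<lambda>_. undefined) = dirac_sum j x" for j and x :: "nat \<Rightarrow> 'a"
    by (rule join_eqI) (auto simp: emeasure_join emeasure_dirac_sum)
  then have "F \<omega> (npts \<omega>) 0 = tsum (npts \<omega>) \<omega> (\<lambda>x. ennreal (hp (dirac_sum (npts \<omega>) x)))"
    by (simp add: F_def H_def[abs_def] PW.nn_integral_measure_power_0)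
  also have "\<dots> = ennreal (fact (npts \<omega>)) * ennreal (hp \<omega>)"
    by (rule tsum_dirac_sum_all[OF w refl]) measurable
  finally show ?thesis .
qed

lemma R_rec:
  "(case j of 0 \<Rightarrow> 0 | Suc j' \<Rightarrow> R j' i l) + ennreal m * R j i l + (if j = 0 then ennreal (exp (- m) / fact l) else 0)
    = of_nat i * R j (i - 1) l + (case l of 0 \<Rightarrow> 0 | Suc l' \<Rightarrow> R j i l') + (if i = 0 \<and> l = 0 then ennreal (1 / fact j) else 0)"
proof -
  have 1: "(case j of 0 \<Rightarrow> 0 | Suc j' \<Rightarrow> R j' i l) = ennreal (case j of 0 \<Rightarrow> 0 | Suc j' \<Rightarrow> wgt m j' i l)"
    by (cases j) (auto simp: R_def)
  have 2: "ennreal m * R j i l = ennreal (m * wgt m j i l)"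
    unfolding R_def by (intro ennreal_mult[symmetric] m_nonneg wgt_nonneg)
  have 3: "(if j = 0 then ennreal (exp (- m) / fact l) else 0) = ennreal (if j = 0 then exp (- m) / fact l else 0)" by simp
  have 4: "of_nat i * R j (i - 1) l = ennreal (real i * wgt m j (i - 1) l)"
    unfolding R_def ennreal_of_nat_eq_real_of_nat by (intro ennreal_mult[symmetric] wgt_nonneg) simp
  have 5: "(case l of 0 \<Rightarrow> 0 | Suc l' \<Rightarrow> R j i l') = ennreal (case l of 0 \<Rightarrow> 0 | Suc l' \<Rightarrow> wgt m j i l')"
    by (cases l) (auto simp: R_def)
  have 6: "(if i = 0 \<and> l = 0 then ennreal (1 / fact j) else 0) = ennreal (if i = 0 \<and> l = 0 then 1 / fact j else 0)" by simp
  have e3: "ennreal a + ennreal b + ennreal c = ennreal (a + b + c)" if "0 \<le> a" "0 \<le> b" "0 \<le> c" for a b c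
    using that by simp
  have n1: "0 \<le> (case j of 0 \<Rightarrow> 0 | Suc j' \<Rightarrow> wgt m j' i l)" by (cases j) (auto simp: wgt_nonneg)
  have n5: "0 \<le> (case l of 0 \<Rightarrow> 0 | Suc l' \<Rightarrow> wgt m j i l')" by (cases l) (auto simp: wgt_nonneg)
  have n2: "0 \<le> m * wgt m j i l" using m_nonneg wgt_nonneg by simp
  have n4: "0 \<le> real i * wgt m j (i - 1) l" using wgt_nonneg by simp
  show ?thesis
    unfolding 1 2 3 4 5 6
    by (subst e3[OF n1 n2], simp, subst e3[OF n4 n5], simp) (simp only: wgt_rec)
qed

text \<open>
  All terms are series in the quantities \<open>F \<omega> j l\<close>, the total contribution of \<open>j\<close> kept and \<open>l\<close>
  new points. The integrals of \<open>U\<close> shift \<open>j\<close> or \<open>l\<close> by one, and the coefficients match by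
  \<open>R_rec\<close>. The boundary terms of the recursion are those where no point is kept, which gives
  the constant, and those where all points are kept and none is new, which gives \<open>hp \<omega>\<close>.
\<close>

lemma stein_equation:
  assumes w: "\<omega> \<in> \<Omega>"
  shows "ennreal (hp \<omega>) + (\<integral>\<^sup>+ y. U y \<omega> \<partial>M) = steinc + (\<integral>\<^sup>+ y. U y (remove_point y \<omega>) \<partial>\<omega>)"
proof -
  define n where "n = npts \<omega>"
  let ?F = "F \<omega>"
  define T1 where "T1 = (\<Sum>j\<le>n. \<Sum>l. (case j of 0 \<Rightarrow> 0 | Suc j' \<Rightarrow> R j' (n - j) l) * ?F j l)"
  define T2 where "T2 = (\<Sum>j\<le>n. \<Sum>l. (ennreal m * R j (n - j) l) * ?F j l)"
  define T3 where "T3 = (\<Sum>j\<le>n. \<Sum>l. (if j = 0 then ennreal (exp (- m) / fact l) else 0) * ?F j l)"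
  define T4 where "T4 = (\<Sum>j\<le>n. \<Sum>l. (of_nat (n - j) * R j (n - j - 1) l) * ?F j l)"
  define T5 where "T5 = (\<Sum>j\<le>n. \<Sum>l. (case l of 0 \<Rightarrow> 0 | Suc l' \<Rightarrow> R j (n - j) l') * ?F j l)"
  define T6 where "T6 = (\<Sum>j\<le>n. \<Sum>l. (if n - j = 0 \<and> l = 0 then ennreal (1 / fact j) else 0) * ?F j l)"
  \<comment> \<open>The six terms of \<open>R_rec\<close>, in this order.\<close>
  have main: "T1 + T2 + T3 = T4 + T5 + T6"
  proof -
    have "T1 + T2 + T3 = (\<Sum>j\<le>n. \<Sum>l. ((case j of 0 \<Rightarrow> 0 | Suc j' \<Rightarrow> R j' (n - j) l) + ennreal m * R j (n - j) l
      + (if j = 0 then ennreal (exp (- m) / fact l) else 0)) * ?F j l)"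
      unfolding T1_def T2_def T3_def by (simp add: sum.distrib[symmetric] suminf_add distrib_right)
    also have "\<dots> = (\<Sum>j\<le>n. \<Sum>l. (of_nat (n - j) * R j (n - j - 1) l + (case l of 0 \<Rightarrow> 0 | Suc l' \<Rightarrow> R j (n - j) l')
      + (if n - j = 0 \<and> l = 0 then ennreal (1 / fact j) else 0)) * ?F j l)"
      unfolding R_rec ..
    also have "\<dots> = T4 + T5 + T6"
      unfolding T4_def T5_def T6_def by (simp add: sum.distrib[symmetric] suminf_add distrib_right)
    finally show ?thesis .
  qed
  have T3: "T3 = steinc"
  proof -
    have "T3 = (\<Sum>j\<le>n. if j = 0 then (\<Sum>l. ennreal (exp (- m) / fact l) * ?F j l) else 0)"
      unfolding T3_def by (intro sum.cong) auto
    then show ?thesis by (simp add: steinc_def F_zero)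
  qed
  have T5: "T5 = (\<integral>\<^sup>+ y. U y \<omega> \<partial>M) + T2"
  proof -
    have "T5 = (\<Sum>j\<le>n. \<Sum>l. R j (n - j) l * ?F j (Suc l))"
      unfolding T5_def by (subst suminf_ennreal_Suc) simp
    also have "\<dots> = (\<integral>\<^sup>+ y. U y \<omega> \<partial>M) + T2"
      using U_M_identity[OF w n_def[symmetric]] by (simp add: T2_def ac_simps)
    finally show ?thesis .
  qed
  have T6: "T6 = ennreal (hp \<omega>)"
  proof -
    have "(\<Sum>l. (if n - j = 0 \<and> l = 0 then ennreal (1 / fact j) else 0) * ?F j l)
      = (if j = n then ennreal (1 / fact n) * ?F n 0 else 0)" if "j \<le> n" for j
      using that by (subst suminf_ennreal_Suc) auto
    then have "T6 = (\<Sum>j\<le>n. if j = n then ennreal (1 / fact n) * ?F n 0 else 0)"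
      unfolding T6_def by (intro sum.cong) auto
    also have "\<dots> = (ennreal (1 / fact n) * ennreal (fact n)) * ennreal (hp \<omega>)"
      using F_all[OF w] by (simp add: n_def mult.assoc)
    also have "ennreal (1 / fact n) * ennreal (fact n) = 1" by (subst ennreal_mult[symmetric]) auto
    finally show ?thesis by simp
  qed
  have T1: "T1 = (\<integral>\<^sup>+ y. U y (remove_point y \<omega>) \<partial>\<omega>) + T4"
  proof (cases n)
    case 0
    then have z: "emeasure \<omega> UNIV = 0" using npts[OF w] by (simp add: n_def)
    have "emeasure \<omega> {y} = 0" for y
      using emeasure_space[of \<omega> "{y}"] by (simp add: space_lf w z)
    then have "(\<integral>\<^sup>+ y. U y (remove_point y \<omega>) \<partial>\<omega>) = (\<integral>\<^sup>+ y. 0 \<partial>\<omega>)"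
      by (intro nn_integral_counting_cong counting_of_lf w U_remove_measurable) auto
    then show ?thesis by (simp add: T1_def T4_def 0)
  next
    case (Suc n')
    have "T1 = (\<Sum>j\<le>n'. \<Sum>l. R j (n' - j) l * ?F (Suc j) l)"
      unfolding T1_def Suc by (subst sum.atMost_Suc_shift) simp
    moreover have "T4 = (\<Sum>j\<le>n'. \<Sum>l. R j (n' - j) l * (of_nat (Suc n' - j) * ?F j l))"
    proof -
      have "T4 = (\<Sum>j\<le>n'. \<Sum>l. (of_nat (n - j) * R j (n - j - 1) l) * ?F j l)"
        unfolding T4_def Suc by simp
      also have "\<dots> = (\<Sum>j\<le>n'. \<Sum>l. R j (n' - j) l * (of_nat (Suc n' - j) * ?F j l))"
        unfolding Suc by (intro sum.cong refl suminf_cong) (simp add: ac_simps)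
      finally show ?thesis .
    qed
    ultimately show ?thesis using U_remove_identity[OF w, of n'] Suc by (simp add: n_def)
  qed
  have T2fin: "T2 \<noteq> top"
  proof -
    have "T2 = ennreal m * (\<Sum>j\<le>n. \<Sum>l. R j (n - j) l * ?F j l)"
      unfolding T2_def by (simp add: sum_distrib_left mult.assoc)
    moreover have "(\<Sum>j\<le>n. \<Sum>l. R j (n - j) l * ?F j l) < \<infinity>"
      using weighted_F_finite[OF w _ R_le] by (auto simp: n_def)
    ultimately have "T2 < top" by (simp only: ennreal_mult_less_top) auto
    then show ?thesis by simp
  qed
  have T4fin: "T4 \<noteq> top"
  proof -
    have "T4 = (\<Sum>j\<le>n. of_nat (n - j) * (\<Sum>l. R j (n - j - 1) l * ?F j l))"
      unfolding T4_def by (simp add: mult.assoc)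
    moreover have "(\<Sum>l. R j (n - j - 1) l * ?F j l) < \<infinity>" if "j \<le> n" for j
      using weighted_F_finite[OF w _ R_le] that by (auto simp: n_def)
    ultimately have "T4 < top" by (auto simp: ennreal_mult_less_top of_nat_less_top)
    then show ?thesis by simp
  qed
  have "(T2 + T4) + ((\<integral>\<^sup>+ y. U y (remove_point y \<omega>) \<partial>\<omega>) + steinc) = (T2 + T4) + ((\<integral>\<^sup>+ y. U y \<omega> \<partial>M) + ennreal (hp \<omega>))"
    using main unfolding T1 T3 T5 T6 by (simp only: ac_simps)
  moreover have "T2 + T4 \<noteq> top" using T2fin T4fin by simp
  ultimately show ?thesis by (simp add: ennreal_add_left_cancel add.commute)
qed

end

section \<open>Local statistics of a Poisson process\<close>

lemma distinct_tuples_permute: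
  assumes "x \<in> distinct_tuples k \<omega>" "\<pi> permutes {..<k}"
  shows "(\<lambda>i. x (\<pi> i)) \<in> distinct_tuples k \<omega>"
proof -
  obtain i where i: "i \<in> inj_tuples k (point_indices \<omega>)" "x = pts k i"
    using assms(1) by (auto simp: distinct_tuples_def distinct_indices_eq)
  have "(\<lambda>l. i (\<pi> l)) \<in> inj_tuples k (point_indices \<omega>)"
    using bij_betwE[OF inj_tuples_permute_bij[OF assms(2)]] i(1) by blast
  moreover have "pts k (\<lambda>l. i (\<pi> l)) = (\<lambda>l. x (\<pi> l))" unfolding i(2) by (rule pts_permute[OF assms(2)])
  ultimately show ?thesis unfolding distinct_tuples_def distinct_indices_eq by (metis imageI)
qed

lemma image_permute: "\<pi> permutes {..<k} \<Longrightarrow> (\<lambda>i. x (\<pi> i)) ` {..<k} = x ` {..<k}"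
  using permutes_image[of \<pi> "{..<k}"] by (metis image_image)

lemma extensional_permute: "\<pi> permutes {..<k} \<Longrightarrow> x \<in> extensional {..<k} \<Longrightarrow> (\<lambda>i. x (\<pi> i)) \<in> extensional {..<k}"
  by (auto simp: extensional_def permutes_not_in)

lemma (in exhaustion) measurable_add_dirac_tuple[measurable (raw)]:
  assumes "X \<in> T \<rightarrow>\<^sub>M N" "x \<in> T \<rightarrow>\<^sub>M tuple_space j"
  shows "(\<lambda>t. add_measure (X t) (dirac_sum j (x t))) \<in> T \<rightarrow>\<^sub>M N"
  by (rule measurable_add_dirac[OF assms(1) measurable_tuple_component[OF assms(2)]])

lemma measurable_combine_tuple[measurable (raw)]:
  assumes "I \<subseteq> {..<k}" "x \<in> T \<rightarrow>\<^sub>M tuple_space k" "w \<in> T \<rightarrow>\<^sub>M tuple_space (k - card I)"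
  shows "(\<lambda>t. combine_tuple k I (x t) (w t)) \<in> T \<rightarrow>\<^sub>M tuple_space k"
proof (rule measurable_tupleI)
  fix j assume j: "j < k"
  have fin: "finite I" using assms(1) finite_subset by blast
  show "(\<lambda>t. combine_tuple k I (x t) (w t) j) \<in> T \<rightarrow>\<^sub>M borel"
  proof (cases "j < card I")
    case True
    then have "sorted_list_of_set I ! j \<in> set (sorted_list_of_set I)" by (intro nth_mem) simp
    then have "sorted_list_of_set I ! j < k" using fin assms(1) by auto
    from measurable_tuple_component[OF assms(2) this] show ?thesis
      using True j by (simp add: combine_tuple_def)
  next
    case False
    then have "j - card I < k - card I" using j by auto
    from measurable_tuple_component[OF assms(3) this] show ?thesis
      using False j by (simp add: combine_tuple_def)
  qed
qed simp

text \<open>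
  A statistic may be infinite on a null set of configurations, while test functions are only
  defined on finite counting measures.
\<close>

definition finite_part :: "'a::topological_space measure \<Rightarrow> 'a measure" where
  "finite_part \<mu> = (if \<mu> \<in> finite_counting_measures then \<mu> else null_measure borel)"

context finite_counting
begin

lemma finite_part_lf: "finite_part \<mu> \<in> \<Omega>"
  using lf_null by (auto simp: finite_part_def fin_iff)

lemma measurable_finite_part:
  assumes "\<And>t. t \<in> space T \<Longrightarrow> X t \<in> finite_counting_measures \<longleftrightarrow> emeasure (X t) UNIV < \<infinity>"
    and "\<And>B. B \<in> sets borel \<Longrightarrow> (\<lambda>t. emeasure (X t) B) \<in> borel_measurable T"
  shows "(\<lambda>t. finite_part (X t)) \<in> T \<rightarrow>\<^sub>M N"
proof (rule measurable_eval_sigmaI)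
  fix B :: "'a set" assume B: "B \<in> sets borel"
  have [measurable]: "(\<lambda>t. emeasure (X t) B) \<in> borel_measurable T" "(\<lambda>t. emeasure (X t) UNIV) \<in> borel_measurable T"
    using assms(2) B by auto
  have "(\<lambda>t. if emeasure (X t) UNIV < \<infinity> then emeasure (X t) B else 0) \<in> borel_measurable T" by measurable
  then show "(\<lambda>t. emeasure (finite_part (X t)) B) \<in> borel_measurable T"
    by (rule measurable_cong[THEN iffD2, rotated]) (simp add: finite_part_def assms(1))
qed (rule finite_part_lf)

end

text \<open>
  The contribution of a tuple \<open>x\<close> depends only on the points in the deterministic set \<open>S x\<close>.
  This holds for the truncated statistic, and with the whole space in place of \<open>S x\<close> also for
  the original one.
\<close>

locale local_statistic = poisson C P \<eta> K
  for C :: "nat \<Rightarrow> 'a::{second_countable_topology, t2_space} set" and P :: "'p measure" and \<eta> K +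
  fixes k :: nat and G :: "(nat \<Rightarrow> 'a) \<Rightarrow> 'a measure \<Rightarrow> real"
    and f :: "(nat \<Rightarrow> 'a) \<Rightarrow> 'a measure \<Rightarrow> 'b::{second_countable_topology, t2_space}"
    and S :: "(nat \<Rightarrow> 'a) \<Rightarrow> 'a set"
  assumes k1: "1 \<le> k"
    and lc: "locally_compact_space (euclidean :: 'a topology)"
    and G01: "\<And>x \<omega>. x \<in> extensional {..<k} \<Longrightarrow> \<omega> \<in> counting_measures \<Longrightarrow> G x \<omega> \<in> {0, 1}"
    and G_meas: "(\<lambda>(x, \<omega>). G x \<omega>) \<in> tuple_space k \<Otimes>\<^sub>M N \<rightarrow>\<^sub>M borel"
    and f_meas: "(\<lambda>(x, \<omega>). f x \<omega>) \<in> tuple_space k \<Otimes>\<^sub>M N \<rightarrow>\<^sub>M borel"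
    and G_sym: "symmetric_in_tuple k G" and f_sym: "symmetric_in_tuple k f"
    and S_meas[measurable]: "S \<in> tuple_space k \<rightarrow>\<^sub>M closed_set_space"
    and S_sub: "\<And>x. x \<in> extensional {..<k} \<Longrightarrow> x ` {..<k} \<subseteq> S x"
    and G_local: "\<And>\<omega> x. \<omega> \<in> counting_measures \<Longrightarrow> x \<in> distinct_tuples k \<omega> \<Longrightarrow> G x \<omega> = G x (restr \<omega> (S x))"
    and f_local: "\<And>\<omega> x. \<omega> \<in> counting_measures \<Longrightarrow> x \<in> distinct_tuples k \<omega> \<Longrightarrow> G x \<omega> = 1 \<Longrightarrow>
      f x \<omega> = f x (restr \<omega> (S x))"
begin

sublocale Y: finite_counting "TYPE('b)" .

abbreviation "E \<equiv> extensional {..<k}"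
abbreviation "Kk \<equiv> measure_power k K"

abbreviation "g x \<omega> \<equiv> ennreal (G x \<omega>)"

definition ck :: "nat \<Rightarrow> ennreal" where "ck j = ennreal (1 / fact j)"

definition disj :: "(nat \<Rightarrow> 'a) \<Rightarrow> (nat \<Rightarrow> 'a) \<Rightarrow> bool" where
  "disj x z \<longleftrightarrow> S x \<inter> S z = {}"

text \<open>
  The sets \<open>S x\<close> need not be symmetric in \<open>x\<close>, but the statistics are; hence a tuple counts as
  far from \<open>x\<close> as soon as one of its reorderings is. Splitting the statistic along \<open>disj\<close>
  itself would not give counting measures.
\<close>

definition far :: "(nat \<Rightarrow> 'a) \<Rightarrow> (nat \<Rightarrow> 'a) \<Rightarrow> bool" where
  "far x z \<longleftrightarrow> (\<exists>\<pi>\<in>{\<pi>. \<pi> permutes {..<k}}. disj x (\<lambda>i. z (\<pi> i)))"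

definition Gf :: "(nat \<Rightarrow> 'a) \<Rightarrow> (nat \<Rightarrow> 'a) \<Rightarrow> 'a measure \<Rightarrow> real" where
  "Gf x z \<omega> = G z \<omega> * (if far x z then 1 else 0)"

definition Gn :: "(nat \<Rightarrow> 'a) \<Rightarrow> (nat \<Rightarrow> 'a) \<Rightarrow> 'a measure \<Rightarrow> real" where
  "Gn x z \<omega> = G z \<omega> * (if far x z then 0 else 1)"

abbreviation "xi \<omega> \<equiv> tuple_measure k G f \<omega>"
abbreviation "xif x \<omega> \<equiv> tuple_measure k (Gf x) f \<omega>"
abbreviation "xin x \<omega> \<equiv> tuple_measure k (Gn x) f \<omega>"

lemma G_measurable[measurable (raw)]:
  assumes "x \<in> T \<rightarrow>\<^sub>M tuple_space k" "X \<in> T \<rightarrow>\<^sub>M N"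
  shows "(\<lambda>t. G (x t) (X t)) \<in> borel_measurable T"
  using measurable_compose[OF measurable_Pair[OF assms] G_meas] by simp

lemma f_measurable[measurable (raw)]:
  assumes "x \<in> T \<rightarrow>\<^sub>M tuple_space k" "X \<in> T \<rightarrow>\<^sub>M N"
  shows "(\<lambda>t. f (x t) (X t)) \<in> T \<rightarrow>\<^sub>M borel"
  using measurable_compose[OF measurable_Pair[OF assms] f_meas] by simp

lemma disj_measurable[measurable (raw)]:
  assumes "x \<in> T \<rightarrow>\<^sub>M tuple_space k" "z \<in> T \<rightarrow>\<^sub>M tuple_space k"
  shows "Measurable.pred T (\<lambda>t. disj (x t) (z t))"
  unfolding disj_def
  by (rule pred_closed_disjoint[OF lc]) (rule measurable_compose[OF assms(1) S_meas], rule measurable_compose[OF assms(2) S_meas])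

lemma far_measurable[measurable (raw)]:
  assumes x: "x \<in> T \<rightarrow>\<^sub>M tuple_space k" and z: "z \<in> T \<rightarrow>\<^sub>M tuple_space k"
  shows "Measurable.pred T (\<lambda>t. far (x t) (z t))"
proof -
  have "(\<lambda>t i. z t (\<pi> i)) \<in> T \<rightarrow>\<^sub>M tuple_space k" if \<pi>: "\<pi> permutes {..<k}" for \<pi>
  proof (rule measurable_tupleI)
    show "(\<lambda>t. z t (\<pi> i)) \<in> T \<rightarrow>\<^sub>M borel" if "i < k" for i
      using permutes_in_image[OF \<pi>, of i] that by (intro measurable_tuple_component[OF z]) auto
    show "(\<lambda>i. z t (\<pi> i)) \<in> E" if "t \<in> space T" for t
      using measurable_space[OF z that] by (intro extensional_permute[OF \<pi>]) (simp add: space_tuple_space)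
  qed
  then show ?thesis
    unfolding far_def
    by (intro measurable_pred_countable(2) disj_measurable[OF x] countable_finite finite_permutations) auto
qed

lemma far_sym: "tuple_sym k (far x)"
  unfolding tuple_sym_def
proof (intro allI impI)
  fix \<pi> z assume \<pi>: "\<pi> permutes {..<k}"
  show "far x (\<lambda>i. z (\<pi> i)) = far x z"
  proof
    assume "far x (\<lambda>i. z (\<pi> i))"
    then obtain \<rho> where \<rho>: "\<rho> permutes {..<k}" "disj x (\<lambda>i. z (\<pi> (\<rho> i)))" by (auto simp: far_def)
    have "(\<pi> \<circ> \<rho>) permutes {..<k}" by (rule permutes_compose[OF \<rho>(1) \<pi>])
    then show "far x z" using \<rho>(2) unfolding far_def by (intro bexI[of _ "\<pi> \<circ> \<rho>"]) (auto simp: o_def)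
  next
    assume "far x z"
    then obtain \<rho> where \<rho>: "\<rho> permutes {..<k}" "disj x (\<lambda>i. z (\<rho> i))" by (auto simp: far_def)
    have "(inv \<pi> \<circ> \<rho>) permutes {..<k}" by (rule permutes_compose[OF \<rho>(1) permutes_inv[OF \<pi>]])
    then show "far x (\<lambda>i. z (\<pi> i))"
      using \<rho>(2) unfolding far_def by (intro bexI[of _ "inv \<pi> \<circ> \<rho>"]) (auto simp: o_def permutes_inverses[OF \<pi>])
  qed
qed

lemma disj_imp_far: "disj x z \<Longrightarrow> far x z"
  unfolding far_def by (intro bexI[of _ id]) (auto simp: permutes_id)

lemma not_disj_self: "x \<in> E \<Longrightarrow> \<pi> permutes {..<k} \<Longrightarrow> \<not> disj x (\<lambda>i. x (\<pi> i))"
proof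
  assume x: "x \<in> E" and \<pi>: "\<pi> permutes {..<k}" and d: "disj x (\<lambda>i. x (\<pi> i))"
  have "x 0 \<in> x ` {..<k}" using k1 by auto
  moreover from this have "x 0 \<in> (\<lambda>i. x (\<pi> i)) ` {..<k}" by (simp only: image_permute[OF \<pi>])
  ultimately show False using S_sub[OF x] S_sub[OF extensional_permute[OF \<pi> x]] d by (auto simp: disj_def)
qed

lemma not_far_self: "x \<in> E \<Longrightarrow> \<not> far x x"
  unfolding far_def using not_disj_self by blast

lemma G_sym': "\<omega> \<in> counting_measures \<Longrightarrow> tuple_sym k (\<lambda>x. G x \<omega>)"
  by (rule tuple_sym_component[OF G_sym])

lemma f_sym': "\<omega> \<in> counting_measures \<Longrightarrow> tuple_sym k (\<lambda>x. f x \<omega>)"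
  by (rule tuple_sym_component[OF f_sym])

lemma Gf_sym: "\<omega> \<in> counting_measures \<Longrightarrow> tuple_sym k (\<lambda>z. Gf x z \<omega>)"
  unfolding Gf_def by (rule tuple_sym_comp[OF G_sym' far_sym])

lemma Gn_sym: "\<omega> \<in> counting_measures \<Longrightarrow> tuple_sym k (\<lambda>z. Gn x z \<omega>)"
  unfolding Gn_def by (rule tuple_sym_comp[OF G_sym' far_sym])

lemma Gf01: "z \<in> E \<Longrightarrow> \<omega> \<in> counting_measures \<Longrightarrow> Gf x z \<omega> \<in> {0, 1}"
  using G01[of z \<omega>] by (auto simp: Gf_def)

lemma Gn01: "z \<in> E \<Longrightarrow> \<omega> \<in> counting_measures \<Longrightarrow> Gn x z \<omega> \<in> {0, 1}"
  using G01[of z \<omega>] by (auto simp: Gn_def)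

lemma xi_finite_iff: "\<omega> \<in> counting_measures \<Longrightarrow> xi \<omega> \<in> finite_counting_measures \<longleftrightarrow> emeasure (xi \<omega>) UNIV < \<infinity>"
  by (rule tuple_measure_finite_counting_iff[OF G_sym' f_sym' G01])

lemma xif_finite_iff: "\<omega> \<in> counting_measures \<Longrightarrow> xif x \<omega> \<in> finite_counting_measures \<longleftrightarrow> emeasure (xif x \<omega>) UNIV < \<infinity>"
  by (rule tuple_measure_finite_counting_iff[OF Gf_sym f_sym' Gf01])

lemma xin_values: "\<omega> \<in> counting_measures \<Longrightarrow> emeasure (xin x \<omega>) UNIV = \<infinity> \<or> (\<exists>n::nat. emeasure (xin x \<omega>) UNIV = of_nat n)"
  by (rule tuple_measure_values[OF Gn_sym f_sym' Gn01]) auto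

lemma emeasure_xi: "B \<in> sets borel \<Longrightarrow> emeasure (xi \<omega>) B = ck k * tsum k \<omega> (\<lambda>z. g z \<omega> * indicator B (f z \<omega>))"
  unfolding ck_def by (rule emeasure_tuple_measure)

lemma emeasure_xif: "B \<in> sets borel \<Longrightarrow> emeasure (xif x \<omega>) B = ck k * tsum k \<omega> (\<lambda>z. ennreal (Gf x z \<omega>) * indicator B (f z \<omega>))"
  unfolding ck_def by (rule emeasure_tuple_measure)

lemma emeasure_xin: "B \<in> sets borel \<Longrightarrow> emeasure (xin x \<omega>) B = ck k * tsum k \<omega> (\<lambda>z. ennreal (Gn x z \<omega>) * indicator B (f z \<omega>))"
  unfolding ck_def by (rule emeasure_tuple_measure)

lemma xi_split: "B \<in> sets borel \<Longrightarrow> emeasure (xi \<omega>) B = emeasure (xif x \<omega>) B + emeasure (xin x \<omega>) B"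
proof -
  assume B: "B \<in> sets borel"
  have "g z \<omega> * indicator B (f z \<omega>) = ennreal (Gf x z \<omega>) * indicator B (f z \<omega>) + ennreal (Gn x z \<omega>) * indicator B (f z \<omega>)" for z
    by (simp add: Gf_def Gn_def)
  then show ?thesis by (simp add: emeasure_xi emeasure_xif emeasure_xin B tsum_add distrib_left)
qed

lemma measurable_emeasure_xi[measurable (raw)]:
  assumes [measurable]: "X \<in> T \<rightarrow>\<^sub>M N" "B \<in> sets borel"
  shows "(\<lambda>t. emeasure (xi (X t)) B) \<in> borel_measurable T"
  unfolding emeasure_xi[OF assms(2)] by measurable

lemma measurable_finite_xi[measurable (raw)]:
  assumes [measurable]: "X \<in> T \<rightarrow>\<^sub>M N"
  shows "(\<lambda>t. finite_part (xi (X t))) \<in> T \<rightarrow>\<^sub>M Y.N"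
proof (rule Y.measurable_finite_part)
  show "xi (X t) \<in> finite_counting_measures \<longleftrightarrow> emeasure (xi (X t)) UNIV < \<infinity>" if "t \<in> space T" for t
    using measurable_space[OF assms that] by (intro xi_finite_iff counting_of_lf) simp
qed (rule measurable_emeasure_xi[OF assms])

lemma measurable_finite_xif[measurable (raw)]:
  assumes [measurable]: "x \<in> T \<rightarrow>\<^sub>M tuple_space k" "X \<in> T \<rightarrow>\<^sub>M N"
  shows "(\<lambda>t. finite_part (xif (x t) (X t))) \<in> T \<rightarrow>\<^sub>M Y.N"
proof (rule Y.measurable_finite_part)
  show "xif (x t) (X t) \<in> finite_counting_measures \<longleftrightarrow> emeasure (xif (x t) (X t)) UNIV < \<infinity>" if "t \<in> space T" for t
    using measurable_space[OF assms(2) that] by (intro xif_finite_iff counting_of_lf) simp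
  fix B :: "'b set" assume B[measurable]: "B \<in> sets borel"
  show "(\<lambda>t. emeasure (xif (x t) (X t)) B) \<in> borel_measurable T"
    unfolding emeasure_xif[OF B] Gf_def by measurable
qed

lemma S_closed: "x \<in> E \<Longrightarrow> closed (S x)"
  using closed_of_measurable[OF S_meas, of x] by (simp add: space_tuple_space)

lemma S_borel: "x \<in> E \<Longrightarrow> S x \<in> sets borel"
  using S_closed by (rule borel_closed)

lemma Sc_borel: "x \<in> E \<Longrightarrow> - S x \<in> sets borel"
  using S_borel by (rule borel_comp)

text \<open>
  By symmetry the tuple may be reordered such that its region misses \<open>S x\<close>. The region
  contains the tuple, and it determines the contribution.
\<close>

lemma local_far:
  assumes w: "\<omega> \<in> counting_measures" and x: "x \<in> E" and z: "z \<in> distinct_tuples k \<omega>" and far: "far x z"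
  shows "z ` {..<k} \<subseteq> - S x" "G z (restr \<omega> (- S x)) = G z \<omega>"
    "G z \<omega> = 1 \<Longrightarrow> f z (restr \<omega> (- S x)) = f z \<omega>"
proof -
  obtain \<pi> where \<pi>: "\<pi> permutes {..<k}" "disj x (\<lambda>i. z (\<pi> i))" using far by (auto simp: far_def)
  define z' where "z' i = z (\<pi> i)" for i
  have zE: "z \<in> E" by (rule distinct_tuples_extensional[OF z])
  have z'E: "z' \<in> E" unfolding z'_def[abs_def] by (rule extensional_permute[OF \<pi>(1) zE])
  have im: "z' ` {..<k} = z ` {..<k}" unfolding z'_def[abs_def] by (rule image_permute[OF \<pi>(1)])
  have sub: "S z' \<subseteq> - S x" using \<pi>(2) by (auto simp: disj_def z'_def[abs_def])
  show "z ` {..<k} \<subseteq> - S x" using S_sub[OF z'E] sub im by auto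
  then have zA: "z' ` {..<k} \<subseteq> - S x" by (simp add: im)
  let ?\<omega>' = "restr \<omega> (- S x)"
  have w': "?\<omega>' \<in> counting_measures" by (rule counting_restr[OF w Sc_borel[OF x]])
  have z'd: "z' \<in> distinct_tuples k \<omega>" unfolding z'_def[abs_def] by (rule distinct_tuples_permute[OF z \<pi>(1)])
  have z'd': "z' \<in> distinct_tuples k ?\<omega>'" by (rule distinct_tuples_restr[OF w Sc_borel[OF x] z'd zA])
  have r: "restr ?\<omega>' (S z') = restr \<omega> (S z')"
    using sub by (subst restr_restr) (auto simp: sets_counting w Sc_borel S_borel x z'E Int_absorb1)
  have Gz: "G z' \<mu> = G z \<mu>" "f z' \<mu> = f z \<mu>" if "\<mu> \<in> counting_measures" for \<mu>
    using tuple_symD[OF G_sym'[OF that] \<pi>(1) zE] tuple_symD[OF f_sym'[OF that] \<pi>(1) zE] by (simp_all add: z'_def[abs_def])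
  have "G z' ?\<omega>' = G z' \<omega>" using G_local[OF w' z'd'] G_local[OF w z'd] by (simp add: r)
  then show G: "G z ?\<omega>' = G z \<omega>" using Gz w w' by simp
  assume "G z \<omega> = 1"
  then have "G z' \<omega> = 1" "G z' ?\<omega>' = 1" using Gz w w' G by simp_all
  then have "f z' ?\<omega>' = f z' \<omega>" using f_local[OF w' z'd'] f_local[OF w z'd] by (simp add: r)
  then show "f z ?\<omega>' = f z \<omega>" using Gz w w' by simp
qed

text \<open>The contributions to \<open>xif x\<close> depend only on the points outside \<open>S x\<close>.\<close>

lemma xif_local:
  assumes w: "\<omega> \<in> counting_measures" and x: "x \<in> E"
  shows "xif x (restr \<omega> (- S x)) = xif x \<omega>"
proof (rule measure_eq_borelI)
  fix B :: "'b set" assume B: "B \<in> sets borel"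
  let ?\<omega>' = "restr \<omega> (- S x)"
  have "tsum k ?\<omega>' (\<lambda>z. ennreal (Gf x z ?\<omega>') * indicator B (f z ?\<omega>')) =
     tsum k \<omega> (\<lambda>z. ennreal (Gf x z \<omega>) * indicator B (f z \<omega>))"
    unfolding tsum_restr[OF w Sc_borel[OF x]]
  proof (rule tsum_cong)
    fix z assume z: "z \<in> distinct_tuples k \<omega>"
    show "ennreal (Gf x z ?\<omega>') * indicator B (f z ?\<omega>') * (if z ` {..<k} \<subseteq> - S x then 1 else 0)
      = ennreal (Gf x z \<omega>) * indicator B (f z \<omega>)"
    proof (cases "far x z")
      case True
      note l = local_far[OF w x z True]
      show ?thesis
      proof (cases "G z \<omega> = 1")
        case G1: True
        then show ?thesis using l(1,2) l(3)[OF G1] by (simp add: Gf_def)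
      next
        case False
        then have "G z \<omega> = 0" using G01[OF distinct_tuples_extensional[OF z] w] by auto
        then show ?thesis using l(2) by (simp add: Gf_def)
      qed
    qed (simp add: Gf_def)
  qed
  then show "emeasure (xif x ?\<omega>') B = emeasure (xif x \<omega>) B" by (simp add: emeasure_xif[OF B])
qed auto

lemma xif_add_dirac:
  assumes w: "\<omega> \<in> counting_measures" and x: "x \<in> E"
  shows "xif x (add_measure \<omega> (dirac_sum k x)) = xif x \<omega>"
proof -
  have "restr (add_measure \<omega> (dirac_sum k x)) (- S x) = restr \<omega> (- S x)"
    using S_sub[OF x] by (intro restr_add_dirac_disjoint) (auto simp: sets_counting w Sc_borel x)
  then show ?thesis
    using xif_local[OF w x] xif_local[OF counting_add_dirac[OF w] x, of k x] by simp
qed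

lemma local_near:
  assumes w: "\<omega> \<in> counting_measures" and x: "x \<in> E"
  shows "G x (add_measure (restr \<omega> (S x)) (dirac_sum k x)) = G x (add_measure \<omega> (dirac_sum k x))"
    "G x (add_measure \<omega> (dirac_sum k x)) = 1 \<Longrightarrow>
      f x (add_measure (restr \<omega> (S x)) (dirac_sum k x)) = f x (add_measure \<omega> (dirac_sum k x))"
proof -
  let ?\<omega>1 = "add_measure \<omega> (dirac_sum k x)" and ?\<omega>2 = "add_measure (restr \<omega> (S x)) (dirac_sum k x)"
  note r = counting_restr[OF w S_borel[OF x]]
  have c: "?\<omega>1 \<in> counting_measures" "?\<omega>2 \<in> counting_measures"
    by (intro counting_add_dirac w r)+
  have d: "x \<in> distinct_tuples k ?\<omega>1" "x \<in> distinct_tuples k ?\<omega>2"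
    by (intro distinct_tuples_add_dirac w r x)+
  have r1: "restr ?\<omega>1 (S x) = ?\<omega>2"
    using S_sub[OF x] by (intro restr_add_dirac_subset) (auto simp: sets_counting w S_borel x)
  have r2: "restr ?\<omega>2 (S x) = ?\<omega>2"
    using S_sub[OF x]
    by (subst restr_add_dirac_subset) (auto simp: sets_counting w S_borel x restr_restr)
  show G: "G x ?\<omega>2 = G x ?\<omega>1" using G_local[OF c(1) d(1)] by (simp add: r1)
  assume "G x ?\<omega>1 = 1"
  then show "f x ?\<omega>2 = f x ?\<omega>1" using f_local[OF c(1) d(1)] by (simp add: r1)
qed

definition partials :: "nat set set" where
  "partials = {I. {} \<subset> I \<and> I \<subset> {..<k}}"

lemma finite_partials: "finite partials"
  unfolding partials_def by (rule finite_subset[of _ "Pow {..<k}"]) auto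

lemma Pow_partials: "Pow {..<k} = insert {} (insert {..<k} partials)" "{} \<notin> insert {..<k} partials" "{..<k} \<notin> partials"
proof -
  have "(0::nat) \<in> {..<k}" using k1 by simp
  then show "Pow {..<k} = insert {} (insert {..<k} partials)" "{} \<notin> insert {..<k} partials" "{..<k} \<notin> partials"
    by (auto simp: partials_def)
qed

lemma partialsD: "I \<in> partials \<Longrightarrow> I \<subseteq> {..<k} \<and> card I \<le> k"
  using card_mono[of "{..<k}" I] by (auto simp: partials_def)

lemma combine_tuple_full: "x \<in> E \<Longrightarrow> combine_tuple k {..<k} x w = x"
  by (auto simp: combine_tuple_def fun_eq_iff lessThan_atLeast0 extensional_def)

lemma combine_tuple_empty: "w \<in> E \<Longrightarrow> combine_tuple k {} x w = w"
  by (auto simp: combine_tuple_def fun_eq_iff extensional_def)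

text \<open>
  The case of \<open>k\<close> added points in \<open>tsum_add_dirac_sum\<close>. The terms in which none or all of the
  points of \<open>x\<close> are used are stated separately.
\<close>

lemma tsum_insert_tuple:
  fixes \<omega> :: "'a measure"
  assumes w: "\<omega> \<in> counting_measures" and x: "x \<in> E" and sym: "tuple_sym k \<phi>"
  shows "ck k * tsum k (add_measure \<omega> (dirac_sum k x)) \<phi> = \<phi> x + ck k * tsum k \<omega> \<phi>
    + (\<Sum>I\<in>partials. ck (k - card I) * tsum (k - card I) \<omega> (\<lambda>w. \<phi> (combine_tuple k I x w)))"
proof -
  let ?h = "\<lambda>I. if card I \<le> k then ennreal (1 / fact (k - card I)) * tsum (k - card I) \<omega> (\<lambda>w. \<phi> (combine_tuple k I x w)) else 0"
  have "ck k * tsum k (add_measure \<omega> (dirac_sum k x)) \<phi> = (\<Sum>I\<in>Pow {..<k}. ?h I)"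
    unfolding ck_def by (rule tsum_add_dirac_sum[OF w sym])
  also have "\<dots> = ?h {} + (?h {..<k} + (\<Sum>I\<in>partials. ?h I))"
    unfolding Pow_partials(1) using Pow_partials(2,3) finite_partials by simp
  also have "?h {} = ck k * tsum k \<omega> \<phi>"
  proof -
    have "tsum k \<omega> (\<lambda>w. \<phi> (combine_tuple k {} x w)) = tsum k \<omega> \<phi>"
      by (rule tsum_cong) (simp add: combine_tuple_empty distinct_tuples_extensional)
    then show ?thesis by (simp add: ck_def)
  qed
  also have "?h {..<k} = \<phi> x" by (simp add: combine_tuple_full x)
  also have "(\<Sum>I\<in>partials. ?h I) = (\<Sum>I\<in>partials. ck (k - card I) * tsum (k - card I) \<omega> (\<lambda>w. \<phi> (combine_tuple k I x w)))"
    using partialsD by (intro sum.cong) (auto simp: ck_def)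
  finally show ?thesis by (simp add: ac_simps)
qed

text \<open>
  A bound for the number of points, other than the one of \<open>x\<close>, that appear near \<open>x\<close> once \<open>x\<close>
  is added: tuples of old points that are near \<open>x\<close>, and tuples that use some but not all
  points of \<open>x\<close>.
\<close>

definition near_count :: "(nat \<Rightarrow> 'a) \<Rightarrow> 'a measure \<Rightarrow> ennreal" where
  "near_count x \<omega> = ck k * tsum k \<omega> (\<lambda>z. (if disj x z then 0 else 1) * g z (add_measure \<omega> (dirac_sum k x)))
    + (\<Sum>I\<in>partials. ck (k - card I) * tsum (k - card I) \<omega> (\<lambda>z. g (combine_tuple k I x z) (add_measure \<omega> (dirac_sum k x))))"

lemma ennreal_nat_ge_1:
  assumes "a = \<infinity> \<or> (\<exists>n::nat. a = of_nat n)" "a \<noteq> (0::ennreal)"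
  shows "1 \<le> a"
proof -
  consider "a = \<infinity>" | n :: nat where "a = of_nat n" using assms(1) by blast
  then show ?thesis
  proof cases
    case 2
    then have "1 \<le> n" using assms(2) by (cases n) auto
    then have "of_nat 1 \<le> (of_nat n :: ennreal)" by (subst of_nat_le_iff)
    then show ?thesis using 2 by simp
  qed simp
qed

lemma remove_point_null: "remove_point y (null_measure borel) = null_measure borel"
  by (simp add: remove_point_def)

text \<open>
  If no other tuple is near \<open>x\<close>, removing the point of \<open>x\<close> leaves exactly the far part, to
  which the points of \<open>x\<close> do not contribute. Otherwise at least one point is near, since
  numbers of points are integers, and the bound on \<open>U\<close> suffices.
\<close>

lemma insert_bound:
  assumes w: "\<omega> \<in> \<Omega>" and x: "x \<in> E" and U2: "\<And>y \<mu>. \<mu> \<in> Y.\<Omega> \<Longrightarrow> U y \<mu> \<le> (2::ennreal)"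
    and G1: "G x (add_measure \<omega> (dirac_sum k x)) = 1" and y: "y = f x (add_measure \<omega> (dirac_sum k x))"
  shows "U y (remove_point y (finite_part (xi (add_measure \<omega> (dirac_sum k x)))))
    \<le> U y (finite_part (xif x \<omega>)) + 2 * near_count x \<omega>"
proof -
  let ?\<omega>1 = "add_measure \<omega> (dirac_sum k x)"
  have wc: "\<omega> \<in> counting_measures" by (rule counting_of_lf[OF w])
  have c1: "?\<omega>1 \<in> counting_measures" by (rule counting_add_dirac[OF wc])
  define \<phi> where "\<phi> B z = ennreal (Gn x z ?\<omega>1) * indicator B (f z ?\<omega>1)" for B z
  define R where "R B = ck k * tsum k \<omega> (\<phi> B) + (\<Sum>I\<in>partials. ck (k - card I) * tsum (k - card I) \<omega> (\<lambda>w. \<phi> B (combine_tuple k I x w)))" for B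
  have xin: "emeasure (xin x ?\<omega>1) B = indicator B y + R B" if B: "B \<in> sets borel" for B
  proof -
    have "tuple_sym k (\<phi> B)" unfolding \<phi>_def[abs_def] by (rule tuple_sym_comp[OF Gn_sym[OF c1] f_sym'[OF c1]])
    from tsum_insert_tuple[OF wc x this]
    have "emeasure (xin x ?\<omega>1) B = \<phi> B x + R B"
      unfolding emeasure_xin[OF B] \<phi>_def[symmetric] R_def by (simp add: add.assoc)
    also have "\<phi> B x = indicator B y" by (simp add: \<phi>_def Gn_def not_far_self[OF x] G1 y)
    finally show ?thesis .
  qed
  have R_le: "R UNIV \<le> near_count x \<omega>"
    unfolding R_def near_count_def
  proof (intro add_mono mult_left_mono sum_mono tsum_mono)
    fix z
    show "\<phi> UNIV z \<le> (if disj x z then 0 else 1) * g z ?\<omega>1"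
      using disj_imp_far[of x z] by (auto simp: \<phi>_def Gn_def)
    show "\<phi> UNIV (combine_tuple k I x z) \<le> g (combine_tuple k I x z) ?\<omega>1" for I
      by (auto simp: \<phi>_def Gn_def)
  qed auto
  have R_mono: "R B \<le> R UNIV" for B
    unfolding R_def \<phi>_def by (intro add_mono mult_left_mono sum_mono tsum_mono) (auto split: split_indicator)
  have R_int: "R UNIV = \<infinity> \<or> (\<exists>n::nat. R UNIV = of_nat n)"
  proof (cases "R UNIV = \<infinity>")
    case False
    have "emeasure (xin x ?\<omega>1) UNIV = 1 + R UNIV" using xin[of UNIV] by simp
    moreover have "1 + R UNIV \<noteq> \<infinity>" using False by simp
    ultimately obtain n :: nat where n: "1 + R UNIV = of_nat n" using xin_values[OF c1, of x] by auto
    then obtain n' where "n = Suc n'" by (cases n) auto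
    then have "R UNIV + 1 = of_nat n' + 1" using n by (simp add: add.commute)
    then have "R UNIV = of_nat n'" by (metis ennreal_add_diff_cancel_right ennreal_one_neq_top)
    then show ?thesis by blast
  qed simp
  show ?thesis
  proof (cases "R UNIV = 0")
    case True
    then have R0: "R B = 0" for B using R_mono[of B] by simp
    have eq: "emeasure (xi ?\<omega>1) B = emeasure (xif x \<omega>) B + indicator B y" if "B \<in> sets borel" for B
      using xi_split[OF that, of ?\<omega>1 x] xin[OF that] xif_add_dirac[OF wc x] R0 by simp
    have "remove_point y (finite_part (xi ?\<omega>1)) = finite_part (xif x \<omega>)"
    proof (cases "emeasure (xif x \<omega>) UNIV < \<infinity>")
      case fin: True
      then have f: "xif x \<omega> \<in> finite_counting_measures" using xif_finite_iff[OF wc] by simp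
      have "emeasure (xi ?\<omega>1) UNIV < \<infinity>" using eq[of UNIV] fin by (simp add: less_top)
      then have f1: "xi ?\<omega>1 \<in> finite_counting_measures" using xi_finite_iff[OF c1] by simp
      have "xi ?\<omega>1 = add_measure (xif x \<omega>) (dirac y)"
        by (rule measure_eq_borelI) (auto simp: eq emeasure_add_measure emeasure_dirac_sum)
      moreover have "xif x \<omega> \<in> counting_measures" using f by (simp add: finite_counting_measures_def)
      ultimately have "remove_point y (xi ?\<omega>1) = xif x \<omega>" by (simp add: remove_point_add_dirac)
      then show ?thesis using f f1 by (simp add: finite_part_def)
    next
      case inf: False
      then have "xif x \<omega> \<notin> finite_counting_measures" using xif_finite_iff[OF wc] by simp
      moreover have "\<not> emeasure (xi ?\<omega>1) UNIV < \<infinity>" using eq[of UNIV] inf by (simp add: less_top)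
      then have "xi ?\<omega>1 \<notin> finite_counting_measures" using xi_finite_iff[OF c1] by simp
      ultimately show ?thesis by (simp add: finite_part_def remove_point_null)
    qed
    then show ?thesis by simp
  next
    case False
    have "U y (remove_point y (finite_part (xi ?\<omega>1))) \<le> 2 * 1"
      using U2[OF Y.lf_remove_point[OF Y.finite_part_lf]] by simp
    also have "\<dots> \<le> 2 * near_count x \<omega>"
      using ennreal_nat_ge_1[OF R_int False] R_le by (intro mult_left_mono) auto
    finally show ?thesis by (rule order_trans) simp
  qed
qed

text \<open>The same argument for the original configuration, in which \<open>x\<close> has not been added.\<close>

lemma far_bound:
  assumes w: "\<omega> \<in> \<Omega>" and x: "x \<in> E" and U2: "\<And>y \<mu>. \<mu> \<in> Y.\<Omega> \<Longrightarrow> U y \<mu> \<le> (2::ennreal)"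
  shows "U y (finite_part (xif x \<omega>)) \<le> U y (finite_part (xi \<omega>))
    + 2 * (ck k * tsum k \<omega> (\<lambda>z. (if disj x z then 0 else 1) * g z \<omega>))"
proof -
  have wc: "\<omega> \<in> counting_measures" by (rule counting_of_lf[OF w])
  have UNIV_b: "(UNIV :: 'b set) \<in> sets borel" by simp
  have le: "emeasure (xin x \<omega>) UNIV \<le> ck k * tsum k \<omega> (\<lambda>z. (if disj x z then 0 else 1) * g z \<omega>)"
    unfolding emeasure_xin[OF UNIV_b]
    using disj_imp_far by (intro mult_left_mono tsum_mono) (auto simp: Gn_def)
  show ?thesis
  proof (cases "emeasure (xin x \<omega>) UNIV = 0")
    case True
    have "emeasure (xin x \<omega>) B = 0" for B
      using emeasure_mono[of B UNIV "xin x \<omega>"] True by (cases "B \<in> sets borel") (auto simp: emeasure_notin_sets)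
    then have "xi \<omega> = xif x \<omega>"
      using xi_split[of _ \<omega> x] by (intro measure_eq_borelI) auto
    then show ?thesis by simp
  next
    case False
    have "U y (finite_part (xif x \<omega>)) \<le> 2 * 1" using U2[OF Y.finite_part_lf] by simp
    also have "\<dots> \<le> 2 * (ck k * tsum k \<omega> (\<lambda>z. (if disj x z then 0 else 1) * g z \<omega>))"
      using ennreal_nat_ge_1[OF xin_values[OF wc] False] le by (intro mult_left_mono) (auto intro: order_trans)
    finally show ?thesis by (rule order_trans) simp
  qed
qed

end

section \<open>Palm expectations\<close>

context local_statistic
begin

abbreviation "ad \<omega> j x \<equiv> add_measure \<omega> (dirac_sum j x)"

lemma eta_counting: "p \<in> space P \<Longrightarrow> \<eta> p \<in> counting_measures"
  by (rule counting_of_lf[OF eta_lf])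

lemma sets_eta: "p \<in> space P \<Longrightarrow> sets (\<eta> p) = sets borel"
  by (rule sets_lf[OF eta_lf])

lemma const_tuple[measurable]: "x \<in> E \<Longrightarrow> (\<lambda>_. x) \<in> T \<rightarrow>\<^sub>M tuple_space k"
  by (intro measurable_const) (simp add: space_tuple_space)

definition palm :: "(nat \<Rightarrow> 'a) \<Rightarrow> ennreal" where
  "palm x = (\<integral>\<^sup>+ p. g x (ad (\<eta> p) k x) \<partial>P)"

definition palm2 :: "nat \<Rightarrow> ((nat \<Rightarrow> 'a) \<Rightarrow> nat \<Rightarrow> 'a) \<Rightarrow> (nat \<Rightarrow> 'a) \<Rightarrow> (nat \<Rightarrow> 'a) \<Rightarrow> ennreal" where
  "palm2 j c x z = (\<integral>\<^sup>+ p. g x (ad (ad (\<eta> p) k x) j z) * g (c z) (ad (ad (\<eta> p) k x) j z) \<partial>P)"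

abbreviation "near x z \<equiv> (if disj x z then 0 else 1 :: ennreal)"

text \<open>
  Up to constant factors \<open>A2\<close>, \<open>A3\<close> and \<open>A4\<close> are the terms \<open>E2\<close>, \<open>E3\<close> and \<open>E4\<close>, while \<open>D2\<close>
  collects the pairs of tuples with disjoint regions.
\<close>

definition A2 :: ennreal where
  "A2 = (\<integral>\<^sup>+ x. \<integral>\<^sup>+ z. near x z * palm x * palm z \<partial>Kk \<partial>Kk)"

definition D2 :: ennreal where
  "D2 = (\<integral>\<^sup>+ x. \<integral>\<^sup>+ z. (1 - near x z) * palm x * palm z \<partial>Kk \<partial>Kk)"

definition A3 :: ennreal where
  "A3 = (\<integral>\<^sup>+ x. \<integral>\<^sup>+ z. near x z * palm2 k (\<lambda>z. z) x z \<partial>Kk \<partial>Kk)"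

definition A4 :: ennreal where
  "A4 = (\<Sum>I\<in>partials. ck (k - card I) *
     (\<integral>\<^sup>+ x. \<integral>\<^sup>+ z. palm2 (k - card I) (combine_tuple k I x) x z \<partial>measure_power (k - card I) K \<partial>Kk))"

definition mean :: ennreal where
  "mean = ck k * (\<integral>\<^sup>+ x. palm x \<partial>Kk)"

lemma sigma_finite_Kj: "sigma_finite_measure (measure_power j K)"
  by (rule PW.sigma_finite_measure_power)

lemma palm_measurable[measurable]: "palm \<in> borel_measurable (tuple_space k)"
  unfolding palm_def by measurable

lemma palm2_measurable[measurable (raw)]:
  assumes [measurable]: "x \<in> T \<rightarrow>\<^sub>M tuple_space k" "z \<in> T \<rightarrow>\<^sub>M tuple_space j"
    "(\<lambda>(t, w). c t w) \<in> T \<Otimes>\<^sub>M tuple_space j \<rightarrow>\<^sub>M tuple_space k"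
  shows "(\<lambda>t. palm2 j (c t) (x t) (z t)) \<in> borel_measurable T"
  unfolding palm2_def by measurable

text \<open>
  The second tuple is summed over a configuration that does not contain the first one; the
  points of both may then be added in either order.
\<close>

lemma mecke_pair:
  assumes x: "x \<in> E" and [measurable]: "(\<lambda>(z, \<omega>). \<Psi> z \<omega>) \<in> borel_measurable (tuple_space j \<Otimes>\<^sub>M N)"
  shows "(\<integral>\<^sup>+ p. g x (ad (\<eta> p) k x) * tsum j (\<eta> p) (\<lambda>z. \<Psi> z (ad (\<eta> p) k x)) \<partial>P)
    = (\<integral>\<^sup>+ z. \<integral>\<^sup>+ p. g x (ad (ad (\<eta> p) k x) j z) * \<Psi> z (ad (ad (\<eta> p) k x) j z) \<partial>P \<partial>measure_power j K)"
proof -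
  note [measurable] = const_tuple[OF x]
  have "(\<integral>\<^sup>+ p. g x (ad (\<eta> p) k x) * tsum j (\<eta> p) (\<lambda>z. \<Psi> z (ad (\<eta> p) k x)) \<partial>P)
    = (\<integral>\<^sup>+ p. tsum j (\<eta> p) (\<lambda>z. g x (ad (\<eta> p) k x) * \<Psi> z (ad (\<eta> p) k x)) \<partial>P)"
    by (simp only: tsum_cmult)
  also have "\<dots> = (\<integral>\<^sup>+ z. \<integral>\<^sup>+ p. g x (ad (ad (\<eta> p) j z) k x) * \<Psi> z (ad (ad (\<eta> p) j z) k x) \<partial>P \<partial>measure_power j K)"
    by (rule multivariate_mecke) measurable
  also have "\<dots> = (\<integral>\<^sup>+ z. \<integral>\<^sup>+ p. g x (ad (ad (\<eta> p) k x) j z) * \<Psi> z (ad (ad (\<eta> p) k x) j z) \<partial>P \<partial>measure_power j K)"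
    by (intro nn_integral_cong) (simp only: add_dirac_commute[OF sets_eta])
  finally show ?thesis .
qed

lemma g_idem: "x \<in> E \<Longrightarrow> \<omega> \<in> counting_measures \<Longrightarrow> g x \<omega> * g x \<omega> = g x \<omega>"
  using G01[of x \<omega>] by auto

lemma near_count_expectation_at:
  assumes x: "x \<in> E"
  shows "(\<integral>\<^sup>+ p. g x (ad (\<eta> p) k x) * near_count x (\<eta> p) \<partial>P)
    = ck k * (\<integral>\<^sup>+ z. near x z * palm2 k (\<lambda>z. z) x z \<partial>Kk)
      + (\<Sum>I\<in>partials. ck (k - card I) * (\<integral>\<^sup>+ z. palm2 (k - card I) (combine_tuple k I x) x z \<partial>measure_power (k - card I) K))"
proof -
  note [measurable] = const_tuple[OF x]
  have [measurable]: "combine_tuple k I x \<in> tuple_space (k - card I) \<rightarrow>\<^sub>M tuple_space k" if "I \<in> partials" for I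
    using partialsD[OF that] by (intro measurable_combine_tuple) (auto simp: x)
  let ?g = "\<lambda>p. g x (ad (\<eta> p) k x)"
  let ?t = "\<lambda>p. tsum k (\<eta> p) (\<lambda>z. near x z * g z (ad (\<eta> p) k x))"
  let ?s = "\<lambda>I p. tsum (k - card I) (\<eta> p) (\<lambda>z. g (combine_tuple k I x z) (ad (\<eta> p) k x))"
  have [measurable]: "?t \<in> borel_measurable P" by measurable
  have s: "?s I \<in> borel_measurable P" if "I \<in> partials" for I using that by measurable
  have "(\<integral>\<^sup>+ p. ?g p * near_count x (\<eta> p) \<partial>P)
    = (\<integral>\<^sup>+ p. ck k * (?g p * ?t p) + (\<Sum>I\<in>partials. ck (k - card I) * (?g p * ?s I p)) \<partial>P)"
    unfolding near_count_def by (simp only: distrib_left sum_distrib_left mult.left_commute)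
  also have "\<dots> = ck k * (\<integral>\<^sup>+ p. ?g p * ?t p \<partial>P) + (\<Sum>I\<in>partials. ck (k - card I) * (\<integral>\<^sup>+ p. ?g p * ?s I p \<partial>P))"
  proof -
    have "(\<lambda>p. \<Sum>I\<in>partials. ck (k - card I) * (?g p * ?s I p)) \<in> borel_measurable P"
      using s by (intro borel_measurable_sum) measurable
    then show ?thesis
      using s by (subst nn_integral_add) (auto simp: nn_integral_cmult nn_integral_sum)
  qed
  also have "(\<integral>\<^sup>+ p. ?g p * ?t p \<partial>P) = (\<integral>\<^sup>+ z. near x z * palm2 k (\<lambda>z. z) x z \<partial>Kk)"
  proof -
    have "(\<integral>\<^sup>+ p. ?g p * ?t p \<partial>P)
      = (\<integral>\<^sup>+ z. \<integral>\<^sup>+ p. g x (ad (ad (\<eta> p) k x) k z) * (near x z * g z (ad (ad (\<eta> p) k x) k z)) \<partial>P \<partial>Kk)"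
      by (rule mecke_pair[OF x]) measurable
    also have "\<dots> = (\<integral>\<^sup>+ z. near x z * palm2 k (\<lambda>z. z) x z \<partial>Kk)"
      unfolding palm2_def by (intro nn_integral_cong) simp
    finally show ?thesis .
  qed
  also have "(\<Sum>I\<in>partials. ck (k - card I) * (\<integral>\<^sup>+ p. ?g p * ?s I p \<partial>P))
    = (\<Sum>I\<in>partials. ck (k - card I) * (\<integral>\<^sup>+ z. palm2 (k - card I) (combine_tuple k I x) x z \<partial>measure_power (k - card I) K))"
  proof (intro sum.cong refl arg_cong2[where f = "(*)"])
    fix I assume [measurable]: "I \<in> partials"
    show "(\<integral>\<^sup>+ p. ?g p * ?s I p \<partial>P) = (\<integral>\<^sup>+ z. palm2 (k - card I) (combine_tuple k I x) x z \<partial>measure_power (k - card I) K)"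
      unfolding palm2_def by (rule mecke_pair[OF x]) measurable
  qed
  finally show ?thesis .
qed

lemma combine_tuple_pair_measurable:
  assumes "I \<in> partials"
  shows "(\<lambda>((x, z), w). combine_tuple k I x w)
    \<in> (tuple_space k \<Otimes>\<^sub>M tuple_space (k - card I)) \<Otimes>\<^sub>M tuple_space (k - card I) \<rightarrow>\<^sub>M tuple_space k"
  using partialsD[OF assms] unfolding case_prod_unfold by (intro measurable_combine_tuple) auto

lemma palm2_combine_pair:
  assumes "I \<in> partials"
  shows "(\<lambda>(x, z). palm2 (k - card I) (combine_tuple k I x) x z) \<in> borel_measurable (tuple_space k \<Otimes>\<^sub>M tuple_space (k - card I))"
  using combine_tuple_pair_measurable[OF assms] unfolding case_prod_unfold
  by (intro palm2_measurable) (auto simp: case_prod_unfold)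

text \<open>
  Conditionally on \<open>x\<close> being added, the neighbours made of old points give \<open>A3\<close>, and those
  that share points with \<open>x\<close> give \<open>A4\<close>.
\<close>

lemma near_count_expectation:
  "(\<integral>\<^sup>+ x. \<integral>\<^sup>+ p. g x (ad (\<eta> p) k x) * near_count x (\<eta> p) \<partial>P \<partial>Kk) = ck k * A3 + A4"
proof -
  interpret Kk: sigma_finite_measure Kk by (rule sigma_finite_Kj)
  let ?a = "\<lambda>x. \<integral>\<^sup>+ z. near x z * palm2 k (\<lambda>z. z) x z \<partial>Kk"
  let ?b = "\<lambda>I x. \<integral>\<^sup>+ z. palm2 (k - card I) (combine_tuple k I x) x z \<partial>measure_power (k - card I) K"
  have a[measurable]: "?a \<in> borel_measurable (tuple_space k)" by measurable
  have b: "?b I \<in> borel_measurable (tuple_space k)" if I: "I \<in> partials" for I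
  proof -
    note [measurable] = palm2_combine_pair[OF I]
    interpret Kj: sigma_finite_measure "measure_power (k - card I) K" by (rule sigma_finite_Kj)
    show ?thesis by measurable
  qed
  have "(\<integral>\<^sup>+ x. \<integral>\<^sup>+ p. g x (ad (\<eta> p) k x) * near_count x (\<eta> p) \<partial>P \<partial>Kk)
    = (\<integral>\<^sup>+ x. ck k * ?a x + (\<Sum>I\<in>partials. ck (k - card I) * ?b I x) \<partial>Kk)"
    by (intro nn_integral_cong near_count_expectation_at) (simp add: PW.space_measure_power)
  also have "\<dots> = (\<integral>\<^sup>+ x. ck k * ?a x \<partial>Kk) + (\<integral>\<^sup>+ x. (\<Sum>I\<in>partials. ck (k - card I) * ?b I x) \<partial>Kk)"
    using b by (intro nn_integral_add) auto
  also have "(\<integral>\<^sup>+ x. (\<Sum>I\<in>partials. ck (k - card I) * ?b I x) \<partial>Kk) = (\<Sum>I\<in>partials. ck (k - card I) * (\<integral>\<^sup>+ x. ?b I x \<partial>Kk))"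
    using b by (subst nn_integral_sum) (auto simp: nn_integral_cmult)
  also have "(\<integral>\<^sup>+ x. ck k * ?a x \<partial>Kk) = ck k * (\<integral>\<^sup>+ x. ?a x \<partial>Kk)" by (rule nn_integral_cmult) measurable
  finally show ?thesis by (simp add: A3_def A4_def)
qed

text \<open>
  Each of the two tuples lies outside the region of the other one, so its contribution is not
  affected when the other one is added, and the regions carry independent parts of the
  process.
\<close>

lemma palm2_disjoint:
  assumes x: "x \<in> E" and z: "z \<in> E" and d: "disj x z"
  shows "palm2 k (\<lambda>z. z) x z = palm x * palm z"
proof -
  note [measurable] = const_tuple[OF x] const_tuple[OF z] S_borel[OF x] Sc_borel[OF x]
  have zx: "z ` {..<k} \<inter> S x = {}" and xz: "x ` {..<k} \<inter> S z = {}"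
    using d S_sub[OF x] S_sub[OF z] by (auto simp: disj_def)
  have sub: "- S x \<inter> S z = S z" using d by (auto simp: disj_def)
  have Gx: "G x (ad (ad \<omega> k x) k z) = G x (ad (restr \<omega> (S x)) k x)" if w: "\<omega> \<in> counting_measures" for \<omega>
  proof -
    have c: "ad \<omega> k x \<in> counting_measures" "ad (ad \<omega> k x) k z \<in> counting_measures"
      by (intro counting_add_dirac w)+
    have "x \<in> distinct_tuples k (ad (ad \<omega> k x) k z)"
      by (intro distinct_tuples_mono_add distinct_tuples_add_dirac c w x)
    from G_local[OF c(2) this] have "G x (ad (ad \<omega> k x) k z) = G x (restr (ad (ad \<omega> k x) k z) (S x))" .
    also have "restr (ad (ad \<omega> k x) k z) (S x) = restr (ad \<omega> k x) (S x)"
      using zx by (intro restr_add_dirac_disjoint) (auto simp: sets_counting w S_borel x)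
    also have "\<dots> = ad (restr \<omega> (S x)) k x"
      using S_sub[OF x] by (intro restr_add_dirac_subset) (auto simp: sets_counting w S_borel x)
    finally show ?thesis .
  qed
  have Gz1: "G z (ad (ad \<omega> k x) k z) = G z (ad (restr \<omega> (S z)) k z)" if w: "\<omega> \<in> counting_measures" for \<omega>
  proof -
    have c: "ad \<omega> k x \<in> counting_measures" "ad (ad \<omega> k x) k z \<in> counting_measures"
      by (intro counting_add_dirac w)+
    have "z \<in> distinct_tuples k (ad (ad \<omega> k x) k z)"
      by (intro distinct_tuples_add_dirac c z)
    from G_local[OF c(2) this] have "G z (ad (ad \<omega> k x) k z) = G z (restr (ad (ad \<omega> k x) k z) (S z))" .
    also have "restr (ad (ad \<omega> k x) k z) (S z) = ad (restr (ad \<omega> k x) (S z)) k z"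
      using S_sub[OF z] by (intro restr_add_dirac_subset) (auto simp: sets_counting w S_borel z)
    also have "restr (ad \<omega> k x) (S z) = restr \<omega> (S z)"
      using xz by (intro restr_add_dirac_disjoint) (auto simp: sets_counting w S_borel z)
    finally show ?thesis .
  qed
  have Gz2: "G z (ad (restr \<omega> (- S x)) k z) = G z (ad (restr \<omega> (S z)) k z)" if w: "\<omega> \<in> counting_measures" for \<omega>
  proof -
    have c: "restr \<omega> (- S x) \<in> counting_measures" by (rule counting_restr[OF w Sc_borel[OF x]])
    have "restr (restr \<omega> (- S x)) (S z) = restr \<omega> (S z)"
      by (subst restr_restr) (auto simp: sets_counting w Sc_borel S_borel x z sub)
    then show ?thesis using local_near(1)[OF c z] by simp
  qed
  have "palm2 k (\<lambda>z. z) x z = (\<integral>\<^sup>+ p. g x (ad (restr (\<eta> p) (S x)) k x) * g z (ad (restr (\<eta> p) (- S x)) k z) \<partial>P)"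
    unfolding palm2_def by (intro nn_integral_cong) (simp add: Gx Gz1 Gz2 eta_counting)
  also have "\<dots> = (\<integral>\<^sup>+ q. \<integral>\<^sup>+ p. g x (ad (restr (\<eta> p) (S x)) k x) * g z (ad (restr (\<eta> q) (- S x)) k z) \<partial>P \<partial>P)"
    by (rule nn_integral_restr_indep) measurable
  also have "\<dots> = (\<integral>\<^sup>+ q. palm x * g z (ad (\<eta> q) k z) \<partial>P)"
  proof (rule nn_integral_cong)
    fix q assume q: "q \<in> space P"
    have "(\<integral>\<^sup>+ p. g x (ad (restr (\<eta> p) (S x)) k x) * g z (ad (restr (\<eta> q) (- S x)) k z) \<partial>P)
      = (\<integral>\<^sup>+ p. g x (ad (\<eta> p) k x) * g z (ad (\<eta> q) k z) \<partial>P)"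
      using local_near(1)[OF eta_counting x] Gz2[OF eta_counting[OF q]] local_near(1)[OF eta_counting[OF q] z]
      by (intro nn_integral_cong) simp
    also have "\<dots> = palm x * g z (ad (\<eta> q) k z)"
      unfolding palm_def by (rule nn_integral_multc) measurable
    finally show "(\<integral>\<^sup>+ p. g x (ad (restr (\<eta> p) (S x)) k x) * g z (ad (restr (\<eta> q) (- S x)) k z) \<partial>P)
      = palm x * g z (ad (\<eta> q) k z)" .
  qed
  also have "\<dots> = palm x * palm z"
    unfolding palm_def[of z] by (rule nn_integral_cmult) measurable
  finally show ?thesis .
qed

lemma mean_square: "mean * mean = ck k * ck k * (A2 + D2)"
proof -
  interpret Kk: sigma_finite_measure Kk by (rule sigma_finite_Kj)
  let ?I = "\<integral>\<^sup>+ x. palm x \<partial>Kk"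
  have "A2 + D2 = (\<integral>\<^sup>+ x. (\<integral>\<^sup>+ z. near x z * palm x * palm z \<partial>Kk) + (\<integral>\<^sup>+ z. (1 - near x z) * palm x * palm z \<partial>Kk) \<partial>Kk)"
    unfolding A2_def D2_def by (rule nn_integral_add[symmetric]) measurable
  also have "\<dots> = (\<integral>\<^sup>+ x. palm x * ?I \<partial>Kk)"
  proof (rule nn_integral_cong)
    fix x assume "x \<in> space Kk"
    then have x: "x \<in> E" by (simp add: PW.space_measure_power)
    note [measurable] = const_tuple[OF x]
    have "(\<integral>\<^sup>+ z. near x z * palm x * palm z \<partial>Kk) + (\<integral>\<^sup>+ z. (1 - near x z) * palm x * palm z \<partial>Kk)
      = (\<integral>\<^sup>+ z. near x z * palm x * palm z + (1 - near x z) * palm x * palm z \<partial>Kk)"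
      by (rule nn_integral_add[symmetric]) measurable
    also have "\<dots> = (\<integral>\<^sup>+ z. palm x * palm z \<partial>Kk)"
      by (intro nn_integral_cong) auto
    also have "\<dots> = palm x * ?I" by (rule nn_integral_cmult) measurable
    finally show "(\<integral>\<^sup>+ z. near x z * palm x * palm z \<partial>Kk) + (\<integral>\<^sup>+ z. (1 - near x z) * palm x * palm z \<partial>Kk) = palm x * ?I" .
  qed
  also have "\<dots> = ?I * ?I" by (rule nn_integral_multc) measurable
  finally show ?thesis by (simp add: mean_def ac_simps)
qed

lemma xi_insert_UNIV:
  assumes w: "\<omega> \<in> counting_measures" and x: "x \<in> E"
  shows "emeasure (xi (ad \<omega> k x)) UNIV = g x (ad \<omega> k x) + near_count x \<omega>
    + ck k * tsum k \<omega> (\<lambda>z. (1 - near x z) * g z (ad \<omega> k x))"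
proof -
  let ?\<omega>1 = "ad \<omega> k x"
  have c1: "?\<omega>1 \<in> counting_measures" by (rule counting_add_dirac[OF w])
  have "tuple_sym k (\<lambda>z. g z ?\<omega>1)"
    using G_sym'[OF c1] by (simp add: tuple_sym_def)
  from tsum_insert_tuple[OF w x this]
  have "emeasure (xi ?\<omega>1) UNIV = g x ?\<omega>1 + ck k * tsum k \<omega> (\<lambda>z. g z ?\<omega>1)
    + (\<Sum>I\<in>partials. ck (k - card I) * tsum (k - card I) \<omega> (\<lambda>w. g (combine_tuple k I x w) ?\<omega>1))"
    by (simp add: emeasure_xi)
  moreover have "tsum k \<omega> (\<lambda>z. g z ?\<omega>1) = tsum k \<omega> (\<lambda>z. near x z * g z ?\<omega>1) + tsum k \<omega> (\<lambda>z. (1 - near x z) * g z ?\<omega>1)"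
    unfolding tsum_add[symmetric] by (intro tsum_cong) auto
  ultimately show ?thesis by (simp add: near_count_def distrib_left ac_simps)
qed

lemma disjoint_expectation_at:
  assumes x: "x \<in> E"
  shows "(\<integral>\<^sup>+ p. g x (ad (\<eta> p) k x) * tsum k (\<eta> p) (\<lambda>z. (1 - near x z) * g z (ad (\<eta> p) k x)) \<partial>P)
    = (\<integral>\<^sup>+ z. (1 - near x z) * palm x * palm z \<partial>Kk)"
proof -
  note [measurable] = const_tuple[OF x]
  have "(\<integral>\<^sup>+ p. g x (ad (\<eta> p) k x) * tsum k (\<eta> p) (\<lambda>z. (1 - near x z) * g z (ad (\<eta> p) k x)) \<partial>P)
    = (\<integral>\<^sup>+ z. \<integral>\<^sup>+ p. g x (ad (ad (\<eta> p) k x) k z) * ((1 - near x z) * g z (ad (ad (\<eta> p) k x) k z)) \<partial>P \<partial>Kk)"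
    by (rule mecke_pair[OF x]) measurable
  also have "\<dots> = (\<integral>\<^sup>+ z. (1 - near x z) * palm x * palm z \<partial>Kk)"
  proof (rule nn_integral_cong)
    fix z assume "z \<in> space Kk"
    then have z: "z \<in> E" by (simp add: PW.space_measure_power)
    show "(\<integral>\<^sup>+ p. g x (ad (ad (\<eta> p) k x) k z) * ((1 - near x z) * g z (ad (ad (\<eta> p) k x) k z)) \<partial>P)
      = (1 - near x z) * palm x * palm z"
      using palm2_disjoint[OF x z] by (auto simp: palm2_def)
  qed
  finally show ?thesis .
qed

lemma mean_eq: "(\<integral>\<^sup>+ p. emeasure (xi (\<eta> p)) UNIV \<partial>P) = mean"
proof -
  have "(\<integral>\<^sup>+ p. emeasure (xi (\<eta> p)) UNIV \<partial>P) = ck k * (\<integral>\<^sup>+ p. tsum k (\<eta> p) (\<lambda>z. g z (\<eta> p)) \<partial>P)"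
    by (simp add: emeasure_xi nn_integral_cmult)
  also have "(\<integral>\<^sup>+ p. tsum k (\<eta> p) (\<lambda>z. g z (\<eta> p)) \<partial>P) = (\<integral>\<^sup>+ x. palm x \<partial>Kk)"
    unfolding palm_def by (rule multivariate_mecke) measurable
  finally show ?thesis by (simp add: mean_def)
qed

lemma near_count_measurable: "(\<lambda>(x, \<omega>). near_count x \<omega>) \<in> borel_measurable (tuple_space k \<Otimes>\<^sub>M N)"
proof -
  have "(\<lambda>z. ck (k - card I) * tsum (k - card I) (snd z) (\<lambda>w. g (combine_tuple k I (fst z) w) (ad (snd z) k (fst z))))
    \<in> borel_measurable (tuple_space k \<Otimes>\<^sub>M N)" if "I \<in> partials" for I
  proof -
    have [measurable]: "(\<lambda>(t, w). combine_tuple k I (fst t) w) \<in> (tuple_space k \<Otimes>\<^sub>M N) \<Otimes>\<^sub>M tuple_space (k - card I) \<rightarrow>\<^sub>M tuple_space k"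
      using partialsD[OF that] unfolding case_prod_unfold by (intro measurable_combine_tuple) auto
    show ?thesis by measurable
  qed
  note s = borel_measurable_sum[OF this]
  have "(\<lambda>z. ck k * tsum k (snd z) (\<lambda>w. near (fst z) w * g w (ad (snd z) k (fst z)))) \<in> borel_measurable (tuple_space k \<Otimes>\<^sub>M N)"
    by measurable
  from borel_measurable_add[OF this s] show ?thesis
    unfolding near_count_def case_prod_unfold .
qed

lemma near_count_measurable'[measurable (raw)]:
  assumes "x \<in> T \<rightarrow>\<^sub>M tuple_space k" "X \<in> T \<rightarrow>\<^sub>M N"
  shows "(\<lambda>t. near_count (x t) (X t)) \<in> borel_measurable T"
  using measurable_compose[OF measurable_Pair[OF assms] near_count_measurable] by simp

text \<open>
  Apply the Mecke formula to one factor and sort the tuples counted by the other factor: the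
  same tuple gives the mean, overlapping tuples and tuples with intersecting regions give \<open>A4\<close>
  and \<open>A3\<close>, and the remaining ones factorise by \<open>palm2_disjoint\<close>.
\<close>

lemma second_moment:
  "(\<integral>\<^sup>+ p. emeasure (xi (\<eta> p)) UNIV * emeasure (xi (\<eta> p)) UNIV \<partial>P) = mean + ck k * (ck k * A3 + A4) + ck k * ck k * D2"
proof -
  interpret Kk: sigma_finite_measure Kk by (rule sigma_finite_Kj)
  let ?X = "\<lambda>\<omega>. emeasure (xi \<omega>) UNIV"
  let ?t = "\<lambda>x \<omega>. tsum k \<omega> (\<lambda>z. (1 - near x z) * g z (ad \<omega> k x))"
  have "(\<integral>\<^sup>+ p. ?X (\<eta> p) * ?X (\<eta> p) \<partial>P) = (\<integral>\<^sup>+ p. ck k * tsum k (\<eta> p) (\<lambda>x. ?X (\<eta> p) * g x (\<eta> p)) \<partial>P)"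
    unfolding tsum_cmult by (intro nn_integral_cong) (simp add: emeasure_xi ac_simps)
  also have "\<dots> = ck k * (\<integral>\<^sup>+ p. tsum k (\<eta> p) (\<lambda>x. ?X (\<eta> p) * g x (\<eta> p)) \<partial>P)"
    by (rule nn_integral_cmult) measurable
  also have "(\<integral>\<^sup>+ p. tsum k (\<eta> p) (\<lambda>x. ?X (\<eta> p) * g x (\<eta> p)) \<partial>P)
    = (\<integral>\<^sup>+ x. \<integral>\<^sup>+ p. ?X (ad (\<eta> p) k x) * g x (ad (\<eta> p) k x) \<partial>P \<partial>Kk)"
    by (rule multivariate_mecke) measurable
  also have "\<dots> = (\<integral>\<^sup>+ x. palm x + (\<integral>\<^sup>+ p. g x (ad (\<eta> p) k x) * near_count x (\<eta> p) \<partial>P)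
     + ck k * (\<integral>\<^sup>+ z. (1 - near x z) * palm x * palm z \<partial>Kk) \<partial>Kk)"
  proof (rule nn_integral_cong)
    fix x assume "x \<in> space Kk"
    then have x: "x \<in> E" by (simp add: PW.space_measure_power)
    note [measurable] = const_tuple[OF x]
    have alg: "(a + n + c * t) * a = a * a + a * n + c * (a * t)" for a n c t :: ennreal
      by (simp only: distrib_right mult.assoc mult.commute[of n a] mult.commute[of t a])
    have "(\<integral>\<^sup>+ p. ?X (ad (\<eta> p) k x) * g x (ad (\<eta> p) k x) \<partial>P)
      = (\<integral>\<^sup>+ p. (g x (ad (\<eta> p) k x) + g x (ad (\<eta> p) k x) * near_count x (\<eta> p)) + ck k * (g x (ad (\<eta> p) k x) * ?t x (\<eta> p)) \<partial>P)"
    proof (rule nn_integral_cong)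
      fix p assume p: "p \<in> space P"
      have "?X (ad (\<eta> p) k x) * g x (ad (\<eta> p) k x)
        = g x (ad (\<eta> p) k x) * g x (ad (\<eta> p) k x) + g x (ad (\<eta> p) k x) * near_count x (\<eta> p) + ck k * (g x (ad (\<eta> p) k x) * ?t x (\<eta> p))"
        unfolding xi_insert_UNIV[OF eta_counting[OF p] x] by (rule alg)
      then show "?X (ad (\<eta> p) k x) * g x (ad (\<eta> p) k x)
        = (g x (ad (\<eta> p) k x) + g x (ad (\<eta> p) k x) * near_count x (\<eta> p)) + ck k * (g x (ad (\<eta> p) k x) * ?t x (\<eta> p))"
        by (simp only: g_idem[OF x counting_add_dirac[OF eta_counting[OF p]]])
    qed
    also have "\<dots> = (\<integral>\<^sup>+ p. g x (ad (\<eta> p) k x) + g x (ad (\<eta> p) k x) * near_count x (\<eta> p) \<partial>P)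
       + (\<integral>\<^sup>+ p. ck k * (g x (ad (\<eta> p) k x) * ?t x (\<eta> p)) \<partial>P)"
      by (rule nn_integral_add) measurable
    also have "(\<integral>\<^sup>+ p. g x (ad (\<eta> p) k x) + g x (ad (\<eta> p) k x) * near_count x (\<eta> p) \<partial>P)
      = palm x + (\<integral>\<^sup>+ p. g x (ad (\<eta> p) k x) * near_count x (\<eta> p) \<partial>P)"
      unfolding palm_def by (rule nn_integral_add) measurable
    also have "(\<integral>\<^sup>+ p. ck k * (g x (ad (\<eta> p) k x) * ?t x (\<eta> p)) \<partial>P) = ck k * (\<integral>\<^sup>+ p. g x (ad (\<eta> p) k x) * ?t x (\<eta> p) \<partial>P)"
      by (rule nn_integral_cmult) measurable
    also have "(\<integral>\<^sup>+ p. g x (ad (\<eta> p) k x) * ?t x (\<eta> p) \<partial>P) = (\<integral>\<^sup>+ z. (1 - near x z) * palm x * palm z \<partial>Kk)"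
      by (rule disjoint_expectation_at[OF x])
    finally show "(\<integral>\<^sup>+ p. ?X (ad (\<eta> p) k x) * g x (ad (\<eta> p) k x) \<partial>P)
      = palm x + (\<integral>\<^sup>+ p. g x (ad (\<eta> p) k x) * near_count x (\<eta> p) \<partial>P) + ck k * (\<integral>\<^sup>+ z. (1 - near x z) * palm x * palm z \<partial>Kk)" .
  qed
  also have "\<dots> = (\<integral>\<^sup>+ x. palm x \<partial>Kk) + (\<integral>\<^sup>+ x. \<integral>\<^sup>+ p. g x (ad (\<eta> p) k x) * near_count x (\<eta> p) \<partial>P \<partial>Kk)
     + ck k * D2"
    unfolding D2_def by (subst nn_integral_add, measurable, subst nn_integral_add, measurable, subst nn_integral_cmult, measurable)
  finally show ?thesis
    unfolding near_count_expectation mean_def by (simp only: distrib_left mult.assoc)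
qed

section \<open>The intensity measure and the comparison of Palm expectations\<close>

text \<open>The intensity measure of the statistic in the form given by the Mecke formula.\<close>

definition Lt :: "'b measure" where
  "Lt = distr (density (Kk \<Otimes>\<^sub>M P) (\<lambda>(x, p). ck k * g x (ad (\<eta> p) k x))) borel (\<lambda>(x, p). f x (ad (\<eta> p) k x))"

lemma sets_Lt[simp, measurable_cong]: "sets Lt = sets borel"
  by (simp add: Lt_def)

lemma nn_integral_Lt:
  assumes [measurable]: "\<phi> \<in> borel_measurable borel"
  shows "(\<integral>\<^sup>+ y. \<phi> y \<partial>Lt) = ck k * (\<integral>\<^sup>+ x. \<integral>\<^sup>+ p. g x (ad (\<eta> p) k x) * \<phi> (f x (ad (\<eta> p) k x)) \<partial>P \<partial>Kk)"
proof -
  have "(\<integral>\<^sup>+ y. \<phi> y \<partial>Lt) = (\<integral>\<^sup>+ z. (case z of (x, p) \<Rightarrow> ck k * g x (ad (\<eta> p) k x)) * \<phi> (case z of (x, p) \<Rightarrow> f x (ad (\<eta> p) k x)) \<partial>(Kk \<Otimes>\<^sub>M P))"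
    unfolding Lt_def by (subst nn_integral_distr, measurable, subst nn_integral_density, measurable)
  also have "\<dots> = (\<integral>\<^sup>+ x. \<integral>\<^sup>+ p. ck k * (g x (ad (\<eta> p) k x) * \<phi> (f x (ad (\<eta> p) k x))) \<partial>P \<partial>Kk)"
    by (subst nn_integral_fst[symmetric]) (auto simp: mult.assoc)
  also have "\<dots> = (\<integral>\<^sup>+ x. ck k * (\<integral>\<^sup>+ p. g x (ad (\<eta> p) k x) * \<phi> (f x (ad (\<eta> p) k x)) \<partial>P) \<partial>Kk)"
  proof (rule nn_integral_cong)
    fix x assume "x \<in> space Kk"
    then have x: "x \<in> E" by (simp add: PW.space_measure_power)
    note [measurable] = const_tuple[OF x]
    show "(\<integral>\<^sup>+ p. ck k * (g x (ad (\<eta> p) k x) * \<phi> (f x (ad (\<eta> p) k x))) \<partial>P)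
      = ck k * (\<integral>\<^sup>+ p. g x (ad (\<eta> p) k x) * \<phi> (f x (ad (\<eta> p) k x)) \<partial>P)"
      by (rule nn_integral_cmult) measurable
  qed
  also have "\<dots> = ck k * (\<integral>\<^sup>+ x. \<integral>\<^sup>+ p. g x (ad (\<eta> p) k x) * \<phi> (f x (ad (\<eta> p) k x)) \<partial>P \<partial>Kk)"
    by (rule nn_integral_cmult) measurable
  finally show ?thesis .
qed

lemma emeasure_Lt:
  assumes B[measurable]: "B \<in> sets borel"
  shows "emeasure Lt B = (\<integral>\<^sup>+ p. emeasure (xi (\<eta> p)) B \<partial>P)"
proof -
  have "emeasure Lt B = ck k * (\<integral>\<^sup>+ x. \<integral>\<^sup>+ p. g x (ad (\<eta> p) k x) * indicator B (f x (ad (\<eta> p) k x)) \<partial>P \<partial>Kk)"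
    using nn_integral_Lt[of "indicator B"] by simp
  also have "(\<integral>\<^sup>+ x. \<integral>\<^sup>+ p. g x (ad (\<eta> p) k x) * indicator B (f x (ad (\<eta> p) k x)) \<partial>P \<partial>Kk)
    = (\<integral>\<^sup>+ p. tsum k (\<eta> p) (\<lambda>x. g x (\<eta> p) * indicator B (f x (\<eta> p))) \<partial>P)"
    by (rule multivariate_mecke[symmetric]) measurable
  also have "ck k * \<dots> = (\<integral>\<^sup>+ p. emeasure (xi (\<eta> p)) B \<partial>P)"
    unfolding emeasure_xi[OF B] by (rule nn_integral_cmult[symmetric]) measurable
  finally show ?thesis .
qed

lemma intensity_Lt: "intensity_measure P (\<lambda>p. xi (\<eta> p)) = Lt"
proof -
  have "intensity_measure P (\<lambda>p. xi (\<eta> p)) = measure_of (space Lt) (sets Lt) (emeasure Lt)"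
    unfolding intensity_measure_def
    using sets_eq_imp_space_eq[OF sets_Lt]
    by (auto intro!: measure_of_eq simp: emeasure_Lt sets.sigma_sets_eq[of borel, simplified])
  also have "\<dots> = Lt" by (rule measure_of_of_measure)
  finally show ?thesis .
qed

lemma AE_xi_finite:
  assumes "mean < \<infinity>"
  shows "AE p in P. finite_part (xi (\<eta> p)) = xi (\<eta> p)"
proof -
  have "AE p in P. emeasure (xi (\<eta> p)) UNIV \<noteq> \<infinity>"
    using assms by (intro nn_integral_PInf_AE) (auto simp: mean_eq less_top)
  then show ?thesis
  proof (rule AE_mp, intro AE_I2 impI)
    fix p assume p: "p \<in> space P" and "emeasure (xi (\<eta> p)) UNIV \<noteq> \<infinity>"
    then have "xi (\<eta> p) \<in> finite_counting_measures" using xi_finite_iff[OF eta_counting[OF p]] by (simp add: less_top)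
    then show "finite_part (xi (\<eta> p)) = xi (\<eta> p)" by (simp add: finite_part_def)
  qed
qed

end

locale palm_functional = local_statistic C P \<eta> K k G f S
  for C :: "nat \<Rightarrow> 'a::{second_countable_topology, t2_space} set" and P :: "'p measure" and \<eta> K k G
    and f :: "(nat \<Rightarrow> 'a) \<Rightarrow> 'a measure \<Rightarrow> 'b::{second_countable_topology, t2_space}" and S +
  fixes U :: "'b \<Rightarrow> 'b measure \<Rightarrow> ennreal"
  assumes mean_finite: "mean < \<infinity>"
    and U_meas: "(\<lambda>(y, \<mu>). U y \<mu>) \<in> borel_measurable (borel \<Otimes>\<^sub>M Y.N)"
    and U2: "\<And>y \<mu>. \<mu> \<in> Y.\<Omega> \<Longrightarrow> U y \<mu> \<le> 2"
begin

lemma U_measurable[measurable (raw)]: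
  assumes "y \<in> T \<rightarrow>\<^sub>M borel" "\<mu> \<in> T \<rightarrow>\<^sub>M Y.N"
  shows "(\<lambda>t. U (y t) (\<mu> t)) \<in> borel_measurable T"
  using measurable_compose[OF measurable_Pair[OF assms] U_meas] by simp

abbreviation "fxi \<omega> \<equiv> finite_part (xi \<omega>)"
abbreviation "fxif x \<omega> \<equiv> finite_part (xif x \<omega>)"

lemma palm_formula:
  "(\<integral>\<^sup>+ p. \<integral>\<^sup>+ y. U y (remove_point y (fxi (\<eta> p))) \<partial>fxi (\<eta> p) \<partial>P)
    = ck k * (\<integral>\<^sup>+ x. \<integral>\<^sup>+ p. g x (ad (\<eta> p) k x) *
        U (f x (ad (\<eta> p) k x)) (remove_point (f x (ad (\<eta> p) k x)) (fxi (ad (\<eta> p) k x))) \<partial>P \<partial>Kk)"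
proof -
  have "(\<integral>\<^sup>+ p. \<integral>\<^sup>+ y. U y (remove_point y (fxi (\<eta> p))) \<partial>fxi (\<eta> p) \<partial>P)
    = (\<integral>\<^sup>+ p. ck k * tsum k (\<eta> p) (\<lambda>x. g x (\<eta> p) * U (f x (\<eta> p)) (remove_point (f x (\<eta> p)) (fxi (\<eta> p)))) \<partial>P)"
  proof (rule nn_integral_cong_AE, use AE_xi_finite[OF mean_finite] in eventually_elim)
    case (elim p)
    have [measurable]: "(\<lambda>_. fxi (\<eta> p)) \<in> borel \<rightarrow>\<^sub>M Y.N" by (intro measurable_const) (simp add: Y.finite_part_lf)
    have "(\<integral>\<^sup>+ y. U y (remove_point y (fxi (\<eta> p))) \<partial>fxi (\<eta> p)) = (\<integral>\<^sup>+ y. U y (remove_point y (fxi (\<eta> p))) \<partial>xi (\<eta> p))"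
      by (simp only: elim)
    also have "\<dots> = ck k * tsum k (\<eta> p) (\<lambda>x. g x (\<eta> p) * U (f x (\<eta> p)) (remove_point (f x (\<eta> p)) (fxi (\<eta> p))))"
      unfolding ck_def by (rule nn_integral_tuple_measure) measurable
    finally show ?case .
  qed
  also have "\<dots> = ck k * (\<integral>\<^sup>+ p. tsum k (\<eta> p) (\<lambda>x. g x (\<eta> p) * U (f x (\<eta> p)) (remove_point (f x (\<eta> p)) (fxi (\<eta> p)))) \<partial>P)"
    by (rule nn_integral_cmult) measurable
  also have "(\<integral>\<^sup>+ p. tsum k (\<eta> p) (\<lambda>x. g x (\<eta> p) * U (f x (\<eta> p)) (remove_point (f x (\<eta> p)) (fxi (\<eta> p)))) \<partial>P)
    = (\<integral>\<^sup>+ x. \<integral>\<^sup>+ p. g x (ad (\<eta> p) k x) *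
        U (f x (ad (\<eta> p) k x)) (remove_point (f x (ad (\<eta> p) k x)) (fxi (ad (\<eta> p) k x))) \<partial>P \<partial>Kk)"
    by (rule multivariate_mecke) measurable
  finally show ?thesis .
qed

text \<open>
  The first two factors depend on the process inside \<open>S x\<close>, and the far part depends on it
  outside.
\<close>

lemma independence_formula:
  assumes x: "x \<in> E"
  shows "(\<integral>\<^sup>+ p. g x (ad (\<eta> p) k x) * U (f x (ad (\<eta> p) k x)) (fxif x (\<eta> p)) \<partial>P)
    = (\<integral>\<^sup>+ q. \<integral>\<^sup>+ p. g x (ad (\<eta> p) k x) * U (f x (ad (\<eta> p) k x)) (fxif x (\<eta> q)) \<partial>P \<partial>P)"
proof -
  note [measurable] = const_tuple[OF x] S_borel[OF x]
  define \<Phi> where "\<Phi> \<omega> \<omega>' = g x (ad \<omega> k x) * U (f x (ad \<omega> k x)) (fxif x \<omega>')" for \<omega> \<omega>'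
  have eq: "\<Phi> (restr \<omega> (S x)) (restr \<omega>' (- S x)) = \<Phi> \<omega> \<omega>'" if w: "\<omega> \<in> counting_measures" "\<omega>' \<in> counting_measures" for \<omega> \<omega>'
  proof -
    have "ad \<omega> k x \<in> counting_measures" by (rule counting_add_dirac[OF w(1)])
    then have "G x (ad \<omega> k x) = 0 \<or> G x (ad \<omega> k x) = 1" using G01[OF x] by auto
    then show ?thesis
      using local_near[OF w(1) x] xif_local[OF w(2) x] by (auto simp: \<Phi>_def)
  qed
  have "(\<integral>\<^sup>+ p. \<Phi> (\<eta> p) (\<eta> p) \<partial>P) = (\<integral>\<^sup>+ p. \<Phi> (restr (\<eta> p) (S x)) (restr (\<eta> p) (- S x)) \<partial>P)"
    by (intro nn_integral_cong) (simp add: eq eta_counting)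
  also have "\<dots> = (\<integral>\<^sup>+ q. \<integral>\<^sup>+ p. \<Phi> (restr (\<eta> p) (S x)) (restr (\<eta> q) (- S x)) \<partial>P \<partial>P)"
    by (rule nn_integral_restr_indep) (unfold \<Phi>_def, measurable)
  also have "\<dots> = (\<integral>\<^sup>+ q. \<integral>\<^sup>+ p. \<Phi> (\<eta> p) (\<eta> q) \<partial>P \<partial>P)"
    by (intro nn_integral_cong) (simp add: eq eta_counting)
  finally show ?thesis by (simp only: \<Phi>_def)
qed

definition neighbours :: "(nat \<Rightarrow> 'a) \<Rightarrow> 'a measure \<Rightarrow> ennreal" where
  "neighbours x \<omega> = ck k * tsum k \<omega> (\<lambda>z. near x z * g z \<omega>)"

lemma neighbours_measurable[measurable (raw)]:
  assumes [measurable]: "x \<in> T \<rightarrow>\<^sub>M tuple_space k" "X \<in> T \<rightarrow>\<^sub>M N"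
  shows "(\<lambda>t. neighbours (x t) (X t)) \<in> borel_measurable T"
  unfolding neighbours_def by measurable

lemma neighbours_expectation:
  assumes x: "x \<in> E"
  shows "(\<integral>\<^sup>+ q. neighbours x (\<eta> q) \<partial>P) = ck k * (\<integral>\<^sup>+ z. near x z * palm z \<partial>Kk)"
proof -
  note [measurable] = const_tuple[OF x]
  have "(\<integral>\<^sup>+ q. neighbours x (\<eta> q) \<partial>P) = ck k * (\<integral>\<^sup>+ q. tsum k (\<eta> q) (\<lambda>z. near x z * g z (\<eta> q)) \<partial>P)"
    unfolding neighbours_def by (rule nn_integral_cmult) measurable
  also have "(\<integral>\<^sup>+ q. tsum k (\<eta> q) (\<lambda>z. near x z * g z (\<eta> q)) \<partial>P)
    = (\<integral>\<^sup>+ z. \<integral>\<^sup>+ q. near x z * g z (ad (\<eta> q) k z) \<partial>P \<partial>Kk)"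
    by (rule multivariate_mecke) measurable
  also have "\<dots> = (\<integral>\<^sup>+ z. near x z * palm z \<partial>Kk)"
    unfolding palm_def by (intro nn_integral_cong) simp
  finally show ?thesis .
qed

text \<open>
  Replace the statistic with \<open>x\<close> added by its far part, use independence to resample the
  process in the far part, and replace the far part by the whole statistic again. The two
  replacements cost \<open>insert_bound\<close> and \<open>far_bound\<close>.
\<close>

lemma palm_comparison_at:
  assumes x: "x \<in> E"
  shows "(\<integral>\<^sup>+ p. g x (ad (\<eta> p) k x) * U (f x (ad (\<eta> p) k x)) (remove_point (f x (ad (\<eta> p) k x)) (fxi (ad (\<eta> p) k x))) \<partial>P)
    \<le> (\<integral>\<^sup>+ q. \<integral>\<^sup>+ p. g x (ad (\<eta> p) k x) * U (f x (ad (\<eta> p) k x)) (fxi (\<eta> q)) \<partial>P \<partial>P)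
      + 2 * ck k * (\<integral>\<^sup>+ z. near x z * palm x * palm z \<partial>Kk)
      + 2 * (\<integral>\<^sup>+ p. g x (ad (\<eta> p) k x) * near_count x (\<eta> p) \<partial>P)"
proof -
  note [measurable] = const_tuple[OF x]
  have "(\<integral>\<^sup>+ p. g x (ad (\<eta> p) k x) * U (f x (ad (\<eta> p) k x)) (remove_point (f x (ad (\<eta> p) k x)) (fxi (ad (\<eta> p) k x))) \<partial>P)
    \<le> (\<integral>\<^sup>+ p. g x (ad (\<eta> p) k x) * U (f x (ad (\<eta> p) k x)) (fxif x (\<eta> p)) + 2 * (g x (ad (\<eta> p) k x) * near_count x (\<eta> p)) \<partial>P)"
  proof (rule nn_integral_mono)
    fix p assume p: "p \<in> space P"
    have "ad (\<eta> p) k x \<in> counting_measures" by (rule counting_add_dirac[OF eta_counting[OF p]])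
    then have "G x (ad (\<eta> p) k x) = 0 \<or> G x (ad (\<eta> p) k x) = 1" using G01[OF x] by auto
    then show "g x (ad (\<eta> p) k x) * U (f x (ad (\<eta> p) k x)) (remove_point (f x (ad (\<eta> p) k x)) (fxi (ad (\<eta> p) k x)))
      \<le> g x (ad (\<eta> p) k x) * U (f x (ad (\<eta> p) k x)) (fxif x (\<eta> p)) + 2 * (g x (ad (\<eta> p) k x) * near_count x (\<eta> p))"
      using insert_bound[OF eta_lf[OF p] x U2 _ refl] by auto
  qed
  also have "\<dots> = (\<integral>\<^sup>+ p. g x (ad (\<eta> p) k x) * U (f x (ad (\<eta> p) k x)) (fxif x (\<eta> p)) \<partial>P)
      + (\<integral>\<^sup>+ p. 2 * (g x (ad (\<eta> p) k x) * near_count x (\<eta> p)) \<partial>P)"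
    by (rule nn_integral_add) measurable
  also have "(\<integral>\<^sup>+ p. 2 * (g x (ad (\<eta> p) k x) * near_count x (\<eta> p)) \<partial>P)
      = 2 * (\<integral>\<^sup>+ p. g x (ad (\<eta> p) k x) * near_count x (\<eta> p) \<partial>P)"
    by (rule nn_integral_cmult) measurable
  also have "(\<integral>\<^sup>+ p. g x (ad (\<eta> p) k x) * U (f x (ad (\<eta> p) k x)) (fxif x (\<eta> p)) \<partial>P)
    \<le> (\<integral>\<^sup>+ q. (\<integral>\<^sup>+ p. g x (ad (\<eta> p) k x) * U (f x (ad (\<eta> p) k x)) (fxi (\<eta> q)) \<partial>P) + palm x * (2 * neighbours x (\<eta> q)) \<partial>P)"
    unfolding independence_formula[OF x]
  proof (rule nn_integral_mono)
    fix q assume q: "q \<in> space P"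
    have [measurable]: "(\<lambda>_. fxi (\<eta> q)) \<in> P \<rightarrow>\<^sub>M Y.N" by (intro measurable_const) (simp add: Y.finite_part_lf)
    have "(\<integral>\<^sup>+ p. g x (ad (\<eta> p) k x) * U (f x (ad (\<eta> p) k x)) (fxif x (\<eta> q)) \<partial>P)
      \<le> (\<integral>\<^sup>+ p. g x (ad (\<eta> p) k x) * U (f x (ad (\<eta> p) k x)) (fxi (\<eta> q)) + g x (ad (\<eta> p) k x) * (2 * neighbours x (\<eta> q)) \<partial>P)"
      unfolding distrib_left[symmetric] neighbours_def
      by (intro nn_integral_mono mult_left_mono far_bound[OF eta_lf[OF q] x U2]) auto
    also have "\<dots> = (\<integral>\<^sup>+ p. g x (ad (\<eta> p) k x) * U (f x (ad (\<eta> p) k x)) (fxi (\<eta> q)) \<partial>P)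
       + (\<integral>\<^sup>+ p. g x (ad (\<eta> p) k x) * (2 * neighbours x (\<eta> q)) \<partial>P)"
      by (rule nn_integral_add) measurable
    also have "(\<integral>\<^sup>+ p. g x (ad (\<eta> p) k x) * (2 * neighbours x (\<eta> q)) \<partial>P) = palm x * (2 * neighbours x (\<eta> q))"
      unfolding palm_def by (rule nn_integral_multc) measurable
    finally show "(\<integral>\<^sup>+ p. g x (ad (\<eta> p) k x) * U (f x (ad (\<eta> p) k x)) (fxif x (\<eta> q)) \<partial>P)
      \<le> (\<integral>\<^sup>+ p. g x (ad (\<eta> p) k x) * U (f x (ad (\<eta> p) k x)) (fxi (\<eta> q)) \<partial>P) + palm x * (2 * neighbours x (\<eta> q))" .
  qed
  also have "\<dots> = (\<integral>\<^sup>+ q. \<integral>\<^sup>+ p. g x (ad (\<eta> p) k x) * U (f x (ad (\<eta> p) k x)) (fxi (\<eta> q)) \<partial>P \<partial>P)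
     + (\<integral>\<^sup>+ q. palm x * (2 * neighbours x (\<eta> q)) \<partial>P)"
    by (rule nn_integral_add) measurable
  also have "(\<integral>\<^sup>+ q. palm x * (2 * neighbours x (\<eta> q)) \<partial>P) = palm x * (2 * (\<integral>\<^sup>+ q. neighbours x (\<eta> q) \<partial>P))"
    by (subst nn_integral_cmult, measurable, subst nn_integral_cmult, measurable)
  also have "\<dots> = 2 * ck k * (palm x * (\<integral>\<^sup>+ z. near x z * palm z \<partial>Kk))"
    unfolding neighbours_expectation[OF x] by (simp only: ac_simps)
  also have "palm x * (\<integral>\<^sup>+ z. near x z * palm z \<partial>Kk) = (\<integral>\<^sup>+ z. near x z * palm x * palm z \<partial>Kk)"
    by (subst nn_integral_cmult[symmetric], measurable) (intro nn_integral_cong, simp only: ac_simps)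
  finally show ?thesis by (simp add: add_mono)
qed

text \<open>
  The left-hand side is the expected integral with respect to the point process in the Stein
  equation. Up to the error terms it is bounded by the expected integral with respect to the
  intensity measure of the statistic, which takes the place of \<open>M\<close>.
\<close>

lemma palm_comparison:
  "(\<integral>\<^sup>+ p. \<integral>\<^sup>+ y. U y (remove_point y (fxi (\<eta> p))) \<partial>fxi (\<eta> p) \<partial>P)
    \<le> (\<integral>\<^sup>+ q. \<integral>\<^sup>+ y. U y (fxi (\<eta> q)) \<partial>Lt \<partial>P) + 2 * (ck k * ck k * A2) + 2 * (ck k * (ck k * A3 + A4))"
proof -
  interpret Kk: sigma_finite_measure Kk by (rule sigma_finite_Kj)
  interpret KkP: pair_sigma_finite Kk P ..
  let ?J = "\<lambda>x q. \<integral>\<^sup>+ p. g x (ad (\<eta> p) k x) * U (f x (ad (\<eta> p) k x)) (fxi (\<eta> q)) \<partial>P"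
  have J[measurable]: "(\<lambda>(x, q). ?J x q) \<in> borel_measurable (tuple_space k \<Otimes>\<^sub>M P)" by measurable
  have "(\<integral>\<^sup>+ x. \<integral>\<^sup>+ p. g x (ad (\<eta> p) k x) *
        U (f x (ad (\<eta> p) k x)) (remove_point (f x (ad (\<eta> p) k x)) (fxi (ad (\<eta> p) k x))) \<partial>P \<partial>Kk)
    \<le> (\<integral>\<^sup>+ x. (\<integral>\<^sup>+ q. ?J x q \<partial>P) + 2 * ck k * (\<integral>\<^sup>+ z. near x z * palm x * palm z \<partial>Kk)
      + 2 * (\<integral>\<^sup>+ p. g x (ad (\<eta> p) k x) * near_count x (\<eta> p) \<partial>P) \<partial>Kk)"
    by (intro nn_integral_mono palm_comparison_at) (simp add: PW.space_measure_power)
  also have "\<dots> = (\<integral>\<^sup>+ x. \<integral>\<^sup>+ q. ?J x q \<partial>P \<partial>Kk) + 2 * ck k * A2 + 2 * (ck k * A3 + A4)"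
    unfolding near_count_expectation[symmetric] A2_def
    by (subst nn_integral_add, measurable, subst nn_integral_add, measurable,
        subst nn_integral_cmult, measurable, subst nn_integral_cmult, measurable)
  also have "(\<integral>\<^sup>+ x. \<integral>\<^sup>+ q. ?J x q \<partial>P \<partial>Kk) = (\<integral>\<^sup>+ q. \<integral>\<^sup>+ x. ?J x q \<partial>Kk \<partial>P)"
    by (rule KkP.Fubini'[symmetric]) measurable
  finally have "(\<integral>\<^sup>+ p. \<integral>\<^sup>+ y. U y (remove_point y (fxi (\<eta> p))) \<partial>fxi (\<eta> p) \<partial>P)
    \<le> ck k * ((\<integral>\<^sup>+ q. \<integral>\<^sup>+ x. ?J x q \<partial>Kk \<partial>P) + 2 * ck k * A2 + 2 * (ck k * A3 + A4))"
    unfolding palm_formula by (rule mult_left_mono) simp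
  also have "\<dots> = ck k * (\<integral>\<^sup>+ q. \<integral>\<^sup>+ x. ?J x q \<partial>Kk \<partial>P) + 2 * (ck k * ck k * A2) + 2 * (ck k * (ck k * A3 + A4))"
    by (simp only: distrib_left ac_simps)
  also have "ck k * (\<integral>\<^sup>+ q. \<integral>\<^sup>+ x. ?J x q \<partial>Kk \<partial>P) = (\<integral>\<^sup>+ q. ck k * (\<integral>\<^sup>+ x. ?J x q \<partial>Kk) \<partial>P)"
    by (rule nn_integral_cmult[symmetric]) measurable
  also have "\<dots> = (\<integral>\<^sup>+ q. \<integral>\<^sup>+ y. U y (fxi (\<eta> q)) \<partial>Lt \<partial>P)"
  proof (rule nn_integral_cong)
    fix q
    have [measurable]: "(\<lambda>_. fxi (\<eta> q)) \<in> borel \<rightarrow>\<^sub>M Y.N" by (intro measurable_const) (simp add: Y.finite_part_lf)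
    show "ck k * (\<integral>\<^sup>+ x. ?J x q \<partial>Kk) = (\<integral>\<^sup>+ y. U y (fxi (\<eta> q)) \<partial>Lt)"
      by (rule nn_integral_Lt[symmetric]) measurable
  qed
  finally show ?thesis .
qed

end

section \<open>Integrals of functions with small oscillation\<close>

text \<open>
  The integrand is a constant \<open>a \<le> 1\<close> plus a function \<open>v\<close> with values in the unit interval,
  which is a mixture of indicators of its level sets. For a level set \<open>A\<close> the difference of
  the masses is combined with the fraction \<open>1 - a\<close> of the difference of the total masses; this
  amounts to averaging the bounds for \<open>A\<close> and for its complement.
\<close>

lemma nn_integral_diff_le_d_TV:
  fixes \<phi> :: "'a::topological_space \<Rightarrow> ennreal"
  assumes L: "finite_measure L" "sets L = sets borel" and M: "finite_measure M" "sets M = sets borel"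
    and \<phi>: "\<phi> \<in> borel_measurable borel" and le2: "\<And>y. \<phi> y \<le> 2" and osc: "\<And>y y'. \<phi> y \<le> \<phi> y' + 1"
  shows "(\<integral>\<^sup>+ y. \<phi> y \<partial>L) + emeasure M UNIV \<le> (\<integral>\<^sup>+ y. \<phi> y \<partial>M) + emeasure L UNIV + d_TV L M"
proof -
  interpret L: finite_measure L by fact
  interpret M: finite_measure M by fact
  have sp: "space L = UNIV" "space M = UNIV" using sets_eq_imp_space_eq[OF L(2)] sets_eq_imp_space_eq[OF M(2)] by auto
  note [measurable_cong] = L(2) M(2)
  note [measurable] = \<phi>
  define a where "a = min (INF y. \<phi> y) 1"
  have a1: "a \<le> 1" by (simp add: a_def)
  have a\<phi>: "a \<le> \<phi> y" for y unfolding a_def by (metis INF_lower UNIV_I min.coboundedI1)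
  define v where "v y = \<phi> y - a" for y
  have [measurable]: "v \<in> borel_measurable borel" unfolding v_def by measurable
  have \<phi>v: "\<phi> y = a + v y" for y unfolding v_def using diff_add_cancel_ennreal[OF a\<phi>[of y]] by (simp only: add.commute)
  have sub: "x - c \<le> z \<longleftrightarrow> x \<le> c + z" if "c \<le> 1" for x c z :: ennreal
    using that by (auto simp: ennreal_minus_le_iff top_unique)
  have v1: "v y \<le> 1" for y
  proof (cases "(INF y. \<phi> y) \<le> 1")
    case True
    have "\<phi> y - 1 \<le> (INF y. \<phi> y)"
      by (rule INF_greatest) (use osc[of y] in \<open>simp add: sub add.commute\<close>)
    then have "\<phi> y - 1 \<le> a" using True by (simp add: a_def)
    then have "\<phi> y \<le> a + 1" by (simp add: sub add.commute)
    then show ?thesis unfolding v_def by (simp add: sub[OF a1])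
  next
    case False
    then have "a = 1" by (simp add: a_def min_def)
    then show ?thesis unfolding v_def using le2[of y] by (simp add: sub)
  qed
  obtain a' where a': "a = ennreal a'" "0 \<le> a'" "a' \<le> 1"
    using a1 by (cases a) (auto simp: top_unique)
  define b where "b = 1 - a'"
  have b: "0 \<le> b" "b \<le> 1" using a' by (auto simp: b_def)
  have level: "emeasure L A + ennreal b * emeasure M UNIV \<le> emeasure M A + (ennreal b * emeasure L UNIV + d_TV L M)"
    if A: "A \<in> sets borel" for A
  proof (cases "d_TV L M")
    case (real d)
    have 1: "\<bar>measure L A - measure M A\<bar> \<le> d" if "A \<in> sets borel" for A
      using d_TV_ge[OF that, of L M] real by (simp add: L.emeasure_eq_measure M.emeasure_eq_measure)
    have Ac: "- A \<in> sets borel" using A by auto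
    have c: "measure L UNIV = measure L A + measure L (- A)" "measure M UNIV = measure M A + measure M (- A)"
      using L.finite_measure_compl[of A] M.finite_measure_compl[of A] A L(2) M(2) by (auto simp: sp Compl_eq_Diff_UNIV)
    \<comment> \<open>The average of the bounds for the set and for its complement.\<close>
    have "(1 - b) * (measure L A - measure M A) + b * (measure M (- A) - measure L (- A)) \<le> (1 - b) * d + b * d"
      using 1[OF A] 1[OF Ac] b by (intro add_mono mult_left_mono) auto
    then have "measure L A + b * measure M UNIV \<le> measure M A + (b * measure L UNIV + d)"
      unfolding c by (simp add: algebra_simps)
    then show ?thesis
      using real b by (simp add: L.emeasure_eq_measure M.emeasure_eq_measure ennreal_mult[symmetric] ennreal_plus[symmetric] del: ennreal_plus)
  qed simp
  define I where "I = restrict_space lborel {0..1 :: real}"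
  have I1: "(\<integral>\<^sup>+ t. c \<partial>I) = c" for c
    unfolding I_def by (subst nn_integral_restrict_space) (auto simp: nn_integral_cmult_indicator)
  have emI: "emeasure I (space I) = 1" using I1[of 1] by simp
  interpret I: sigma_finite_measure I unfolding I_def
    by (rule sigma_finite_measure_restrict_space) (auto intro: sigma_finite_lborel)
  have lev: "{y. ennreal t < v y} \<in> sets borel" for t
  proof -
    have "{y \<in> space borel. ennreal t < v y} \<in> sets borel" by measurable
    then show ?thesis by simp
  qed
  have level_int: "(\<integral>\<^sup>+ y. (if ennreal t < v y then 1 else 0) \<partial>N) = emeasure N {y. ennreal t < v y}"
    if "sets N = sets borel" for N t
  proof -
    have "(\<integral>\<^sup>+ y. (if ennreal t < v y then 1 else 0) \<partial>N) = (\<integral>\<^sup>+ y. indicator {y. ennreal t < v y} y \<partial>N)"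
      by (intro nn_integral_cong) auto
    also have "\<dots> = emeasure N {y. ennreal t < v y}" by (rule nn_integral_indicator) (simp add: that lev)
    finally show ?thesis .
  qed
  have vint: "(\<integral>\<^sup>+ y. v y \<partial>N) = (\<integral>\<^sup>+ t. emeasure N {y. ennreal t < v y} \<partial>I)"
    if "finite_measure N" and [measurable_cong]: "sets N = sets borel" for N
  proof -
    interpret N: finite_measure N by fact
    interpret pair_sigma_finite I N by standard
    have [measurable]: "(\<lambda>t. t) \<in> borel_measurable I" unfolding I_def by (rule measurable_restrict_space1) simp
    have spN: "space N = UNIV" using sets_eq_imp_space_eq[OF that(2)] by simp
    have "v y = (\<integral>\<^sup>+ t. indicator {t. ennreal t < v y} t \<partial>I)" for y
    proof -
      obtain r where r: "v y = ennreal r" "0 \<le> r" "r \<le> 1" using v1[of y] by (cases "v y") (auto simp: top_unique)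
      have e: "indicator {t. ennreal t < v y} t * indicator {0..1} t = (indicator {0..<r} t :: ennreal)" for t
        using r by (auto simp: ennreal_less_iff split: split_indicator)
      have "(\<integral>\<^sup>+ t. indicator {t. ennreal t < v y} t \<partial>I)
        = (\<integral>\<^sup>+ t. indicator {t. ennreal t < v y} t * indicator {0..1} t \<partial>lborel)"
        unfolding I_def by (rule nn_integral_restrict_space) simp
      also have "\<dots> = (\<integral>\<^sup>+ t. indicator {0..<r} t \<partial>lborel)" by (simp only: e)
      also have "\<dots> = ennreal r" using r by simp
      finally show ?thesis by (simp add: r)
    qed
    then have "(\<integral>\<^sup>+ y. v y \<partial>N) = (\<integral>\<^sup>+ y. \<integral>\<^sup>+ t. indicator {t. ennreal t < v y} t \<partial>I \<partial>N)" by simp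
    also have "\<dots> = (\<integral>\<^sup>+ y. \<integral>\<^sup>+ t. (if ennreal t < v y then 1 else 0) \<partial>I \<partial>N)"
      by (intro nn_integral_cong) auto
    also have "\<dots> = (\<integral>\<^sup>+ t. \<integral>\<^sup>+ y. (if ennreal t < v y then 1 else 0) \<partial>N \<partial>I)"
      by (rule Fubini') measurable
    also have "\<dots> = (\<integral>\<^sup>+ t. emeasure N {y. ennreal t < v y} \<partial>I)"
      by (intro nn_integral_cong level_int[OF that(2)])
    finally show ?thesis .
  qed
  have em: "(\<lambda>t. emeasure N {y. ennreal t < v y}) \<in> borel_measurable I"
    if "finite_measure N" and [measurable_cong]: "sets N = sets borel" for N
  proof -
    interpret N: finite_measure N by fact
    have [measurable]: "(\<lambda>t. t) \<in> borel_measurable I" unfolding I_def by (rule measurable_restrict_space1) simp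
    have "(\<lambda>t. \<integral>\<^sup>+ y. (if ennreal t < v y then 1 else 0) \<partial>N) \<in> borel_measurable I" by measurable
    then show ?thesis by (simp only: level_int[OF that(2)])
  qed
  have "(\<integral>\<^sup>+ y. v y \<partial>L) + ennreal b * emeasure M UNIV
    = (\<integral>\<^sup>+ t. emeasure L {y. ennreal t < v y} + ennreal b * emeasure M UNIV \<partial>I)"
    unfolding vint[OF L] by (subst nn_integral_add) (auto simp: emI em[OF L])
  also have "\<dots> \<le> (\<integral>\<^sup>+ t. emeasure M {y. ennreal t < v y} + (ennreal b * emeasure L UNIV + d_TV L M) \<partial>I)"
    by (intro nn_integral_mono level lev)
  also have "\<dots> = (\<integral>\<^sup>+ y. v y \<partial>M) + (ennreal b * emeasure L UNIV + d_TV L M)"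
    unfolding vint[OF M] by (subst nn_integral_add) (auto simp: emI em[OF M])
  finally have v: "(\<integral>\<^sup>+ y. v y \<partial>L) + ennreal b * emeasure M UNIV
    \<le> (\<integral>\<^sup>+ y. v y \<partial>M) + (ennreal b * emeasure L UNIV + d_TV L M)" .
  have one: "c = a * c + ennreal b * c" for c :: ennreal
    using a' by (simp add: b_def distrib_right[symmetric] ennreal_plus[symmetric] del: ennreal_plus)
  have \<phi>int: "(\<integral>\<^sup>+ y. \<phi> y \<partial>N) = a * emeasure N UNIV + (\<integral>\<^sup>+ y. v y \<partial>N)"
    if [measurable_cong]: "sets N = sets borel" for N
    unfolding \<phi>v using sets_eq_imp_space_eq[OF that] by (subst nn_integral_add) auto
  have "(\<integral>\<^sup>+ y. \<phi> y \<partial>L) + emeasure M UNIV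
    = a * emeasure L UNIV + a * emeasure M UNIV + ((\<integral>\<^sup>+ y. v y \<partial>L) + ennreal b * emeasure M UNIV)"
    unfolding \<phi>int[OF L(2)] by (subst one[of "emeasure M UNIV"]) (simp only: ac_simps)
  also have "\<dots> \<le> a * emeasure L UNIV + a * emeasure M UNIV + ((\<integral>\<^sup>+ y. v y \<partial>M) + (ennreal b * emeasure L UNIV + d_TV L M))"
    by (intro add_left_mono v)
  also have "\<dots> = (\<integral>\<^sup>+ y. \<phi> y \<partial>M) + emeasure L UNIV + d_TV L M"
    unfolding \<phi>int[OF M(2)] by (subst (3) one[of "emeasure L UNIV"]) (simp only: ac_simps)
  finally show ?thesis .
qed

section \<open>Stein's method for local statistics\<close>

lemma KR_test_functions_uminus: "h \<in> KR_test_functions \<Longrightarrow> (\<lambda>\<omega>. - h \<omega>) \<in> KR_test_functions"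
  by (auto simp: KR_test_functions_def abs_minus_commute)

context stein
begin

lemma h_integrable:
  assumes P: "prob_space P" and X[measurable]: "X \<in> P \<rightarrow>\<^sub>M N"
    and fin: "(\<integral>\<^sup>+ p. emeasure (X p) UNIV \<partial>P) < \<infinity>"
  shows "integrable P (\<lambda>p. h (X p))"
    and "integrable P (\<lambda>p. measure (X p) UNIV)"
    and "(\<integral>\<^sup>+ p. emeasure (X p) UNIV \<partial>P) = ennreal (\<integral>p. measure (X p) UNIV \<partial>P)"
    and "(\<integral>\<^sup>+ p. ennreal (hp (X p)) \<partial>P) = ennreal ((\<integral>p. h (X p) \<partial>P) + \<bar>h zero\<bar> + (\<integral>p. measure (X p) UNIV \<partial>P))"
    and "0 \<le> (\<integral>p. h (X p) \<partial>P) + \<bar>h zero\<bar> + (\<integral>p. measure (X p) UNIV \<partial>P)"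
proof -
  interpret P: prob_space P by fact
  have Xl: "X p \<in> \<Omega>" if "p \<in> space P" for p using measurable_space[OF X that] by simp
  have m[measurable]: "(\<lambda>p. measure (X p) UNIV) \<in> borel_measurable P" unfolding measure_def by measurable
  have em: "emeasure (X p) UNIV = ennreal (measure (X p) UNIV)" if "p \<in> space P" for p
    using finite_lf[OF Xl[OF that], of UNIV] by (simp add: emeasure_eq_ennreal_measure)
  have eq: "(\<integral>\<^sup>+ p. ennreal (measure (X p) UNIV) \<partial>P) = (\<integral>\<^sup>+ p. emeasure (X p) UNIV \<partial>P)"
    by (intro nn_integral_cong) (simp add: em)
  show 1: "integrable P (\<lambda>p. measure (X p) UNIV)"
    by (rule integrableI_nonneg) (use fin eq in auto)
  show "(\<integral>\<^sup>+ p. emeasure (X p) UNIV \<partial>P) = ennreal (\<integral>p. measure (X p) UNIV \<partial>P)"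
    unfolding eq[symmetric] by (rule nn_integral_eq_integral[OF 1]) simp
  have hm[measurable]: "(\<lambda>p. h (X p)) \<in> borel_measurable P" by measurable
  show 2: "integrable P (\<lambda>p. h (X p))"
  proof (rule Bochner_Integration.integrable_bound)
    show "integrable P (\<lambda>p. \<bar>h zero\<bar> + measure (X p) UNIV)" using 1 by simp
    show "AE p in P. norm (h (X p)) \<le> norm (\<bar>h zero\<bar> + measure (X p) UNIV)"
    proof (rule AE_I2)
      fix p assume "p \<in> space P"
      then show "norm (h (X p)) \<le> norm (\<bar>h zero\<bar> + measure (X p) UNIV)"
        using h_size[OF Xl, of p] by simp
    qed
  qed measurable
  have 3: "integrable P (\<lambda>p. hp (X p))" unfolding hp_def using 1 2 by simp
  have "0 \<le> (\<integral>p. hp (X p) \<partial>P)" by (rule integral_nonneg_AE) (auto intro!: AE_I2 hp_nonneg Xl)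
  then show "0 \<le> (\<integral>p. h (X p) \<partial>P) + \<bar>h zero\<bar> + (\<integral>p. measure (X p) UNIV \<partial>P)"
    unfolding hp_def using 1 2 by (simp add: P.prob_space)
  have "(\<integral>\<^sup>+ p. ennreal (hp (X p)) \<partial>P) = ennreal (\<integral>p. hp (X p) \<partial>P)"
    by (rule nn_integral_eq_integral[OF 3]) (auto intro!: AE_I2 hp_nonneg Xl)
  then show "(\<integral>\<^sup>+ p. ennreal (hp (X p)) \<partial>P) = ennreal ((\<integral>p. h (X p) \<partial>P) + \<bar>h zero\<bar> + (\<integral>p. measure (X p) UNIV \<partial>P))"
    unfolding hp_def using 1 2 by (simp add: P.prob_space)
qed

lemma nn_integral_U_M_finite:
  assumes P: "prob_space P" and X: "X \<in> P \<rightarrow>\<^sub>M N"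
  shows "(\<integral>\<^sup>+ p. \<integral>\<^sup>+ y. U y (X p) \<partial>M \<partial>P) < \<infinity>"
proof -
  interpret P: prob_space P by fact
  have sp: "space M = UNIV" using sets_eq_imp_space_eq[OF M_sets] by simp
  have "(\<integral>\<^sup>+ p. \<integral>\<^sup>+ y. U y (X p) \<partial>M \<partial>P) \<le> (\<integral>\<^sup>+ p. \<integral>\<^sup>+ y. 2 \<partial>M \<partial>P)"
    using measurable_space[OF X] by (intro nn_integral_mono U_le_2) simp
  also have "\<dots> < \<infinity>" by (simp add: P.emeasure_space_1 M_UNIV sp ennreal_mult_less_top)
  finally show ?thesis .
qed

lemma U_remove_pair_measurable: "(\<lambda>(y, \<omega>). U y (remove_point y \<omega>)) \<in> borel_measurable (borel \<Otimes>\<^sub>M N)"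
proof -
  have "(\<lambda>z. (fst z, remove_point (fst z) (snd z))) \<in> borel \<Otimes>\<^sub>M N \<rightarrow>\<^sub>M borel \<Otimes>\<^sub>M N" by measurable
  from measurable_compose[OF this U_measurable] show ?thesis by (simp add: case_prod_unfold)
qed

lemma measurable_nn_integral_U_remove:
  assumes X[measurable]: "X \<in> T \<rightarrow>\<^sub>M N"
  shows "(\<lambda>t. \<integral>\<^sup>+ y. U y (remove_point y (X t)) \<partial>X t) \<in> borel_measurable T"
proof (rule kernel_nn_integral_measurable[OF _ X])
  have "(\<lambda>z. (snd z, X (fst z))) \<in> T \<Otimes>\<^sub>M borel \<rightarrow>\<^sub>M borel \<Otimes>\<^sub>M N" by measurable
  from measurable_compose[OF this U_remove_pair_measurable]
  show "(\<lambda>(t, y). U y (remove_point y (X t))) \<in> borel_measurable (T \<Otimes>\<^sub>M borel)"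
    by (simp add: case_prod_unfold)
qed

text \<open>
  For the Poisson process the two integrals in the Stein equation have the same expectation,
  by the Mecke formula.
\<close>

lemma poisson_hp:
  assumes Q: "poisson (\<lambda>_. UNIV :: 'a set) Q \<zeta> M"
  shows "(\<integral>\<^sup>+ q. ennreal (hp (\<zeta> q)) \<partial>Q) = steinc"
proof -
  interpret Q: poisson "\<lambda>_. UNIV :: 'a set" Q \<zeta> M by fact
  have [measurable]: "\<zeta> \<in> Q \<rightarrow>\<^sub>M N" by (rule Q.\<eta>_N)
  have U1[measurable]: "(\<lambda>(p, y). U y (\<zeta> p)) \<in> borel_measurable (Q \<Otimes>\<^sub>M M)"
  proof -
    have "(\<lambda>z. (snd z, \<zeta> (fst z))) \<in> Q \<Otimes>\<^sub>M M \<rightarrow>\<^sub>M borel \<Otimes>\<^sub>M N" by measurable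
    from measurable_compose[OF this U_measurable] show ?thesis by (simp add: case_prod_unfold)
  qed
  have IM[measurable]: "(\<lambda>q. \<integral>\<^sup>+ y. U y (\<zeta> q) \<partial>M) \<in> borel_measurable Q" by measurable
  have IR[measurable]: "(\<lambda>q. \<integral>\<^sup>+ y. U y (remove_point y (\<zeta> q)) \<partial>\<zeta> q) \<in> borel_measurable Q"
    by (rule measurable_nn_integral_U_remove) measurable
  have "(\<integral>\<^sup>+ q. ennreal (hp (\<zeta> q)) \<partial>Q) + (\<integral>\<^sup>+ q. \<integral>\<^sup>+ y. U y (\<zeta> q) \<partial>M \<partial>Q)
    = (\<integral>\<^sup>+ q. ennreal (hp (\<zeta> q)) + (\<integral>\<^sup>+ y. U y (\<zeta> q) \<partial>M) \<partial>Q)"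
    by (rule nn_integral_add[symmetric]) measurable
  also have "\<dots> = (\<integral>\<^sup>+ q. steinc + (\<integral>\<^sup>+ y. U y (remove_point y (\<zeta> q)) \<partial>\<zeta> q) \<partial>Q)"
    by (intro nn_integral_cong stein_equation Q.eta_lf)
  also have "\<dots> = steinc + (\<integral>\<^sup>+ q. \<integral>\<^sup>+ y. U y (remove_point y (\<zeta> q)) \<partial>\<zeta> q \<partial>Q)"
    by (subst nn_integral_add) (auto simp: Q.emeasure_space_1)
  also have "(\<integral>\<^sup>+ q. \<integral>\<^sup>+ y. U y (remove_point y (\<zeta> q)) \<partial>\<zeta> q \<partial>Q) = (\<integral>\<^sup>+ y. \<integral>\<^sup>+ q. U y (\<zeta> q) \<partial>Q \<partial>M)"
    unfolding Q.mecke[OF U_remove_pair_measurable]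
    by (intro nn_integral_cong) (simp add: remove_point_add_dirac[OF counting_of_lf[OF Q.eta_lf]])
  also have "\<dots> = (\<integral>\<^sup>+ q. \<integral>\<^sup>+ y. U y (\<zeta> q) \<partial>M \<partial>Q)"
    by (rule Q.PK.Fubini') measurable
  finally show ?thesis
    using nn_integral_U_M_finite[OF Q.prob_space_axioms Q.\<eta>_N]
    by (auto simp: add.commute[of _ "\<integral>\<^sup>+ q. \<integral>\<^sup>+ y. U y (\<zeta> q) \<partial>M \<partial>Q"] ennreal_add_left_cancel)
qed

end

lemma (in local_statistic) finite_measure_Lt: "mean < \<infinity> \<Longrightarrow> finite_measure Lt"
  by (rule finite_measureI) (use sets_eq_imp_space_eq[OF sets_Lt] in \<open>simp add: emeasure_Lt mean_eq less_top\<close>)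

text \<open>
  Integrate the Stein equation and insert \<open>palm_comparison\<close> and \<open>nn_integral_diff_le_d_TV\<close>.
  The total masses that arise from the passage from \<open>h\<close> to \<open>hp\<close> and from the oscillation bound
  cancel.
\<close>

lemma (in local_statistic) test_function_bound:
  assumes mean: "mean < \<infinity>" and M: "finite_measure M" "sets M = sets borel" and h: "h \<in> KR_test_functions"
    and Q: "poisson (\<lambda>_. UNIV :: 'b set) Q \<zeta> M"
  shows "ennreal ((\<integral>p. h (finite_part (xi (\<eta> p))) \<partial>P) - (\<integral>q. h (\<zeta> q) \<partial>Q))
    \<le> d_TV Lt M + 2 * (ck k * ck k * A2) + 2 * (ck k * (ck k * A3 + A4))"
proof -
  interpret M: finite_measure M by fact
  interpret st: stein "TYPE('b)" M h by standard (use M h in auto)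
  interpret pf: palm_functional C P \<eta> K k G f S st.U
    by standard (use mean st.U_measurable st.U_le_2 in auto)
  interpret Q: poisson "\<lambda>_. UNIV :: 'b set" Q \<zeta> M by fact
  let ?X = "\<lambda>p. finite_part (xi (\<eta> p))"
  have X[measurable]: "?X \<in> P \<rightarrow>\<^sub>M Y.N" by measurable
  have XUNIV: "(\<integral>\<^sup>+ p. emeasure (?X p) UNIV \<partial>P) = mean"
    unfolding mean_eq[symmetric]
    by (rule nn_integral_cong_AE) (use AE_xi_finite[OF mean] in eventually_elim, simp)
  have finX: "(\<integral>\<^sup>+ p. emeasure (?X p) UNIV \<partial>P) < \<infinity>" using mean XUNIV by simp
  have MU: "(\<integral>\<^sup>+ q. emeasure (\<zeta> q) UNIV \<partial>Q) = emeasure M UNIV"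
  proof -
    have "(\<integral>\<^sup>+ q. emeasure (\<zeta> q) UNIV \<partial>Q) = (\<integral>\<^sup>+ q. \<integral>\<^sup>+ y. 1 \<partial>\<zeta> q \<partial>Q)"
      by (intro nn_integral_cong) (simp add: Y.space_lf Q.eta_lf)
    also have "\<dots> = (\<integral>\<^sup>+ y. \<integral>\<^sup>+ q. 1 \<partial>Q \<partial>M)" by (rule Q.mecke) simp
    also have "\<dots> = emeasure M UNIV" using sets_eq_imp_space_eq[OF M(2)] by (simp add: Q.emeasure_space_1)
    finally show ?thesis .
  qed
  have finQ: "(\<integral>\<^sup>+ q. emeasure (\<zeta> q) UNIV \<partial>Q) < \<infinity>" unfolding MU by (metis M.emeasure_finite less_top infinity_ennreal_def)
  interpret Lt: finite_measure Lt by (rule finite_measure_Lt[OF mean])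
  have LtU: "emeasure Lt UNIV = mean" by (simp add: emeasure_Lt mean_eq)
  let ?I = "\<integral>\<^sup>+ p. \<integral>\<^sup>+ y. st.U y (?X p) \<partial>M \<partial>P"
  let ?R = "2 * (ck k * ck k * A2) + 2 * (ck k * (ck k * A3 + A4))"
  have Xl: "?X p \<in> Y.\<Omega>" for p by (rule Y.finite_part_lf)
  have J: "(\<lambda>p. \<integral>\<^sup>+ y. st.U y (?X p) \<partial>N) \<in> borel_measurable P"
    if "finite_measure N" and [measurable_cong]: "sets N = sets borel" for N
  proof -
    interpret N: finite_measure N by fact
    show ?thesis by measurable
  qed
  note [measurable] = J[OF M] J[OF Lt.finite_measure_axioms sets_Lt]
  have "(\<integral>\<^sup>+ p. ennreal (st.hp (?X p)) \<partial>P) + ?I = (\<integral>\<^sup>+ p. ennreal (st.hp (?X p)) + (\<integral>\<^sup>+ y. st.U y (?X p) \<partial>M) \<partial>P)"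
    by (rule nn_integral_add[symmetric]) measurable
  also have "\<dots> = (\<integral>\<^sup>+ p. st.steinc + (\<integral>\<^sup>+ y. st.U y (remove_point y (?X p)) \<partial>?X p) \<partial>P)"
    by (intro nn_integral_cong st.stein_equation Xl)
  also have "\<dots> = st.steinc + (\<integral>\<^sup>+ p. \<integral>\<^sup>+ y. st.U y (remove_point y (?X p)) \<partial>?X p \<partial>P)"
    by (subst nn_integral_add) (auto simp: emeasure_space_1 intro: st.measurable_nn_integral_U_remove[OF X])
  also have "\<dots> \<le> st.steinc + ((\<integral>\<^sup>+ q. \<integral>\<^sup>+ y. st.U y (?X q) \<partial>Lt \<partial>P) + ?R)"
    using pf.palm_comparison by (simp add: add.assoc add_left_mono)
  finally have 1: "(\<integral>\<^sup>+ p. ennreal (st.hp (?X p)) \<partial>P) + ?I \<le> st.steinc + ((\<integral>\<^sup>+ q. \<integral>\<^sup>+ y. st.U y (?X q) \<partial>Lt \<partial>P) + ?R)" .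
  have "(\<integral>\<^sup>+ q. \<integral>\<^sup>+ y. st.U y (?X q) \<partial>Lt \<partial>P) + emeasure M UNIV
    = (\<integral>\<^sup>+ q. (\<integral>\<^sup>+ y. st.U y (?X q) \<partial>Lt) + emeasure M UNIV \<partial>P)"
    by (subst nn_integral_add) (auto simp: emeasure_space_1)
  also have "\<dots> \<le> (\<integral>\<^sup>+ q. (\<integral>\<^sup>+ y. st.U y (?X q) \<partial>M) + (emeasure Lt UNIV + d_TV Lt M) \<partial>P)"
  proof (rule nn_integral_mono)
    fix q
    have c: "(\<lambda>_. ?X q) \<in> borel \<rightarrow>\<^sub>M Y.N" by (intro measurable_const) (simp add: Xl)
    have "(\<lambda>y. st.U y (?X q)) \<in> borel_measurable borel" by (rule pf.U_measurable[OF _ c]) simp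
    from nn_integral_diff_le_d_TV[OF Lt.finite_measure_axioms sets_Lt M this st.U_le_2[OF Xl] st.U_osc[OF Xl]]
    show "(\<integral>\<^sup>+ y. st.U y (?X q) \<partial>Lt) + emeasure M UNIV \<le> (\<integral>\<^sup>+ y. st.U y (?X q) \<partial>M) + (emeasure Lt UNIV + d_TV Lt M)"
      by (simp add: add.assoc)
  qed
  also have "\<dots> = ?I + (emeasure Lt UNIV + d_TV Lt M)"
    by (subst nn_integral_add) (auto simp: emeasure_space_1)
  finally have 2: "(\<integral>\<^sup>+ q. \<integral>\<^sup>+ y. st.U y (?X q) \<partial>Lt \<partial>P) + emeasure M UNIV \<le> ?I + (mean + d_TV Lt M)"
    unfolding LtU .
  have "?I + ((\<integral>\<^sup>+ p. ennreal (st.hp (?X p)) \<partial>P) + emeasure M UNIV)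
    = ((\<integral>\<^sup>+ p. ennreal (st.hp (?X p)) \<partial>P) + ?I) + emeasure M UNIV" by (simp only: ac_simps)
  also have "\<dots> \<le> st.steinc + ((\<integral>\<^sup>+ q. \<integral>\<^sup>+ y. st.U y (?X q) \<partial>Lt \<partial>P) + ?R) + emeasure M UNIV"
    by (intro add_right_mono 1)
  also have "\<dots> = st.steinc + ((\<integral>\<^sup>+ q. \<integral>\<^sup>+ y. st.U y (?X q) \<partial>Lt \<partial>P) + emeasure M UNIV) + ?R"
    by (simp only: ac_simps)
  also have "\<dots> \<le> st.steinc + (?I + (mean + d_TV Lt M)) + ?R"
    by (intro add_right_mono add_left_mono 2)
  also have "\<dots> = ?I + (st.steinc + mean + (d_TV Lt M + ?R))" by (simp only: ac_simps)
  finally have "(\<integral>\<^sup>+ p. ennreal (st.hp (?X p)) \<partial>P) + emeasure M UNIV \<le> st.steinc + mean + (d_TV Lt M + ?R)"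
    using st.nn_integral_U_M_finite[OF prob_space_axioms X] by (simp only: ennreal_add_left_cancel_le) (auto simp: less_top)
  then have main: "(\<integral>\<^sup>+ p. ennreal (st.hp (?X p)) \<partial>P) + emeasure M UNIV
    \<le> (\<integral>\<^sup>+ q. ennreal (st.hp (\<zeta> q)) \<partial>Q) + mean + (d_TV Lt M + ?R)"
    by (simp only: st.poisson_hp[OF Q])
  let ?x = "\<integral>p. h (?X p) \<partial>P" and ?z = "\<integral>q. h (\<zeta> q) \<partial>Q" and ?h = "\<bar>h (null_measure borel)\<bar>"
  let ?mX = "\<integral>p. measure (?X p) UNIV \<partial>P" and ?mQ = "\<integral>q. measure (\<zeta> q) UNIV \<partial>Q"
  note hX = st.h_integrable[OF prob_space_axioms X finX]
  note hQ = st.h_integrable[OF Q.prob_space_axioms Q.\<eta>_N finQ]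
  have nn: "0 \<le> ?mX" "0 \<le> ?mQ" by simp_all
  show ?thesis
  proof (cases "d_TV Lt M + ?R")
    case (real c)
    have c: "d_TV Lt M + ?R = ennreal c" "0 \<le> c" by (rule real)+
    have "ennreal (?x + ?h + ?mX) + ennreal ?mQ \<le> ennreal (?z + ?h + ?mQ) + ennreal ?mX + ennreal c"
      using main unfolding hX(4) hQ(4) MU[symmetric] XUNIV[symmetric] hX(3) hQ(3) c(1) .
    then have "?x + ?h + ?mX + ?mQ \<le> ?z + ?h + ?mQ + ?mX + c"
      using nn hX(5) hQ(5) c(2) by (simp add: ennreal_plus[symmetric] del: ennreal_plus)
    then have "ennreal (?x - ?z) \<le> ennreal c" by (intro ennreal_leI) simp
    then show ?thesis by (simp only: c(1)[symmetric] add.assoc)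
  next
    case top
    then show ?thesis by (simp only: add.assoc top_greatest)
  qed
qed

section \<open>The variance\<close>

text \<open>
  Pairs of tuples with disjoint regions contribute \<open>D2\<close> both to the second moment and to the
  square of the mean. The mean is finite, so \<open>D2\<close> may be cancelled, even if the variance is
  infinite.
\<close>

lemma (in local_statistic) variance_identity:
  assumes fin: "mean < \<infinity>"
  shows "ext_variance P (\<lambda>p. emeasure (xi (\<eta> p)) UNIV) + ck k * ck k * A2 = mean + ck k * (ck k * A3 + A4)"
proof -
  let ?X = "\<lambda>p. emeasure (xi (\<eta> p)) UNIV"
  let ?V = "ext_variance P ?X"
  obtain m where m: "mean = ennreal m" "0 \<le> m" using fin by (cases mean) auto
  have X[measurable]: "?X \<in> borel_measurable P" by measurable
  have sq[measurable]: "(\<lambda>p. ennreal ((enn2real (?X p) - m)\<^sup>2)) \<in> borel_measurable P" by measurable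
  have V: "?V = (\<integral>\<^sup>+ p. ennreal ((enn2real (?X p) - m)\<^sup>2) \<partial>P)"
    unfolding ext_variance_def mean_eq using m by simp
  have "?V + 2 * (mean * mean) = (\<integral>\<^sup>+ p. ennreal ((enn2real (?X p) - m)\<^sup>2) \<partial>P) + (\<integral>\<^sup>+ p. 2 * mean * ?X p \<partial>P)"
    unfolding V by (subst nn_integral_cmult) (auto simp: mean_eq mult.assoc)
  also have "\<dots> = (\<integral>\<^sup>+ p. ennreal ((enn2real (?X p) - m)\<^sup>2) + 2 * mean * ?X p \<partial>P)"
    by (rule nn_integral_add[symmetric]) measurable
  also have "\<dots> = (\<integral>\<^sup>+ p. ?X p * ?X p + mean * mean \<partial>P)"
  proof (rule nn_integral_cong_AE, use AE_xi_finite[OF fin] in eventually_elim)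
    case (elim p)
    then have "xi (\<eta> p) \<in> finite_counting_measures"
      using Y.finite_part_lf[of "xi (\<eta> p)"] by (simp add: Y.fin_iff)
    then have "?X p < \<infinity>" by (simp add: finite_counting_measures_def)
    then obtain r where r: "?X p = ennreal r" "0 \<le> r" by (cases "?X p") auto
    have "(r - m)\<^sup>2 + 2 * m * r = r * r + m * m" by (simp add: power2_eq_square algebra_simps)
    then have "ennreal ((r - m)\<^sup>2) + 2 * ennreal m * ennreal r = ennreal r * ennreal r + ennreal m * ennreal m"
      using r(2) m(2)
      by (simp add: ennreal_mult[symmetric] ennreal_plus[symmetric] ennreal_numeral[symmetric] del: ennreal_plus ennreal_numeral)
    then show ?case using r m by simp
  qed
  also have "\<dots> = (\<integral>\<^sup>+ p. ?X p * ?X p \<partial>P) + mean * mean"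
    by (subst nn_integral_add) (auto simp: emeasure_space_1)
  finally have "(ck k * ck k * D2 + mean * mean) + (?V + ck k * ck k * A2)
    = (ck k * ck k * D2 + mean * mean) + (mean + ck k * (ck k * A3 + A4))"
    unfolding second_moment mean_square by (simp add: distrib_left mult_2 add_ac)
  moreover have "ck k * ck k * D2 + mean * mean < \<infinity>"
  proof -
    have "mean * mean < \<infinity>" using m by (simp add: ennreal_mult[symmetric])
    moreover have "ck k * ck k * D2 \<le> mean * mean" unfolding mean_square by (simp add: distrib_left)
    ultimately show ?thesis by (auto simp: le_less_trans)
  qed
  ultimately show ?thesis by (auto simp: ennreal_add_left_cancel)
qed

section \<open>Truncation\<close>

lemma restr_UNIV[simp]: "restr \<omega> UNIV = \<omega>"
  by (simp add: restr_def density_1)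

locale truncated_statistic = poisson C P \<eta> K
  for C :: "nat \<Rightarrow> 'a::{second_countable_topology, t2_space} set" and P :: "'p measure" and \<eta> K +
  fixes k :: nat and g gt :: "(nat \<Rightarrow> 'a) \<Rightarrow> 'a measure \<Rightarrow> real"
    and f :: "(nat \<Rightarrow> 'a) \<Rightarrow> 'a measure \<Rightarrow> 'b::{second_countable_topology, t2_space}"
    and \<S> :: "(nat \<Rightarrow> 'a) \<Rightarrow> 'a measure \<Rightarrow> 'a set" and S :: "(nat \<Rightarrow> 'a) \<Rightarrow> 'a set"
  assumes k1: "1 \<le> k"
    and lc: "locally_compact_space (euclidean :: 'a topology)"
    and g01: "\<And>x \<omega>. x \<in> space (tuple_space k) \<Longrightarrow> \<omega> \<in> counting_measures \<Longrightarrow> g x \<omega> \<in> {0, 1}"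
    and g_meas: "(\<lambda>(x, \<omega>). g x \<omega>) \<in> tuple_space k \<Otimes>\<^sub>M N_space \<rightarrow>\<^sub>M borel"
    and f_meas: "(\<lambda>(x, \<omega>). f x \<omega>) \<in> tuple_space k \<Otimes>\<^sub>M N_space \<rightarrow>\<^sub>M borel"
    and g_sym: "symmetric_in_tuple k g" and f_sym: "symmetric_in_tuple k f"
    and stop_meas: "(\<lambda>(x, \<omega>). \<S> x \<omega>) \<in> tuple_space k \<Otimes>\<^sub>M N_space \<rightarrow>\<^sub>M closed_set_space"
    and localized: "localized k g f \<S>"
    and S_meas: "S \<in> tuple_space k \<rightarrow>\<^sub>M closed_set_space"
    and S_sub: "\<And>x. x \<in> space (tuple_space k) \<Longrightarrow> x ` {..<k} \<subseteq> S x"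
    and stops: "\<And>x. x \<in> space (tuple_space k) \<Longrightarrow> stops_at \<S> x (S x)"
    and gt_eq: "gt = (\<lambda>x \<omega>. g x \<omega> * (if \<S> x \<omega> \<subseteq> S x then 1 else 0))"
    and gt_sym: "symmetric_in_tuple k gt"
begin

text \<open>The points that the truncation removes.\<close>

definition gd :: "(nat \<Rightarrow> 'a) \<Rightarrow> 'a measure \<Rightarrow> real" where
  "gd x \<omega> = g x \<omega> * (if \<S> x \<omega> \<subseteq> S x then 0 else 1)"

lemma g_split: "g x \<omega> = gt x \<omega> + gd x \<omega>"
  by (simp add: gt_eq gd_def)

lemma measurable_N_of_N_space:
  assumes "F \<in> tuple_space k \<Otimes>\<^sub>M N_space \<rightarrow>\<^sub>M T" shows "F \<in> tuple_space k \<Otimes>\<^sub>M N \<rightarrow>\<^sub>M T"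
proof -
  have "snd \<in> tuple_space k \<Otimes>\<^sub>M N \<rightarrow>\<^sub>M N_space"
    unfolding N_space_def by (rule measurable_eval_sigma_change[OF measurable_snd]) (auto simp: space_pair_measure counting_of_lf)
  then have "(\<lambda>z. (fst z, snd z)) \<in> tuple_space k \<Otimes>\<^sub>M N \<rightarrow>\<^sub>M tuple_space k \<Otimes>\<^sub>M N_space" by measurable
  from measurable_compose[OF this assms] show ?thesis by simp
qed

lemma stop_pred: "Measurable.pred (tuple_space k \<Otimes>\<^sub>M N) (\<lambda>z. \<S> (fst z) (snd z) \<subseteq> S (fst z))"
  using measurable_N_of_N_space[OF stop_meas]
  by (intro pred_closed_subset[OF lc] measurable_compose[OF measurable_fst S_meas]) (simp add: case_prod_unfold)

lemma g_measurable_N: "(\<lambda>z. g (fst z) (snd z)) \<in> borel_measurable (tuple_space k \<Otimes>\<^sub>M N)"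
  using measurable_N_of_N_space[OF g_meas] by (simp add: case_prod_unfold)

lemma gt_measurable_N: "(\<lambda>(x, \<omega>). gt x \<omega>) \<in> borel_measurable (tuple_space k \<Otimes>\<^sub>M N)"
proof -
  note [measurable] = stop_pred g_measurable_N
  show ?thesis unfolding gt_eq case_prod_unfold by measurable
qed

lemma gd_measurable_N: "(\<lambda>(x, \<omega>). gd x \<omega>) \<in> borel_measurable (tuple_space k \<Otimes>\<^sub>M N)"
proof -
  note [measurable] = stop_pred g_measurable_N
  show ?thesis unfolding gd_def case_prod_unfold by measurable
qed

lemma gd_sym: "symmetric_in_tuple k gd"
proof -
  have "gd = (\<lambda>x \<omega>. g x \<omega> - gt x \<omega>)" using g_split by (auto simp: fun_eq_iff)
  then show ?thesis using g_sym gt_sym by (simp add: symmetric_in_tuple_def)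
qed

lemma stop_restr:
  "x \<in> extensional {..<k} \<Longrightarrow> \<omega> \<in> counting_measures \<Longrightarrow> \<S> x (restr \<omega> (S x)) \<subseteq> S x \<longleftrightarrow> \<S> x \<omega> \<subseteq> S x"
  using stops[of x] unfolding stops_at_def space_tuple_space by blast

text \<open>
  If the stopping set is contained in \<open>S x\<close>, localization applies with \<open>S x\<close> itself. Whether
  this is the case can be decided from the points in \<open>S x\<close> alone, by \<open>stop_restr\<close>.
\<close>

lemma localized_S:
  assumes "\<omega> \<in> counting_measures" "x \<in> distinct_tuples k \<omega>" "\<S> x \<omega> \<subseteq> S x"
  shows "g x \<omega> = g x (restr \<omega> (S x))" "g x \<omega> = 1 \<Longrightarrow> f x \<omega> = f x (restr \<omega> (S x))"
proof -
  have "x \<in> space (tuple_space k)" using distinct_tuples_extensional[OF assms(2)] by (simp add: space_tuple_space)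
  then have "S x \<in> sets borel" by (intro borel_closed closed_of_measurable[OF S_meas])
  then show "g x \<omega> = g x (restr \<omega> (S x))" "g x \<omega> = 1 \<Longrightarrow> f x \<omega> = f x (restr \<omega> (S x))"
    using localized assms unfolding localized_def by blast+
qed

sublocale tr: local_statistic C P \<eta> K k gt f S
proof
  show "gt x \<omega> \<in> {0, 1}" if "x \<in> extensional {..<k}" "\<omega> \<in> counting_measures" for x \<omega>
    using g01[of x \<omega>] that by (auto simp: gt_eq space_tuple_space)
  show "gt x \<omega> = gt x (restr \<omega> (S x))" if "\<omega> \<in> counting_measures" "x \<in> distinct_tuples k \<omega>" for \<omega> x
    using localized_S[OF that] stop_restr[OF distinct_tuples_extensional[OF that(2)] that(1)] by (auto simp: gt_eq)
  show "f x \<omega> = f x (restr \<omega> (S x))" if "\<omega> \<in> counting_measures" "x \<in> distinct_tuples k \<omega>" "gt x \<omega> = 1" for \<omega> x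
    using localized_S[OF that(1,2)] that(3) by (auto simp: gt_eq split: if_splits)
  show "x ` {..<k} \<subseteq> S x" if "x \<in> extensional {..<k}" for x using S_sub[of x] that by (simp add: space_tuple_space)
qed (fact k1 lc gt_measurable_N measurable_N_of_N_space[OF f_meas] gt_sym f_sym S_meas)+

lemma UNIV_closed_set: "(\<lambda>_. UNIV) \<in> tuple_space k \<rightarrow>\<^sub>M closed_set_space"
  by (intro measurable_const) simp

text \<open>
  The original statistic and the removed points are local with respect to the whole space,
  which gives access to the Mecke formula for their means and intensity measures.
\<close>

sublocale fu: local_statistic C P \<eta> K k g f "\<lambda>_. UNIV"
proof
  show "g x \<omega> \<in> {0, 1}" if "x \<in> extensional {..<k}" "\<omega> \<in> counting_measures" for x \<omega>
    using g01[of x \<omega>] that by (auto simp: space_tuple_space)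
qed (fact k1 lc measurable_N_of_N_space[OF g_meas] measurable_N_of_N_space[OF f_meas] g_sym f_sym UNIV_closed_set | simp)+

sublocale dr: local_statistic C P \<eta> K k gd f "\<lambda>_. UNIV"
proof
  show "gd x \<omega> \<in> {0, 1}" if "x \<in> extensional {..<k}" "\<omega> \<in> counting_measures" for x \<omega>
    using g01[of x \<omega>] that by (auto simp: gd_def space_tuple_space)
qed (fact k1 lc gd_measurable_N measurable_N_of_N_space[OF f_meas] gd_sym f_sym UNIV_closed_set | simp)+

lemma ennreal_g_split: "x \<in> extensional {..<k} \<Longrightarrow> \<omega> \<in> counting_measures \<Longrightarrow> ennreal (g x \<omega>) = ennreal (gt x \<omega>) + ennreal (gd x \<omega>)"
  using tr.G01[of x \<omega>] dr.G01[of x \<omega>] unfolding g_split[of x \<omega>] by (intro ennreal_plus) auto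

lemma emeasure_split:
  assumes w: "\<omega> \<in> counting_measures" and B: "B \<in> sets borel"
  shows "emeasure (fu.xi \<omega>) B = emeasure (tr.xi \<omega>) B + emeasure (dr.xi \<omega>) B"
proof -
  have "tsum k \<omega> (\<lambda>z. ennreal (g z \<omega>) * indicator B (f z \<omega>))
    = tsum k \<omega> (\<lambda>z. ennreal (gt z \<omega>) * indicator B (f z \<omega>) + ennreal (gd z \<omega>) * indicator B (f z \<omega>))"
    by (rule tsum_cong) (simp add: ennreal_g_split w distrib_right distinct_tuples_extensional)
  then show ?thesis by (simp add: fu.emeasure_xi tr.emeasure_xi dr.emeasure_xi B tsum_add distrib_left fu.ck_def tr.ck_def dr.ck_def)
qed

lemma mean_split: "fu.mean = tr.mean + dr.mean"
proof -
  have "fu.mean = (\<integral>\<^sup>+ p. emeasure (tr.xi (\<eta> p)) UNIV + emeasure (dr.xi (\<eta> p)) UNIV \<partial>P)"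
    unfolding fu.mean_eq[symmetric] by (intro nn_integral_cong) (simp add: emeasure_split tr.eta_counting)
  also have "\<dots> = tr.mean + dr.mean"
    unfolding tr.mean_eq[symmetric] dr.mean_eq[symmetric] by (rule nn_integral_add) measurable
  finally show ?thesis .
qed

lemma Lt_split:
  assumes [measurable]: "B \<in> sets borel"
  shows "emeasure fu.Lt B = emeasure tr.Lt B + emeasure dr.Lt B"
proof -
  have "emeasure fu.Lt B = (\<integral>\<^sup>+ p. emeasure (tr.xi (\<eta> p)) B + emeasure (dr.xi (\<eta> p)) B \<partial>P)"
    unfolding fu.emeasure_Lt[OF assms] by (intro nn_integral_cong) (simp add: emeasure_split tr.eta_counting assms)
  also have "\<dots> = emeasure tr.Lt B + emeasure dr.Lt B"
    unfolding tr.emeasure_Lt[OF assms] dr.emeasure_Lt[OF assms] by (rule nn_integral_add) measurable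
  finally show ?thesis .
qed

context
  assumes mean: "fu.mean < \<infinity>"
begin

lemma tr_mean: "tr.mean < \<infinity>" and dr_mean: "dr.mean < \<infinity>"
  using mean unfolding mean_split by auto

lemma d_TV_truncation: "d_TV tr.Lt M \<le> d_TV fu.Lt M + dr.mean"
  unfolding d_TV_def[of tr.Lt]
proof (rule SUP_least)
  fix A assume "A \<in> {A \<in> sets borel. emeasure tr.Lt A < \<infinity> \<and> emeasure M A < \<infinity>}"
  then have A: "A \<in> sets borel" "emeasure M A < \<infinity>" by auto
  interpret fL: finite_measure fu.Lt by (rule fu.finite_measure_Lt[OF mean])
  interpret tL: finite_measure tr.Lt by (rule tr.finite_measure_Lt[OF tr_mean])
  interpret dL: finite_measure dr.Lt by (rule dr.finite_measure_Lt[OF dr_mean])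
  have "measure fu.Lt A = measure tr.Lt A + measure dr.Lt A"
    using Lt_split[OF A(1)] by (simp add: fL.emeasure_eq_measure tL.emeasure_eq_measure dL.emeasure_eq_measure ennreal_plus[symmetric] del: ennreal_plus)
  then have "\<bar>measure tr.Lt A - measure M A\<bar> \<le> \<bar>measure fu.Lt A - measure M A\<bar> + measure dr.Lt A"
    using measure_nonneg[of dr.Lt A] by arith
  then have "ennreal \<bar>measure tr.Lt A - measure M A\<bar> \<le> ennreal (\<bar>measure fu.Lt A - measure M A\<bar> + measure dr.Lt A)"
    by (rule ennreal_leI)
  also have "\<dots> = ennreal \<bar>measure fu.Lt A - measure M A\<bar> + emeasure dr.Lt A"
    by (simp add: dL.emeasure_eq_measure)
  also have "\<dots> \<le> d_TV fu.Lt M + emeasure dr.Lt UNIV"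
  proof (intro add_mono d_TV_ge emeasure_mono)
    show "emeasure fu.Lt A < \<infinity>" by (metis fL.emeasure_finite less_top infinity_ennreal_def)
  qed (use A in auto)
  also have "emeasure dr.Lt UNIV = dr.mean" by (simp add: dr.emeasure_Lt dr.mean_eq)
  finally show "ennreal \<bar>measure tr.Lt A - measure M A\<bar> \<le> d_TV fu.Lt M + dr.mean" .
qed

end

end

context truncated_statistic
begin

context
  assumes mean: "fu.mean < \<infinity>"
begin

text \<open>
  The total variation distance between the two point processes is at most the number of
  removed points.
\<close>

lemma test_function_truncation:
  assumes h: "h \<in> KR_test_functions"
  shows "ennreal \<bar>(\<integral>p. h (finite_part (fu.xi (\<eta> p))) \<partial>P) - (\<integral>p. h (finite_part (tr.xi (\<eta> p))) \<partial>P)\<bar> \<le> dr.mean"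
proof -
  interpret st: stein "TYPE('b)" "null_measure borel :: 'b measure" h
    by standard (auto simp: h intro!: exI[of _ "{UNIV}"])
  let ?X = "\<lambda>p. finite_part (fu.xi (\<eta> p))" and ?Y = "\<lambda>p. finite_part (tr.xi (\<eta> p))"
  have fX: "(\<integral>\<^sup>+ p. emeasure (?X p) UNIV \<partial>P) < \<infinity>"
  proof -
    have "(\<integral>\<^sup>+ p. emeasure (?X p) UNIV \<partial>P) = fu.mean" unfolding fu.mean_eq[symmetric]
      by (rule nn_integral_cong_AE) (use fu.AE_xi_finite[OF mean] in eventually_elim, simp)
    then show ?thesis using mean by simp
  qed
  have fY: "(\<integral>\<^sup>+ p. emeasure (?Y p) UNIV \<partial>P) < \<infinity>"
  proof -
    have "(\<integral>\<^sup>+ p. emeasure (?Y p) UNIV \<partial>P) = tr.mean" unfolding tr.mean_eq[symmetric]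
      by (rule nn_integral_cong_AE) (use tr.AE_xi_finite[OF tr_mean[OF mean]] in eventually_elim, simp)
    then show ?thesis using tr_mean[OF mean] by simp
  qed
  have iX: "integrable P (\<lambda>p. h (?X p))"
    by (rule st.h_integrable(1)[OF prob_space_axioms _ fX]) measurable
  have iY: "integrable P (\<lambda>p. h (?Y p))"
    by (rule st.h_integrable(1)[OF prob_space_axioms _ fY]) measurable
  have "ennreal \<bar>(\<integral>p. h (?X p) \<partial>P) - (\<integral>p. h (?Y p) \<partial>P)\<bar> = ennreal (norm (\<integral>p. h (?X p) - h (?Y p) \<partial>P))"
    using iX iY by simp
  also have "\<dots> \<le> (\<integral>\<^sup>+ p. ennreal (norm (h (?X p) - h (?Y p))) \<partial>P)"
    by (rule integral_norm_bound_ennreal) (use iX iY in auto)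
  also have "\<dots> \<le> (\<integral>\<^sup>+ p. emeasure (dr.xi (\<eta> p)) UNIV \<partial>P)"
  proof (rule nn_integral_mono_AE, use fu.AE_xi_finite[OF mean] tr.AE_xi_finite[OF tr_mean[OF mean]] AE_space in eventually_elim)
    case (elim p)
    let ?d = "emeasure (dr.xi (\<eta> p)) UNIV"
    have fin: "emeasure (?X p) A < \<infinity>" "emeasure (?Y p) A < \<infinity>" for A
      by (intro tr.Y.finite_lf tr.Y.finite_part_lf)+
    note sp = emeasure_split[OF tr.eta_counting[OF elim(3)]]
    have "?d \<le> emeasure (?X p) UNIV" using sp[of UNIV] by (simp add: elim)
    then have dfin: "?d < \<infinity>" using fin(1)[of UNIV] by (auto intro: le_less_trans)
    have "\<bar>h (?X p) - h (?Y p)\<bar> \<le> enn2real ?d"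
    proof (rule st.h_bound)
      fix A :: "'b set" assume A: "A \<in> sets borel"
      have le: "emeasure (dr.xi (\<eta> p)) A \<le> ?d"
        by (rule order_trans[OF emeasure_space]) (simp add: tuple_measure_def space_scale_measure)
      have "emeasure (?X p) A = emeasure (?Y p) A + emeasure (dr.xi (\<eta> p)) A" using sp[OF A] by (simp add: elim)
      then have "measure (?X p) A = measure (?Y p) A + enn2real (emeasure (dr.xi (\<eta> p)) A)"
        unfolding measure_def using fin(2)[of A] le dfin by (simp add: enn2real_plus less_top le_less_trans)
      moreover have "enn2real (emeasure (dr.xi (\<eta> p)) A) \<le> enn2real ?d" using le dfin by (intro enn2real_mono) auto
      ultimately show "\<bar>measure (?X p) A - measure (?Y p) A\<bar> \<le> enn2real ?d" by simp
    qed (simp_all add: tr.Y.finite_part_lf)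
    then have "ennreal \<bar>h (?X p) - h (?Y p)\<bar> \<le> ennreal (enn2real ?d)" by (rule ennreal_leI)
    also have "\<dots> = ?d" using dfin by (intro ennreal_enn2real) simp
    finally show ?case by simp
  qed
  also have "\<dots> = dr.mean" by (rule dr.mean_eq)
  finally show ?thesis .
qed

lemma one_sided_bound:
  assumes M: "finite_measure M" "sets M = sets borel" and h: "h \<in> KR_test_functions"
    and Q: "poisson (\<lambda>_. UNIV :: 'b set) Q \<zeta> M"
  shows "ennreal ((\<integral>p. h (finite_part (fu.xi (\<eta> p))) \<partial>P) - (\<integral>q. h (\<zeta> q) \<partial>Q))
    \<le> d_TV fu.Lt M + 2 * dr.mean + 2 * (tr.ck k * tr.ck k * tr.A2) + 2 * (tr.ck k * (tr.ck k * tr.A3 + tr.A4))"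
proof -
  let ?x = "\<integral>p. h (finite_part (fu.xi (\<eta> p))) \<partial>P" and ?y = "\<integral>p. h (finite_part (tr.xi (\<eta> p))) \<partial>P" and ?z = "\<integral>q. h (\<zeta> q) \<partial>Q"
  let ?R = "2 * (tr.ck k * tr.ck k * tr.A2) + 2 * (tr.ck k * (tr.ck k * tr.A3 + tr.A4))"
  have "ennreal (?x - ?z) \<le> ennreal (\<bar>?x - ?y\<bar> + max 0 (?y - ?z))" by (intro ennreal_leI) auto
  also have "\<dots> = ennreal \<bar>?x - ?y\<bar> + ennreal (?y - ?z)"
    by (subst ennreal_plus) (auto simp: max_def ennreal_neg)
  also have "\<dots> \<le> dr.mean + (d_TV tr.Lt M + ?R)"
    using test_function_truncation[OF h] tr.test_function_bound[OF tr_mean[OF mean] M h Q] by (intro add_mono) (simp_all add: add.assoc)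
  also have "\<dots> \<le> dr.mean + ((d_TV fu.Lt M + dr.mean) + ?R)"
    by (intro add_mono order_refl d_TV_truncation[OF mean])
  finally show ?thesis by (simp add: mult_2 ac_simps)
qed

text \<open>The negative of a test function is a test function.\<close>

lemma two_sided_bound:
  assumes M: "finite_measure M" "sets M = sets borel" and h: "h \<in> KR_test_functions"
    and Q: "poisson (\<lambda>_. UNIV :: 'b set) Q \<zeta> M"
  shows "ennreal \<bar>(\<integral>p. h (finite_part (fu.xi (\<eta> p))) \<partial>P) - (\<integral>q. h (\<zeta> q) \<partial>Q)\<bar>
    \<le> d_TV fu.Lt M + 2 * dr.mean + 2 * (tr.ck k * tr.ck k * tr.A2) + 2 * (tr.ck k * (tr.ck k * tr.A3 + tr.A4))"
proof -
  let ?x = "\<integral>p. h (finite_part (fu.xi (\<eta> p))) \<partial>P" and ?z = "\<integral>q. h (\<zeta> q) \<partial>Q"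
  have "\<bar>?x - ?z\<bar> = ?x - ?z \<or> \<bar>?x - ?z\<bar> = (\<integral>p. - h (finite_part (fu.xi (\<eta> p))) \<partial>P) - (\<integral>q. - h (\<zeta> q) \<partial>Q)"
    unfolding integral_minus by arith
  then show ?thesis
    by (elim disjE ssubst) (rule one_sided_bound[OF M h Q], rule one_sided_bound[OF M KR_test_functions_uminus[OF h] Q])
qed

end

end

section \<open>Modification on a null set\<close>

lemma sets_KR_space: "space finite_N_space = finite_counting_measures"
  by (simp add: finite_N_space_def)

text \<open>
  The process need not be measurable, but on the completed space it suffices that it agrees
  almost surely with a measurable one.
\<close>

lemma KR_expectation_AE:
  assumes eq: "AE p in P. \<xi> p = Z p" and Z: "Z \<in> P \<rightarrow>\<^sub>M finite_N_space" and h: "h \<in> KR_test_functions"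
  shows "KR_expectation P \<xi> h = (\<integral>p. h (Z p) \<partial>P)"
proof -
  let ?f = "\<lambda>p. if \<xi> p \<in> finite_counting_measures then h (\<xi> p) else 0"
  have hZ: "(\<lambda>p. h (Z p)) \<in> borel_measurable P"
    using measurable_compose[OF Z] h by (auto simp: KR_test_functions_def)
  then have hZc: "(\<lambda>p. h (Z p)) \<in> borel_measurable (completion P)" by (rule measurable_completion)
  have "AE p in P. ?f p = h (Z p)"
    using eq AE_space
  proof eventually_elim
    case (elim p)
    then show ?case using measurable_space[OF Z, of p] by (simp add: sets_KR_space)
  qed
  then have ae: "AE p in completion P. ?f p = h (Z p)" by (rule AE_completion)
  have fm: "?f \<in> borel_measurable (completion P)"
  proof (rule measurableI)
    fix A :: "real set" assume A: "A \<in> sets borel"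
    show "?f -` A \<inter> space (completion P) \<in> sets (completion P)"
    proof (rule completion.in_sets_AE)
      show "(\<lambda>p. h (Z p)) -` A \<inter> space (completion P) \<in> sets (completion P)" by (rule measurable_sets[OF hZc A])
      show "AE p in completion P. p \<in> (\<lambda>p. h (Z p)) -` A \<inter> space (completion P) \<longleftrightarrow> p \<in> ?f -` A \<inter> space (completion P)"
        using ae by eventually_elim (simp only: vimage_def Int_iff mem_Collect_eq)
    qed simp
  qed simp
  have "KR_expectation P \<xi> h = (\<integral>p. h (Z p) \<partial>completion P)"
    unfolding KR_expectation_def by (rule integral_cong_AE[OF fm hZc ae])
  also have "\<dots> = (\<integral>p. h (Z p) \<partial>P)" by (rule integral_completion[OF hZ])
  finally show ?thesis .
qed

text \<open>Independence is a property of the joint distribution.\<close>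

lemma (in prob_space) indep_vars_cong_AE:
  assumes I: "finite I" and X: "indep_vars (\<lambda>_. T) X I" and eq: "AE p in M. \<forall>i\<in>I. X i p = Y i p"
    and Y: "\<And>i. i \<in> I \<Longrightarrow> Y i \<in> M \<rightarrow>\<^sub>M T"
  shows "indep_vars (\<lambda>_. T) Y I"
proof (cases "I = {}")
  case True
  then show ?thesis by (simp add: indep_vars_def indep_sets_def)
next
  case False
  have Xm: "X i \<in> M \<rightarrow>\<^sub>M T" if "i \<in> I" for i using X that by (auto simp: indep_vars_def)
  have "distr M (\<Pi>\<^sub>M i\<in>I. T) (\<lambda>x. \<lambda>i\<in>I. Y i x) = distr M (\<Pi>\<^sub>M i\<in>I. T) (\<lambda>x. \<lambda>i\<in>I. X i x)"
    by (rule distr_cong_AE[OF refl refl]) (use eq in \<open>eventually_elim, auto\<close>, intro measurable_restrict Y, assumption, intro measurable_restrict Xm)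
  also have "\<dots> = (\<Pi>\<^sub>M i\<in>I. distr M T (X i))"
    using indep_vars_iff_distr_eq_PiM'[OF False, where X = X and M' = "\<lambda>_. T"] Xm X by simp
  also have "\<dots> = (\<Pi>\<^sub>M i\<in>I. distr M T (Y i))"
  proof (rule PiM_cong[OF refl])
    fix i assume i: "i \<in> I"
    have "AE p in M. X i p = Y i p" using eq by eventually_elim (use i in auto)
    then show "distr M T (X i) = distr M T (Y i)"
      by (rule distr_cong_AE[OF refl refl _ Xm[OF i] Y[OF i]])
  qed
  finally show ?thesis
    using indep_vars_iff_distr_eq_PiM'[OF False, where X = Y and M' = "\<lambda>_. T"] Y by simp
qed

lemma poisson_process_cong_AE:
  fixes \<eta> \<eta>' :: "'p \<Rightarrow> 'b::topological_space measure"
  assumes P: "prob_space P" and p: "poisson_process P \<eta> K" and eq: "AE p in P. \<eta> p = \<eta>' p" and \<eta>': "\<eta>' \<in> P \<rightarrow>\<^sub>M N_space"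
  shows "poisson_process P \<eta>' K"
  unfolding poisson_process_def
proof (intro conjI ballI allI impI)
  interpret prob_space P by fact
  have \<eta>: "\<eta> \<in> P \<rightarrow>\<^sub>M N_space" using p by (simp add: poisson_process_def)
  have m: "(\<lambda>p. emeasure (\<eta> p) B) \<in> borel_measurable P" "(\<lambda>p. emeasure (\<eta>' p) B) \<in> borel_measurable P" if "B \<in> sets borel" for B
    using measurable_emeasure_eval[OF _ that] \<eta> \<eta>' unfolding N_space_def by auto
  show "\<eta>' \<in> P \<rightarrow>\<^sub>M N_space" by fact
  show "prob {p \<in> space P. emeasure (\<eta>' p) B = of_nat n} =
      (if emeasure K B = \<infinity> then 0 else exp (- measure K B) * measure K B ^ n / fact n)" if B: "B \<in> sets borel" for B and n :: nat
  proof -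
    note [measurable] = m[OF B]
    have "prob {p \<in> space P. emeasure (\<eta>' p) B = of_nat n} = prob {p \<in> space P. emeasure (\<eta> p) B = of_nat n}"
      by (rule finite_measure_eq_AE) (use eq in \<open>eventually_elim, auto\<close>, measurable)
    then show ?thesis using p B by (simp add: poisson_process_def)
  qed
  fix l :: nat and B :: "nat \<Rightarrow> 'b set" assume B: "(\<forall>i<l. B i \<in> sets borel) \<and> disjoint_family_on B {..<l}"
  show "indep_vars (\<lambda>_. borel) (\<lambda>i p. emeasure (\<eta>' p) (B i)) {..<l}"
  proof (rule indep_vars_cong_AE)
    show "indep_vars (\<lambda>_. borel) (\<lambda>i p. emeasure (\<eta> p) (B i)) {..<l}"
      using p B unfolding poisson_process_def by blast
    show "AE p in P. \<forall>i\<in>{..<l}. emeasure (\<eta> p) (B i) = emeasure (\<eta>' p) (B i)"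
      using eq by eventually_elim simp
  qed (use B m(2) in auto)
qed

text \<open>
  A Poisson variable with finite mean is almost surely finite, so with probability one all
  sets \<open>C i\<close> contain only finitely many points; on the remaining null set the process is
  replaced by the empty configuration.
\<close>

lemma (in exhaustion) poisson_modification:
  assumes P: "prob_space P" and p: "poisson_process P \<eta> K" and K: "sets K = sets borel" "\<And>i. emeasure K (C i) < \<infinity>"
  obtains \<eta>' where "poisson C P \<eta>' K" "AE p in P. \<eta> p = \<eta>' p"
proof -
  interpret prob_space P by fact
  have \<eta>: "\<eta> \<in> P \<rightarrow>\<^sub>M N_space" using p by (simp add: poisson_process_def)
  have m: "(\<lambda>p. emeasure (\<eta> p) B) \<in> borel_measurable P" if "B \<in> sets borel" for B
    using measurable_emeasure_eval[OF _ that] \<eta> unfolding N_space_def by auto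
  have cnt: "\<eta> p \<in> counting_measures" if "p \<in> space P" for p
    using measurable_space[OF \<eta> that] by (simp add: N_space_def)
  have "AE p in P. emeasure (\<eta> p) (C i) < \<infinity>" for i
  proof -
    let ?S = "\<lambda>n::nat. {p \<in> space P. emeasure (\<eta> p) (C i) = of_nat n}" and ?l = "measure K (C i)"
    note [measurable] = m[OF C_sets[of i]]
    have d: "disjoint_family ?S" by (auto simp: disjoint_family_on_def)
    have [measurable]: "?S n \<in> events" for n by measurable
    have "(\<lambda>n. ?l ^ n / fact n) sums exp ?l"
      using exp_converges[of ?l] by (simp add: divide_inverse mult.commute)
    from sums_mult[OF this, of "exp (- ?l)"]
    have s: "(\<lambda>n. exp (- ?l) * ?l ^ n / fact n) sums 1" by (simp add: exp_minus)
    have "(\<lambda>n. prob (?S n)) sums prob (\<Union>n. ?S n)"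
      using d by (intro finite_measure_UNION) auto
    moreover have "prob (?S n) = exp (- ?l) * ?l ^ n / fact n" for n
      using p K(2)[of i] by (auto simp: poisson_process_def)
    ultimately have "prob (\<Union>n. ?S n) = 1" using s by (simp add: sums_unique2)
    from AE_prob_1[OF this] show ?thesis by (rule AE_mp) (intro AE_I2, auto simp: of_nat_less_top)
  qed
  then have "AE p in P. \<forall>i. emeasure (\<eta> p) (C i) < \<infinity>" by (simp add: AE_all_countable)
  then have good: "AE p in P. \<eta> p \<in> \<Omega>"
    using AE_space by eventually_elim (simp add: locally_finite_def cnt)
  define \<eta>' where "\<eta>' p = (if \<forall>i. emeasure (\<eta> p) (C i) < \<infinity> then \<eta> p else null_measure borel)" for p
  have eq: "AE p in P. \<eta> p = \<eta>' p"
    using good by eventually_elim (simp add: \<eta>'_def locally_finite_def)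
  have N: "\<eta>' \<in> P \<rightarrow>\<^sub>M N"
  proof (rule measurable_eval_sigmaI)
    show "\<eta>' p \<in> \<Omega>" if "p \<in> space P" for p
      using lf_null cnt[OF that] by (auto simp: \<eta>'_def locally_finite_def)
    fix B :: "'a set" assume B: "B \<in> sets borel"
    note [measurable] = m[OF B] m[OF C_sets]
    have "(\<lambda>p. if \<forall>i. emeasure (\<eta> p) (C i) < \<infinity> then emeasure (\<eta> p) B else 0) \<in> borel_measurable P" by measurable
    then show "(\<lambda>p. emeasure (\<eta>' p) B) \<in> borel_measurable P"
      by (rule measurable_cong[THEN iffD2, rotated]) (simp add: \<eta>'_def)
  qed
  then have "\<eta>' \<in> P \<rightarrow>\<^sub>M N_space"
    unfolding N_space_def
    by (rule measurable_eval_sigma_change) (use measurable_space[OF N] counting_of_lf in simp)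
  from poisson_process_cong_AE[OF P p eq this] have "poisson C P \<eta>' K"
    by unfold_locales (use K N in auto)
  from that[OF this eq] show thesis .
qed

section \<open>The approximation bound\<close>

text \<open>
  The variance \<open>V\<close> may be infinite, in which case both sides are infinite; otherwise all terms
  in the hypothesis are real numbers.
\<close>

lemma enn2ereal_bound_rewrite:
  fixes V m D E1 E2 E3 E4 :: ennreal
  assumes eq: "2 * V + E2 = 2 * m + (E3 + E4)" and m: "m < \<infinity>" and E2: "E2 < \<infinity>"
  shows "enn2ereal D + 2 * (enn2ereal V - enn2ereal m) + enn2ereal E1 + 2 * enn2ereal E2
    = enn2ereal (D + E1 + E2 + E3 + E4)"
proof -
  obtain m' where m': "m = ennreal m'" "0 \<le> m'" using m by (cases m) auto
  obtain e2 where e2: "E2 = ennreal e2" "0 \<le> e2" using E2 by (cases E2) auto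
  have nn: "enn2ereal D \<noteq> - \<infinity>" "enn2ereal E1 \<noteq> - \<infinity>"
    using enn2ereal_nonneg[of D] enn2ereal_nonneg[of E1] by auto
  have split: "enn2ereal (D + E1 + E2 + E3 + E4) = enn2ereal D + enn2ereal E1 + enn2ereal (E2 + (E3 + E4))"
    by (simp add: plus_ennreal.rep_eq add.assoc)
  show ?thesis
  proof (cases V)
    case (real v)
    have "E3 + E4 < \<infinity>"
    proof -
      have "E3 + E4 \<le> 2 * V + E2" unfolding eq by simp
      also have "\<dots> < \<infinity>" using real e2 by (simp add: ennreal_mult_less_top)
      finally show ?thesis .
    qed
    then obtain r where r: "E3 + E4 = ennreal r" "0 \<le> r" by (cases "E3 + E4") auto
    have "ennreal (2 * v + e2) = ennreal (2 * m' + r)"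
      using eq real m' e2 r by (simp add: ennreal_mult)
    then have "2 * v + e2 = 2 * m' + r" using real m' e2 r by (simp del: ennreal_plus)
    then have "ereal (2 * (v - m') + 2 * e2) = ereal (e2 + r)" by simp
    moreover have "2 * (enn2ereal V - enn2ereal m) = ereal (2 * (v - m'))" "2 * enn2ereal E2 = ereal (2 * e2)"
      using real m' e2 by (simp_all add: enn2ereal_ennreal)
    moreover have "enn2ereal (E2 + (E3 + E4)) = ereal (e2 + r)"
      unfolding r e2 using e2 r by (simp add: enn2ereal_ennreal ennreal_plus[symmetric] del: ennreal_plus)
    ultimately show ?thesis unfolding split
      by (cases "enn2ereal D"; cases "enn2ereal E1") auto
  next
    case top
    then have "E3 + E4 = \<infinity>" using eq[symmetric] m' by (auto simp: ennreal_mult_eq_top_iff ennreal_top_mult)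
    then have "enn2ereal (E2 + (E3 + E4)) = \<infinity>" by simp
    moreover have "2 * (enn2ereal V - enn2ereal m) = \<infinity>" using top m' by (simp add: enn2ereal_ennreal)
    moreover have "2 * enn2ereal E2 = ereal (2 * e2)" using e2 by (simp add: enn2ereal_ennreal)
    ultimately show ?thesis unfolding split using nn by simp
  qed
qed

theorem theorem4p1:
  fixes k :: nat
    and g :: "(nat \<Rightarrow> 'x::{second_countable_topology, t2_space}) \<Rightarrow> 'x measure \<Rightarrow> real"
    and f :: "(nat \<Rightarrow> 'x) \<Rightarrow> 'x measure \<Rightarrow> 'y::{second_countable_topology, t2_space}"
    and \<S> :: "(nat \<Rightarrow> 'x) \<Rightarrow> 'x measure \<Rightarrow> 'x set"
    and Sx :: "(nat \<Rightarrow> 'x) \<Rightarrow> 'x set"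
    and P :: "'p measure" and \<eta> :: "'p \<Rightarrow> 'x measure" and K :: "'x measure"
    and Q :: "'q measure" and \<zeta> :: "'q \<Rightarrow> 'y measure" and M :: "'y measure"
  assumes "locally_compact_space (euclidean :: 'x topology)"
    and "locally_compact_space (euclidean :: 'y topology)"
    and "k \<ge> 1"
    and "\<And>x \<omega>. x \<in> space (tuple_space k) \<Longrightarrow> \<omega> \<in> counting_measures \<Longrightarrow> g x \<omega> \<in> {0, 1}"
    and "(\<lambda>(x, \<omega>). g x \<omega>) \<in> tuple_space k \<Otimes>\<^sub>M N_space \<rightarrow>\<^sub>M borel"
    and "(\<lambda>(x, \<omega>). f x \<omega>) \<in> tuple_space k \<Otimes>\<^sub>M N_space \<rightarrow>\<^sub>M borel"
    and "symmetric_in_tuple k g"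
    and "symmetric_in_tuple k f"
    and "(\<lambda>(x, \<omega>). \<S> x \<omega>) \<in> tuple_space k \<Otimes>\<^sub>M N_space \<rightarrow>\<^sub>M closed_set_space"
    and "stopping_set k \<S>"
    and "localized k g f \<S>"
    and "prob_space P"
    and "sets K = sets borel"
    and "sigma_finite_measure K"
    and "poisson_process P \<eta> K"
    and "\<xi> = (\<lambda>p. tuple_measure k g f (\<eta> p))"
    and "L = intensity_measure P \<xi>"
    and "emeasure L UNIV < \<infinity>"
    and "prob_space Q"
    and "sets M = sets borel"
    and "finite_measure M"
    and "poisson_process Q \<zeta> M"
    and "Sx \<in> tuple_space k \<rightarrow>\<^sub>M closed_set_space"
    and "\<And>x. x \<in> space (tuple_space k) \<Longrightarrow> x ` {..<k} \<subseteq> Sx x"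
    and "\<And>x. x \<in> space (tuple_space k) \<Longrightarrow> stops_at \<S> x (Sx x)"
    and "gt = (\<lambda>x \<omega>. g x \<omega> * (if \<S> x \<omega> \<subseteq> Sx x then 1 else 0))"
    and "symmetric_in_tuple k gt"
    and "\<xi>tr = (\<lambda>p. tuple_measure k gt f (\<eta> p))"
    and "E1 = ennreal (2 / fact k) *
      (\<integral>\<^sup>+ x. (\<integral>\<^sup>+ p. ennreal (g x (add_measure (\<eta> p) (dirac_sum k x)) *
          (if \<S> x (add_measure (\<eta> p) (dirac_sum k x)) \<subseteq> Sx x then 0 else 1)) \<partial>P)
        \<partial>measure_power k K)"
    and "E2 = ennreal (2 / (fact k)\<^sup>2) *
      (\<integral>\<^sup>+ x. (\<integral>\<^sup>+ z. (if Sx x \<inter> Sx z \<noteq> {} then 1 else 0) *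
          (\<integral>\<^sup>+ p. ennreal (gt x (add_measure (\<eta> p) (dirac_sum k x))) \<partial>P) *
          (\<integral>\<^sup>+ p. ennreal (gt z (add_measure (\<eta> p) (dirac_sum k z))) \<partial>P)
        \<partial>measure_power k K) \<partial>measure_power k K)"
    and "E3 = ennreal (2 / (fact k)\<^sup>2) *
      (\<integral>\<^sup>+ x. (\<integral>\<^sup>+ z. (if Sx x \<inter> Sx z \<noteq> {} then 1 else 0) *
          (\<integral>\<^sup>+ p. ennreal
            (gt x (add_measure (add_measure (\<eta> p) (dirac_sum k x)) (dirac_sum k z)) *
             gt z (add_measure (add_measure (\<eta> p) (dirac_sum k x)) (dirac_sum k z))) \<partial>P)
        \<partial>measure_power k K) \<partial>measure_power k K)"
    and "E4 = ennreal (2 / fact k) *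
      (\<Sum>I\<in>{I. {} \<subset> I \<and> I \<subset> {..<k}}. ennreal (1 / fact (k - card I)) *
        (\<integral>\<^sup>+ x. (\<integral>\<^sup>+ z. (\<integral>\<^sup>+ p. ennreal
            (gt x (add_measure (add_measure (\<eta> p) (dirac_sum k x)) (dirac_sum (k - card I) z)) *
             gt (combine_tuple k I x z)
               (add_measure (add_measure (\<eta> p) (dirac_sum k x)) (dirac_sum (k - card I) z))) \<partial>P)
          \<partial>measure_power (k - card I) K) \<partial>measure_power k K))"
  shows "(enn2ereal (d_KR P \<xi> Q \<zeta>) \<le>
           enn2ereal (d_TV L M)
           + 2 * (enn2ereal (ext_variance P (\<lambda>p. emeasure (\<xi>tr p) UNIV))
                  - enn2ereal (\<integral>\<^sup>+ p. emeasure (\<xi>tr p) UNIV \<partial>P))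
           + enn2ereal E1 + 2 * enn2ereal E2)
         \<and> (enn2ereal (d_TV L M)
           + 2 * (enn2ereal (ext_variance P (\<lambda>p. emeasure (\<xi>tr p) UNIV))
                  - enn2ereal (\<integral>\<^sup>+ p. emeasure (\<xi>tr p) UNIV \<partial>P))
           + enn2ereal E1 + 2 * enn2ereal E2
         = enn2ereal (d_TV L M + E1 + E2 + E3 + E4))"
proof -
  interpret P: prob_space P by fact
  interpret Q: prob_space Q by fact
  interpret K: sigma_finite_measure K by fact
  interpret M: finite_measure M by fact
  obtain C where C: "range C \<subseteq> sets K" "(\<Union>i. C i) = space K" "\<And>i. emeasure K (C i) \<noteq> \<infinity>" "incseq C"
    by (rule K.sigma_finite_incseq) blast
  interpret X: exhaustion C
    using C sets_eq_imp_space_eq[OF assms(13)] by unfold_locales (auto simp: assms(13))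
  interpret Y: exhaustion "\<lambda>_. UNIV :: 'y set" by unfold_locales (auto simp: incseq_def)
  have Kfin: "emeasure K (C i) < \<infinity>" for i using C(3)[of i] by (simp add: less_top)
  obtain \<eta>' where \<eta>': "poisson C P \<eta>' K" and eq: "AE p in P. \<eta> p = \<eta>' p"
    using X.poisson_modification[OF assms(12,15,13) Kfin] by blast
  have Mfin: "emeasure M UNIV < \<infinity>" by (metis M.emeasure_finite less_top infinity_ennreal_def)
  obtain \<zeta>' where \<zeta>': "poisson (\<lambda>_. UNIV) Q \<zeta>' M" and eqQ: "AE q in Q. \<zeta> q = \<zeta>' q"
    using Y.poisson_modification[OF assms(19,22,20) Mfin] by blast
  interpret ts: truncated_statistic C P \<eta>' K k g gt f \<S> Sx
    by (intro truncated_statistic.intro \<eta>' truncated_statistic_axioms.intro) (fact assms)+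
  \<comment> \<open>All expectations in the statement are unchanged if \<open>\<eta>\<close> is replaced by its modification.\<close>
  have avg: "(\<integral>\<^sup>+ p. F (\<eta> p) \<partial>P) = (\<integral>\<^sup>+ p. F (\<eta>' p) \<partial>P)" for F
    by (rule nn_integral_cong_AE) (use eq in eventually_elim, simp)
  have E: "x \<in> extensional {..<j}" if "x \<in> space (measure_power j K)" for x j
    using that by (simp add: ts.PW.space_measure_power)
  have gt_nn: "0 \<le> gt x \<omega>" if "x \<in> space (measure_power k K)" "\<omega> \<in> counting_measures" for x \<omega>
    using ts.tr.G01[OF E[OF that(1)] that(2)] by auto
  have cnt: "add_measure (add_measure (\<eta>' p) (dirac_sum k x)) (dirac_sum j z) \<in> counting_measures" if "p \<in> space P" for p x j z
    by (intro counting_add_dirac ts.tr.eta_counting[OF that])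
  let ?c = "ts.tr.ck k"
  have c1: "ennreal (2 / fact k) = 2 * ?c"
    using ennreal_mult[of 2 "1 / fact k"] by (simp add: ts.tr.ck_def)
  have c2: "ennreal (2 / (fact k)\<^sup>2) = 2 * (?c * ?c)"
  proof -
    have "(2 :: real) / (fact k)\<^sup>2 = 2 * (1 / fact k * (1 / fact k))" by (simp add: power2_eq_square)
    then show ?thesis by (simp add: ts.tr.ck_def ennreal_mult del: times_divide_eq_left times_divide_eq_right)
  qed
  have E1: "E1 = 2 * ts.dr.mean"
  proof -
    have "E1 = 2 * ?c * (\<integral>\<^sup>+ x. ts.dr.palm x \<partial>measure_power k K)"
      unfolding assms(29) c1 ts.dr.palm_def ts.gd_def
      by (intro arg_cong2[of _ _ _ _ "(*)"] refl nn_integral_cong avg[of "\<lambda>\<omega>. ennreal (g _ (add_measure \<omega> (dirac_sum k _)) * _ \<omega>)"])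
    then show ?thesis by (simp add: ts.dr.mean_def mult.assoc)
  qed
  have palm: "(\<integral>\<^sup>+ p. ennreal (gt x (add_measure (\<eta> p) (dirac_sum k x))) \<partial>P) = ts.tr.palm x" for x
    unfolding ts.tr.palm_def by (rule avg)
  have palm2: "(\<integral>\<^sup>+ p. ennreal (gt x (add_measure (add_measure (\<eta> p) (dirac_sum k x)) (dirac_sum j z)) *
      gt (c z) (add_measure (add_measure (\<eta> p) (dirac_sum k x)) (dirac_sum j z))) \<partial>P) = ts.tr.palm2 j c x z"
    if x: "x \<in> space (measure_power k K)" for j c x z
  proof -
    let ?a = "\<lambda>\<omega>. add_measure (add_measure \<omega> (dirac_sum k x)) (dirac_sum j z)"
    have "(\<integral>\<^sup>+ p. ennreal (gt x (?a (\<eta> p)) * gt (c z) (?a (\<eta> p))) \<partial>P) = (\<integral>\<^sup>+ p. ennreal (gt x (?a (\<eta>' p)) * gt (c z) (?a (\<eta>' p))) \<partial>P)"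
      by (rule avg)
    also have "\<dots> = ts.tr.palm2 j c x z"
      unfolding ts.tr.palm2_def by (intro nn_integral_cong ennreal_mult' gt_nn[OF x] cnt)
    finally show ?thesis .
  qed
  have near: "(if Sx x \<inter> Sx z \<noteq> {} then 1 else 0) = ts.tr.near x z" for x z
    by (simp add: ts.tr.disj_def)
  have E2: "E2 = 2 * (?c * ?c * ts.tr.A2)"
    unfolding assms(30) c2 palm near ts.tr.A2_def by (simp only: mult.assoc)
  have E3: "E3 = 2 * (?c * (?c * ts.tr.A3))"
  proof -
    have "E3 = 2 * (?c * ?c) * ts.tr.A3"
      unfolding assms(31) c2 near ts.tr.A3_def
      by (intro arg_cong2[of _ _ _ _ "(*)"] refl nn_integral_cong palm2[of _ k _ "\<lambda>z. z"])
    then show ?thesis by (simp only: mult.assoc)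
  qed
  have E4: "E4 = 2 * (?c * ts.tr.A4)"
  proof -
    have "E4 = 2 * ?c * ts.tr.A4"
      unfolding assms(32) c1 ts.tr.A4_def ts.tr.ck_def[of "k - card _"]
      by (intro arg_cong2[of _ _ _ _ "(*)"] refl sum.cong nn_integral_cong palm2) (auto simp: ts.tr.partials_def)
    then show ?thesis by (simp only: mult.assoc)
  qed
  have "intensity_measure P \<xi> = intensity_measure P (\<lambda>p. ts.fu.xi (\<eta>' p))"
    unfolding intensity_measure_def assms(16) avg[of "\<lambda>\<omega>. emeasure (ts.fu.xi \<omega>) _"] ..
  then have L: "L = ts.fu.Lt" unfolding assms(17) ts.fu.intensity_Lt .
  have mean: "ts.fu.mean < \<infinity>"
    using assms(18) by (simp add: L ts.fu.emeasure_Lt ts.fu.mean_eq)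
  have tmean: "ts.tr.mean < \<infinity>" by (rule ts.tr_mean[OF mean])
  have V: "ext_variance P (\<lambda>p. emeasure (\<xi>tr p) UNIV) = ext_variance P (\<lambda>p. emeasure (ts.tr.xi (\<eta>' p)) UNIV)"
    unfolding ext_variance_def assms(28) avg[of "\<lambda>\<omega>. emeasure (ts.tr.xi \<omega>) UNIV"]
    by (rule avg[of "\<lambda>\<omega>. ennreal ((enn2real (emeasure (ts.tr.xi \<omega>) UNIV) - _)\<^sup>2)"])
  have m: "(\<integral>\<^sup>+ p. emeasure (\<xi>tr p) UNIV \<partial>P) = ts.tr.mean"
    unfolding assms(28) avg[of "\<lambda>\<omega>. emeasure (ts.tr.xi \<omega>) UNIV"] by (rule ts.tr.mean_eq)
  have ident: "2 * ext_variance P (\<lambda>p. emeasure (\<xi>tr p) UNIV) + E2 = 2 * ts.tr.mean + (E3 + E4)"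
  proof -
    have "2 * ext_variance P (\<lambda>p. emeasure (\<xi>tr p) UNIV) + E2
      = 2 * (ext_variance P (\<lambda>p. emeasure (ts.tr.xi (\<eta>' p)) UNIV) + ?c * ?c * ts.tr.A2)"
      unfolding V E2 by (simp only: distrib_left)
    also have "\<dots> = 2 * ts.tr.mean + (E3 + E4)"
      unfolding ts.tr.variance_identity[OF tmean] E3 E4 by (simp only: distrib_left)
    finally show ?thesis .
  qed
  have E2fin: "E2 < \<infinity>"
  proof -
    have "?c * ?c * ts.tr.A2 \<le> ts.tr.mean * ts.tr.mean"
      unfolding ts.tr.mean_square by (simp add: distrib_left)
    also have "\<dots> < \<infinity>" using tmean by (simp add: ennreal_mult_less_top)
    finally show ?thesis unfolding E2 by (simp add: ennreal_mult_less_top)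
  qed
  have bound: "d_KR P \<xi> Q \<zeta> \<le> d_TV L M + E1 + E2 + E3 + E4"
    unfolding d_KR_def
  proof (rule SUP_least)
    fix h :: "'y measure \<Rightarrow> real" assume h: "h \<in> KR_test_functions"
    have 1: "KR_expectation P \<xi> h = (\<integral>p. h (finite_part (ts.fu.xi (\<eta>' p))) \<partial>P)"
    proof (rule KR_expectation_AE[OF _ _ h])
      show "AE p in P. \<xi> p = finite_part (ts.fu.xi (\<eta>' p))"
        using eq ts.fu.AE_xi_finite[OF mean] by eventually_elim (simp add: assms(16))
      show "(\<lambda>p. finite_part (ts.fu.xi (\<eta>' p))) \<in> P \<rightarrow>\<^sub>M finite_N_space"
        unfolding ts.tr.Y.N_eq by measurable
    qed
    have 2: "KR_expectation Q \<zeta> h = (\<integral>q. h (\<zeta>' q) \<partial>Q)"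
      by (rule KR_expectation_AE[OF eqQ _ h]) (simp add: ts.tr.Y.N_eq poisson.\<eta>_N[OF \<zeta>'])
    show "ennreal \<bar>KR_expectation P \<xi> h - KR_expectation Q \<zeta> h\<bar> \<le> d_TV L M + E1 + E2 + E3 + E4"
      using ts.two_sided_bound[OF mean assms(21,20) h \<zeta>'] unfolding 1 2 L E1 E2 E3 E4
      by (simp only: distrib_left add.assoc)
  qed
  have rewrite: "enn2ereal (d_TV L M)
           + 2 * (enn2ereal (ext_variance P (\<lambda>p. emeasure (\<xi>tr p) UNIV)) - enn2ereal (\<integral>\<^sup>+ p. emeasure (\<xi>tr p) UNIV \<partial>P))
           + enn2ereal E1 + 2 * enn2ereal E2 = enn2ereal (d_TV L M + E1 + E2 + E3 + E4)"
    unfolding m by (rule enn2ereal_bound_rewrite[OF ident tmean E2fin])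
  show ?thesis
    unfolding rewrite using bound by (simp add: less_eq_ennreal.rep_eq)
qed

end
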